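(* Let $T$ be a complete theory which is weakly FHP and $\mathrm{NTP}_2$, let $\mathbb{M}$ be a monster model, and let $G=G(\mathbb{M})$ be a $\emptyset$-definable group. Assume there is a model $M\models T$ such that $G(M)$ is amenable as a discrete group. Then for every $L(\mathbb{M})$-definable set $X\subseteq G(\mathbb{M})$ the following are equivalent: (1) $X$ does not $G$-divide; (2) $X$ is $f$-generic; (3) $X$ is non-null.
   Context: A family $\mathcal{F}$ of sets satisfies the $(p,k)$-property if for every tuple $(S_1,\dots,S_p)$ of members of $\mathcal{F}$ (repetitions allowed) there is $I\subseteq[p]$, $|I|=k$, with $\bigcap_{i\in I}S_i\neq\emptyset$. $\mathcal{F}$ satisfies $\mathrm{WFHP}(k,p,\beta)$ if for every $n$ and tuple $(S_1,\dots,S_n)$ from $\mathcal{F}$ such that $\{S_1,\dots,S_n\}$ satisfies the $(p,k)$-property there is $J\subseteq[n]$, $|J|\geq\beta n$, with $\bigcap_{i\in J}S_i\neq\emptyset$. $\mathcal{F}$ satisfies $\mathrm{WFHP}_k$ if there is $p_0\geq k$ such that for every $p\geq p_0$ there is $\beta>0$ with $\mathrm{WFHP}(k,p,\beta)$. A theory is weakly FHP (WFHP) if every partitioned formula $\varphi(x,y)$ satisfies $\mathrm{WFHP}_k$ for some $k$ (i.e. the family $\{\varphi(N,b):b\in N^y\}$ does) in every model $N$. A formula $\varphi(x;y)$ has $k$-$\mathrm{TP}_2$ if there is an array $(a_{\alpha,i})_{\alpha,i<\omega}$ such that $\{\varphi(x,a_{\alpha,f(\alpha)}):\alpha<\omega\}$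 is consistent for every $f:\omega\to\omega$ and $\{\varphi(x,a_{\alpha,i}):i<\omega\}$ is $k$-inconsistent for each $\alpha$; $T$ is $\mathrm{NTP}_2$ if no formula has $k$-$\mathrm{TP}_2$ for any $k$. $\psi(x,b)$ divides over a small set $A$ if there are $k$ and $(b_i)_{i<\omega}$ with $b_i\equiv_A b$ and $\{\psi(x,b_i)\}$ $k$-inconsistent; it forks over $A$ if it implies a finite disjunction of formulas each dividing over $A$. $X$ is $f$-generic if there is a small model $M'\prec\mathbb{M}$ such that $g\cdot X$ does not fork over $M'$ for every $g\in G(\mathbb{M})$. $X$ $G$-divides if there are an infinite sequence $(g_i)_{i<\omega}$ in $G(\mathbb{M})$ and $k$ such that $\{g_i\cdot X:i<\omega\}$ is $k$-inconsistent. $X$ is non-null if there is a left-$G(\mathbb{M})$-invariant Keisler measure $\mu$ (finitely additive probability measure on definable sets) concentrated on $G$ with $\mu(X)>0$. *)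

theory Defs
  imports Complex_Main "HOL-Algebra.Coset"
begin

unbundle cardinal_syntax

section \<open>First-order logic\<close>

record ('f, 'r) language =
  funcs :: "'f set"
  rels :: "'r set"
  farity :: "'f \<Rightarrow> nat"
  rarity :: "'r \<Rightarrow> nat"

datatype 'f fo_term = FVar nat | FApp 'f "'f fo_term list"

datatype ('f, 'r) fo_form =
    FEq "'f fo_term" "'f fo_term"
  | FRel 'r "'f fo_term list"
  | FNot "('f, 'r) fo_form"
  | FAnd "('f, 'r) fo_form" "('f, 'r) fo_form"
  | FEx "('f, 'r) fo_form"

text \<open>
  Variables are de Bruijn indices: in \<open>FEx \<phi>\<close> the bound variable is variable 0 of \<open>\<phi>\<close>, and the
  variables of the context are shifted by one. \<open>form L n \<phi>\<close> says that \<open>\<phi>\<close> is an \<open>L\<close>-formula all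
  of whose free variables are among the variables \<open>0, \<dots>, n - 1\<close>.
\<close>

fun wf_term :: "('f, 'r) language \<Rightarrow> nat \<Rightarrow> 'f fo_term \<Rightarrow> bool" where
  "wf_term L n (FVar i) \<longleftrightarrow> i < n"
| "wf_term L n (FApp f ts) \<longleftrightarrow>
     f \<in> funcs L \<and> length ts = farity L f \<and> (\<forall>t \<in> set ts. wf_term L n t)"

fun form :: "('f, 'r) language \<Rightarrow> nat \<Rightarrow> ('f, 'r) fo_form \<Rightarrow> bool" where
  "form L n (FEq s t) \<longleftrightarrow> wf_term L n s \<and> wf_term L n t"
| "form L n (FRel r ts) \<longleftrightarrow>
     r \<in> rels L \<and> length ts = rarity L r \<and> (\<forall>t \<in> set ts. wf_term L n t)"
| "form L n (FNot \<phi>) \<longleftrightarrow> form L n \<phi>"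
| "form L n (FAnd \<phi> \<psi>) \<longleftrightarrow> form L n \<phi> \<and> form L n \<psi>"
| "form L n (FEx \<phi>) \<longleftrightarrow> form L (Suc n) \<phi>"

abbreviation sentence :: "('f, 'r) language \<Rightarrow> ('f, 'r) fo_form \<Rightarrow> bool" where
  "sentence L \<sigma> \<equiv> form L 0 \<sigma>"

record ('f, 'r, 'm) fo_struct =
  univ :: "'m set"
  fint :: "'f \<Rightarrow> 'm list \<Rightarrow> 'm"
  rint :: "'r \<Rightarrow> 'm list \<Rightarrow> bool"

definition tuples :: "'m set \<Rightarrow> nat \<Rightarrow> 'm list set" where
  "tuples A n = {a. length a = n \<and> set a \<subseteq> A}"

definition is_struct :: "('f, 'r) language \<Rightarrow> ('f, 'r, 'm) fo_struct \<Rightarrow> bool" where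
  "is_struct L N \<longleftrightarrow> univ N \<noteq> {} \<and>
     (\<forall>f \<in> funcs L. \<forall>a \<in> tuples (univ N) (farity L f). fint N f a \<in> univ N)"

primrec eval_term :: "('f, 'r, 'm) fo_struct \<Rightarrow> 'm list \<Rightarrow> 'f fo_term \<Rightarrow> 'm" where
  "eval_term N e (FVar i) = e ! i"
| "eval_term N e (FApp f ts) = fint N f (map (eval_term N e) ts)"

primrec sat :: "('f, 'r, 'm) fo_struct \<Rightarrow> 'm list \<Rightarrow> ('f, 'r) fo_form \<Rightarrow> bool" where
  "sat N e (FEq s t) \<longleftrightarrow> eval_term N e s = eval_term N e t"
| "sat N e (FRel r ts) \<longleftrightarrow> rint N r (map (eval_term N e) ts)"
| "sat N e (FNot \<phi>) \<longleftrightarrow> \<not> sat N e \<phi>"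
| "sat N e (FAnd \<phi> \<psi>) \<longleftrightarrow> sat N e \<phi> \<and> sat N e \<psi>"
| "sat N e (FEx \<phi>) \<longleftrightarrow> (\<exists>a \<in> univ N. sat N (a # e) \<phi>)"

definition is_model ::
  "('f, 'r) language \<Rightarrow> ('f, 'r) fo_form set \<Rightarrow> ('f, 'r, 'm) fo_struct \<Rightarrow> bool" where
  "is_model L T N \<longleftrightarrow> is_struct L N \<and> (\<forall>\<sigma> \<in> T. sat N [] \<sigma>)"

text \<open>
  HOL cannot quantify over types inside a formula, so consequence is defined over the structures
  whose elements are taken from the type of formulas. That type is infinite and has at least as
  many elements as there are \<open>L\<close>-formulas, so by downward Loewenheim-Skolem this is semantic
  consequence over all structures.
\<close>

definition entails ::
  "('f, 'r) language \<Rightarrow> ('f, 'r) fo_form set \<Rightarrow> ('f, 'r) fo_form \<Rightarrow> bool" where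
  "entails L T \<sigma> \<longleftrightarrow>
     (\<forall>N :: ('f, 'r, ('f, 'r) fo_form) fo_struct. is_model L T N \<longrightarrow> sat N [] \<sigma>)"

text \<open>Exactly one of \<open>\<sigma>\<close>, \<open>\<not>\<sigma>\<close> is a consequence: completeness together with consistency.\<close>

definition complete_theory :: "('f, 'r) language \<Rightarrow> ('f, 'r) fo_form set \<Rightarrow> bool" where
  "complete_theory L T \<longleftrightarrow> (\<forall>\<sigma> \<in> T. sentence L \<sigma>) \<and>
     (\<forall>\<sigma>. sentence L \<sigma> \<longrightarrow> (entails L T \<sigma> \<longleftrightarrow> \<not> entails L T (FNot \<sigma>)))"

text \<open>
  A partitioned formula \<open>\<phi>(x,y)\<close> is given by \<open>m\<close>, \<open>n\<close> and \<open>\<phi>\<close> with \<open>form L (m + n) \<phi>\<close>: the first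
  \<open>m\<close> free variables are \<open>x\<close>, the next \<open>n\<close> are \<open>y\<close>. \<open>dset N m \<phi> b\<close> is \<open>\<phi>(N,b)\<close>.
\<close>

definition dset ::
  "('f, 'r, 'm) fo_struct \<Rightarrow> nat \<Rightarrow> ('f, 'r) fo_form \<Rightarrow> 'm list \<Rightarrow> 'm list set" where
  "dset N m \<phi> b = {a \<in> tuples (univ N) m. sat N (a @ b) \<phi>}"

text \<open>The subsets of \<open>N\<^sup>m\<close> definable with parameters from \<open>N\<close>.\<close>

definition definable :: "('f, 'r) language \<Rightarrow> ('f, 'r, 'm) fo_struct \<Rightarrow> nat \<Rightarrow> 'm list set set" where
  "definable L N m = {dset N m \<phi> b | \<phi> n b. form L (m + n) \<phi> \<and> b \<in> tuples (univ N) n}"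

definition elem_substruct ::
  "('f, 'r) language \<Rightarrow> ('f, 'r, 'm) fo_struct \<Rightarrow> ('f, 'r, 'm) fo_struct \<Rightarrow> bool" where
  "elem_substruct L M N \<longleftrightarrow> is_struct L M \<and> is_struct L N \<and> univ M \<subseteq> univ N \<and>
     (\<forall>n \<phi>. \<forall>a \<in> tuples (univ M) n. form L n \<phi> \<longrightarrow> (sat M a \<phi> \<longleftrightarrow> sat N a \<phi>))"

definition same_type ::
  "('f, 'r) language \<Rightarrow> ('f, 'r, 'm) fo_struct \<Rightarrow> 'm set \<Rightarrow> 'm list \<Rightarrow> 'm list \<Rightarrow> bool" where
  "same_type L N A b b' \<longleftrightarrow> length b = length b' \<and>
     (\<forall>n \<theta>. \<forall>c \<in> tuples A n.
        form L (length b + n) \<theta> \<longrightarrow> (sat N (b @ c) \<theta> \<longleftrightarrow> sat N (b' @ c) \<theta>))"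


section \<open>Monster models\<close>

definition automorphism ::
  "('f, 'r) language \<Rightarrow> ('f, 'r, 'm) fo_struct \<Rightarrow> ('m \<Rightarrow> 'm) \<Rightarrow> bool" where
  "automorphism L N h \<longleftrightarrow> bij_betw h (univ N) (univ N) \<and>
     (\<forall>f \<in> funcs L. \<forall>a \<in> tuples (univ N) (farity L f). h (fint N f a) = fint N f (map h a)) \<and>
     (\<forall>r \<in> rels L. \<forall>a \<in> tuples (univ N) (rarity L r). rint N r (map h a) \<longleftrightarrow> rint N r a)"

definition elem_map ::
  "('f, 'r) language \<Rightarrow> ('f, 'r, 'm) fo_struct \<Rightarrow> 'm set \<Rightarrow> ('m \<Rightarrow> 'm) \<Rightarrow> bool" where
  "elem_map L N A h \<longleftrightarrow> h ` A \<subseteq> univ N \<and>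
     (\<forall>n \<phi>. \<forall>a \<in> tuples A n. form L n \<phi> \<longrightarrow> (sat N (map h a) \<phi> \<longleftrightarrow> sat N a \<phi>))"

text \<open>A set \<open>p\<close> of pairs \<open>(\<phi>,c)\<close> stands for the partial type \<open>{\<phi>(x,c) | (\<phi>,c) \<in> p}\<close>.\<close>

definition saturated ::
  "('f, 'r) language \<Rightarrow> 'k rel \<Rightarrow> ('f, 'r, 'm) fo_struct \<Rightarrow> bool" where
  "saturated L \<kappa> N \<longleftrightarrow>
     (\<forall>A m. \<forall>p :: (('f, 'r) fo_form \<times> 'm list) set.
        A \<subseteq> univ N \<and> |A| <o \<kappa> \<and>
        (\<forall>(\<phi>, c) \<in> p. set c \<subseteq> A \<and> form L (m + length c) \<phi>) \<and>
        (\<forall>q \<subseteq> p. finite q \<longrightarrow> (\<exists>a \<in> tuples (univ N) m. \<forall>(\<phi>, c) \<in> q. sat N (a @ c) \<phi>)) \<longrightarrow>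
        (\<exists>a \<in> tuples (univ N) m. \<forall>(\<phi>, c) \<in> p. sat N (a @ c) \<phi>))"

definition strongly_homogeneous ::
  "('f, 'r) language \<Rightarrow> 'k rel \<Rightarrow> ('f, 'r, 'm) fo_struct \<Rightarrow> bool" where
  "strongly_homogeneous L \<kappa> N \<longleftrightarrow>
     (\<forall>A h. A \<subseteq> univ N \<and> |A| <o \<kappa> \<and> elem_map L N A h \<longrightarrow>
        (\<exists>s. automorphism L N s \<and> (\<forall>a \<in> A. s a = h a)))"

text \<open>
  \<open>\<kappa>\<close> is the bound for smallness: ``small'' means of cardinality less than \<open>\<kappa>\<close>. The number of
  \<open>L\<close>-formulas is \<open>|L| + \<aleph>\<^sub>0\<close>.
\<close>

definition monster_model ::
  "('f, 'r) language \<Rightarrow> ('f, 'r) fo_form set \<Rightarrow> 'k rel \<Rightarrow> ('f, 'r, 'm) fo_struct \<Rightarrow> bool" where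
  "monster_model L T \<kappa> N \<longleftrightarrow> is_model L T N \<and> Card_order \<kappa> \<and> |{\<phi>. \<exists>n. form L n \<phi>}| <o \<kappa> \<and>
     saturated L \<kappa> N \<and> strongly_homogeneous L \<kappa> N"


section \<open>Weakly FHP theories\<close>

definition pk_property :: "nat \<Rightarrow> nat \<Rightarrow> 'a set set \<Rightarrow> bool" where
  "pk_property p k F \<longleftrightarrow>
     (\<forall>S :: nat \<Rightarrow> 'a set. (\<forall>i < p. S i \<in> F) \<longrightarrow>
        (\<exists>I \<subseteq> {..<p}. card I = k \<and> (\<Inter>i \<in> I. S i) \<noteq> {}))"

definition WFHP :: "nat \<Rightarrow> nat \<Rightarrow> real \<Rightarrow> 'a set set \<Rightarrow> bool" where
  "WFHP k p \<beta> F \<longleftrightarrow>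
     (\<forall>n. \<forall>S :: nat \<Rightarrow> 'a set. (\<forall>i < n. S i \<in> F) \<and> pk_property p k (S ` {..<n}) \<longrightarrow>
        (\<exists>J \<subseteq> {..<n}. real (card J) \<ge> \<beta> * real n \<and> (\<Inter>i \<in> J. S i) \<noteq> {}))"

definition WFHP_at :: "nat \<Rightarrow> 'a set set \<Rightarrow> bool" where
  "WFHP_at k F \<longleftrightarrow> (\<exists>p0 \<ge> k. \<forall>p \<ge> p0. \<exists>\<beta> > 0. WFHP k p \<beta> F)"

text \<open>
  The models range over those with universe in the given type. For fixed \<open>k, p, \<beta>, n\<close> the
  condition on \<open>\<phi>\<close> is a first-order sentence, so for complete \<open>T\<close> every type housing a model of
  \<open>T\<close> gives the same notion.
\<close>

definition weakly_FHP ::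
  "'m itself \<Rightarrow> ('f, 'r) language \<Rightarrow> ('f, 'r) fo_form set \<Rightarrow> bool" where
  "weakly_FHP _ L T \<longleftrightarrow>
     (\<forall>m n \<phi>. form L (m + n) \<phi> \<longrightarrow>
        (\<exists>k. \<forall>N :: ('f, 'r, 'm) fo_struct. is_model L T N \<longrightarrow>
           WFHP_at k {dset N m \<phi> b | b. b \<in> tuples (univ N) n}))"


section \<open>\<open>NTP\<^sub>2\<close>, dividing and forking\<close>

definition consistent_seq :: "(nat \<Rightarrow> 'a set) \<Rightarrow> bool" where
  "consistent_seq S \<longleftrightarrow> (\<forall>I. finite I \<longrightarrow> (\<Inter>i \<in> I. S i) \<noteq> {})"

text \<open>Finiteness of \<open>I\<close> matters only for \<open>k = 0\<close>, since infinite sets have \<open>card\<close> 0.\<close>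

definition k_inconsistent :: "nat \<Rightarrow> (nat \<Rightarrow> 'a set) \<Rightarrow> bool" where
  "k_inconsistent k S \<longleftrightarrow> (\<forall>I. finite I \<and> card I = k \<longrightarrow> (\<Inter>i \<in> I. S i) = {})"

definition has_TP2 ::
  "('f, 'r, 'm) fo_struct \<Rightarrow> nat \<Rightarrow> nat \<Rightarrow> nat \<Rightarrow> ('f, 'r) fo_form \<Rightarrow> bool" where
  "has_TP2 N k m n \<phi> \<longleftrightarrow>
     (\<exists>a :: nat \<Rightarrow> nat \<Rightarrow> 'm list. (\<forall>\<alpha> i. a \<alpha> i \<in> tuples (univ N) n) \<and>
        (\<forall>f :: nat \<Rightarrow> nat. consistent_seq (\<lambda>\<alpha>. dset N m \<phi> (a \<alpha> (f \<alpha>)))) \<and>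
        (\<forall>\<alpha>. k_inconsistent k (\<lambda>i. dset N m \<phi> (a \<alpha> i))))"

text \<open>\<open>NTP\<^sub>2\<close> for the complete theory of \<open>N\<close>, evaluated in a monster model \<open>N\<close>.\<close>

definition NTP2 :: "('f, 'r) language \<Rightarrow> ('f, 'r, 'm) fo_struct \<Rightarrow> bool" where
  "NTP2 L N \<longleftrightarrow> (\<forall>k m n \<phi>. form L (m + n) \<phi> \<longrightarrow> \<not> has_TP2 N k m n \<phi>)"

definition divides_over ::
  "('f, 'r) language \<Rightarrow> ('f, 'r, 'm) fo_struct \<Rightarrow> 'm set \<Rightarrow> nat \<Rightarrow> ('f, 'r) fo_form \<Rightarrow> 'm list \<Rightarrow> bool"
  where
  "divides_over L N A m \<psi> b \<longleftrightarrow>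
     (\<exists>k. \<exists>s :: nat \<Rightarrow> 'm list.
        (\<forall>i. s i \<in> tuples (univ N) (length b) \<and> same_type L N A (s i) b) \<and>
        k_inconsistent k (\<lambda>i. dset N m \<psi> (s i)))"

text \<open>
  Whether a formula \<open>\<psi>(x,b)\<close> forks depends only on the set \<open>\<psi>(N,b)\<close>, so forking is stated for
  subsets \<open>X\<close> of \<open>N\<^sup>m\<close>. Elements \<open>(\<psi>,c)\<close> of \<open>F\<close> are the disjuncts \<open>\<psi>(x,c)\<close>.
\<close>

definition forks_over ::
  "('f, 'r) language \<Rightarrow> ('f, 'r, 'm) fo_struct \<Rightarrow> 'm set \<Rightarrow> nat \<Rightarrow> 'm list set \<Rightarrow> bool" where
  "forks_over L N A m X \<longleftrightarrow>
     (\<exists>F :: (('f, 'r) fo_form \<times> 'm list) set. finite F \<and>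
        (\<forall>(\<psi>, c) \<in> F. set c \<subseteq> univ N \<and> form L (m + length c) \<psi> \<and> divides_over L N A m \<psi> c) \<and>
        X \<subseteq> (\<Union>(\<psi>, c) \<in> F. dset N m \<psi> c))"


section \<open>Definable groups\<close>

text \<open>
  A \<open>\<emptyset>\<close>-definable group is given by a formula \<open>\<gamma>\<close> in \<open>d\<close> variables defining its elements and a
  formula \<open>\<mu>\<close> in \<open>3d\<close> variables defining the graph of multiplication; \<open>def_group N d \<gamma> \<mu>\<close> is
  \<open>G(N)\<close>.
\<close>

definition def_group ::
  "('f, 'r, 'm) fo_struct \<Rightarrow> nat \<Rightarrow> ('f, 'r) fo_form \<Rightarrow> ('f, 'r) fo_form \<Rightarrow> 'm list monoid" where
  "def_group N d \<gamma> \<mu> =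
     (let G = dset N d \<gamma> [];
          mul = (\<lambda>a b. THE c. c \<in> G \<and> sat N (a @ b @ c) \<mu>)
      in \<lparr>carrier = G, mult = mul,
          one = (THE e. e \<in> G \<and> (\<forall>a \<in> G. mul e a = a \<and> mul a e = a))\<rparr>)"

definition definable_group ::
  "('f, 'r) language \<Rightarrow> ('f, 'r, 'm) fo_struct \<Rightarrow> nat \<Rightarrow> ('f, 'r) fo_form \<Rightarrow> ('f, 'r) fo_form \<Rightarrow> bool"
  where
  "definable_group L N d \<gamma> \<mu> \<longleftrightarrow> form L d \<gamma> \<and> form L (d + d + d) \<mu> \<and>
     (\<forall>a \<in> dset N d \<gamma> []. \<forall>b \<in> dset N d \<gamma> []. \<exists>!c. c \<in> dset N d \<gamma> [] \<and> sat N (a @ b @ c) \<mu>) \<and>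
     group (def_group N d \<gamma> \<mu>)"

definition fin_add_prob :: "'a set \<Rightarrow> 'a set set \<Rightarrow> ('a set \<Rightarrow> real) \<Rightarrow> bool" where
  "fin_add_prob \<Omega> \<A> \<nu> \<longleftrightarrow> \<nu> \<Omega> = 1 \<and> (\<forall>A \<in> \<A>. 0 \<le> \<nu> A) \<and>
     (\<forall>A \<in> \<A>. \<forall>B \<in> \<A>. A \<inter> B = {} \<longrightarrow> \<nu> (A \<union> B) = \<nu> A + \<nu> B)"

definition amenable_discrete :: "('a, 'b) monoid_scheme \<Rightarrow> bool" where
  "amenable_discrete G \<longleftrightarrow> group G \<and>
     (\<exists>\<nu>. fin_add_prob (carrier G) (Pow (carrier G)) \<nu> \<and>
        (\<forall>g \<in> carrier G. \<forall>A \<subseteq> carrier G. \<nu> (g <#\<^bsub>G\<^esub> A) = \<nu> A))"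

definition f_generic ::
  "('f, 'r) language \<Rightarrow> ('f, 'r, 'm) fo_struct \<Rightarrow> 'k rel \<Rightarrow> nat \<Rightarrow> 'm list monoid \<Rightarrow> 'm list set \<Rightarrow> bool"
  where
  "f_generic L N \<kappa> d G X \<longleftrightarrow>
     (\<exists>M :: ('f, 'r, 'm) fo_struct. elem_substruct L M N \<and> |univ M| <o \<kappa> \<and>
        (\<forall>g \<in> carrier G. \<not> forks_over L N (univ M) d (g <#\<^bsub>G\<^esub> X)))"

definition G_divides :: "('a, 'b) monoid_scheme \<Rightarrow> 'a set \<Rightarrow> bool" where
  "G_divides G X \<longleftrightarrow>
     (\<exists>g :: nat \<Rightarrow> 'a. (\<forall>i. g i \<in> carrier G) \<and> (\<exists>k. k_inconsistent k (\<lambda>i. g i <#\<^bsub>G\<^esub> X)))"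

definition keisler_measure ::
  "('f, 'r) language \<Rightarrow> ('f, 'r, 'm) fo_struct \<Rightarrow> nat \<Rightarrow> ('m list set \<Rightarrow> real) \<Rightarrow> bool" where
  "keisler_measure L N d \<nu> \<longleftrightarrow> fin_add_prob (tuples (univ N) d) (definable L N d) \<nu>"

definition non_null ::
  "('f, 'r) language \<Rightarrow> ('f, 'r, 'm) fo_struct \<Rightarrow> nat \<Rightarrow> 'm list monoid \<Rightarrow> 'm list set \<Rightarrow> bool" where
  "non_null L N d G X \<longleftrightarrow>
     (\<exists>\<nu>. keisler_measure L N d \<nu> \<and> \<nu> (carrier G) = 1 \<and>
        (\<forall>g \<in> carrier G. \<forall>Y \<in> definable L N d. Y \<subseteq> carrier G \<longrightarrow> \<nu> (g <#\<^bsub>G\<^esub> Y) = \<nu> Y) \<and>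
        \<nu> X > 0)"

end

theory Submission
  imports Defs "HOL-Library.Countable" "HOL-Analysis.Function_Topology"
begin

text \<open>
  \<open>f\<close>-generic sets do not \<open>G\<close>-divide: if \<open>k\<close>-inconsistent sequences of translates of \<open>X\<close> exist, then by
  compactness and saturation there is one whose members all have the type of some \<open>g\<close> over the given
  small model, so that \<open>g X\<close> divides over it. Conversely, choose a small model containing the parameters
  of \<open>X\<close>. By \<open>NTP\<^sub>2\<close>, forking and dividing over it coincide, and a sequence witnessing that \<open>g X\<close> divides
  over it consists of translates of \<open>X\<close>.

  A non-null \<open>X\<close> does not \<open>G\<close>-divide, because the translates in a
  \<open>k\<close>-inconsistent sequence have equal measure and the total measure of finitely many of them is
  at most \<open>k\<close>. If \<open>X\<close> does not \<open>G\<close>-divide, compactness gives a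
  \<open>p\<close> such that the translates of \<open>X\<close> have the \<open>(p,k)\<close>-property, and
  \<open>WFHP\<close> a \<open>\<beta> > 0\<close> such that any \<open>m\<close> of them, repetitions
  allowed, have at least \<open>\<beta> m\<close> with a common point. This passes to the model
  \<open>M\<close> with \<open>G(M)\<close> amenable. There, multiplicative weights (in place of LP duality)
  and compactness give a measure \<open>\<rho>\<close> and \<open>\<delta> > 0\<close> with \<open>\<rho>(g X)
  \<ge> \<delta>\<close> for all \<open>g\<close>; averaging \<open>\<rho>\<close> over \<open>G(M)\<close>
  makes it invariant. Invariance of finitely many sets is transferred back to the monster model, and
  compactness of the space of measures gives the Keisler measure.
\<close>

section \<open>Formulas with named variables and definable relations\<close>

text \<open>The obstacle on the forking side is that a cover may be a disjunction.
  \<open>NTP2\<close> enters only as a bound: for fixed \<Phi> and \<open>k\<close> there is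
  \<open>n\<close> such that among \<open>n\<close> rows of \<open>k\<close>-inconsistent instances
  some path is inconsistent. It is used twice, first to give every finite disjunction of dividing
  formulas a finite family of conjugates without common point, which makes strict coheirs exist, and
  then for the paths through a strict coheir sequence. Tuples are total assignments on countable
  sets of variables, so a whole sequence is again a tuple with a type, and conjugating means
  extending an equality of types by compactness.

  The obstacle on the measure side is that amenability is not first-order and is given in
  \<open>M\<close>, while \<open>X\<close> has parameters in the monster model. Hence all that
  crosses between the models is finite: the \<open>(p,k)\<close>-property for a fixed
  \<open>p\<close>, the density of intersecting subfamilies for each size \<open>m\<close>, and the
  list of nonempty atoms of finitely many sets. Weights are kept integral because an integral weight
  is a repetition of a translate, which is what \<open>WFHP\<close> admits.\<close>

primrec ren_term :: "(nat \<Rightarrow> nat) \<Rightarrow> 'f fo_term \<Rightarrow> 'f fo_term" where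
  "ren_term \<rho> (FVar i) = FVar (\<rho> i)"
| "ren_term \<rho> (FApp f ts) = FApp f (map (ren_term \<rho>) ts)"

primrec ren :: "(nat \<Rightarrow> nat) \<Rightarrow> ('f, 'r) fo_form \<Rightarrow> ('f, 'r) fo_form" where
  "ren \<rho> (FEq s t) = FEq (ren_term \<rho> s) (ren_term \<rho> t)"
| "ren \<rho> (FRel r ts) = FRel r (map (ren_term \<rho>) ts)"
| "ren \<rho> (FNot \<phi>) = FNot (ren \<rho> \<phi>)"
| "ren \<rho> (FAnd \<phi> \<psi>) = FAnd (ren \<rho> \<phi>) (ren \<rho> \<psi>)"
| "ren \<rho> (FEx \<phi>) = FEx (ren (case_nat 0 (\<lambda>i. Suc (\<rho> i))) \<phi>)"

lemma eval_ren_term: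
  "wf_term L n t \<Longrightarrow> (\<And>i. i < n \<Longrightarrow> e ! i = e' ! \<rho> i) \<Longrightarrow> eval_term N e' (ren_term \<rho> t) = eval_term N e t"
proof (induction t)
  case (FApp f ts)
  then have "map (eval_term N e') (map (ren_term \<rho>) ts) = map (eval_term N e) ts" by auto
  then show ?case by (simp only: ren_term.simps eval_term.simps)
qed simp

lemma wf_ren_term:
  "wf_term L n t \<Longrightarrow> (\<And>i. i < n \<Longrightarrow> \<rho> i < m) \<Longrightarrow> wf_term L m (ren_term \<rho> t)"
  by (induction t) auto

lemma sat_ren:
  "form L n \<phi> \<Longrightarrow> (\<And>i. i < n \<Longrightarrow> e ! i = e' ! \<rho> i) \<Longrightarrow> sat N e' (ren \<rho> \<phi>) \<longleftrightarrow> sat N e \<phi>"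
proof (induction \<phi> arbitrary: n e e' \<rho>)
  case (FEq s t)
  then show ?case using eval_ren_term[of L n _ e e' \<rho> N] by auto
next
  case (FRel r ts)
  then have "map (eval_term N e') (map (ren_term \<rho>) ts) = map (eval_term N e) ts"
    using eval_ren_term[of L n _ e e' \<rho> N] by auto
  then show ?case by (simp only: ren.simps sat.simps)
next
  case (FEx \<phi>)
  have "sat N (a # e') (ren (case_nat 0 (\<lambda>i. Suc (\<rho> i))) \<phi>) \<longleftrightarrow> sat N (a # e) \<phi>" for a
    by (rule FEx.IH[of "Suc n"]) (use FEx.prems in \<open>auto split: nat.split simp: less_Suc_eq_0_disj\<close>)
  then show ?case by simp
next
  case (FAnd \<phi> \<psi>)
  then show ?case using FAnd.IH(1)[of n e e' \<rho>] FAnd.IH(2)[of n e e' \<rho>] by simp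
qed auto

lemma form_ren:
  "form L n \<phi> \<Longrightarrow> (\<And>i. i < n \<Longrightarrow> \<rho> i < m) \<Longrightarrow> form L m (ren \<rho> \<phi>)"
proof (induction \<phi> arbitrary: n m \<rho>)
  case (FEx \<phi>)
  then have "form L (Suc m) (ren (case_nat 0 (\<lambda>i. Suc (\<rho> i))) \<phi>)"
    by (intro FEx.IH[of "Suc n"]) (auto split: nat.split)
  then show ?case by simp
qed (auto intro!: wf_ren_term)

lemma wf_term_mono: "wf_term L n t \<Longrightarrow> n \<le> m \<Longrightarrow> wf_term L m t"
  by (induction t) auto

lemma form_mono: "form L n \<phi> \<Longrightarrow> n \<le> m \<Longrightarrow> form L m \<phi>"
  by (induction \<phi> arbitrary: n m) (auto intro: wf_term_mono)

text \<open>Position \<open>i\<close> of the list names the variable of index \<open>i\<close>.\<close>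

type_synonym ('f, 'r, 'v) nform = "('f, 'r) fo_form \<times> 'v list"

definition holds :: "('f, 'r, 'm) fo_struct \<Rightarrow> ('v \<Rightarrow> 'm) \<Rightarrow> ('f, 'r, 'v) nform \<Rightarrow> bool" where
  "holds N s f \<longleftrightarrow> sat N (map s (snd f)) (fst f)"

definition nwf :: "('f, 'r) language \<Rightarrow> ('f, 'r, 'v) nform \<Rightarrow> bool" where
  "nwf L f \<longleftrightarrow> form L (length (snd f)) (fst f)"

text \<open>A closed formula, so that it adds no names; it is true because structures are
  nonempty.\<close>

definition nTrue :: "('f, 'r, 'v) nform" where
  "nTrue = (FEx (FEq (FVar 0) (FVar 0)), [])"

definition nNot :: "('f, 'r, 'v) nform \<Rightarrow> ('f, 'r, 'v) nform" where
  "nNot f = (FNot (fst f), snd f)"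

definition nAnd :: "('f, 'r, 'v) nform \<Rightarrow> ('f, 'r, 'v) nform \<Rightarrow> ('f, 'r, 'v) nform" where
  "nAnd f g = (FAnd (fst f) (ren (\<lambda>i. i + length (snd f)) (fst g)), snd f @ snd g)"

text \<open>A name may occupy several positions, and all those called \<open>v\<close> are sent to
  the bound index. The list itself is kept, so \<open>v\<close> stays listed although its value no
  longer matters; the listed names are an upper bound for the free ones.\<close>

definition nEx :: "'v \<Rightarrow> ('f, 'r, 'v) nform \<Rightarrow> ('f, 'r, 'v) nform" where
  "nEx v f = (FEx (ren (\<lambda>i. if snd f ! i = v then 0 else Suc i) (fst f)), snd f)"

definition nMap :: "('v \<Rightarrow> 'w) \<Rightarrow> ('f, 'r, 'v) nform \<Rightarrow> ('f, 'r, 'w) nform" where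
  "nMap \<rho> f = (fst f, map \<rho> (snd f))"

lemma nwf_ops [simp]:
  "nwf L nTrue" "nwf L (nNot f) = nwf L f" "nwf L f \<Longrightarrow> nwf L g \<Longrightarrow> nwf L (nAnd f g)"
  "nwf L f \<Longrightarrow> nwf L (nEx v f)" "nwf L (nMap \<rho> f) = nwf L f"
  by (auto simp: nwf_def nTrue_def nNot_def nAnd_def nEx_def nMap_def
      intro: form_mono[where n = "length (snd f)"] form_ren)

lemma nvars_ops [simp]:
  "set (snd nTrue) = {}" "set (snd (nNot f)) = set (snd f)"
  "set (snd (nAnd f g)) = set (snd f) \<union> set (snd g)"
  "set (snd (nEx v f)) = set (snd f)" "set (snd (nMap \<rho> f)) = \<rho> ` set (snd f)"
  by (auto simp: nTrue_def nNot_def nAnd_def nEx_def nMap_def)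

lemma holds_nTrue [simp]: "is_struct L N \<Longrightarrow> holds N s nTrue"
  by (auto simp: holds_def nTrue_def is_struct_def)

lemma holds_nNot [simp]: "holds N s (nNot f) \<longleftrightarrow> \<not> holds N s f"
  by (simp add: holds_def nNot_def)

lemma sat_append:
  assumes "form L (length e) \<phi>" shows "sat N (e @ e') \<phi> = sat N e \<phi>"
proof -
  have "ren (\<lambda>i. i) \<phi> = \<phi>" for \<phi> :: "('a, 'b) fo_form"
  proof (induction \<phi>)
    case (FEx \<phi>)
    have "case_nat 0 (\<lambda>i. Suc i) = (\<lambda>i. i)" by (auto split: nat.split)
    then show ?case using FEx by simp
  next
    case (FEq x1 x2)
    have "ren_term (\<lambda>i. i) t = t" for t :: "'a fo_term" by (induction t) (auto intro: map_idI)
    then show ?case by simp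
  next
    case (FRel x1 x2)
    have "ren_term (\<lambda>i. i) t = t" for t :: "'a fo_term" by (induction t) (auto intro: map_idI)
    then show ?case by (auto intro: map_idI)
  qed auto
  then show ?thesis using sat_ren[OF assms, of "e" "e @ e'" "\<lambda>i. i" N] by (simp add: nth_append)
qed

lemma holds_nAnd: "nwf L f \<Longrightarrow> nwf L g \<Longrightarrow> holds N s (nAnd f g) \<longleftrightarrow> holds N s f \<and> holds N s g"
  unfolding holds_def nAnd_def nwf_def
  using sat_append[of L "map s (snd f)" "fst f" N "map s (snd g)"]
    sat_ren[of L "length (snd g)" "fst g" "map s (snd g)" "map s (snd f @ snd g)"
      "\<lambda>i. i + length (snd f)" N]
  by (simp add: nth_append)

lemma holds_nEx:
  assumes "nwf L f" shows "holds N s (nEx v f) \<longleftrightarrow> (\<exists>a \<in> univ N. holds N (s(v := a)) f)"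
proof -
  have "sat N (a # map s (snd f)) (ren (\<lambda>i. if snd f ! i = v then 0 else Suc i) (fst f)) \<longleftrightarrow>
      sat N (map (s(v := a)) (snd f)) (fst f)" for a
    by (rule sat_ren[of L "length (snd f)"]) (use assms in \<open>auto simp: nwf_def\<close>)
  then show ?thesis by (simp add: holds_def nEx_def)
qed

lemma holds_nMap [simp]: "holds N s (nMap \<rho> f) \<longleftrightarrow> holds N (s \<circ> \<rho>) f"
  by (simp add: holds_def nMap_def)

lemma holds_cong: "(\<And>v. v \<in> set (snd f) \<Longrightarrow> s v = s' v) \<Longrightarrow> holds N s f \<longleftrightarrow> holds N s' f"
  unfolding holds_def by (metis map_eq_conv)

text \<open>The three facts are proved together because each quantifier step needs well-formedness
  of the rest. A block of quantifiers is read as the choice of one assignment that differs only on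
  \<open>vs\<close>, which makes the order and repetition of names irrelevant.\<close>

lemma holds_nExs:
  "nwf L f \<Longrightarrow> nwf L (foldr nEx vs f) \<and> set (snd (foldr nEx vs f)) = set (snd f) \<and>
    (holds K s (foldr nEx vs f) \<longleftrightarrow> (\<exists>s'. (\<forall>v. v \<notin> set vs \<longrightarrow> s' v = s v) \<and>
      (\<forall>v \<in> set vs. s' v \<in> univ K) \<and> holds K s' f))"
proof (induction vs arbitrary: s)
  case Nil
  have "s' = s" if "\<forall>v. s' v = s v" for s' using that by auto
  then show ?case using Nil by auto
next
  case (Cons w vs)
  have IH: "nwf L (foldr nEx vs f)" "set (snd (foldr nEx vs f)) = set (snd f)"
    using Cons by blast+
  have "(\<exists>a \<in> univ K. \<exists>s'. (\<forall>v. v \<notin> set vs \<longrightarrow> s' v = (s(w := a)) v) \<and>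
      (\<forall>v \<in> set vs. s' v \<in> univ K) \<and> holds K s' f) \<longleftrightarrow> (\<exists>s'. (\<forall>v. v \<notin> set (w # vs) \<longrightarrow> s' v = s v) \<and>
      (\<forall>v \<in> set (w # vs). s' v \<in> univ K) \<and> holds K s' f)" (is "?l = ?r")
  proof
    assume ?l
    then obtain a s' where a: "a \<in> univ K" "\<forall>v. v \<notin> set vs \<longrightarrow> s' v = (s(w := a)) v"
      "\<forall>v \<in> set vs. s' v \<in> univ K" "holds K s' f" by blast
    \<comment> \<open>If \<open>w\<close> recurs in \<open>vs\<close>, an inner quantifier has
      overwritten \<open>a\<close>, and that value lies in the universe too.\<close>
    then have "s' w \<in> univ K" by (cases "w \<in> set vs") auto
    then show ?r using a by (intro exI[of _ s']) auto
  next
    assume ?r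
    then obtain s' where "\<forall>v. v \<notin> set (w # vs) \<longrightarrow> s' v = s v"
      "\<forall>v \<in> set (w # vs). s' v \<in> univ K" "holds K s' f" by blast
    then show ?l by (intro bexI[of _ "s' w"] exI[of _ s']) auto
  qed
  then show ?case using Cons.IH[OF Cons.prems] IH by (simp add: holds_nEx[OF IH(1)])
qed

section \<open>Relations definable with parameters in a saturated structure\<close>

locale big_model =
  fixes L :: "('f, 'r) language" and \<kappa> :: "'k rel" and N :: "('f, 'r, 'm) fo_struct"
  assumes struct: "is_struct L N"
    and Card: "Card_order \<kappa>"
    and forms_small: "|{\<phi> :: ('f, 'r) fo_form. \<exists>n. form L n \<phi>}| <o \<kappa>"
    and saturated: "saturated L \<kappa> N"
begin

abbreviation U where "U \<equiv> univ N"

definition env :: "('v \<Rightarrow> 'm) set" where "env = {s. \<forall>v. s v \<in> U}"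

lemma mem_env: "s \<in> env \<longleftrightarrow> (\<forall>v. s v \<in> U)"
  by (simp add: env_def)

definition small :: "'m set \<Rightarrow> bool" where "small A \<longleftrightarrow> A \<subseteq> U \<and> |A| <o \<kappa>"

text \<open>A semantic notion of \<open>A\<close>-definability: variables are the names
  \<open>Inl v\<close>, and a parameter is a name \<open>Inr a\<close> evaluated by the identity.
  Only values on \<open>env\<close> are prescribed, so relations can be written as HOL predicates
  and syntax disappears from the later arguments.\<close>

definition dfn :: "'m set \<Rightarrow> (('v \<Rightarrow> 'm) \<Rightarrow> bool) \<Rightarrow> bool" where
  "dfn A P \<longleftrightarrow> (\<exists>f :: ('f, 'r, 'v + 'm) nform. nwf L f \<and> set (snd f) \<subseteq> range Inl \<union> Inr ` A \<and>
     (\<forall>s \<in> env. P s \<longleftrightarrow> holds N (case_sum s id) f))"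

lemma dfnI:
  assumes "nwf L f" "set (snd f) \<subseteq> range Inl \<union> Inr ` A"
    "\<And>s. s \<in> env \<Longrightarrow> P s \<longleftrightarrow> holds N (case_sum s id) f"
  shows "dfn A P"
  using assms unfolding dfn_def by blast

lemma dfnE:
  assumes "dfn A P"
  obtains f where "nwf L f" "set (snd f) \<subseteq> range Inl \<union> Inr ` A"
    "\<forall>s \<in> env. P s \<longleftrightarrow> holds N (case_sum s id) f"
  using assms unfolding dfn_def by blast

lemma dfn_cong: "dfn A P \<Longrightarrow> (\<And>s. s \<in> env \<Longrightarrow> P s = Q s) \<Longrightarrow> dfn A Q"
  by (erule dfnE) (rule dfnI, auto)

lemma dfn_mono: "dfn A P \<Longrightarrow> A \<subseteq> B \<Longrightarrow> dfn B P"
  by (erule dfnE) (rule dfnI, assumption, blast, simp)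

text \<open>A formula mentions finitely many names. This makes infinite sets of variables harmless
  in quantification and compactness.\<close>

lemma dfn_support:
  assumes "dfn A P"
  obtains V where "finite V" "\<And>s s'. s \<in> env \<Longrightarrow> s' \<in> env \<Longrightarrow> (\<And>v. v \<in> V \<Longrightarrow> s v = s' v) \<Longrightarrow> P s = P s'"
proof -
  from assms obtain f where f0: "nwf L f" "set (snd f) \<subseteq> range Inl \<union> Inr ` A"
    and f: "\<forall>s \<in> env. P s \<longleftrightarrow> holds N (case_sum s id) f"
    by (rule dfnE)
  have "P s = P s'" if "s \<in> env" "s' \<in> env" "\<And>v. v \<in> Inl -` set (snd f) \<Longrightarrow> s v = s' v" for s s'
  proof -
    have "holds N (case_sum s id) f \<longleftrightarrow> holds N (case_sum s' id) f"
      by (rule holds_cong) (use that(3) in \<open>auto split: sum.split\<close>)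
    then show ?thesis using f that(1,2) by simp
  qed
  moreover have "finite (Inl -` set (snd f))" by (auto intro: finite_vimageI)
  ultimately show ?thesis using that by blast
qed

lemma dfn_True: "dfn A (\<lambda>s. True)"
  unfolding dfn_def by (intro exI[of _ nTrue]) (use struct in auto)

lemma dfn_not: "dfn A P \<Longrightarrow> dfn A (\<lambda>s. \<not> P s)"
  by (erule dfnE, rule dfnI[of "nNot _"]) auto

lemma dfn_conj:
  assumes "dfn A P" "dfn A Q" shows "dfn A (\<lambda>s. P s \<and> Q s)"
proof -
  from assms(1) obtain f where f: "nwf L f" "set (snd f) \<subseteq> range Inl \<union> Inr ` A"
      "\<forall>s \<in> env. P s \<longleftrightarrow> holds N (case_sum s id) f"
    by (rule dfnE)
  from assms(2) obtain g where g: "nwf L g" "set (snd g) \<subseteq> range Inl \<union> Inr ` A"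
      "\<forall>s \<in> env. Q s \<longleftrightarrow> holds N (case_sum s id) g"
    by (rule dfnE)
  show ?thesis by (rule dfnI[of "nAnd f g"]) (use f g in \<open>simp_all add: holds_nAnd\<close>)
qed

lemma dfn_disj: assumes "dfn A P" "dfn A Q" shows "dfn A (\<lambda>s. P s \<or> Q s)"
  using dfn_not[OF dfn_conj[OF assms[THEN dfn_not]]] by simp

lemma dfn_imp: assumes "dfn A P" "dfn A Q" shows "dfn A (\<lambda>s. P s \<longrightarrow> Q s)"
  using dfn_disj[OF dfn_not[OF assms(1)] assms(2)] by (simp only: imp_conv_disj)

lemma dfn_ball: "finite I \<Longrightarrow> (\<And>i. i \<in> I \<Longrightarrow> dfn A (P i)) \<Longrightarrow> dfn A (\<lambda>s. \<forall>i \<in> I. P i s)"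
  by (induction I rule: finite_induct) (simp_all add: dfn_True dfn_conj)

lemma dfn_bex:
  assumes "finite I" "\<And>i. i \<in> I \<Longrightarrow> dfn A (P i)" shows "dfn A (\<lambda>s. \<exists>i \<in> I. P i s)"
proof -
  have "dfn A (\<lambda>s. \<forall>i \<in> I. \<not> P i s)" by (intro dfn_ball dfn_not assms)
  from dfn_not[OF this] show ?thesis by simp
qed

lemma dfn_subst:
  assumes "dfn A P" "A \<subseteq> U" "range \<sigma> \<subseteq> range Inl \<union> Inr ` A"
  shows "dfn A (\<lambda>s. P (\<lambda>v. case_sum s id (\<sigma> v)))"
proof -
  from assms(1) obtain f where f: "nwf L f" "set (snd f) \<subseteq> range Inl \<union> Inr ` A"
      "\<forall>s \<in> env. P s \<longleftrightarrow> holds N (case_sum s id) f"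
    by (rule dfnE)
  have "P (\<lambda>v. case_sum s id (\<sigma> v)) \<longleftrightarrow> holds N (case_sum s id) (nMap (case_sum \<sigma> Inr) f)"
    if "s \<in> env" for s
  proof -
    have "(\<lambda>v. case_sum s id (\<sigma> v)) \<in> env"
      unfolding mem_env
    proof
      fix v
      have "\<sigma> v \<in> range Inl \<union> Inr ` A" using assms(3) by blast
      then show "case_sum s id (\<sigma> v) \<in> U" using that assms(2) by (auto simp: mem_env split: sum.split)
    qed
    moreover have "case_sum s id \<circ> case_sum \<sigma> Inr = case_sum (\<lambda>v. case_sum s id (\<sigma> v)) id"
      by (auto split: sum.split)
    ultimately show ?thesis using f(3) by simp
  qed
  moreover have "set (snd (nMap (case_sum \<sigma> Inr) f)) \<subseteq> range Inl \<union> Inr ` A"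
  proof clarify
    fix x assume x: "x \<in> set (snd (nMap (case_sum \<sigma> Inr) f))" "x \<notin> Inr ` A"
    then obtain y where y: "y \<in> set (snd f)" "x = case_sum \<sigma> Inr y" by auto
    show "x \<in> range Inl"
    proof (cases y)
      case (Inl v)
      then have "x \<in> range \<sigma>" using y by simp
      then show ?thesis using assms(3) x(2) by blast
    next
      case (Inr a)
      then show ?thesis using y x(2) f(2) by auto
    qed
  qed
  ultimately show ?thesis using f(1)
    by (intro dfnI[of "nMap (case_sum \<sigma> Inr) f"]) simp_all
qed

lemma dfn_reindex: assumes "dfn A P" "A \<subseteq> U" shows "dfn A (\<lambda>s. P (\<lambda>v. s (\<rho> v)))"
  using dfn_subst[OF assms, of "\<lambda>v. Inl (\<rho> v)"] by auto

lemma dfn_param: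
  assumes "dfn A P" "A \<subseteq> U" "range t \<subseteq> A" shows "dfn A (\<lambda>s. P (case_sum s t))"
proof -
  have "case_sum Inl (\<lambda>w. Inr (t w)) v \<in> range Inl \<union> Inr ` A" for v
    using assms(3) by (cases v) auto
  then have "dfn A (\<lambda>s. P (\<lambda>v. case_sum s id (case_sum Inl (\<lambda>w. Inr (t w)) v)))"
    by (intro dfn_subst[OF assms(1,2)]) blast
  moreover have eq: "(\<lambda>v. case_sum s id (case_sum Inl (\<lambda>w. Inr (t w)) v)) = case_sum s t" for s
    by (auto split: sum.split)
  ultimately show ?thesis unfolding eq by simp
qed

lemma dfn_ex1:
  fixes P :: "('v \<Rightarrow> 'm) \<Rightarrow> bool"
  assumes "dfn A P" shows "dfn A (\<lambda>s. \<exists>a \<in> U. P (s(v := a)))"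
proof -
  from assms(1) obtain f where f: "nwf L f" "set (snd f) \<subseteq> range Inl \<union> Inr ` A"
      "\<forall>s \<in> env. P s \<longleftrightarrow> holds N (case_sum s id) f"
    by (rule dfnE)
  show ?thesis
  proof (rule dfnI[of "nEx (Inl v) f"])
    fix s :: "'v \<Rightarrow> 'm" assume s: "s \<in> env"
    have "(case_sum s id)(Inl v := a) = case_sum (s(v := a)) id" for a
      by (auto split: sum.split)
    moreover have "s(v := a) \<in> env" if "a \<in> U" for a using s that by (auto simp: mem_env)
    ultimately show "(\<exists>a \<in> U. P (s(v := a))) \<longleftrightarrow> holds N (case_sum s id) (nEx (Inl v) f)"
      using f(3) by (simp add: holds_nEx[OF f(1)])
  qed (use f in simp_all)
qed

lemma dfn_ex_on:
  assumes "dfn A P" "finite W"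
  shows "dfn A (\<lambda>s. \<exists>t \<in> env. P (\<lambda>v. if v \<in> W then t v else s v))"
  using assms(2)
proof (induction W rule: finite_induct)
  case empty
  obtain u where "u \<in> U" using struct by (auto simp: is_struct_def)
  then have "(\<lambda>_ :: 'a. u) \<in> env" by (simp add: mem_env)
  then have "(\<exists>t \<in> (env :: ('a \<Rightarrow> 'm) set). P s) = P s" for s by auto
  then show ?case using assms(1) by simp
next
  case (insert w W)
  show ?case
  proof (rule dfn_cong[OF dfn_ex1[OF insert.IH, of w]])
    fix s :: "'a \<Rightarrow> 'm" assume s: "s \<in> env"
    show "(\<exists>a \<in> U. \<exists>t \<in> env. P (\<lambda>v. if v \<in> W then t v else (s(w := a)) v)) \<longleftrightarrow>
        (\<exists>t \<in> env. P (\<lambda>v. if v \<in> insert w W then t v else s v))" (is "?l = ?r")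
    proof
      assume ?l
      then obtain a t where at: "a \<in> U" "t \<in> env" "P (\<lambda>v. if v \<in> W then t v else (s(w := a)) v)" by blast
      have e: "(\<lambda>v. if v \<in> W then t v else (s(w := a)) v) =
          (\<lambda>v. if v \<in> insert w W then (t(w := a)) v else s v)" using insert.hyps by auto
      have "t(w := a) \<in> env" using at by (auto simp: mem_env)
      moreover have "P (\<lambda>v. if v \<in> insert w W then (t(w := a)) v else s v)" using at(3) unfolding e .
      ultimately show ?r by blast
    next
      assume ?r
      then obtain t where t: "t \<in> env" "P (\<lambda>v. if v \<in> insert w W then t v else s v)" by blast
      have e: "(\<lambda>v. if v \<in> insert w W then t v else s v) =
          (\<lambda>v. if v \<in> W then t v else (s(w := t w)) v)" by auto
      have "P (\<lambda>v. if v \<in> W then t v else (s(w := t w)) v)" using t(2) unfolding e .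
      moreover have "t w \<in> U" using t(1) by (simp add: mem_env)
      ultimately show ?l using t(1) by blast
    qed
  qed
qed

text \<open>The quantified assignment \<open>t\<close> may be infinite, but by
  \<open>dfn_support\<close> only its finitely many coordinates in \<open>W\<close> influence
  \<open>P\<close>, so finitely many element quantifiers suffice.\<close>

lemma dfn_ex:
  fixes P :: "('v + 'w \<Rightarrow> 'm) \<Rightarrow> bool"
  assumes "dfn A P" "A \<subseteq> U"
  shows "dfn A (\<lambda>s. \<exists>t \<in> env. P (case_sum s t))"
proof -
  obtain V where V: "finite V" "\<And>s s'. s \<in> env \<Longrightarrow> s' \<in> env \<Longrightarrow> (\<And>v. v \<in> V \<Longrightarrow> s v = s' v) \<Longrightarrow> P s = P s'"
    using dfn_support[OF assms(1)] by blast
  define W where "W = V \<inter> range Inr"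
  \<comment> \<open>\<open>s\<close> gives no values to the variables \<open>Inr w\<close>. They
    receive the value of an arbitrary variable, which \<open>t\<close> overwrites wherever
    \<open>P\<close> depends on it.\<close>
  define s0 where "s0 = (\<lambda>(s :: 'v \<Rightarrow> 'm) (v :: 'v + 'w). s (case_sum id (\<lambda>_. undefined) v))"
  have "dfn A (\<lambda>s. \<exists>t \<in> env. P (\<lambda>v. if v \<in> W then t v else s v))"
    by (rule dfn_ex_on[OF assms(1)]) (simp add: W_def V)
  from dfn_reindex[OF this assms(2), of "case_sum id (\<lambda>_. undefined)"]
  have "dfn A (\<lambda>s. \<exists>t \<in> env. P (\<lambda>v. if v \<in> W then t v else s0 s v))"
    unfolding s0_def .
  then show ?thesis
  proof (rule dfn_cong)
    fix s :: "'v \<Rightarrow> 'm" assume s: "s \<in> env"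
    have s0: "s0 s (Inl v) = s v" "s0 s \<in> env" for v using s by (auto simp: s0_def mem_env)
    show "(\<exists>t \<in> env. P (\<lambda>v. if v \<in> W then t v else s0 s v)) \<longleftrightarrow> (\<exists>t \<in> env. P (case_sum s t))"
    proof
      assume "\<exists>t \<in> env. P (\<lambda>v. if v \<in> W then t v else s0 s v)"
      then obtain t where t: "t \<in> env" "P (\<lambda>v. if v \<in> W then t v else s0 s v)" by blast
      have "P (\<lambda>v. if v \<in> W then t v else s0 s v) = P (case_sum s (t \<circ> Inr))"
      proof (rule V(2))
        show "(if v \<in> W then t v else s0 s v) = case_sum s (t \<circ> Inr) v" if "v \<in> V" for v
          using that s0(1) by (cases v) (auto simp: W_def)
      qed (use t s s0 in \<open>auto simp: mem_env split: sum.split\<close>)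
      then show "\<exists>t \<in> env. P (case_sum s t)"
        using t by (intro bexI[of _ "t \<circ> Inr"]) (auto simp: mem_env)
    next
      assume "\<exists>t \<in> env. P (case_sum s t)"
      then obtain t where t: "t \<in> env" "P (case_sum s t)" by blast
      have "P (\<lambda>v. if v \<in> W then case_sum s t v else s0 s v) = P (case_sum s t)"
      proof (rule V(2))
        show "(if v \<in> W then case_sum s t v else s0 s v) = case_sum s t v" if "v \<in> V" for v
          using that s0(1) by (cases v) (auto simp: W_def)
      qed (use t s s0 in \<open>auto simp: mem_env split: sum.split\<close>)
      then show "\<exists>t \<in> env. P (\<lambda>v. if v \<in> W then t v else s0 s v)"
        using t s by (intro bexI[of _ "case_sum s t"]) (auto simp: mem_env split: sum.split)
    qed
  qed
qed

lemma dfn_form: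
  assumes "form L (length vs) \<phi>" "set vs \<subseteq> range Inl \<union> Inr ` A"
  shows "dfn A (\<lambda>s. sat N (map (case_sum s id) vs) \<phi>)"
  by (rule dfnI[of "(\<phi>, vs)"]) (use assms in \<open>auto simp: nwf_def holds_def\<close>)

section \<open>Compactness and types\<close>

lemma infinite_forms: "infinite {\<phi> :: ('f, 'r) fo_form. \<exists>n. form L n \<phi>}"
proof (rule infinite_super)
  show "range (\<lambda>i. FEq (FVar i) (FVar i)) \<subseteq> {\<phi> :: ('f, 'r) fo_form. \<exists>n. form L n \<phi>}"
    by auto
  show "infinite (range (\<lambda>i. FEq (FVar i) (FVar i) :: ('f, 'r) fo_form))"
    by (rule range_inj_infinite) (auto intro: injI)
qed

lemma infinite_\<kappa>: "\<not> finite (Field \<kappa>)"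
  using forms_small infinite_forms Card
  by (metis card_of_Field_ordIso card_of_ordLeq_finite ordIso_symmetric ordLess_imp_ordLeq
      ordLess_ordIso_trans)

lemma small_countable: assumes "countable C" "C \<subseteq> U" shows "small C"
proof -
  have "|C| \<le>o |UNIV :: nat set|"
    using assms(1) by (meson card_of_ordLeqI countableE UNIV_I)
  also have "|UNIV :: nat set| \<le>o |{\<phi> :: ('f, 'r) fo_form. \<exists>n. form L n \<phi>}|"
    using infinite_forms by (simp only: infinite_iff_card_of_nat)
  also note forms_small
  finally show ?thesis using assms(2) by (simp add: small_def)
qed

lemma small_Un: "small A \<Longrightarrow> small B \<Longrightarrow> small (A \<union> B)"
  unfolding small_def using card_of_Un_ordLess_infinite_Field[OF infinite_\<kappa> Card] by blast

lemma small_sub: "small A \<Longrightarrow> A \<subseteq> U"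
  by (simp add: small_def)

lemma small_range: fixes t :: "'v :: countable \<Rightarrow> 'm" shows "t \<in> env \<Longrightarrow> small (range t)"
  by (rule small_countable) (auto simp: mem_env)

lemma saturated_one:
  fixes \<Gamma> :: "((unit \<Rightarrow> 'm) \<Rightarrow> bool) set"
  assumes A: "small A" and \<Gamma>: "\<And>P. P \<in> \<Gamma> \<Longrightarrow> dfn A P"
    and fip: "\<And>\<Delta>. finite \<Delta> \<Longrightarrow> \<Delta> \<subseteq> \<Gamma> \<Longrightarrow> \<exists>x \<in> U. \<forall>P \<in> \<Delta>. P (\<lambda>_. x)"
  shows "\<exists>x \<in> U. \<forall>P \<in> \<Gamma>. P (\<lambda>_. x)"
proof -
  obtain u0 where u0: "u0 \<in> U" using struct by (auto simp: is_struct_def)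
  have "\<forall>P \<in> \<Gamma>. \<exists>f :: ('f, 'r, unit + 'm) nform. nwf L f \<and> set (snd f) \<subseteq> range Inl \<union> Inr ` A \<and>
     (\<forall>s \<in> env. P s \<longleftrightarrow> holds N (case_sum s id) f)" using \<Gamma> unfolding dfn_def by blast
  then obtain f where f: "\<And>P. P \<in> \<Gamma> \<Longrightarrow> nwf L (f P)" "\<And>P. P \<in> \<Gamma> \<Longrightarrow> set (snd (f P)) \<subseteq> range Inl \<union> Inr ` A"
     "\<And>P s. P \<in> \<Gamma> \<Longrightarrow> s \<in> env \<Longrightarrow> P s \<longleftrightarrow> holds N (case_sum s id) (f P)" by metis
  \<comment> \<open>One slot is kept for every position of the name list, so that position
    \<open>i\<close> can become variable \<open>Suc i\<close>. The slots of the type variable are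
    filled with \<open>u0\<close> and never read; they are the reason why \<open>u0\<close> joins
    the parameter set.\<close>
  define c where "c = (\<lambda>P. map (case_sum (\<lambda>_. u0) id) (snd (f P)))"
  define \<rho> where "\<rho> = (\<lambda>P i. if snd (f P) ! i = Inl () then 0 else Suc i)"
  define \<phi> where "\<phi> = (\<lambda>P. ren (\<rho> P) (fst (f P)))"
  have sat: "sat N ([x] @ c P) (\<phi> P) = P (\<lambda>_. x)" if "P \<in> \<Gamma>" "x \<in> U" for P x
  proof -
    have "sat N ([x] @ c P) (ren (\<rho> P) (fst (f P))) =
        sat N (map (case_sum (\<lambda>_. x) id) (snd (f P))) (fst (f P))"
    proof (rule sat_ren)
      show "form L (length (snd (f P))) (fst (f P))" using f(1)[OF that(1)] by (simp add: nwf_def)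
      fix i assume i: "i < length (snd (f P))"
      then show "map (case_sum (\<lambda>_. x) id) (snd (f P)) ! i = ([x] @ c P) ! \<rho> P i"
        by (cases "snd (f P) ! i") (auto simp: \<rho>_def c_def)
    qed
    also have "\<dots> = P (\<lambda>_. x)" using f(3)[OF that(1), of "\<lambda>_. x"] that(2) by (simp add: mem_env holds_def)
    finally show ?thesis by (simp add: \<phi>_def)
  qed
  have A': "insert u0 A \<subseteq> U" "|insert u0 A| <o \<kappa>"
    using small_Un[OF A, of "{u0}"] small_countable[of "{u0}"] u0 by (auto simp: small_def)
  have c: "set (c P) \<subseteq> insert u0 A \<and> form L (1 + length (c P)) (\<phi> P)" if P: "P \<in> \<Gamma>" for P
  proof
    show "set (c P) \<subseteq> insert u0 A"
    proof
      fix x assume "x \<in> set (c P)"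
      then obtain y where "y \<in> set (snd (f P))" "x = case_sum (\<lambda>_. u0) id y" by (auto simp: c_def)
      then show "x \<in> insert u0 A" using f(2)[OF P] by (cases y) auto
    qed
    show "form L (1 + length (c P)) (\<phi> P)"
      unfolding \<phi>_def by (rule form_ren) (use f(1)[OF P] in \<open>auto simp: nwf_def \<rho>_def c_def\<close>)
  qed
  have "\<exists>a \<in> tuples U 1. \<forall>(\<phi>, c) \<in> (\<lambda>P. (\<phi> P, c P)) ` \<Gamma>. sat N (a @ c) \<phi>"
  proof (rule saturated[unfolded saturated_def, rule_format, of "insert u0 A"], intro conjI allI impI)
    show "\<forall>(\<phi>, c) \<in> (\<lambda>P. (\<phi> P, c P)) ` \<Gamma>. set c \<subseteq> insert u0 A \<and> form L (1 + length c) \<phi>"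
      using c by blast
    fix q assume "q \<subseteq> (\<lambda>P. (\<phi> P, c P)) ` \<Gamma>" "finite q"
    then obtain \<Delta> where \<Delta>: "\<Delta> \<subseteq> \<Gamma>" "finite \<Delta>" "q = (\<lambda>P. (\<phi> P, c P)) ` \<Delta>"
      by (meson finite_subset_image)
    then obtain x where x: "x \<in> U" "\<forall>P \<in> \<Delta>. P (\<lambda>_. x)" using fip by blast
    have "\<forall>(\<phi>, c) \<in> q. sat N ([x] @ c) \<phi>" unfolding \<Delta>(3) using x sat \<Delta>(1) by blast
    moreover have "[x] \<in> tuples U 1" using x by (simp add: tuples_def)
    ultimately show "\<exists>a \<in> tuples U 1. \<forall>(\<phi>, c) \<in> q. sat N (a @ c) \<phi>" by blast
  qed (use A' in auto)
  then obtain a where a: "a \<in> tuples U 1" "\<forall>P \<in> \<Gamma>. sat N (a @ c P) (\<phi> P)" by auto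
  then obtain x where "a = [x]" "x \<in> U" by (auto simp: tuples_def length_Suc_conv)
  then show ?thesis using a(2) sat by auto
qed

text \<open>\<open>saturated\<close> realises types in finitely many variables. A type in infinitely
  many is realised one coordinate at a time: \<open>ok j s\<close> says that the first
  \<open>j\<close> values of \<open>s\<close> leave \<Gamma> finitely satisfiable, and only these
  values become new parameters.\<close>

lemma compactness_nat:
  fixes \<Gamma> :: "((nat \<Rightarrow> 'm) \<Rightarrow> bool) set"
  assumes A: "small A" and \<Gamma>: "\<And>P. P \<in> \<Gamma> \<Longrightarrow> dfn A P"
    and fip: "\<And>\<Delta>. finite \<Delta> \<Longrightarrow> \<Delta> \<subseteq> \<Gamma> \<Longrightarrow> \<exists>s \<in> env. \<forall>P \<in> \<Delta>. P s"
  shows "\<exists>s \<in> env. \<forall>P \<in> \<Gamma>. P s"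
proof -
  define ok where "ok = (\<lambda>j (s :: nat \<Rightarrow> 'm). s \<in> env \<and>
      (\<forall>\<Delta>. finite \<Delta> \<longrightarrow> \<Delta> \<subseteq> \<Gamma> \<longrightarrow> (\<exists>t \<in> env. \<forall>P \<in> \<Delta>. P (\<lambda>i. if i < j then s i else t i))))"
  obtain u0 where u0: "u0 \<in> U" using struct by (auto simp: is_struct_def)
  have ok0: "ok 0 (\<lambda>_. u0)" using u0 fip by (simp add: ok_def mem_env)
  have step: "\<exists>a \<in> U. ok (Suc j) (s(j := a))" if s: "ok j s" for j s
  proof -
    \<comment> \<open>\<open>R \<Delta>\<close> is the projection of \<Delta> to coordinate
      \<open>j\<close> once the earlier coordinates are fixed; one-variable saturation is applied to
      all these projections.\<close>
    define R where "R = (\<lambda>\<Delta> x. \<exists>t \<in> env. \<forall>P \<in> \<Delta>. P (\<lambda>i. if i < j then s i else if i = j then x () else t i))"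
    let ?B = "A \<union> s ` {..<j}"
    have s': "s i \<in> U" for i using s by (simp add: ok_def mem_env)
    have B: "small ?B" by (intro small_Un A small_countable) (use s' in auto)
    have dR: "dfn ?B (R \<Delta>)" if "finite \<Delta>" "\<Delta> \<subseteq> \<Gamma>" for \<Delta>
    proof -
      have "dfn A (\<lambda>s. \<forall>P \<in> \<Delta>. P s)" using that \<Gamma> by (intro dfn_ball) auto
      then have "dfn ?B (\<lambda>s. \<forall>P \<in> \<Delta>. P s)" by (rule dfn_mono) auto
      from dfn_subst[OF this small_sub[OF B], of
          "\<lambda>i. if i < j then Inr (s i) else if i = j then Inl (Inl ()) else Inl (Inr i)"]
      have "dfn ?B (\<lambda>z. \<forall>P \<in> \<Delta>. P (\<lambda>v. case_sum z id (if v < j then Inr (s v) else if v = j then Inl (Inl ()) else Inl (Inr v))))"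
        by auto
      from dfn_ex[OF this small_sub[OF B]]
      show ?thesis
      proof (rule dfn_cong)
        fix x :: "unit \<Rightarrow> 'm" assume "x \<in> env"
        have "(\<lambda>v. case_sum (case_sum x t) id (if v < j then Inr (s v) else if v = j then Inl (Inl ()) else Inl (Inr v)))
          = (\<lambda>i. if i < j then s i else if i = j then x () else t i)" for t
          by (auto simp: fun_eq_iff)
        then show "(\<exists>t \<in> env. \<forall>P \<in> \<Delta>. P (\<lambda>v. case_sum (case_sum x t) id (if v < j then Inr (s v) else if v = j then Inl (Inl ()) else Inl (Inr v)))) = R \<Delta> x"
          unfolding R_def by (simp only:)
      qed
    qed
    have "\<exists>a \<in> U. \<forall>P \<in> R ` {\<Delta>. finite \<Delta> \<and> \<Delta> \<subseteq> \<Gamma>}. P (\<lambda>_. a)"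
    proof (rule saturated_one[OF B])
      show "dfn ?B P" if "P \<in> R ` {\<Delta>. finite \<Delta> \<and> \<Delta> \<subseteq> \<Gamma>}" for P using that dR by blast
      fix D assume "finite D" "D \<subseteq> R ` {\<Delta>. finite \<Delta> \<and> \<Delta> \<subseteq> \<Gamma>}"
      then obtain E where E: "finite E" "E \<subseteq> {\<Delta>. finite \<Delta> \<and> \<Delta> \<subseteq> \<Gamma>}" "D = R ` E"
        by (meson finite_subset_image)
      \<comment> \<open>A solution of the union solves all members of \<open>E\<close> with the same
        value at \<open>j\<close>.\<close>
      then have "finite (\<Union>E)" "\<Union>E \<subseteq> \<Gamma>" by auto
      then obtain t where t: "t \<in> env" "\<forall>P \<in> \<Union>E. P (\<lambda>i. if i < j then s i else t i)"
        using s unfolding ok_def by blast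
      have "R \<Delta> (\<lambda>_. t j)" if "\<Delta> \<in> E" for \<Delta>
      proof -
        have "(\<lambda>i. if i < j then s i else if i = j then t j else t i) = (\<lambda>i. if i < j then s i else t i)"
          by auto
        then show ?thesis unfolding R_def using t that by (intro bexI[of _ t]) auto
      qed
      then show "\<exists>x \<in> U. \<forall>P \<in> D. P (\<lambda>_. x)"
        using E t(1) by (intro bexI[of _ "t j"]) (auto simp: mem_env)
    qed
    then obtain a where a: "a \<in> U" "\<And>\<Delta>. finite \<Delta> \<Longrightarrow> \<Delta> \<subseteq> \<Gamma> \<Longrightarrow> R \<Delta> (\<lambda>_. a)" by blast
    have "ok (Suc j) (s(j := a))"
      unfolding ok_def
    proof (intro conjI allI impI)
      show "s(j := a) \<in> env" using a s' by (simp add: mem_env)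
      fix \<Delta> assume "finite \<Delta>" "\<Delta> \<subseteq> \<Gamma>"
      then obtain t where t: "t \<in> env" "\<forall>P \<in> \<Delta>. P (\<lambda>i. if i < j then s i else if i = j then a else t i)"
        using a(2) unfolding R_def by blast
      have "(\<lambda>i. if i < j then s i else if i = j then a else t i) =
          (\<lambda>i. if i < Suc j then (s(j := a)) i else t i)" by (auto simp: fun_eq_iff)
      then show "\<exists>t \<in> env. \<forall>P \<in> \<Delta>. P (\<lambda>i. if i < Suc j then (s(j := a)) i else t i)"
        using t by auto
    qed
    then show ?thesis using a(1) by blast
  qed
  obtain S where S: "\<And>n. ok n (S n)" "\<And>n. \<exists>a \<in> U. S (Suc n) = (S n)(n := a)"
    using dependent_nat_choice[of ok "\<lambda>n s s'. \<exists>a \<in> U. s' = s(n := a)"] ok0 step by metis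
  define s where "s = (\<lambda>i. S (Suc i) i)"
  have pre: "S n i = s i" if "i < n" for n i
    using that
  proof (induction n)
    case (Suc n)
    obtain a where "S (Suc n) = (S n)(n := a)" using S(2) by blast
    then show ?case using Suc by (cases "i = n") (auto simp: s_def)
  qed simp
  have s: "s \<in> env" using S(1) by (simp add: s_def ok_def mem_env)
  have "P s" if P: "P \<in> \<Gamma>" for P
  proof -
    obtain V where V: "finite V" "\<And>s s'. s \<in> env \<Longrightarrow> s' \<in> env \<Longrightarrow> (\<And>v. v \<in> V \<Longrightarrow> s v = s' v) \<Longrightarrow> P s = P s'"
      using dfn_support[OF \<Gamma>[OF P]] by blast
    obtain n where n: "\<And>v. v \<in> V \<Longrightarrow> v < n" using V(1) by (meson finite_nat_set_iff_bounded)
    have "\<exists>t \<in> env. \<forall>P \<in> {P}. P (\<lambda>i. if i < n then S n i else t i)"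
      using S(1)[of n] P unfolding ok_def by blast
    then obtain t where t: "t \<in> env" "P (\<lambda>i. if i < n then S n i else t i)" by blast
    \<comment> \<open>\<open>P\<close> depends only on coordinates below \<open>n\<close>, where
      \<open>S n\<close> already has its final values.\<close>
    have "P (\<lambda>i. if i < n then S n i else t i) = P s"
      using S(1)[of n] t(1) s n pre by (intro V(2)) (auto simp: mem_env ok_def)
    then show ?thesis using t by simp
  qed
  then show ?thesis using s by blast
qed

lemma compactness:
  fixes \<Gamma> :: "(('v :: countable \<Rightarrow> 'm) \<Rightarrow> bool) set"
  assumes A: "small A" and \<Gamma>: "\<And>P. P \<in> \<Gamma> \<Longrightarrow> dfn A P"
    and fip: "\<And>\<Delta>. finite \<Delta> \<Longrightarrow> \<Delta> \<subseteq> \<Gamma> \<Longrightarrow> \<exists>s \<in> env. \<forall>P \<in> \<Delta>. P s"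
  shows "\<exists>s \<in> env. \<forall>P \<in> \<Gamma>. P s"
proof -
  let ?h = "\<lambda>(P :: ('v \<Rightarrow> 'm) \<Rightarrow> bool) (s :: nat \<Rightarrow> 'm). P (\<lambda>v. s (to_nat v))"
  have "\<exists>s \<in> env. \<forall>P \<in> ?h ` \<Gamma>. P s"
  proof (rule compactness_nat[OF A])
    show "dfn A P" if "P \<in> ?h ` \<Gamma>" for P using that \<Gamma> dfn_reindex[OF _ small_sub[OF A]] by blast
    fix D assume "finite D" "D \<subseteq> ?h ` \<Gamma>"
    then obtain \<Delta> where \<Delta>: "\<Delta> \<subseteq> \<Gamma>" "finite \<Delta>" "D = ?h ` \<Delta>" by (meson finite_subset_image)
    then obtain s where s: "s \<in> env" "\<forall>P \<in> \<Delta>. P s" using fip by blast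
    then show "\<exists>s \<in> env. \<forall>P \<in> D. P s"
      unfolding \<Delta>(3) by (intro bexI[of _ "\<lambda>n. s (from_nat n)"]) (auto simp: mem_env)
  qed
  then obtain s where "s \<in> env" "\<forall>P \<in> \<Gamma>. P (\<lambda>v. s (to_nat v))" by auto
  then show ?thesis by (intro bexI[of _ "\<lambda>v. s (to_nat v)"]) (auto simp: mem_env)
qed

section \<open>Types of tuples over parameter sets\<close>

definition eqv :: "'m set \<Rightarrow> ('v \<Rightarrow> 'm) \<Rightarrow> ('v \<Rightarrow> 'm) \<Rightarrow> bool" where
  "eqv A t t' \<longleftrightarrow> (\<forall>P. dfn A P \<longrightarrow> (P t \<longleftrightarrow> P t'))"

lemma eqvI: assumes "\<And>P. dfn A P \<Longrightarrow> P t \<Longrightarrow> P t'" shows "eqv A t t'"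
  unfolding eqv_def using assms dfn_not by blast

lemma eqvD: "eqv A t t' \<Longrightarrow> dfn A P \<Longrightarrow> P t \<Longrightarrow> P t'"
  unfolding eqv_def by blast

lemma eqv_refl [simp]: "eqv A t t" by (simp add: eqv_def)
lemma eqv_sym: "eqv A t t' \<Longrightarrow> eqv A t' t" unfolding eqv_def by blast
lemma eqv_trans [trans]: "eqv A t t' \<Longrightarrow> eqv A t' t'' \<Longrightarrow> eqv A t t''" unfolding eqv_def by blast
lemma eqv_mono: "eqv B t t' \<Longrightarrow> A \<subseteq> B \<Longrightarrow> eqv A t t'"
  unfolding eqv_def using dfn_mono by blast

lemma eqv_reindex: assumes "eqv A t t'" "A \<subseteq> U" shows "eqv A (\<lambda>v. t (\<rho> v)) (\<lambda>v. t' (\<rho> v))"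
  using eqvD[OF assms(1) dfn_reindex[OF _ assms(2)]] by (intro eqvI) blast

text \<open>Does the work of an automorphism over \<open>A\<close> that takes \<open>t\<close> to
  \<open>t'\<close>. Finitely many conditions on \<open>u\<close> relative to \<open>t\<close> are
  solvable; solvability is a definable property of \<open>t\<close>, hence of \<open>t'\<close>, and
  compactness collects the solutions.\<close>

lemma eqv_extend:
  fixes t t' :: "'v :: countable \<Rightarrow> 'm" and u :: "'w :: countable \<Rightarrow> 'm"
  assumes A: "small A" and e: "eqv A t t'" and env: "t \<in> env" "t' \<in> env" "u \<in> env"
  obtains u' where "u' \<in> env" "eqv A (case_sum t u) (case_sum t' u')"
proof -
  define \<Gamma> where "\<Gamma> = (\<lambda>P u'. P (case_sum t' u')) ` {P. dfn A P \<and> P (case_sum t u)}"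
  let ?B = "A \<union> range t'"
  have B: "small ?B" by (intro small_Un A small_range env)
  have "\<exists>u' \<in> env. \<forall>P \<in> \<Gamma>. P u'"
  proof (rule compactness[OF B])
    fix P assume "P \<in> \<Gamma>"
    then obtain Q where Q: "dfn A Q" "P = (\<lambda>u'. Q (case_sum t' u'))" by (auto simp: \<Gamma>_def)
    have "dfn ?B Q" using Q(1) by (rule dfn_mono) simp
    from dfn_reindex[OF this small_sub[OF B], of "case_sum Inr Inl"]
    have "dfn ?B (\<lambda>s. Q (\<lambda>v. s (case_sum Inr Inl v)))" .
    from dfn_param[OF this small_sub[OF B], of t']
    have "dfn ?B (\<lambda>s. Q (\<lambda>v. case_sum s t' (case_sum Inr Inl v)))" by simp
    moreover have eq: "(\<lambda>v. case_sum s t' (case_sum Inr Inl v)) = case_sum t' s" for s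
      by (auto split: sum.split)
    ultimately show "dfn ?B P" unfolding Q(2) eq by simp
  next
    fix \<Delta> assume "finite \<Delta>" "\<Delta> \<subseteq> \<Gamma>"
    then obtain E where E: "E \<subseteq> {P. dfn A P \<and> P (case_sum t u)}" "finite E" "\<Delta> = (\<lambda>P u'. P (case_sum t' u')) ` E"
      unfolding \<Gamma>_def by (meson finite_subset_image)
    have "dfn A (\<lambda>s. \<forall>P \<in> E. P s)" using E by (intro dfn_ball) auto
    then have "dfn A (\<lambda>s. \<exists>u \<in> env. \<forall>P \<in> E. P (case_sum s u))" by (rule dfn_ex) (rule small_sub[OF A])
    from eqvD[OF e this] have "\<exists>u \<in> env. \<forall>P \<in> E. P (case_sum t' u)" using E(1) env by blast
    then show "\<exists>u' \<in> env. \<forall>P \<in> \<Delta>. P u'" unfolding E(3) by auto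
  qed
  then obtain u' where "u' \<in> env" "\<And>P. dfn A P \<Longrightarrow> P (case_sum t u) \<Longrightarrow> P (case_sum t' u')"
    unfolding \<Gamma>_def by auto
  then show ?thesis using that eqvI by metis
qed

text \<open>Parameters from \<open>range u\<close> can be turned into variables evaluated at
  \<open>u\<close>, so a relation over \<open>A\<close> and \<open>u\<close> is one over
  \<open>A\<close> about the pair.\<close>

lemma eqv_Un_range:
  assumes "eqv A (case_sum t u) (case_sum t' u)" "A \<subseteq> U" "t \<in> env" "t' \<in> env" "u \<in> env"
  shows "eqv (A \<union> range u) t t'"
proof (rule eqvI)
  fix P assume P: "dfn (A \<union> range u) P" "P t"
  from P(1) obtain f where f: "nwf L f" "set (snd f) \<subseteq> range Inl \<union> Inr ` (A \<union> range u)"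
      "\<forall>s \<in> env. P s \<longleftrightarrow> holds N (case_sum s id) f"
    by (rule dfnE)
  define \<sigma> where "\<sigma> = (\<lambda>a. if a \<in> A then Inr a else Inl (Inr (inv_into UNIV u a)) :: ('a + 'b) + 'm)"
  define g where "g = nMap (case_sum (\<lambda>v. Inl (Inl v)) \<sigma>) f"
  have "dfn A (\<lambda>s. holds N (case_sum s id) g)"
  proof (rule dfnI)
    show "nwf L g" using f(1) by (simp add: g_def)
    show "set (snd g) \<subseteq> range Inl \<union> Inr ` A"
      using f(2) by (auto simp: g_def \<sigma>_def split: sum.split)
  qed simp
  moreover have "holds N (case_sum (case_sum s u) id) g = P s" if "s \<in> env" for s
  proof -
    have "holds N (case_sum (case_sum s u) id \<circ> case_sum (\<lambda>v. Inl (Inl v)) \<sigma>) f = holds N (case_sum s id) f"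
    proof (rule holds_cong)
      fix v assume "v \<in> set (snd f)"
      then have "v \<in> range Inl \<union> Inr ` (A \<union> range u)" using f(2) by blast
      then show "(case_sum (case_sum s u) id \<circ> case_sum (\<lambda>v. Inl (Inl v)) \<sigma>) v = case_sum s id v"
        by (auto simp: \<sigma>_def f_inv_into_f)
    qed
    then show ?thesis using f(3) that by (simp add: g_def)
  qed
  ultimately show "P t'" using eqvD[OF assms(1)] assms(3,4) P(2) by blast
qed

lemma eqv_Un_rangeD:
  assumes "eqv (A \<union> range u) t t'" "A \<subseteq> U" "u \<in> env"
  shows "eqv A (case_sum t u) (case_sum t' u)"
proof (rule eqvI)
  fix P assume P: "dfn A P" "P (case_sum t u)"
  have "dfn (A \<union> range u) P" using P(1) by (rule dfn_mono) simp
  then have "dfn (A \<union> range u) (\<lambda>s. P (case_sum s u))"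
    by (rule dfn_param) (use assms(2,3) in \<open>auto simp: mem_env\<close>)
  then show "P (case_sum t' u)" using eqvD[OF assms(1)] P(2) by blast
qed

section \<open>Dividing and coheirs\<close>

lemma env_nonempty: obtains s :: "'v \<Rightarrow> 'm" where "s \<in> env"
proof -
  obtain u where "u \<in> U" using struct by (auto simp: is_struct_def)
  then have "(\<lambda>_ :: 'v. u) \<in> env" by (simp add: mem_env)
  then show ?thesis using that by blast
qed

lemma case_sum_env [simp]: "case_sum s t \<in> env \<longleftrightarrow> s \<in> env \<and> t \<in> env"
  by (auto simp: mem_env split: sum.splits)

text \<open>\<open>\<rho> i\<close> cuts the \<open>i\<close>-th instance out of one big tuple;
  consistency of finitely many instances thus becomes a definable condition on a whole sequence or
  array.\<close>

lemma dfn_simul: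
  fixes \<Phi> :: "('x + 'v \<Rightarrow> 'm) \<Rightarrow> bool"
  assumes "dfn A \<Phi>" "A \<subseteq> U" "finite I"
  shows "dfn A (\<lambda>s. \<exists>x \<in> env. \<forall>i \<in> I. \<Phi> (case_sum x (\<lambda>v. s (\<rho> i v))))"
proof -
  have "dfn A (\<lambda>z. \<Phi> (case_sum (\<lambda>x. z (Inr x)) (\<lambda>v. z (Inl (\<rho> i v)))))" for i
  proof -
    have eq: "case_sum (\<lambda>x. z (Inr x)) (\<lambda>v. z (Inl (\<rho> i v))) = (\<lambda>w. z (case_sum Inr (\<lambda>v. Inl (\<rho> i v)) w))" for z
      by (auto split: sum.split)
    show ?thesis unfolding eq by (rule dfn_reindex) fact+
  qed
  then have "dfn A (\<lambda>z. \<forall>i \<in> I. \<Phi> (case_sum (\<lambda>x. z (Inr x)) (\<lambda>v. z (Inl (\<rho> i v)))))"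
    using assms(3) by (intro dfn_ball)
  from dfn_ex[OF this assms(2)] show ?thesis by simp
qed

definition kinc :: "(('x + 'v \<Rightarrow> 'm) \<Rightarrow> bool) \<Rightarrow> nat \<Rightarrow> (nat \<Rightarrow> 'v \<Rightarrow> 'm) \<Rightarrow> bool" where
  "kinc \<Phi> k r \<longleftrightarrow> (\<forall>I. finite I \<longrightarrow> card I = k \<longrightarrow> \<not> (\<exists>x \<in> env. \<forall>i \<in> I. \<Phi> (case_sum x (r i))))"

definition divs :: "'m set \<Rightarrow> (('x + 'v \<Rightarrow> 'm) \<Rightarrow> bool) \<Rightarrow> ('v \<Rightarrow> 'm) \<Rightarrow> bool" where
  "divs A \<Phi> t \<longleftrightarrow> (\<exists>k r. (\<forall>i. r i \<in> env \<and> eqv A (r i) t) \<and> kinc \<Phi> k r)"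

lemma kinc_inj:
  assumes "kinc \<Phi> k r" "inj g" shows "kinc \<Phi> k (\<lambda>i. r (g i))"
  unfolding kinc_def
proof (intro allI impI)
  fix I :: "nat set" assume I: "finite I" "card I = k"
  have "finite (g ` I)" "card (g ` I) = k" using I assms(2) by (auto simp: card_image inj_on_subset)
  then show "\<not> (\<exists>x \<in> env. \<forall>i \<in> I. \<Phi> (case_sum x (r (g i))))" using assms(1) unfolding kinc_def by blast
qed

text \<open>\<open>NTP2\<close> speaks of formulas in lists of variables. Only the finitely many
  object variables that occur in the formula matter, so the array is rewritten for a formula whose
  \<open>x\<close> lists these variables and whose \<open>y\<close> has one slot per position of the
  name list.\<close>

lemma has_TP2_of_array:
  fixes \<Phi> :: "('x + 'v \<Rightarrow> 'm) \<Rightarrow> bool" and r :: "nat \<Rightarrow> nat \<Rightarrow> 'v \<Rightarrow> 'm"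
  assumes \<Phi>: "dfn A \<Phi>" and A: "A \<subseteq> U" and r: "\<And>\<alpha> i. r \<alpha> i \<in> env"
    and rows: "\<And>\<alpha>. kinc \<Phi> k (r \<alpha>)"
    and paths: "\<And>f n. \<exists>x \<in> env. \<forall>\<alpha> < n. \<Phi> (case_sum x (r \<alpha> (f \<alpha>)))"
  shows "\<exists>m n \<phi>. form L (m + n) \<phi> \<and> has_TP2 N k m n \<phi>"
proof -
  obtain u0 where u0: "u0 \<in> U" using struct by (auto simp: is_struct_def)
  from \<Phi> obtain f where f: "nwf L f" "set (snd f) \<subseteq> range Inl \<union> Inr ` A"
      "\<forall>s \<in> env. \<Phi> s \<longleftrightarrow> holds N (case_sum s id) f" by (rule dfnE)
  define vs where "vs = snd f"
  define xs where "xs = concat (map (\<lambda>z. case z of Inl (Inl x) \<Rightarrow> [x] | _ \<Rightarrow> []) vs)"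
  define m where "m = length xs"
  define n where "n = length vs"
  have xs: "x \<in> set xs" if "Inl (Inl x) \<in> set vs" for x
    using that by (force simp: xs_def)
  then have "\<forall>x. \<exists>p. Inl (Inl x) \<in> set vs \<longrightarrow> p < m \<and> xs ! p = x"
    unfolding m_def by (metis in_set_conv_nth)
  then obtain pos where pos: "\<And>x. Inl (Inl x) \<in> set vs \<Longrightarrow> pos x < m \<and> xs ! pos x = x" by metis
  \<comment> \<open>Object variables are read from the \<open>x\<close> block. Every other position
    \<open>i\<close> has its own slot \<open>m + i\<close>, which holds a row entry or a fixed
    parameter.\<close>
  define \<rho> where "\<rho> = (\<lambda>i. case vs ! i of Inl (Inl x) \<Rightarrow> pos x | _ \<Rightarrow> m + i)"
  define \<phi> where "\<phi> = ren \<rho> (fst f)"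
  define b where "b = (\<lambda>t. map (\<lambda>z. case z of Inl (Inl x) \<Rightarrow> u0 | Inl (Inr v) \<Rightarrow> t v | Inr c \<Rightarrow> c) vs)"
  define X where "X = (\<lambda>(a :: 'm list) x. if pos x < m then a ! pos x else u0)"
  have form: "form L (m + n) \<phi>"
    unfolding \<phi>_def
  proof (rule form_ren)
    show "form L n (fst f)" using f(1) by (simp add: nwf_def n_def vs_def)
    fix i assume "i < n"
    then have "vs ! i \<in> set vs" by (simp add: n_def)
    then show "\<rho> i < m + n" using pos \<open>i < n\<close> by (fastforce simp: \<rho>_def split: sum.splits)
  qed
  have b: "b t \<in> tuples U n" if "t \<in> env" for t
  proof -
    have "(case z of Inl (Inl x) \<Rightarrow> u0 | Inl (Inr v) \<Rightarrow> t v | Inr c \<Rightarrow> c) \<in> U" if z: "z \<in> set vs" for z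
    proof -
      have "z \<in> range Inl \<union> Inr ` A" using f(2) z by (auto simp: vs_def)
      then show ?thesis using A u0 \<open>t \<in> env\<close> by (auto simp: mem_env split: sum.splits)
    qed
    then show ?thesis by (auto simp: tuples_def b_def n_def)
  qed
  have X: "X a \<in> env" if "a \<in> tuples U m" for a
    using that u0 by (auto simp: X_def mem_env tuples_def)
  have sat: "sat N (a @ b t) \<phi> = \<Phi> (case_sum (X a) t)" if "a \<in> tuples U m" "t \<in> env" for a t
  proof -
    have "sat N (a @ b t) (ren \<rho> (fst f)) = sat N (map (case_sum (case_sum (X a) t) id) vs) (fst f)"
    proof (rule sat_ren)
      show "form L n (fst f)" using f(1) by (simp add: nwf_def n_def vs_def)
      fix i assume i: "i < n"
      then have v: "vs ! i \<in> set vs" by (simp add: n_def)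
      have "length a = m" using that by (simp add: tuples_def)
      then show "map (case_sum (case_sum (X a) t) id) vs ! i = (a @ b t) ! \<rho> i"
      proof (cases "vs ! i")
        case (Inl w)
        then show ?thesis
          using v i pos \<open>length a = m\<close>
          by (cases w) (auto simp: \<rho>_def X_def b_def nth_append n_def)
      next
        case (Inr c)
        then show ?thesis
          using i \<open>length a = m\<close> by (simp add: \<rho>_def b_def nth_append n_def)
      qed
    qed
    then show ?thesis using f(3) X that by (simp add: \<phi>_def holds_def vs_def)
  qed
  have "has_TP2 N k m n \<phi>"
    unfolding has_TP2_def
  proof (intro exI[of _ "\<lambda>\<alpha> i. b (r \<alpha> i)"] conjI allI)
    show "b (r \<alpha> i) \<in> tuples U n" for \<alpha> i using b r by blast
    fix g :: "nat \<Rightarrow> nat"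
    show "consistent_seq (\<lambda>\<alpha>. dset N m \<phi> (b (r \<alpha> (g \<alpha>))))"
      unfolding consistent_seq_def
    proof (intro allI impI)
      fix I :: "nat set" assume "finite I"
      then obtain l where l: "\<And>i. i \<in> I \<Longrightarrow> i < l" by (meson finite_nat_set_iff_bounded)
      obtain x where x: "x \<in> env" "\<forall>\<alpha> < l. \<Phi> (case_sum x (r \<alpha> (g \<alpha>)))" using paths by blast
      have mx: "map x xs \<in> tuples U m" using x(1) by (auto simp: tuples_def m_def mem_env)
      have "\<Phi> (case_sum (X (map x xs)) t) = \<Phi> (case_sum x t)" if t: "t \<in> env" for t
      proof -
        have "holds N (case_sum (case_sum (X (map x xs)) t) id) f = holds N (case_sum (case_sum x t) id) f"
        proof (rule holds_cong)
          fix v assume "v \<in> set (snd f)"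
          then show "case_sum (case_sum (X (map x xs)) t) id v = case_sum (case_sum x t) id v"
            using pos by (auto simp: X_def vs_def m_def split: sum.splits)
        qed
        then show ?thesis using f(3) t x(1) X[OF mx] by simp
      qed
      then have "map x xs \<in> (\<Inter>\<alpha> \<in> I. dset N m \<phi> (b (r \<alpha> (g \<alpha>))))"
        using x(2) l sat mx r by (auto simp: dset_def)
      then show "(\<Inter>\<alpha> \<in> I. dset N m \<phi> (b (r \<alpha> (g \<alpha>)))) \<noteq> {}" by blast
    qed
  next
    fix \<alpha>
    show "k_inconsistent k (\<lambda>i. dset N m \<phi> (b (r \<alpha> i)))"
      unfolding k_inconsistent_def
    proof (intro allI impI, rule ccontr)
      fix I :: "nat set" assume I: "finite I \<and> card I = k" "(\<Inter>i \<in> I. dset N m \<phi> (b (r \<alpha> i))) \<noteq> {}"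
      have K: "\<not> (\<exists>x \<in> env. \<forall>i \<in> I. \<Phi> (case_sum x (r \<alpha> i)))" using rows I(1) unfolding kinc_def by blast
      \<comment> \<open>The empty intersection is \<open>UNIV\<close> and yields no tuple of the
        structure; but for empty \<open>I\<close> the row condition \<open>K\<close> fails, as
        \<open>env\<close> is nonempty.\<close>
      have "I \<noteq> {}" using K by (metis empty_iff env_nonempty)
      then obtain a where "a \<in> tuples U m" "\<forall>i \<in> I. sat N (a @ b (r \<alpha> i)) \<phi>"
        using I(2) by (auto simp: dset_def)
      then show False using K sat r X by blast
    qed
  qed
  then show ?thesis using form by blast
qed

end

section \<open>\<open>NTP2\<close> as a bound on the number of rows of an array\<close>

locale ntp2_model = big_model L \<kappa> N for L :: "('f, 'r) language" and \<kappa> :: "'k rel"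
    and N :: "('f, 'r, 'm) fo_struct" +
  assumes ntp2: "NTP2 L N"
begin

text \<open>If such arrays with \<open>n\<close> rows existed for every \<open>n\<close>,
  compactness would produce one with infinitely many rows, that is,
  \<open>k\<close>-\<open>TP2\<close>. The bound does not depend on the array, and every later use
  of \<open>NTP2\<close> goes through it.\<close>

lemma ntp2_bound:
  fixes \<Phi> :: "('x + 'v :: countable \<Rightarrow> 'm) \<Rightarrow> bool"
  assumes \<Phi>: "dfn A \<Phi>" and A: "small A"
  shows "\<exists>n :: nat. \<forall>r :: nat \<Rightarrow> nat \<Rightarrow> 'v \<Rightarrow> 'm. (\<forall>\<alpha> i. r \<alpha> i \<in> env) \<longrightarrow> (\<forall>\<alpha> < n. kinc \<Phi> k (r \<alpha>)) \<longrightarrow>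
    \<not> (\<forall>f. \<exists>x \<in> env. \<forall>\<alpha> < n. \<Phi> (case_sum x (r \<alpha> (f \<alpha>))))"
proof (rule ccontr)
  assume neg: "\<not> ?thesis"
  have ex: "\<forall>n. \<exists>r :: nat \<Rightarrow> nat \<Rightarrow> 'v \<Rightarrow> 'm. (\<forall>\<alpha> i. r \<alpha> i \<in> env) \<and> (\<forall>\<alpha> < n. kinc \<Phi> k (r \<alpha>)) \<and>
      (\<forall>f. \<exists>x \<in> env. \<forall>\<alpha> < n. \<Phi> (case_sum x (r \<alpha> (f \<alpha>))))"
    using neg unfolding not_ex not_all not_imp not_not .
  obtain r :: "nat \<Rightarrow> nat \<Rightarrow> nat \<Rightarrow> 'v \<Rightarrow> 'm" where r0: "\<forall>n. (\<forall>\<alpha> i. r n \<alpha> i \<in> env) \<and> (\<forall>\<alpha> < n. kinc \<Phi> k (r n \<alpha>)) \<and>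
      (\<forall>f. \<exists>x \<in> env. \<forall>\<alpha> < n. \<Phi> (case_sum x (r n \<alpha> (f \<alpha>))))"
    using choice[OF ex] by (rule exE)
  then have r: "\<And>n \<alpha> i. r n \<alpha> i \<in> env" "\<And>n \<alpha>. \<alpha> < n \<Longrightarrow> kinc \<Phi> k (r n \<alpha>)"
      "\<And>n f. \<exists>x \<in> env. \<forall>\<alpha> < n. \<Phi> (case_sum x (r n \<alpha> (f \<alpha>)))" by blast+
  define Kc where "Kc = (\<lambda>(\<alpha> :: nat, I) (s :: nat \<times> nat \<times> 'v \<Rightarrow> 'm).
      \<not> (\<exists>x \<in> env. \<forall>i \<in> I. \<Phi> (case_sum x (\<lambda>v. s (\<alpha>, i, v)))))"
  \<comment> \<open>Paths are cut to finite lists, so that each condition concerns finitely many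
    entries.\<close>
  define Pth where "Pth = (\<lambda>g (s :: nat \<times> nat \<times> 'v \<Rightarrow> 'm).
      \<exists>x \<in> env. \<forall>\<alpha> \<in> {..<length g}. \<Phi> (case_sum x (\<lambda>v. s (\<alpha>, g ! \<alpha>, v))))"
  define \<Gamma> where "\<Gamma> = (\<lambda>n. Kc ` {(\<alpha>, I). \<alpha> < n \<and> finite I \<and> card I = k} \<union> Pth ` {g. length g \<le> n})"
  have "\<exists>s \<in> env. \<forall>P \<in> (\<Union>n. \<Gamma> n). P s"
  proof (rule compactness[OF A])
    fix P assume "P \<in> (\<Union>n. \<Gamma> n)"
    then consider \<alpha> I where "P = Kc (\<alpha>, I)" "finite I" | g where "P = Pth g"
      unfolding \<Gamma>_def by blast
    then show "dfn A P"
    proof cases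
      case 1
      then show ?thesis unfolding Kc_def prod.case by (auto simp only: intro!: dfn_not dfn_simul[OF \<Phi> small_sub[OF A]])
    next
      case 2
      then show ?thesis unfolding Pth_def by (auto simp only: finite_lessThan intro!: dfn_simul[OF \<Phi> small_sub[OF A]])
    qed
  next
    fix \<Delta> assume \<Delta>: "finite \<Delta>" "\<Delta> \<subseteq> (\<Union>n. \<Gamma> n)"
    then have "\<forall>P. \<exists>n. P \<in> \<Delta> \<longrightarrow> P \<in> \<Gamma> n" by blast
    from choice[OF this] obtain h where h: "\<forall>P. P \<in> \<Delta> \<longrightarrow> P \<in> \<Gamma> (h P)" ..
    \<comment> \<open>The sets \<open>\<Gamma> n\<close> increase with \<open>n\<close>, and the
      array \<open>r n\<close> satisfies all of \<open>\<Gamma> n\<close>; so it suffices to go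
      beyond every stage met by \<Delta>.\<close>
    define n where "n = Suc (Max (h ` \<Delta>))"
    have n: "h P < n" if "P \<in> \<Delta>" for P using \<Delta>(1) that by (simp add: n_def less_Suc_eq_le)
    have sub: "P \<in> \<Gamma> n" if "P \<in> \<Delta>" for P
    proof -
      have "\<Gamma> (h P) \<subseteq> \<Gamma> n" using n[OF that] unfolding \<Gamma>_def by (intro Un_mono image_mono) auto
      then show ?thesis using h that by blast
    qed
    let ?s = "\<lambda>(\<alpha>, i, v). r n \<alpha> i v"
    have "P ?s" if "P \<in> \<Delta>" for P
      using sub[OF that] unfolding \<Gamma>_def
    proof (elim UnE imageE)
      fix p assume "P = Kc p" "p \<in> {(\<alpha>, I). \<alpha> < n \<and> finite I \<and> card I = k}"
      then show ?thesis using r(2) by (auto simp: Kc_def kinc_def)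
    next
      fix g assume g: "P = Pth g" "g \<in> {g. length g \<le> n}"
      obtain x where "x \<in> env" "\<forall>\<alpha> < n. \<Phi> (case_sum x (r n \<alpha> (g ! \<alpha>)))" using r(3) by blast
      then have "\<forall>\<alpha> \<in> {..<length g}. \<Phi> (case_sum x (r n \<alpha> (g ! \<alpha>)))" using g by auto
      then show ?thesis using g \<open>x \<in> env\<close> unfolding Pth_def by auto
    qed
    moreover have "?s \<in> env" using r(1) by (auto simp: mem_env)
    ultimately show "\<exists>s \<in> env. \<forall>P \<in> \<Delta>. P s" by blast
  qed
  then obtain s where s: "s \<in> env" "\<And>P n. P \<in> \<Gamma> n \<Longrightarrow> P s" by blast
  have "\<exists>m n \<phi>. form L (m + n) \<phi> \<and> has_TP2 N k m n \<phi>"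
  proof (rule has_TP2_of_array[OF \<Phi> small_sub[OF A], of "\<lambda>\<alpha> i v. s (\<alpha>, i, v)"])
    show "(\<lambda>v. s (\<alpha>, i, v)) \<in> env" for \<alpha> i using s(1) by (auto simp: mem_env)
    show "kinc \<Phi> k (\<lambda>i v. s (\<alpha>, i, v))" for \<alpha>
      unfolding kinc_def
    proof (intro allI impI)
      fix I :: "nat set" assume "finite I" "card I = k"
      then have "Kc (\<alpha>, I) \<in> \<Gamma> (Suc \<alpha>)" unfolding \<Gamma>_def by (intro UnI1 imageI) auto
      from s(2)[OF this] show "\<not> (\<exists>x \<in> env. \<forall>i \<in> I. \<Phi> (case_sum x (\<lambda>v. s (\<alpha>, i, v))))"
        by (simp add: Kc_def)
    qed
    show "\<exists>x \<in> env. \<forall>\<alpha> < n. \<Phi> (case_sum x (\<lambda>v. s (\<alpha>, f \<alpha>, v)))" for f n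
    proof -
      have "Pth (map f [0..<n]) \<in> \<Gamma> n" unfolding \<Gamma>_def by (intro UnI2 imageI) auto
      from s(2)[OF this] show ?thesis by (auto simp: Pth_def)
    qed
  qed
  then show False using ntp2 by (auto simp: NTP2_def)
qed

end

section \<open>Coheirs over a small elementary submodel\<close>

locale elem_submodel = ntp2_model L \<kappa> N for L :: "('f, 'r) language" and \<kappa> :: "'k rel"
    and N :: "('f, 'r, 'm) fo_struct" +
  fixes M :: "('f, 'r, 'm) fo_struct"
  assumes elem: "elem_substruct L M N" and M_small: "|univ M| <o \<kappa>"
begin

abbreviation M0 where "M0 \<equiv> univ M"

lemma small_M0: "small M0"
  using elem M_small by (auto simp: small_def elem_substruct_def)

lemmas M0_U = small_sub[OF small_M0]

text \<open>Quantifying away the variables of \<open>P\<close> leaves a formula with parameters in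
  the submodel. Elementarity moves it down, and the witnesses found there solve \<open>P\<close> in
  the large model as well.\<close>

lemma tarski_vaught:
  fixes P :: "('v \<Rightarrow> 'm) \<Rightarrow> bool"
  assumes P: "dfn M0 P" and s: "s \<in> env" "P s"
  shows "\<exists>e. range e \<subseteq> M0 \<and> P e"
proof -
  obtain z where z: "z \<in> M0" using elem by (auto simp: elem_substruct_def is_struct_def)
  from P obtain f where f: "nwf L f" "set (snd f) \<subseteq> range Inl \<union> Inr ` M0"
      "\<forall>s \<in> env. P s \<longleftrightarrow> holds N (case_sum s id) f" by (rule dfnE)
  have el: "holds M t g = holds N t g" if "nwf L g" "\<And>v. v \<in> set (snd g) \<Longrightarrow> t v \<in> M0" for t g
  proof -
    have "map t (snd g) \<in> tuples M0 (length (snd g))" using that(2) by (auto simp: tuples_def)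
    then show ?thesis using elem that(1) unfolding elem_substruct_def holds_def nwf_def by blast
  qed
  define vs where "vs = filter isl (snd f)"
  define g where "g = foldr nEx vs f"
  define e where "e = case_sum (\<lambda>_ :: 'v. z) (id :: 'm \<Rightarrow> 'm)"
  note g = holds_nExs[OF f(1), of vs, folded g_def]
  note g3 = g[THEN conjunct2, THEN conjunct2]
  have fv: "v \<in> set vs \<or> v \<in> Inr ` M0" if "v \<in> set (snd f)" for v
    using that f(2) by (auto simp: vs_def)
  have vsl: "isl v" if "v \<in> set vs" for v using that by (simp add: vs_def)
  have "holds N e g"
  proof -
    let ?s = "\<lambda>v. if v \<in> set vs then case_sum s id v else e v"
    have "holds N ?s f = holds N (case_sum s id) f"
    proof (rule holds_cong)
      fix v assume "v \<in> set (snd f)"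
      then show "?s v = case_sum s id v" using fv[of v] by (cases "v \<in> set vs") (auto simp: e_def)
    qed
    then have "holds N ?s f" using f(3) s by simp
    moreover have "\<forall>v \<in> set vs. ?s v \<in> U"
    proof
      fix v assume v: "v \<in> set vs"
      then obtain w where "v = Inl w" using vsl by (auto simp: isl_def)
      then show "?s v \<in> U" using s(1) v by (simp add: mem_env)
    qed
    moreover have "\<forall>v. v \<notin> set vs \<longrightarrow> ?s v = e v" by simp
    ultimately show ?thesis by (intro g3[THEN iffD2] exI[of _ ?s] conjI)
  qed
  moreover have "holds M e g = holds N e g"
  proof (rule el)
    show "nwf L g" using g by blast
    show "e v \<in> M0" if "v \<in> set (snd g)" for v
    proof -
      have "v \<in> set (snd f)" using that g by blast
      then show ?thesis using f(2) z by (auto simp: e_def)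
    qed
  qed
  ultimately have "holds M e g" by simp
  from g3[THEN iffD1, OF this]
  obtain s' where s': "\<forall>v. v \<notin> set vs \<longrightarrow> s' v = e v" "\<forall>v \<in> set vs. s' v \<in> M0" "holds M s' f"
    by blast
  define t where "t = (\<lambda>v. if Inl v \<in> set vs then s' (Inl v) else z)"
  have t: "range t \<subseteq> M0" using s'(2) z by (auto simp: t_def)
  have fs': "s' v \<in> M0 \<and> s' v = case_sum t id v" if v: "v \<in> set (snd f)" for v
  proof (cases "v \<in> set vs")
    case True
    then obtain w where "v = Inl w" using vsl by (auto simp: isl_def)
    then show ?thesis using True s'(2) by (simp add: t_def)
  next
    case False
    then obtain c where "v = Inr c" "c \<in> M0" using fv[OF v] by auto
    then show ?thesis using False s'(1) by (simp add: e_def)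
  qed
  have "holds N s' f" using el[OF f(1), of s'] fs' s'(3) by blast
  moreover have "holds N s' f = holds N (case_sum t id) f"
    by (rule holds_cong) (use fs' in blast)
  moreover have "t \<in> env" using t M0_U by (auto simp: mem_env)
  ultimately have "P t" using f(3) by blast
  then show ?thesis using t by blast
qed

text \<open>The type of \<open>t\<close> over \<open>B\<close> is a coheir over the small model.\<close>

definition fs :: "'m set \<Rightarrow> ('v \<Rightarrow> 'm) \<Rightarrow> bool" where
  "fs B t \<longleftrightarrow> (\<forall>P. dfn B P \<longrightarrow> P t \<longrightarrow> (\<exists>e. range e \<subseteq> M0 \<and> P e))"

lemma fs_M0: "t \<in> env \<Longrightarrow> fs M0 t"
  unfolding fs_def using tarski_vaught by blast

lemma fs_antimono: "fs C t \<Longrightarrow> B \<subseteq> C \<Longrightarrow> fs B t"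
  unfolding fs_def using dfn_mono by blast

lemma fs_reindex:
  assumes "fs B t" "B \<subseteq> U" shows "fs B (\<lambda>v. t (\<rho> v))"
  unfolding fs_def
proof (intro allI impI)
  fix P assume "dfn B P" "P (\<lambda>v. t (\<rho> v))"
  then obtain e where "range e \<subseteq> M0" "P (\<lambda>v. e (\<rho> v))"
    using assms(1) dfn_reindex[OF _ assms(2), of P \<rho>] unfolding fs_def by blast
  then show "\<exists>e. range e \<subseteq> M0 \<and> P e" by (intro exI[of _ "\<lambda>v. e (\<rho> v)"]) auto
qed

text \<open>The extension must also avoid every relation over \<open>C\<close> that has no solution
  in the submodel. This is consistent: finitely many conditions from the type over \<open>B\<close>
  have a solution in the submodel, and such a solution avoids those relations automatically.\<close>

lemma fs_extend:
  fixes t :: "'v :: countable \<Rightarrow> 'm"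
  assumes "t \<in> env" "fs B t" "B \<subseteq> C" "small C"
  obtains t' where "t' \<in> env" "eqv B t' t" "fs C t'"
proof -
  let ?neg = "\<lambda>Q (t :: 'v \<Rightarrow> 'm). \<not> Q t"
  define \<Gamma> where "\<Gamma> = {P. dfn B P \<and> P t} \<union> ?neg ` {Q. dfn C Q \<and> (\<forall>e. range e \<subseteq> M0 \<longrightarrow> \<not> Q e)}"
  have "\<exists>s \<in> env. \<forall>P \<in> \<Gamma>. P s"
  proof (rule compactness[OF assms(4)])
    show "dfn C P" if "P \<in> \<Gamma>" for P
      using that assms(3) dfn_mono dfn_not unfolding \<Gamma>_def by blast
    fix \<Delta> assume \<Delta>: "finite \<Delta>" "\<Delta> \<subseteq> \<Gamma>"
    have "dfn B (\<lambda>s. \<forall>P \<in> {P \<in> \<Delta>. dfn B P \<and> P t}. P s)" using \<Delta>(1) by (intro dfn_ball) auto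
    then obtain e where e: "range e \<subseteq> M0" "\<forall>P \<in> {P \<in> \<Delta>. dfn B P \<and> P t}. P e"
      using assms(2) unfolding fs_def by blast
    have "e \<in> env" using e(1) M0_U by (auto simp: mem_env)
    moreover have "P e" if "P \<in> \<Delta>" for P
      using that \<Delta>(2) e unfolding \<Gamma>_def by blast
    ultimately show "\<exists>s \<in> env. \<forall>P \<in> \<Delta>. P s" by blast
  qed
  then obtain s where s: "s \<in> env" "\<And>P. P \<in> \<Gamma> \<Longrightarrow> P s" by blast
  have "eqv B t s" using s(2) unfolding \<Gamma>_def by (intro eqvI) blast
  moreover have "fs C s"
    unfolding fs_def
  proof (intro allI impI, rule ccontr)
    fix P assume P: "dfn C P" "P s" "\<not> (\<exists>e. range e \<subseteq> M0 \<and> P e)"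
    then have "?neg P \<in> \<Gamma>" unfolding \<Gamma>_def by blast
    from s(2)[OF this] show False using P(2) by simp
  qed
  ultimately show ?thesis using that s(1) eqv_sym by blast
qed

text \<open>A relation telling \<open>u\<close> from \<open>u'\<close> next to \<open>t\<close>
  would already do so next to some \<open>e\<close> from the submodel; but there \<open>e\<close> is
  a parameter, over which \<open>u\<close> and \<open>u'\<close> have the same type.\<close>

lemma fs_invariant:
  assumes "fs B t" "M0 \<subseteq> B" "B \<subseteq> U" "range u \<subseteq> B" "range u' \<subseteq> B" "eqv M0 u u'"
  shows "eqv M0 (case_sum t u) (case_sum t u')"
proof (rule eqvI, rule ccontr)
  fix P assume P: "dfn M0 P" "P (case_sum t u)" "\<not> P (case_sum t u')"
  have "dfn B P" using P(1) assms(2) by (rule dfn_mono)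
  then have "dfn B (\<lambda>s. P (case_sum s u) \<and> \<not> P (case_sum s u'))"
    by (intro dfn_conj dfn_not dfn_param assms)
  then obtain e where e: "range e \<subseteq> M0" "P (case_sum e u)" "\<not> P (case_sum e u')"
    using assms(1) P(2,3) unfolding fs_def by blast
  have eq: "(\<lambda>v. case_sum s e (case_sum Inr Inl v)) = case_sum e s" for s :: "'b \<Rightarrow> 'm"
    by (auto split: sum.split)
  have "dfn M0 (\<lambda>s. P (\<lambda>v. s (case_sum Inr Inl v)))" using P(1) M0_U by (rule dfn_reindex)
  from dfn_param[OF this M0_U e(1)] have "dfn M0 (\<lambda>s. P (case_sum e s))" unfolding eq .
  from eqvD[OF assms(6) this] e show False by blast
qed

section \<open>Quasi-dividing\<close>

lemma coheir_sequence:
  fixes t :: "'v :: countable \<Rightarrow> 'm"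
  assumes t: "t \<in> env"
  obtains r :: "nat \<Rightarrow> 'v \<Rightarrow> 'm" where "\<And>\<alpha>. r \<alpha> \<in> env" "\<And>\<alpha>. eqv M0 (r \<alpha>) t"
    "\<And>\<alpha>. fs (M0 \<union> (\<Union>\<beta> < \<alpha>. range (r \<beta>))) (r \<alpha>)"
proof -
  define Q where "Q = (\<lambda>(f :: nat \<Rightarrow> 'v \<Rightarrow> 'm) \<alpha> r. r \<in> env \<and> eqv M0 r t \<and>
      fs (M0 \<union> (\<Union>\<beta> < \<alpha>. range (f \<beta>))) r)"
  have "\<exists>f. \<forall>\<alpha>. Q f \<alpha> (f \<alpha>)"
  proof (rule dependent_wf_choice[OF wf_less_than])
    fix f g :: "nat \<Rightarrow> 'v \<Rightarrow> 'm" and \<alpha> r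
    assume "\<And>z. (z, \<alpha>) \<in> less_than \<Longrightarrow> f z = g z"
    then have "(\<Union>\<beta> < \<alpha>. range (f \<beta>)) = (\<Union>\<beta> < \<alpha>. range (g \<beta>))" by (intro SUP_cong) auto
    then show "Q f \<alpha> r = Q g \<alpha> r" unfolding Q_def by simp
  next
    fix \<alpha> and f :: "nat \<Rightarrow> 'v \<Rightarrow> 'm"
    assume "\<And>\<beta>. (\<beta>, \<alpha>) \<in> less_than \<Longrightarrow> Q f \<beta> (f \<beta>)"
    then have "f \<beta> \<in> env" if "\<beta> < \<alpha>" for \<beta> using that by (simp add: Q_def)
    then have "small (M0 \<union> (\<Union>\<beta> < \<alpha>. range (f \<beta>)))"
      by (intro small_Un small_M0 small_countable countable_UN) (auto simp: mem_env)
    from fs_extend[OF t fs_M0[OF t] _ this]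
    show "\<exists>r. Q f \<alpha> r" unfolding Q_def by blast
  qed
  then obtain r where "\<forall>\<alpha>. Q r \<alpha> (r \<alpha>)" by (rule exE)
  then show ?thesis using that unfolding Q_def by blast
qed

lemma ex_enum_finite:
  assumes "finite E" obtains K and e :: "nat \<Rightarrow> 'a" where "E = e ` {..<K :: nat}"
proof -
  obtain xs where "set xs = E" using assms finite_list by blast
  then have "E = (!) xs ` {..<length xs}" by (auto simp: set_conv_nth)
  then show ?thesis using that by blast
qed

text \<open>
  A covering family of copies of a disjunction \<open>W(x,a)\<close> is a finite set of tuples \<open>\<equiv> a\<close> such
  that no \<open>x\<close> satisfies \<open>W\<close> at all of them. If \<open>b\<^sub>0, b\<^sub>1, \<dots>\<close> is a coheir sequence of copies of
  \<open>a\<close>, the disjunction of the \<open>W(x,b\<^sub>\<alpha>)\<close> over \<open>\<alpha> < n\<close> again has one: move a covering family for the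
  first \<open>n\<close> disjuncts along the covering family of the last one.
\<close>

lemma covering_coheir_sequence:
  fixes W :: "('x + 'v :: countable \<Rightarrow> 'm) \<Rightarrow> bool" and b :: "nat \<Rightarrow> 'v \<Rightarrow> 'm"
  assumes W: "dfn M0 W" and z: "z \<in> M0"
    and b: "\<And>\<alpha>. b \<alpha> \<in> env" "\<And>\<alpha>. eqv M0 (b \<alpha>) a" "\<And>\<alpha>. fs (M0 \<union> (\<Union>\<beta> < \<alpha>. range (b \<beta>))) (b \<alpha>)"
    and C: "finite C" "C \<subseteq> env" "\<And>c. c \<in> C \<Longrightarrow> eqv M0 c a"
    and cover: "\<And>x. x \<in> env \<Longrightarrow> \<exists>c \<in> C. \<not> W (case_sum x c)"
  shows "\<exists>E. finite E \<and> E \<subseteq> env \<and> (\<forall>e \<in> E. eqv M0 e (\<lambda>(\<alpha>, v). if \<alpha> < n then b \<alpha> v else z)) \<and>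
    (\<forall>x \<in> env. \<exists>e \<in> E. \<forall>\<alpha> < n. \<not> W (case_sum x (\<lambda>v. e (\<alpha>, v))))"
proof (induction n)
  case 0
  have "(\<lambda>(\<alpha> :: nat, v :: 'v). z) \<in> env" using z M0_U by (auto simp: mem_env)
  then show ?case by (intro exI[of _ "{\<lambda>(\<alpha>, v). z}"]) auto
next
  case (Suc n)
  define pre where "pre = (\<lambda>n (\<alpha>, v). if \<alpha> < n then b \<alpha> v else z)"
  have pre_env: "pre n \<in> env" for n using b(1) z M0_U by (auto simp: pre_def mem_env)
  obtain E where E: "finite E" "E \<subseteq> env" "\<And>e. e \<in> E \<Longrightarrow> eqv M0 e (pre n)"
    "\<And>x. x \<in> env \<Longrightarrow> \<exists>e \<in> E. \<forall>\<alpha> < n. \<not> W (case_sum x (\<lambda>v. e (\<alpha>, v)))"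
    using Suc.IH unfolding pre_def by blast
  obtain K e where e: "E = e ` {..<K :: nat}" using ex_enum_finite[OF E(1)] by blast
  obtain u where u: "u \<in> (env :: (nat \<times> 'v \<Rightarrow> 'm) set)" using env_nonempty by blast
  \<comment> \<open>The covering family as one tuple, so that it can be moved as a whole; indices
    from \<open>K\<close> on are filler.\<close>
  define H where "H = (\<lambda>(i, w). if i < K then e i w else u w)"
  have eH: "e i = (\<lambda>w. H (i, w))" if "i < K" for i using that by (simp add: H_def)
  have "e i \<in> env" if "i < K" for i using E(2) e that by blast
  then have H: "H \<in> env" using u by (auto simp: H_def mem_env)
  define B where "B = M0 \<union> (\<Union>\<beta> < n. range (b \<beta>))"
  define D where "D = B \<union> range H"
  have B: "small B" unfolding B_def
    by (intro small_Un small_M0 small_countable countable_UN) (use b(1) in \<open>auto simp: mem_env\<close>)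
  have D: "small D" unfolding D_def by (intro small_Un B small_range H)
  \<comment> \<open>A copy of \<open>b n\<close> that is a coheir even over the covering family. By
    invariance of coheirs it stands to every \<open>e i\<close> as \<open>b n\<close> stands to the
    first \<open>n\<close> terms.\<close>
  obtain b' where b': "b' \<in> env" "eqv B b' (b n)" "fs D b'"
    using fs_extend[OF b(1) b(3)[of n, folded B_def] _ D] unfolding D_def by blast
  have "pre n w \<in> B" for w
  proof (cases "fst w < n")
    case True
    then have "pre n w \<in> range (b (fst w))" by (simp add: pre_def split_beta)
    then show ?thesis using True unfolding B_def by blast
  qed (use z in \<open>simp add: pre_def B_def split_beta\<close>)
  then have pre_B: "M0 \<union> range (pre n) \<subseteq> B" unfolding B_def by blast
  have last: "eqv M0 (case_sum b' (e i)) (case_sum (b n) (pre n))" if i: "i < K" for i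
  proof -
    have "eqv M0 (case_sum b' (e i)) (case_sum b' (pre n))"
    proof (rule fs_invariant[OF b'(3) _ small_sub[OF D]])
      show "range (e i) \<subseteq> D" using eH[OF i] by (auto simp: D_def)
      show "eqv M0 (e i) (pre n)" using E(3) e i by blast
    qed (use pre_B in \<open>auto simp: D_def B_def\<close>)
    also have "eqv M0 (case_sum b' (pre n)) (case_sum (b n) (pre n))"
      by (rule eqv_Un_rangeD[OF eqv_mono[OF b'(2) pre_B] M0_U pre_env])
    finally show ?thesis .
  qed
  \<comment> \<open>Move \<open>b'\<close> to each member \<open>c\<close> of the covering family
    for \<open>W\<close>, taking \<open>H\<close> along.\<close>
  have "\<exists>H'. H' \<in> env \<and> eqv M0 (case_sum b' H) (case_sum c H')" if c: "c \<in> C" for c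
  proof -
    have "eqv M0 b' (b n)" using b'(2) by (rule eqv_mono) (auto simp: B_def)
    also have "eqv M0 (b n) a" by (rule b(2))
    also have "eqv M0 a c" using C(3)[OF c] by (rule eqv_sym)
    finally have 1: "eqv M0 b' c" .
    have "c \<in> env" using C(2) c by blast
    from eqv_extend[OF small_M0 1 b'(1) this H] show ?thesis by blast
  qed
  then have "\<forall>c. \<exists>H'. c \<in> C \<longrightarrow> H' \<in> env \<and> eqv M0 (case_sum b' H) (case_sum c H')" by blast
  from choice[OF this] obtain H' where
    H': "\<And>c. c \<in> C \<Longrightarrow> H' c \<in> env" "\<And>c. c \<in> C \<Longrightarrow> eqv M0 (case_sum b' H) (case_sum c (H' c))" by blast
  define comb where "comb = (\<lambda>(c :: 'v \<Rightarrow> 'm) e (\<alpha>, v). if \<alpha> = n then c v else e (\<alpha> :: nat, v))"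
  have comb: "comb c e = (\<lambda>w. case_sum c e ((\<lambda>(\<alpha>, v). if \<alpha> = n then Inl v else Inr (\<alpha>, v)) w))" for c e
    by (auto simp: comb_def fun_eq_iff)
  have preS: "pre (Suc n) = comb (b n) (pre n)"
    by (auto simp: pre_def comb_def fun_eq_iff)
  define E' where "E' = (\<lambda>(c, i). comb c (\<lambda>w. H' c (i, w))) ` (C \<times> {..<K})"
  have 1: "finite E'" using C(1) by (simp add: E'_def)
  have 2: "E' \<subseteq> env"
    using C(2) H'(1) by (auto simp: E'_def comb_def mem_env)
  have 3: "eqv M0 e' (pre (Suc n))" if "e' \<in> E'" for e'
  proof -
    obtain c i where ci: "c \<in> C" "i < K" "e' = comb c (\<lambda>w. H' c (i, w))" using \<open>e' \<in> E'\<close> by (auto simp: E'_def)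
    have r: "case_sum c (\<lambda>w. h (i, w)) = (\<lambda>w. case_sum c h (map_sum id (Pair i) w))" for c :: "'v \<Rightarrow> 'm" and h
      by (auto simp: fun_eq_iff split: sum.split)
    have "eqv M0 (case_sum c (\<lambda>w. H' c (i, w))) (case_sum b' (\<lambda>w. H (i, w)))"
      unfolding r by (rule eqv_reindex[OF eqv_sym[OF H'(2)[OF ci(1)]] M0_U])
    also have "eqv M0 \<dots> (case_sum (b n) (pre n))" using last[OF ci(2)] eH[OF ci(2)] by simp
    finally show ?thesis unfolding ci(3) preS comb by (rule eqv_reindex) (rule M0_U)
  qed
  have 4: "\<exists>e \<in> E'. \<forall>\<alpha> < Suc n. \<not> W (case_sum x (\<lambda>v. e (\<alpha>, v)))" if x: "x \<in> env" for x
  proof -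
    obtain c where c: "c \<in> C" "\<not> W (case_sum x c)" using cover[OF x] by blast
    \<comment> \<open>That \<open>H\<close> is a covering family is a definable property, so
      \<open>H' c\<close> inherits it. At \<open>x\<close>, the tuple \<open>c\<close> defeats the
      last disjunct and some member of \<open>H' c\<close> the first \<open>n\<close>.\<close>
    define P where "P = (\<lambda>h. \<not> (\<exists>x \<in> env. \<forall>i \<in> {..<K}. \<exists>\<alpha> \<in> {..<n}. W (case_sum x (\<lambda>v. h (i, \<alpha>, v)))))"
    have "dfn M0 (\<lambda>z. \<exists>\<alpha> \<in> {..<n}. W (case_sum (\<lambda>x. z (Inl x)) (\<lambda>v. z (Inr (\<alpha>, v)))))"
    proof (intro dfn_bex)
      fix \<alpha>
      have eq: "case_sum (\<lambda>x. z (Inl x)) (\<lambda>v. z (Inr (\<alpha>, v))) = (\<lambda>w. z (case_sum Inl (\<lambda>v. Inr (\<alpha>, v)) w))" for z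
        by (auto split: sum.split)
      show "dfn M0 (\<lambda>z. W (case_sum (\<lambda>x. z (Inl x)) (\<lambda>v. z (Inr (\<alpha>, v)))))"
        unfolding eq by (rule dfn_reindex[OF W M0_U])
    qed simp
    from dfn_not[OF dfn_simul[OF this M0_U, of "{..<K}" "\<lambda>i w. (i, w)"]]
    have P: "dfn M0 P" unfolding P_def by simp
    have "P H"
      unfolding P_def
    proof (rule notI, elim bexE)
      fix x :: "'x \<Rightarrow> 'm" assume x: "x \<in> env" "\<forall>i \<in> {..<K}. \<exists>\<alpha> \<in> {..<n}. W (case_sum x (\<lambda>v. H (i, \<alpha>, v)))"
      obtain i where "i < K" "\<forall>\<alpha> < n. \<not> W (case_sum x (\<lambda>v. e i (\<alpha>, v)))"
        using E(4)[OF x(1)] e by auto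
      then show False using x(2) eH by auto
    qed
    moreover have "eqv M0 H (H' c)"
      using eqv_reindex[OF H'(2)[OF c(1)] M0_U, of Inr] by simp
    ultimately have "P (H' c)" using eqvD P by blast
    then obtain i where i: "i < K" "\<forall>\<alpha> < n. \<not> W (case_sum x (\<lambda>v. H' c (i, \<alpha>, v)))"
      unfolding P_def using x by blast
    have "\<forall>\<alpha> < Suc n. \<not> W (case_sum x (\<lambda>v. comb c (\<lambda>w. H' c (i, w)) (\<alpha>, v)))"
      using i(2) c(2) by (auto simp: comb_def less_Suc_eq)
    moreover have "comb c (\<lambda>w. H' c (i, w)) \<in> E'" unfolding E'_def using c(1) i(1) by force
    ultimately show ?thesis by blast
  qed
  show ?case using 1 2 3[unfolded pre_def] 4 by (intro exI[of _ E'] conjI ballI) blast+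
qed

text \<open>Induction on the disjuncts. Copy the dividing sequence of the new \<Phi> along a coheir
  sequence: by \<open>ntp2_bound\<close>, some path of length \<open>n\<close> through the copies
  makes \<Phi> inconsistent. The path is itself a coheir sequence of copies of \<open>a\<close>, so
  the old disjunction has a covering family along it. Each \<open>x\<close> then has a member of
  that family where the old disjuncts fail at every position and \<Phi> fails at one.\<close>

lemma disjunction_quasi_divides:
  fixes a :: "'v :: countable \<Rightarrow> 'm" and F :: "(('x + 'v \<Rightarrow> 'm) \<Rightarrow> bool) set"
  assumes a: "a \<in> env" and F: "finite F" "\<And>\<Phi>. \<Phi> \<in> F \<Longrightarrow> dfn M0 \<Phi>" "\<And>\<Phi>. \<Phi> \<in> F \<Longrightarrow> divs M0 \<Phi> a"
  shows "\<exists>C. finite C \<and> C \<subseteq> env \<and> (\<forall>c \<in> C. eqv M0 c a) \<and>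
    (\<forall>x \<in> env. \<exists>c \<in> C. \<forall>\<Phi> \<in> F. \<not> \<Phi> (case_sum x c))"
  using F
proof (induction F rule: finite_induct)
  case empty
  then show ?case using a by (intro exI[of _ "{a}"]) auto
next
  case (insert \<Phi> F)
  obtain z where z: "z \<in> M0" using elem by (auto simp: elem_substruct_def is_struct_def)
  have \<Phi>: "dfn M0 \<Phi>" "divs M0 \<Phi> a" using insert.prems by auto
  define W where "W = (\<lambda>s. \<exists>\<Phi> \<in> F. \<Phi> s)"
  have W: "dfn M0 W" unfolding W_def using insert.hyps(1) insert.prems(1) by (intro dfn_bex) auto
  have "\<exists>C. finite C \<and> C \<subseteq> env \<and> (\<forall>c \<in> C. eqv M0 c a) \<and>
      (\<forall>x \<in> env. \<exists>c \<in> C. \<forall>\<Phi> \<in> F. \<not> \<Phi> (case_sum x c))"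
    by (rule insert.IH) (use insert.prems in auto)
  then obtain C where C: "finite C" "C \<subseteq> env" "\<And>c. c \<in> C \<Longrightarrow> eqv M0 c a"
      "\<And>x. x \<in> env \<Longrightarrow> \<exists>c \<in> C. \<not> W (case_sum x c)"
    unfolding W_def by auto
  from \<Phi>(2) obtain k r where r: "\<And>i. r i \<in> env" "\<And>i. eqv M0 (r i) a" "kinc \<Phi> k r"
    unfolding divs_def by blast
  \<comment> \<open>The dividing sequence as a single tuple, whose copies are the rows of the
    array.\<close>
  define R where "R = (\<lambda>(i, v). r i v)"
  have R: "R \<in> env" using r(1) by (auto simp: R_def mem_env)
  obtain q :: "nat \<Rightarrow> nat \<times> 'v \<Rightarrow> 'm" where q: "\<And>\<alpha>. q \<alpha> \<in> env" "\<And>\<alpha>. eqv M0 (q \<alpha>) R"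
    "\<And>\<alpha>. fs (M0 \<union> (\<Union>\<beta> < \<alpha>. range (q \<beta>))) (q \<alpha>)" using coheir_sequence[OF R] by blast
  obtain n :: nat where n: "\<forall>r :: nat \<Rightarrow> nat \<Rightarrow> 'v \<Rightarrow> 'm. (\<forall>\<alpha> i. r \<alpha> i \<in> env) \<longrightarrow> (\<forall>\<alpha> < n. kinc \<Phi> k (r \<alpha>)) \<longrightarrow>
    \<not> (\<forall>f. \<exists>x \<in> env. \<forall>\<alpha> < n. \<Phi> (case_sum x (r \<alpha> (f \<alpha>))))"
    using ntp2_bound[OF \<Phi>(1) small_M0, of k] by (rule exE)
  have "kinc \<Phi> k (\<lambda>i v. q \<alpha> (i, v))" for \<alpha>
    unfolding kinc_def
  proof (intro allI impI)
    fix I :: "nat set" assume I: "finite I" "card I = k"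
    have "dfn M0 (\<lambda>s. \<not> (\<exists>x \<in> env. \<forall>i \<in> I. \<Phi> (case_sum x (\<lambda>v. s (i, v)))))"
      by (intro dfn_not dfn_simul \<Phi> M0_U I)
    moreover have "\<not> (\<exists>x \<in> env. \<forall>i \<in> I. \<Phi> (case_sum x (\<lambda>v. R (i, v))))"
      using r(3) I by (auto simp: R_def kinc_def)
    ultimately show "\<not> (\<exists>x \<in> env. \<forall>i \<in> I. \<Phi> (case_sum x (\<lambda>v. q \<alpha> (i, v))))"
      using eqvD[OF eqv_sym[OF q(2)]] by blast
  qed
  moreover have "(\<lambda>v. q \<alpha> (i, v)) \<in> env" for \<alpha> i using q(1) by (auto simp: mem_env)
  ultimately have "\<not> (\<forall>f. \<exists>x \<in> env. \<forall>\<alpha> < n. \<Phi> (case_sum x (\<lambda>v. q \<alpha> (f \<alpha>, v))))"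
    using n[rule_format, of "\<lambda>\<alpha> i v. q \<alpha> (i, v)"] by blast
  then obtain f where f: "\<not> (\<exists>x \<in> env. \<forall>\<alpha> < n. \<Phi> (case_sum x (\<lambda>v. q \<alpha> (f \<alpha>, v))))" by blast
  define b where "b = (\<lambda>\<alpha> v. q \<alpha> (f \<alpha>, v))"
  have b1: "b \<alpha> \<in> env" for \<alpha> using q(1) by (auto simp: mem_env b_def)
  have b2: "eqv M0 (b \<alpha>) a" for \<alpha>
  proof -
    have "eqv M0 (b \<alpha>) (r (f \<alpha>))" using eqv_reindex[OF q(2) M0_U, of \<alpha> "Pair (f \<alpha>)"] by (simp add: b_def R_def)
    then show ?thesis using r(2) eqv_trans by blast
  qed
  have b3: "fs (M0 \<union> (\<Union>\<beta> < \<alpha>. range (b \<beta>))) (b \<alpha>)" for \<alpha>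
  proof -
    have "small (M0 \<union> (\<Union>\<beta> < \<alpha>. range (q \<beta>)))"
      by (intro small_Un small_M0 small_countable countable_UN) (use q(1) in \<open>auto simp: mem_env\<close>)
    from fs_reindex[OF q(3) small_sub[OF this], of "Pair (f \<alpha>)"]
    show ?thesis unfolding b_def by (rule fs_antimono) auto
  qed
  obtain E where E: "finite E" "E \<subseteq> env" "\<And>e. e \<in> E \<Longrightarrow> eqv M0 e (\<lambda>(\<alpha>, v). if \<alpha> < n then b \<alpha> v else z)"
    "\<And>x. x \<in> env \<Longrightarrow> \<exists>e \<in> E. \<forall>\<alpha> < n. \<not> W (case_sum x (\<lambda>v. e (\<alpha>, v)))"
    using covering_coheir_sequence[OF W z b1 b2 b3 C, of n] by blast
  define C' where "C' = (\<lambda>(e, \<alpha>) v. e (\<alpha>, v)) ` (E \<times> {..<n})"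
  show ?case
  proof (intro exI[of _ C'] conjI ballI)
    show "finite C'" using E(1) by (simp add: C'_def)
    show "C' \<subseteq> env" using E(2) by (auto simp: C'_def mem_env)
    show "eqv M0 c a" if c: "c \<in> C'" for c
    proof -
      obtain e \<alpha> where e: "e \<in> E" "\<alpha> < n" "c = (\<lambda>v. e (\<alpha>, v))" using c by (auto simp: C'_def)
      have "eqv M0 c (b \<alpha>)" using eqv_reindex[OF E(3)[OF e(1)] M0_U, of "Pair \<alpha>"] e(2,3) by simp
      then show ?thesis using b2 eqv_trans by blast
    qed
    fix x :: "'x \<Rightarrow> 'm" assume x: "x \<in> env"
    obtain e where e: "e \<in> E" "\<forall>\<alpha> < n. \<not> W (case_sum x (\<lambda>v. e (\<alpha>, v)))" using E(4)[OF x] by blast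
    \<comment> \<open>Inconsistency of \<Phi> along the path is definable, hence also holds along
      \<open>e\<close>, which has the type of the path.\<close>
    have "dfn M0 (\<lambda>s. \<not> (\<exists>x \<in> env. \<forall>\<alpha> \<in> {..<n}. \<Phi> (case_sum x (\<lambda>v. s (\<alpha>, v)))))"
      by (intro dfn_not dfn_simul \<Phi> M0_U) simp
    from eqvD[OF eqv_sym[OF E(3)[OF e(1)]] this] f
    have "\<not> (\<exists>x \<in> env. \<forall>\<alpha> \<in> {..<n}. \<Phi> (case_sum x (\<lambda>v. e (\<alpha>, v))))" by (auto simp: b_def)
    then obtain \<alpha> where "\<alpha> < n" "\<not> \<Phi> (case_sum x (\<lambda>v. e (\<alpha>, v)))" using x by blast
    then show "\<exists>c \<in> C'. \<forall>\<Psi> \<in> insert \<Phi> F. \<not> \<Psi> (case_sum x c)"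
      using e by (intro bexI[of _ "\<lambda>v. e (\<alpha>, v)"]) (auto simp: W_def C'_def image_iff)
  qed
qed

section \<open>Strict coheirs\<close>

lemma case_sum_swap: "(\<lambda>w. case_sum p q (case_sum Inr Inl w)) = case_sum q p"
  by (auto split: sum.split)

lemma eqv_swap:
  assumes "eqv A (case_sum s t) (case_sum s' t')" "A \<subseteq> U"
  shows "eqv A (case_sum t s) (case_sum t' s')"
  using eqv_reindex[OF assms, of "case_sum Inr Inl"] unfolding case_sum_swap .

text \<open>
  If at no coheir copy \<open>a'\<close> of \<open>a\<close> over \<open>u\<close> all the dividing formulas divide over \<open>M u\<close>, then, by
  compactness, some formulas \<open>\<chi>(y,a)\<close> that divide over \<open>M\<close> cover the coheirs of \<open>a\<close> over \<open>u\<close>, and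
  a coheir over \<open>u\<close> of a covering family for them gives a contradiction at \<open>y = u\<close>.
\<close>

lemma strict_coheir:
  fixes a :: "'v :: countable \<Rightarrow> 'm" and u :: "'w :: countable \<Rightarrow> 'm"
    and \<Phi> :: "nat \<Rightarrow> ('x + 'v \<Rightarrow> 'm) \<Rightarrow> bool" and R :: "nat \<Rightarrow> nat \<Rightarrow> 'v \<Rightarrow> 'm"
  assumes a: "a \<in> env" and u: "u \<in> env"
    and \<Phi>: "\<And>j. j < s \<Longrightarrow> dfn M0 (\<Phi> j)"
    and R: "\<And>j i. R j i \<in> env" "\<And>j i. j < s \<Longrightarrow> eqv M0 (R j i) a" "\<And>j. j < s \<Longrightarrow> kinc (\<Phi> j) (k j) (R j)"
  shows "\<exists>a'. a' \<in> env \<and> eqv M0 a' a \<and> fs (M0 \<union> range u) a' \<and> (\<forall>j < s. \<exists>r. (\<forall>i. r i \<in> env) \<and>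
    (\<forall>i. eqv (M0 \<union> range u) (r i) a') \<and> kinc (\<Phi> j) (k j) r)"
proof -
  \<comment> \<open>Dividing has to be witnessed by one of the given sequences \<open>R j\<close>.
    Avoiding such \<chi> then says something about \<open>R j\<close> itself: its instances of
    \<chi> contain consistent subfamilies of every finite size.\<close>
  define bad where "bad = (\<lambda>\<chi> :: ('w + 'v \<Rightarrow> 'm) \<Rightarrow> bool. dfn M0 \<chi> \<and> (\<exists>j < s. \<exists>l. kinc \<chi> l (R j)))"
  let ?neg = "\<lambda>Q (t :: 'v \<Rightarrow> 'm). \<not> Q t" and ?at = "\<lambda>\<chi> (t :: 'v \<Rightarrow> 'm). \<not> \<chi> (case_sum u t)"
  let ?C = "M0 \<union> range u"
  have C: "small ?C" by (intro small_Un small_M0 small_range u)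
  define \<Gamma> where "\<Gamma> = {P. dfn M0 P \<and> P a} \<union> ?neg ` {Q. dfn ?C Q \<and> (\<forall>e. range e \<subseteq> M0 \<longrightarrow> \<not> Q e)} \<union> ?at ` Collect bad"
  have "\<exists>t \<in> env. \<forall>P \<in> \<Gamma>. P t"
  proof (rule compactness[OF C])
    fix P assume "P \<in> \<Gamma>"
    then consider "dfn M0 P" | Q where "P = ?neg Q" "dfn ?C Q" | \<chi> where "P = ?at \<chi>" "dfn M0 \<chi>"
      unfolding \<Gamma>_def bad_def by blast
    then show "dfn ?C P"
    proof cases
      case 1
      then show ?thesis by (rule dfn_mono) simp
    next
      case 2
      then show ?thesis by (simp only: dfn_not)
    next
      case 3
      have "dfn M0 (\<lambda>z. \<chi> (\<lambda>w. z (case_sum Inr Inl w)))" by (rule dfn_reindex[OF 3(2) M0_U])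
      then have "dfn ?C (\<lambda>z. \<chi> (\<lambda>w. z (case_sum Inr Inl w)))" by (rule dfn_mono) simp
      then have "dfn ?C (\<lambda>t. \<chi> (\<lambda>w. case_sum t u (case_sum Inr Inl w)))"
        by (rule dfn_param) (use small_sub[OF C] in auto)
      then have "dfn ?C (\<lambda>t. \<chi> (case_sum u t))" unfolding case_sum_swap .
      then show ?thesis unfolding 3(1) by (rule dfn_not)
    qed
  next
    fix \<Delta> assume \<Delta>: "finite \<Delta>" "\<Delta> \<subseteq> \<Gamma>"
    have "finite (\<Delta> \<inter> ?at ` Collect bad)" "\<Delta> \<inter> ?at ` Collect bad \<subseteq> ?at ` Collect bad" using \<Delta>(1) by auto
    then obtain X where X: "X \<subseteq> Collect bad" "finite X" "\<Delta> \<inter> ?at ` Collect bad = ?at ` X"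
      by (meson finite_subset_image)
    have Xd: "dfn M0 \<chi>" if "\<chi> \<in> X" for \<chi> using that X(1) by (auto simp: bad_def)
    have Xdiv: "divs M0 \<chi> a" if "\<chi> \<in> X" for \<chi>
    proof -
      obtain j l where "j < s" "kinc \<chi> l (R j)" using \<open>\<chi> \<in> X\<close> X(1) by (auto simp: bad_def)
      then show ?thesis unfolding divs_def using R(1,2) by (intro exI[of _ l] exI[of _ "R j"]) auto
    qed
    obtain E where E0: "finite E \<and> E \<subseteq> env \<and> (\<forall>c \<in> E. eqv M0 c a) \<and>
        (\<forall>x \<in> env. \<exists>c \<in> E. \<forall>\<chi> \<in> X. \<not> \<chi> (case_sum x c))"
      using disjunction_quasi_divides[OF a X(2) Xd Xdiv] by (rule exE)
    then have E: "finite E" "E \<subseteq> env" "\<And>c. c \<in> E \<Longrightarrow> eqv M0 c a"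
        "\<And>x. x \<in> env \<Longrightarrow> \<exists>c \<in> E. \<forall>\<chi> \<in> X. \<not> \<chi> (case_sum x c)" by simp_all
    obtain K e where e: "E = e ` {..<K :: nat}" using ex_enum_finite[OF E(1)] by blast
    define H where "H = (\<lambda>(i, v). if i < K then e i v else a v)"
    have eH: "e i = (\<lambda>v. H (i, v))" if "i < K" for i using that by (simp add: H_def)
    have "e i \<in> env" if "i < K" for i using E(2) e that by blast
    then have H: "H \<in> env" using a by (auto simp: H_def mem_env)
    \<comment> \<open>A coheir over \<open>u\<close> of the whole covering family: each member is a
      coheir copy of \<open>a\<close>, and at the point \<open>u\<close> one of them falsifies all
      \<chi> in \<open>X\<close>.\<close>
    obtain H' where H': "H' \<in> env" "eqv M0 H' H" "fs ?C H'"
      using fs_extend[OF H fs_M0[OF H] _ C] by blast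
    define P where "P = (\<lambda>h. \<not> (\<exists>x \<in> env. \<forall>i \<in> {..<K}. \<exists>\<chi> \<in> X. \<chi> (case_sum x (\<lambda>v. h (i, v)))))"
    have "dfn M0 (\<lambda>z. \<exists>\<chi> \<in> X. \<chi> z)" using X(2) Xd by (intro dfn_bex) auto
    from dfn_not[OF dfn_simul[OF this M0_U, of "{..<K}" "\<lambda>i w. (i, w)"]]
    have P: "dfn M0 P" unfolding P_def by simp
    have "P H"
      unfolding P_def
    proof (rule notI, elim bexE)
      fix x :: "'w \<Rightarrow> 'm" assume x: "x \<in> env" "\<forall>i \<in> {..<K}. \<exists>\<chi> \<in> X. \<chi> (case_sum x (\<lambda>v. H (i, v)))"
      obtain i where "i < K" "\<forall>\<chi> \<in> X. \<not> \<chi> (case_sum x (e i))"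
        using E(4)[OF x(1)] e by auto
      then show False using x(2) eH by auto
    qed
    then have "P H'" using eqvD[OF eqv_sym[OF H'(2)] P] by blast
    then obtain i where i: "i < K" "\<forall>\<chi> \<in> X. \<not> \<chi> (case_sum u (\<lambda>v. H' (i, v)))"
      unfolding P_def using u by blast
    let ?t = "\<lambda>v. H' (i, v)"
    have t: "?t \<in> env" using H'(1) by (auto simp: mem_env)
    have "eqv M0 ?t (e i)" using eqv_reindex[OF H'(2) M0_U, of "Pair i"] eH[OF i(1)] by simp
    also have "eqv M0 (e i) a" using E(3) e i(1) by blast
    finally have ta: "eqv M0 ?t a" .
    have tfs: "fs ?C ?t" by (rule fs_reindex[OF H'(3) small_sub[OF C]])
    have "P ?t" if P: "P \<in> \<Delta>" for P
    proof -
      have "P \<in> \<Gamma>" using P \<Delta>(2) by blast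
      then consider "dfn M0 P" "P a" | Q where "P = ?neg Q" "dfn ?C Q" "\<forall>e. range e \<subseteq> M0 \<longrightarrow> \<not> Q e"
        | "P \<in> ?at ` Collect bad"
        unfolding \<Gamma>_def by blast
      then show ?thesis
      proof cases
        case 1
        then show ?thesis using eqvD[OF eqv_sym[OF ta]] by blast
      next
        case 2
        have "\<not> Q ?t" using tfs 2(2,3) unfolding fs_def by blast
        then show ?thesis unfolding 2(1) .
      next
        case 3
        then have "P \<in> ?at ` X" using X(3) P by blast
        then show ?thesis using i(2) by blast
      qed
    qed
    then show "\<exists>t \<in> env. \<forall>P \<in> \<Delta>. P t" using t by blast
  qed
  then obtain a' where a': "a' \<in> env" "\<And>P. P \<in> \<Gamma> \<Longrightarrow> P a'" by blast
  have aa': "eqv M0 a a'" using a'(2) unfolding \<Gamma>_def by (intro eqvI) blast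
  have fsa': "fs ?C a'"
    unfolding fs_def
  proof (intro allI impI, rule ccontr)
    fix P assume P: "dfn ?C P" "P a'" "\<not> (\<exists>e. range e \<subseteq> M0 \<and> P e)"
    then have "?neg P \<in> \<Gamma>" unfolding \<Gamma>_def by blast
    from a'(2)[OF this] show False using P(2) by simp
  qed
  have good: "\<not> kinc \<chi> l (R j)" if "dfn M0 \<chi>" "\<chi> (case_sum u a')" "j < s" for \<chi> j l
  proof
    assume "kinc \<chi> l (R j)"
    then have "?at \<chi> \<in> \<Gamma>" unfolding \<Gamma>_def bad_def using that by blast
    from a'(2)[OF this] show False using that(2) by simp
  qed
  have rows: "\<exists>r. (\<forall>i. r i \<in> env) \<and> (\<forall>i. eqv ?C (r i) a') \<and> kinc (\<Phi> j) (k j) r" if j: "j < s" for j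
  proof -
    define Kc where "Kc = (\<lambda>I (z :: 'w + nat \<times> 'v \<Rightarrow> 'm).
        \<not> (\<exists>x \<in> env. \<forall>i \<in> I. \<Phi> j (case_sum x (\<lambda>v. z (Inr (i, v))))))"
    define Cp where "Cp = (\<lambda>(\<chi>, i) (z :: 'w + nat \<times> 'v \<Rightarrow> 'm).
        \<chi> (case_sum (\<lambda>w. z (Inl w)) (\<lambda>v. z (Inr (i, v)))) :: bool)"
    define \<I> where "\<I> = {I :: nat set. finite I \<and> card I = k j}"
    define X where "X = {\<chi>. dfn M0 \<chi> \<and> \<chi> (case_sum u a')}"
    \<comment> \<open>Look for a copy \<open>y\<close> of \<open>u\<close> together with a sequence
      whose members relate to \<open>y\<close> as \<open>a'\<close> does to \<open>u\<close>. For
      finitely many conditions, a consistent part of \<open>R j\<close> and a common point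
      \<open>y\<close> of it will do. Afterwards \<open>y\<close> is moved to
      \<open>u\<close>.\<close>
    have "\<exists>z \<in> env. \<forall>P \<in> Kc ` \<I> \<union> Cp ` (X \<times> UNIV). P z"
    proof (rule compactness[OF small_M0])
      fix P assume "P \<in> Kc ` \<I> \<union> Cp ` (X \<times> UNIV)"
      then consider I where "P = Kc I" "finite I" | \<chi> i where "P = Cp (\<chi>, i)" "dfn M0 \<chi>"
        unfolding \<I>_def X_def by blast
      then show "dfn M0 P"
      proof cases
        case 1
        show ?thesis unfolding 1(1) Kc_def by (intro dfn_not dfn_simul \<Phi> j M0_U 1(2))
      next
        case 2
        have eq: "case_sum (\<lambda>w. z (Inl w)) (\<lambda>v. z (Inr (i, v))) = (\<lambda>w. z (map_sum id (Pair i) w))"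
          for z :: "'w + nat \<times> 'v \<Rightarrow> 'm"
          by (auto simp: fun_eq_iff split: sum.split)
        show ?thesis unfolding 2(1) Cp_def prod.case eq by (rule dfn_reindex[OF 2(2) M0_U])
      qed
    next
      fix \<Delta> assume \<Delta>: "finite \<Delta>" "\<Delta> \<subseteq> Kc ` \<I> \<union> Cp ` (X \<times> UNIV)"
      have "finite (\<Delta> \<inter> Cp ` (X \<times> UNIV))" "\<Delta> \<inter> Cp ` (X \<times> UNIV) \<subseteq> Cp ` (X \<times> UNIV)" using \<Delta>(1) by auto
      then obtain Y where Y: "Y \<subseteq> X \<times> UNIV" "finite Y" "\<Delta> \<inter> Cp ` (X \<times> UNIV) = Cp ` Y"
        by (meson finite_subset_image)
      define l where "l = Suc (Max (snd ` Y))"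
      have l: "i < l" if "(\<chi>, i) \<in> Y" for \<chi> i
      proof -
        have "i \<in> snd ` Y" using that by force
        then show ?thesis using Y(2) by (simp add: l_def less_Suc_eq_le)
      qed
      have "dfn M0 (\<lambda>z. \<forall>\<chi> \<in> fst ` Y. \<chi> z)" using Y(1,2) unfolding X_def by (intro dfn_ball) auto
      moreover have "\<forall>\<chi> \<in> fst ` Y. \<chi> (case_sum u a')" using Y(1) unfolding X_def by auto
      ultimately have "\<not> kinc (\<lambda>z. \<forall>\<chi> \<in> fst ` Y. \<chi> z) l (R j)" using j by (rule good)
      then obtain I y where I: "finite I" "card I = l" "y \<in> env"
        "\<And>\<chi> i. \<chi> \<in> fst ` Y \<Longrightarrow> i \<in> I \<Longrightarrow> \<chi> (case_sum y (R j i))" unfolding kinc_def by blast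
      obtain f where f: "bij_betw f {..<l} I" using ex_bij_betw_nat_finite[OF I(1)] I(2)
        by (auto simp: atLeast0LessThan)
      \<comment> \<open>Only the first \<open>l\<close> members are constrained and taken from
        \<open>I\<close>. The others continue beyond \<open>I\<close>, so that \<open>g\<close> is
        injective and \<open>k j\<close>-inconsistency survives.\<close>
      define g where "g = (\<lambda>i. if i < l then f i else Suc (Max I) + i)"
      have fI: "f i \<in> I" if "i < l" for i using f that by (auto simp: bij_betw_def)
      have fM: "f i < Suc (Max I)" if "i < l" for i using fI[OF that] I(1) by (simp add: less_Suc_eq_le)
      have "inj g"
      proof (rule injI)
        fix x y assume xy: "g x = g y"
        show "x = y"
        proof (cases "x < l")
          case True
          then have "y < l" using xy fM[OF True] by (auto simp: g_def split: if_splits)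
          then show ?thesis using True xy f by (auto simp: g_def bij_betw_def inj_on_def)
        next
          case False
          then have "\<not> y < l" using xy fM[of y] by (auto simp: g_def split: if_splits)
          then show ?thesis using False xy by (simp add: g_def)
        qed
      qed
      then have kg: "kinc (\<Phi> j) (k j) (\<lambda>i. R j (g i))" by (rule kinc_inj[OF R(3)[OF j]])
      define z where "z = case_sum y (\<lambda>(i, v). R j (g i) v)"
      have "z \<in> env" using I(3) R(1) by (auto simp: z_def mem_env split: sum.split)
      moreover have "P z" if P: "P \<in> \<Delta>" for P
      proof -
        consider I where "P = Kc I" "I \<in> \<I>" | "P \<in> Cp ` Y" using P \<Delta>(2) Y(3) by blast
        then show ?thesis
        proof cases
          case 1
          then show ?thesis using kg unfolding Kc_def z_def kinc_def \<I>_def by simp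
        next
          case 2
          then obtain \<chi> i where c: "P = Cp (\<chi>, i)" "(\<chi>, i) \<in> Y" by auto
          have "i < l" using l c(2) by blast
          then have "g i \<in> I" using fI by (simp add: g_def)
          moreover have "\<chi> \<in> fst ` Y" using c(2) by force
          ultimately show ?thesis unfolding c(1) Cp_def z_def using I(4) by simp
        qed
      qed
      ultimately show "\<exists>z \<in> env. \<forall>P \<in> \<Delta>. P z" by blast
    qed
    then obtain z where z: "z \<in> env" "\<And>P. P \<in> Kc ` \<I> \<union> Cp ` (X \<times> UNIV) \<Longrightarrow> P z" by blast
    let ?y = "\<lambda>w. z (Inl w)" and ?q = "\<lambda>p. z (Inr p)"
    have yq: "?y \<in> env" "?q \<in> env" using z(1) by (auto simp: mem_env)
    have yr: "eqv M0 (case_sum u a') (case_sum ?y (\<lambda>v. ?q (i, v)))" for i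
    proof (rule eqvI)
      fix P assume "dfn M0 P" "P (case_sum u a')"
      then have "Cp (P, i) \<in> Kc ` \<I> \<union> Cp ` (X \<times> UNIV)" unfolding X_def by blast
      from z(2)[OF this] show "P (case_sum ?y (\<lambda>v. ?q (i, v)))" by (simp add: Cp_def)
    qed
    have "eqv M0 ?y u" using eqv_reindex[OF eqv_sym[OF yr[of 0]] M0_U, of Inl] by simp
    from eqv_extend[OF small_M0 this yq(1) u yq(2)]
    obtain q where q: "q \<in> env" "eqv M0 (case_sum ?y ?q) (case_sum u q)" by blast
    have qe: "(\<lambda>v. q (i, v)) \<in> env" for i using q(1) by (auto simp: mem_env)
    show ?thesis
    proof (intro exI[of _ "\<lambda>i v. q (i, v)"] conjI allI)
      show "(\<lambda>v. q (i, v)) \<in> env" for i by (rule qe)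
      show "eqv ?C (\<lambda>v. q (i, v)) a'" for i
      proof (rule eqv_Un_range[OF _ M0_U qe a'(1) u])
        have r: "case_sum y (\<lambda>v. q (i, v)) = (\<lambda>w. case_sum y q (map_sum id (Pair i) w))"
          for y :: "'w \<Rightarrow> 'm" and q :: "nat \<times> 'v \<Rightarrow> 'm"
          by (auto simp: fun_eq_iff split: sum.split)
        have "eqv M0 (case_sum ?y (\<lambda>v. ?q (i, v))) (case_sum u (\<lambda>v. q (i, v)))"
          unfolding r[of ?y ?q] r[of u q] by (rule eqv_reindex[OF q(2) M0_U])
        with yr have "eqv M0 (case_sum u a') (case_sum u (\<lambda>v. q (i, v)))" by (rule eqv_trans)
        from eqv_sym[OF eqv_swap[OF this M0_U]]
        show "eqv M0 (case_sum (\<lambda>v. q (i, v)) u) (case_sum a' u)" .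
      qed
      show "kinc (\<Phi> j) (k j) (\<lambda>i v. q (i, v))"
        unfolding kinc_def
      proof (intro allI impI)
        fix I :: "nat set" assume I: "finite I" "card I = k j"
        have "Kc I \<in> Kc ` \<I> \<union> Cp ` (X \<times> UNIV)" using I unfolding \<I>_def by blast
        then have "Kc I z" by (rule z(2))
        moreover have "dfn M0 (Kc I)" unfolding Kc_def by (intro dfn_not dfn_simul \<Phi> j M0_U I)
        moreover have "z = case_sum ?y ?q" by (auto simp: fun_eq_iff split: sum.split)
        ultimately have "Kc I (case_sum u q)" using eqvD[OF q(2)] by simp
        then show "\<not> (\<exists>x \<in> env. \<forall>i \<in> I. \<Phi> j (case_sum x (\<lambda>v. q (i, v))))" by (simp add: Kc_def)
      qed
    qed
  qed
  show ?thesis using a'(1) eqv_sym[OF aa'] fsa' rows by blast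
qed

section \<open>Forking and dividing over a model\<close>

text \<open>
  Chernikov--Kaplan: the rows of a strict coheir sequence witness dividing of each \<open>\<Phi> j\<close>, while all
  paths through them have the same type over \<open>M\<close>. If \<open>\<Theta>\<close> does not divide, some \<open>\<Phi> j\<close> is consistent
  along long paths.
\<close>

theorem forking_implies_dividing:
  fixes a :: "'v :: countable \<Rightarrow> 'm" and \<Theta> :: "('x + 'v \<Rightarrow> 'm) \<Rightarrow> bool"
    and \<Phi> :: "nat \<Rightarrow> ('x + 'v \<Rightarrow> 'm) \<Rightarrow> bool"
  assumes a: "a \<in> env" and \<Theta>: "dfn M0 \<Theta>" and \<Phi>: "\<And>j. j < s \<Longrightarrow> dfn M0 (\<Phi> j)"
    and div: "\<And>j. j < s \<Longrightarrow> divs M0 (\<Phi> j) a"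
    and imp: "\<And>x. x \<in> env \<Longrightarrow> \<Theta> (case_sum x a) \<Longrightarrow> \<exists>j < s. \<Phi> j (case_sum x a)"
  shows "divs M0 \<Theta> a"
proof (rule ccontr)
  assume nd: "\<not> divs M0 \<Theta> a"
  obtain z where z: "z \<in> M0" using elem by (auto simp: elem_substruct_def is_struct_def)
  have "\<forall>j. \<exists>kr :: nat \<times> (nat \<Rightarrow> 'v \<Rightarrow> 'm). (\<forall>i. snd kr i \<in> env) \<and>
      (j < s \<longrightarrow> (\<forall>i. eqv M0 (snd kr i) a) \<and> kinc (\<Phi> j) (fst kr) (snd kr))"
  proof
    fix j
    show "\<exists>kr :: nat \<times> (nat \<Rightarrow> 'v \<Rightarrow> 'm). (\<forall>i. snd kr i \<in> env) \<and>
      (j < s \<longrightarrow> (\<forall>i. eqv M0 (snd kr i) a) \<and> kinc (\<Phi> j) (fst kr) (snd kr))"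
    proof (cases "j < s")
      case True
      then show ?thesis using div[OF True] unfolding divs_def by auto
    next
      case False
      then show ?thesis using a by (intro exI[of _ "(0, \<lambda>_. a)"]) auto
    qed
  qed
  from choice[OF this] obtain kR :: "nat \<Rightarrow> nat \<times> (nat \<Rightarrow> 'v \<Rightarrow> 'm)" where
    kR: "\<forall>j. (\<forall>i. snd (kR j) i \<in> env) \<and>
      (j < s \<longrightarrow> (\<forall>i. eqv M0 (snd (kR j) i) a) \<and> kinc (\<Phi> j) (fst (kR j)) (snd (kR j)))" ..
  define k where "k = (\<lambda>j. fst (kR j))"
  define R where "R = (\<lambda>j. snd (kR j))"
  have R: "\<And>j i. R j i \<in> env" "\<And>j i. j < s \<Longrightarrow> eqv M0 (R j i) a" "\<And>j. j < s \<Longrightarrow> kinc (\<Phi> j) (k j) (R j)"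
    using kR by (simp_all add: R_def k_def)
  \<comment> \<open>All entries of the rows built before stage \<open>n\<close> as one tuple, filled
    up with \<open>z\<close>; the next strict coheir is taken over it.\<close>
  define cat where "cat = (\<lambda>(f :: nat \<Rightarrow> ('v \<Rightarrow> 'm) \<times> (nat \<Rightarrow> nat \<Rightarrow> 'v \<Rightarrow> 'm)) n (\<beta>, j :: nat, i :: nat, v).
      if \<beta> < n then snd (f \<beta>) j i v else z)"
  define Q where "Q = (\<lambda>f n (p :: ('v \<Rightarrow> 'm) \<times> (nat \<Rightarrow> nat \<Rightarrow> 'v \<Rightarrow> 'm)).
      fst p \<in> env \<and> eqv M0 (fst p) a \<and> fs (M0 \<union> range (cat f n)) (fst p) \<and> (\<forall>j i. snd p j i \<in> env) \<and>
      (\<forall>j < s. (\<forall>i. eqv (M0 \<union> range (cat f n)) (snd p j i) (fst p)) \<and> kinc (\<Phi> j) (k j) (snd p j)))"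
  have "\<exists>f. \<forall>n. Q f n (f n)"
  proof (rule dependent_wf_choice[OF wf_less_than])
    fix f g :: "nat \<Rightarrow> ('v \<Rightarrow> 'm) \<times> (nat \<Rightarrow> nat \<Rightarrow> 'v \<Rightarrow> 'm)" and n p
    assume "\<And>m. (m, n) \<in> less_than \<Longrightarrow> f m = g m"
    then have "cat f n = cat g n" by (auto simp: cat_def fun_eq_iff)
    then show "Q f n p = Q g n p" unfolding Q_def by simp
  next
    fix n and f :: "nat \<Rightarrow> ('v \<Rightarrow> 'm) \<times> (nat \<Rightarrow> nat \<Rightarrow> 'v \<Rightarrow> 'm)"
    assume IH: "\<And>m. (m, n) \<in> less_than \<Longrightarrow> Q f m (f m)"
    have "snd (f m) j i v \<in> U" if "m < n" for m j i v
      using IH[of m] that by (simp add: Q_def mem_env)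
    then have ce: "cat f n \<in> env" using z M0_U by (auto simp: cat_def mem_env)
    have "\<exists>a'. a' \<in> env \<and> eqv M0 a' a \<and> fs (M0 \<union> range (cat f n)) a' \<and> (\<forall>j < s. \<exists>r. (\<forall>i. r i \<in> env) \<and>
        (\<forall>i. eqv (M0 \<union> range (cat f n)) (r i) a') \<and> kinc (\<Phi> j) (k j) r)"
      by (rule strict_coheir[where \<Phi> = \<Phi> and R = R and k = k and s = s, OF a ce \<Phi> R])
    then obtain a' where a': "a' \<in> env" "eqv M0 a' a" "fs (M0 \<union> range (cat f n)) a'"
      "\<forall>j < s. \<exists>r. (\<forall>i. r i \<in> env) \<and> (\<forall>i. eqv (M0 \<union> range (cat f n)) (r i) a') \<and> kinc (\<Phi> j) (k j) r"
      by (elim exE conjE)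
    have "\<forall>j. \<exists>r. (\<forall>i. r i \<in> env) \<and>
      (j < s \<longrightarrow> (\<forall>i. eqv (M0 \<union> range (cat f n)) (r i) a') \<and> kinc (\<Phi> j) (k j) r)"
    proof
      fix j
      show "\<exists>r. (\<forall>i. r i \<in> env) \<and>
        (j < s \<longrightarrow> (\<forall>i. eqv (M0 \<union> range (cat f n)) (r i) a') \<and> kinc (\<Phi> j) (k j) r)"
        using a' by (cases "j < s") auto
    qed
    from choice[OF this] obtain r where "\<forall>j. (\<forall>i. r j i \<in> env) \<and>
      (j < s \<longrightarrow> (\<forall>i. eqv (M0 \<union> range (cat f n)) (r j i) a') \<and> kinc (\<Phi> j) (k j) (r j))" ..
    then show "\<exists>p. Q f n p" unfolding Q_def using a' by (intro exI[of _ "(a', r)"]) simp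
  qed
  then obtain f where f: "\<forall>n. Q f n (f n)" by (rule exE)
  define b where "b = (\<lambda>n. fst (f n))"
  define r where "r = (\<lambda>n. snd (f n))"
  have b: "\<And>n. b n \<in> env" "\<And>n. eqv M0 (b n) a" "\<And>n. fs (M0 \<union> range (cat f n)) (b n)"
    and r: "\<And>n j i. r n j i \<in> env" "\<And>n j i. j < s \<Longrightarrow> eqv (M0 \<union> range (cat f n)) (r n j i) (b n)"
      "\<And>n j. j < s \<Longrightarrow> kinc (\<Phi> j) (k j) (r n j)"
    using f unfolding Q_def b_def r_def by blast+
  have cat_env: "cat f n \<in> env" for n
    using r(1) z M0_U by (auto simp: cat_def mem_env r_def)
  \<comment> \<open>\<open>c \<beta>\<close> tells which of the dividing sequences is used at stage
    \<beta> and which of its entries.\<close>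
  define path where "path = (\<lambda>(c :: nat \<Rightarrow> nat \<times> nat) n (\<beta> :: nat, v).
      if \<beta> < n then r \<beta> (fst (c \<beta>)) (snd (c \<beta>)) v else z)"
  have path_env: "path c n \<in> env" for c n using r(1) z M0_U by (auto simp: path_def mem_env)
  have path_cat: "range (path c n) \<subseteq> M0 \<union> range (cat f n)" for c n
  proof clarify
    fix \<beta> v assume n: "path c n (\<beta>, v) \<notin> range (cat f n)"
    show "path c n (\<beta>, v) \<in> M0"
    proof (cases "\<beta> < n")
      case True
      then have "path c n (\<beta>, v) = cat f n (\<beta>, fst (c \<beta>), snd (c \<beta>), v)"
        by (simp add: path_def cat_def r_def)
      then show ?thesis using n by simp
    qed (use z in \<open>simp add: path_def\<close>)
  qed
  \<comment> \<open>The entry chosen at stage \<open>n\<close> can be replaced by \<open>b n\<close>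
    over everything earlier, and the coheir \<open>b n\<close>, being invariant, cannot tell apart
    two earlier paths of the same type.\<close>
  have paths: "eqv M0 (path c n) (path c' n)" if c: "\<And>\<beta>. fst (c \<beta>) < s" "\<And>\<beta>. fst (c' \<beta>) < s" for c c' n
  proof (induction n)
    case 0
    have "path c 0 = path c' 0" by (auto simp: path_def fun_eq_iff)
    then show ?case by simp
  next
    case (Suc n)
    have step: "eqv M0 (case_sum (r n (fst (c n)) (snd (c n))) (path c n)) (case_sum (b n) (path c n))"
      if "\<And>\<beta>. fst (c \<beta>) < s" for c
    proof (rule eqv_Un_rangeD[OF _ M0_U path_env])
      show "eqv (M0 \<union> range (path c n)) (r n (fst (c n)) (snd (c n))) (b n)"
        by (rule eqv_mono[OF r(2)[OF that]]) (use path_cat in blast)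
    qed
    have "eqv M0 (case_sum (b n) (path c n)) (case_sum (b n) (path c' n))"
      by (rule fs_invariant[OF b(3) _ _ path_cat path_cat Suc.IH])
        (use M0_U cat_env[of n] in \<open>auto simp: mem_env\<close>)
    with step[of c] step[of c'] c
    have e: "eqv M0 (case_sum (r n (fst (c n)) (snd (c n))) (path c n))
        (case_sum (r n (fst (c' n)) (snd (c' n))) (path c' n))"
      using eqv_trans eqv_sym by blast
    have "path c (Suc n) = (\<lambda>w. case_sum (r n (fst (c n)) (snd (c n))) (path c n)
        ((\<lambda>(\<beta>, v). if \<beta> = n then Inl v else Inr (\<beta>, v)) w))" for c
      by (auto simp: path_def fun_eq_iff)
    then show ?case by (simp only:) (rule eqv_reindex[OF e M0_U])
  qed
  have nk: "\<not> kinc \<Theta> l c" if "\<And>i. c i \<in> env" "\<And>i. eqv M0 (c i) a" for l c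
    using nd that unfolding divs_def by blast
  \<comment> \<open>Without disjuncts \<Theta> would have no solution at \<open>a\<close>, and the
    constant sequence would be 1-inconsistent.\<close>
  have s: "0 < s"
  proof -
    have "\<not> kinc \<Theta> 1 (\<lambda>_. a)" using a by (intro nk) auto
    then obtain I :: "nat set" and x where "card I = 1" "x \<in> env" "\<forall>i \<in> I. \<Theta> (case_sum x a)"
      unfolding kinc_def by blast
    then have "\<Theta> (case_sum x a)" by (auto simp: card_1_singleton_iff)
    then show ?thesis using imp \<open>x \<in> env\<close> by fastforce
  qed
  define c0 where "c0 = (\<lambda>_ :: nat. (0 :: nat, 0 :: nat))"
  define d where "d = (\<lambda>\<beta>. r \<beta> 0 0)"
  have d: "d \<beta> \<in> env" "eqv M0 (d \<beta>) a" for \<beta>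
  proof -
    show "d \<beta> \<in> env" using r(1) by (simp add: d_def)
    have "eqv M0 (d \<beta>) (b \<beta>)" unfolding d_def by (rule eqv_mono[OF r(2)[OF s]]) simp
    then show "eqv M0 (d \<beta>) a" using b(2) eqv_trans by blast
  qed
  have "\<forall>j. \<exists>n :: nat. j < s \<longrightarrow> (\<forall>r :: nat \<Rightarrow> nat \<Rightarrow> 'v \<Rightarrow> 'm. (\<forall>\<alpha> i. r \<alpha> i \<in> env) \<longrightarrow> (\<forall>\<alpha> < n. kinc (\<Phi> j) (k j) (r \<alpha>)) \<longrightarrow>
    \<not> (\<forall>f. \<exists>x \<in> env. \<forall>\<alpha> < n. \<Phi> j (case_sum x (r \<alpha> (f \<alpha>)))))"
  proof
    fix j
    show "\<exists>n :: nat. j < s \<longrightarrow> (\<forall>r :: nat \<Rightarrow> nat \<Rightarrow> 'v \<Rightarrow> 'm. (\<forall>\<alpha> i. r \<alpha> i \<in> env) \<longrightarrow> (\<forall>\<alpha> < n. kinc (\<Phi> j) (k j) (r \<alpha>)) \<longrightarrow>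
      \<not> (\<forall>f. \<exists>x \<in> env. \<forall>\<alpha> < n. \<Phi> j (case_sum x (r \<alpha> (f \<alpha>)))))"
    proof (cases "j < s")
      case True
      from ntp2_bound[OF \<Phi>[OF True] small_M0, of "k j"] show ?thesis by (rule ex_forward) (rule impI)
    qed simp
  qed
  from choice[OF this] obtain n :: "nat \<Rightarrow> nat" where
    n: "\<forall>j. j < s \<longrightarrow> (\<forall>r :: nat \<Rightarrow> nat \<Rightarrow> 'v \<Rightarrow> 'm. (\<forall>\<alpha> i. r \<alpha> i \<in> env) \<longrightarrow> (\<forall>\<alpha> < n j. kinc (\<Phi> j) (k j) (r \<alpha>)) \<longrightarrow>
    \<not> (\<forall>f. \<exists>x \<in> env. \<forall>\<alpha> < n j. \<Phi> j (case_sum x (r \<alpha> (f \<alpha>)))))" ..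
  \<comment> \<open>Enough indices for the pigeonhole principle: a common point of so many instances
    of \<Theta> satisfies some \<open>\<Phi> j\<close> at no fewer than \<open>n j\<close> of
    them.\<close>
  have "\<not> kinc \<Theta> (Suc (sum n {..<s})) d" by (rule nk) (rule d)+
  then obtain I x where I: "finite I" "card I = Suc (sum n {..<s})" "x \<in> env" "\<forall>i \<in> I. \<Theta> (case_sum x (d i))"
    unfolding kinc_def by blast
  define Ij where "Ij = (\<lambda>j. {i \<in> I. \<Phi> j (case_sum x (d i))})"
  have cov: "I \<subseteq> (\<Union>j < s. Ij j)"
  proof
    fix i assume i: "i \<in> I"
    \<comment> \<open>The implication from \<Theta> to the disjunction passes from \<open>a\<close>
      to \<open>d i\<close>; the index set \<open>{()}\<close> just brings it into the form of
      \<open>dfn_simul\<close>.\<close>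
    have "dfn M0 (\<lambda>t. \<not> (\<exists>x \<in> env. \<forall>_ \<in> {()}. \<Theta> (case_sum x t) \<and> \<not> (\<exists>j \<in> {..<s}. \<Phi> j (case_sum x t))))"
      by (intro dfn_not dfn_simul[where \<rho> = "\<lambda>_ v. v" and \<Phi> = "\<lambda>z. \<Theta> z \<and> \<not> (\<exists>j \<in> {..<s}. \<Phi> j z)"]
          dfn_conj \<Theta> dfn_bex \<Phi> M0_U) auto
    from eqvD[OF eqv_sym[OF d(2)[of i]] this] imp
    have "\<not> (\<exists>x \<in> env. \<forall>_ \<in> {()}. \<Theta> (case_sum x (d i)) \<and> \<not> (\<exists>j \<in> {..<s}. \<Phi> j (case_sum x (d i))))" by auto
    then show "i \<in> (\<Union>j < s. Ij j)" using I(3,4) i unfolding Ij_def by auto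
  qed
  have "\<exists>j < s. n j \<le> card (Ij j)"
  proof (rule ccontr)
    assume "\<not> ?thesis"
    then have lt: "card (Ij j) \<le> n j" if "j < s" for j using that by force
    have "card I \<le> card (\<Union>j < s. Ij j)" using I(1) by (intro card_mono cov) (auto simp: Ij_def)
    also have "\<dots> \<le> (\<Sum>j < s. card (Ij j))" by (rule card_UN_le) simp
    also have "\<dots> \<le> sum n {..<s}" by (rule sum_mono) (use lt in auto)
    finally show False using I(2) by simp
  qed
  then obtain j where j: "j < s" "n j \<le> card (Ij j)" by blast
  have fin: "finite (Ij j)" using I(1) by (simp add: Ij_def)
  obtain h where h: "bij_betw h {..<card (Ij j)} (Ij j)"
    using ex_bij_betw_nat_finite[OF fin] by (auto simp: atLeast0LessThan)
  have hI: "h \<alpha> \<in> Ij j" if "\<alpha> < n j" for \<alpha> using h that j(2) by (auto simp: bij_betw_def)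
  have hinj: "inj_on h {..<n j}" using h j(2) by (auto simp: bij_betw_def intro: inj_on_subset)
  \<comment> \<open>At the stages selected by \<open>h\<close>, the rows for \<open>j\<close>
    contain an inconsistent path, whereas \<open>c0\<close> is consistent there for
    \<open>\<Phi> j\<close>. By \<open>paths\<close> the two have the same type, a
    contradiction.\<close>
  have "\<not> (\<forall>g. \<exists>x \<in> env. \<forall>\<alpha> < n j. \<Phi> j (case_sum x (r (h \<alpha>) j (g \<alpha>))))"
    using n[rule_format, OF j(1), of "\<lambda>\<alpha>. r (h \<alpha>) j"] r(1) r(3)[OF j(1)] by blast
  then obtain g where g: "\<not> (\<exists>x \<in> env. \<forall>\<alpha> < n j. \<Phi> j (case_sum x (r (h \<alpha>) j (g \<alpha>))))" by blast
  define c where "c = (\<lambda>\<beta>. if \<beta> \<in> h ` {..<n j} then (j, g (inv_into {..<n j} h \<beta>)) else (0, 0))"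
  define m where "m = Suc (Max I)"
  have hm: "h \<alpha> < m" if "\<alpha> < n j" for \<alpha>
    using hI[OF that] I(1) by (simp add: Ij_def m_def less_Suc_eq_le)
  have "eqv M0 (path c0 m) (path c m)" by (rule paths) (use s j(1) in \<open>auto simp: c0_def c_def\<close>)
  moreover have "dfn M0 (\<lambda>t. \<exists>x \<in> env. \<forall>\<alpha> \<in> {..<n j}. \<Phi> j (case_sum x (\<lambda>v. t (h \<alpha>, v))))"
    by (intro dfn_simul \<Phi> j(1) M0_U) simp
  moreover have "(\<lambda>v. path c0 m (h \<alpha>, v)) = d (h \<alpha>)" if "\<alpha> < n j" for \<alpha>
    using hm[OF that] by (simp add: path_def c0_def d_def)
  then have "\<exists>x \<in> env. \<forall>\<alpha> \<in> {..<n j}. \<Phi> j (case_sum x (\<lambda>v. path c0 m (h \<alpha>, v)))"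
    using I(3) hI by (intro bexI[of _ x]) (auto simp: Ij_def)
  ultimately have "\<exists>x \<in> env. \<forall>\<alpha> \<in> {..<n j}. \<Phi> j (case_sum x (\<lambda>v. path c m (h \<alpha>, v)))"
    by (rule eqvD)
  moreover have "(\<lambda>v. path c m (h \<alpha>, v)) = r (h \<alpha>) j (g \<alpha>)" if "\<alpha> < n j" for \<alpha>
    using hm[OF that] that hinj by (simp add: path_def c_def)
  ultimately show False using g by auto
qed

end

section \<open>Small elementary substructures\<close>

definition skolem :: "('f, 'r, 'm) fo_struct \<Rightarrow> 'm list \<Rightarrow> ('f, 'r) fo_form \<Rightarrow> 'm" where
  "skolem K e \<phi> = (SOME a. a \<in> univ K \<and> ((\<exists>a \<in> univ K. sat K (a # e) \<phi>) \<longrightarrow> sat K (a # e) \<phi>))"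

lemma skolem:
  assumes "univ K \<noteq> {}"
  shows "skolem K e \<phi> \<in> univ K" "(\<exists>a \<in> univ K. sat K (a # e) \<phi>) \<Longrightarrow> sat K (skolem K e \<phi> # e) \<phi>"
proof -
  have "\<exists>a. a \<in> univ K \<and> ((\<exists>a \<in> univ K. sat K (a # e) \<phi>) \<longrightarrow> sat K (a # e) \<phi>)"
    using assms by blast
  from someI_ex[OF this, folded skolem_def]
  show "skolem K e \<phi> \<in> univ K" "(\<exists>a \<in> univ K. sat K (a # e) \<phi>) \<Longrightarrow> sat K (skolem K e \<phi> # e) \<phi>"
    by blast+
qed

text \<open>
  The formulas themselves serve as codes for iterated Skolem terms with constants \<open>b\<close>: a conjunction
  codes an element (apply the Skolem function of the first conjunct to the list coded by the second)
  and, by listing its conjuncts, a list. This bounds the Skolem hull of \<open>b\<close> by the number of formulas.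
\<close>

primrec decode :: "('f, 'r, 'm) fo_struct \<Rightarrow> 'm list \<Rightarrow> ('f, 'r) fo_form \<Rightarrow> 'm \<times> 'm list" where
  "decode K b (FEq s t) = (skolem K [] (FEq s t), [])"
| "decode K b (FRel r ts) = (skolem K [] (FRel r ts), [])"
| "decode K b (FNot \<phi>) = (skolem K [] (FNot \<phi>), [])"
| "decode K b (FEx \<phi>) = (skolem K [] (FEx \<phi>), [])"
| "decode K b (FAnd \<phi> \<psi>) =
     (skolem K (snd (decode K b \<psi>) @ b) \<phi>, fst (decode K b \<phi>) # snd (decode K b \<psi>))"

text \<open>The Tarski--Vaught test: functions and relations are kept as they are, so only
  quantifiers could change their meaning.\<close>

lemma sat_univ_update:
  assumes H: "H \<subseteq> univ K"
    and TV: "\<And>\<phi> e. form L (Suc (length e)) \<phi> \<Longrightarrow> set e \<subseteq> H \<Longrightarrow> \<exists>a \<in> univ K. sat K (a # e) \<phi> \<Longrightarrow> \<exists>a \<in> H. sat K (a # e) \<phi>"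
  shows "form L (length e) \<phi> \<Longrightarrow> set e \<subseteq> H \<Longrightarrow> sat (K\<lparr>univ := H\<rparr>) e \<phi> = sat K e \<phi>"
proof (induction \<phi> arbitrary: e)
  case (FEq s t)
  have "eval_term (K\<lparr>univ := H\<rparr>) e t = eval_term K e t" for t by (induction t) (auto cong: map_cong)
  then show ?case by simp
next
  case (FRel r ts)
  have "eval_term (K\<lparr>univ := H\<rparr>) e t = eval_term K e t" for t by (induction t) (auto cong: map_cong)
  then have "eval_term (K\<lparr>univ := H\<rparr>) e = eval_term K e" by blast
  then show ?case by simp
next
  case (FEx \<phi>)
  have "sat (K\<lparr>univ := H\<rparr>) (a # e) \<phi> = sat K (a # e) \<phi>" if "a \<in> H" for a
    using FEx.IH[of "a # e"] FEx.prems that by simp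
  then show ?case using TV[of e \<phi>] FEx.prems H by auto
qed auto

lemma ex_small_elem_substruct:
  fixes L :: "('f, 'r) language" and K :: "('f, 'r, 'm) fo_struct"
  assumes K: "is_struct L K" and b: "set b \<subseteq> univ K"
  obtains K' :: "('f, 'r, 'm) fo_struct" where "elem_substruct L K' K" "set b \<subseteq> univ K'"
    "|univ K'| \<le>o |{\<phi> :: ('f, 'r) fo_form. \<exists>n. form L n \<phi>}|"
proof -
  let ?F = "{\<phi> :: ('f, 'r) fo_form. \<exists>n. form L n \<phi>}"
  define H where "H = (\<lambda>\<phi>. fst (decode K b \<phi>)) ` ?F"
  have ne: "univ K \<noteq> {}" using K by (simp add: is_struct_def)
  have "fst (decode K b \<phi>) \<in> univ K" for \<phi>
    by (cases \<phi>) (simp_all add: skolem(1)[OF ne])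
  then have HK: "H \<subseteq> univ K" by (auto simp: H_def)
  have FAnd: "FAnd \<phi> \<psi> \<in> ?F" if f: "\<phi> \<in> ?F" "\<psi> \<in> ?F" for \<phi> \<psi> :: "('f, 'r) fo_form"
  proof -
    obtain m n where "form L m \<phi>" "form L n \<psi>" using f by blast
    then have "form L (max m n) (FAnd \<phi> \<psi>)" by (auto intro: form_mono)
    then show ?thesis by blast
  qed
  have codes: "\<exists>\<psi> \<in> ?F. snd (decode K b \<psi>) = e" if "set e \<subseteq> H" for e
    using that
  proof (induction e)
    case Nil
    have "FEq (FVar 0) (FVar 0) \<in> ?F" by auto
    then show ?case by (intro bexI[of _ "FEq (FVar 0) (FVar 0)"]) simp_all
  next
    case (Cons a e)
    then obtain \<phi> \<psi> where "\<phi> \<in> ?F" "a = fst (decode K b \<phi>)" "\<psi> \<in> ?F" "snd (decode K b \<psi>) = e"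
      by (auto simp: H_def)
    then show ?case using FAnd by (intro bexI[of _ "FAnd \<phi> \<psi>"]) simp_all
  qed
  \<comment> \<open>The index \<open>n\<close> is free because \<phi> may also mention the entries
    of \<open>b\<close>, which follow those of \<open>e\<close>.\<close>
  have wit: "\<exists>a \<in> H. sat K (a # e @ b) \<phi>" if w: "form L n \<phi>" "set e \<subseteq> H" "\<exists>a \<in> univ K. sat K (a # e @ b) \<phi>" for \<phi> e n
  proof -
    obtain \<psi> where \<psi>: "\<psi> \<in> ?F" "snd (decode K b \<psi>) = e" using codes w(2) by blast
    have "skolem K (e @ b) \<phi> \<in> H"
      unfolding H_def using FAnd[OF _ \<psi>(1), of \<phi>] w(1) \<psi>(2) by (intro image_eqI[of _ _ "FAnd \<phi> \<psi>"]) auto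
    then show ?thesis using skolem(2)[OF ne w(3)] by blast
  qed
  have TV: "\<exists>a \<in> H. sat K (a # e) \<phi>"
    if "form L (Suc (length e)) \<phi>" "set e \<subseteq> H" "\<exists>a \<in> univ K. sat K (a # e) \<phi>" for \<phi> e
  proof -
    have "sat K (a # e @ b) \<phi> = sat K (a # e) \<phi>" for a
      using sat_append[of L "a # e" \<phi> K b] that(1) by simp
    then show ?thesis using wit[OF that(1,2)] that(3) by simp
  qed
  have bH: "set b \<subseteq> H"
  proof
    fix x assume x: "x \<in> set b"
    then obtain i where i: "i < length b" "x = b ! i" by (auto simp: in_set_conv_nth)
    have "\<exists>a \<in> H. sat K (a # [] @ b) (FEq (FVar 0) (FVar (Suc i)))"
      by (rule wit[of "Suc (length b)"]) (use i x b in auto)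
    then show "x \<in> H" using i by auto
  qed
  have cl: "fint K f a \<in> H" if f: "f \<in> funcs L" and a: "a \<in> tuples H (farity L f)" for f a
  proof -
    let ?n = "farity L f"
    \<comment> \<open>Closure under \<open>f\<close> is the Tarski--Vaught condition for the formula
      that defines its value.\<close>
    let ?\<phi> = "FEq (FVar 0) (FApp f (map (\<lambda>i. FVar (Suc i)) [0..<?n]))"
    have l: "length a = ?n" "set a \<subseteq> H" using a by (auto simp: tuples_def)
    have "map (eval_term K (x # a) \<circ> (\<lambda>i. FVar (Suc i))) [0..<?n] = a" for x
      using l(1) by (auto intro: nth_equalityI)
    then have ev: "sat K (x # a) ?\<phi> \<longleftrightarrow> x = fint K f a" for x by simp
    have "fint K f a \<in> univ K" using K f l HK by (auto simp: is_struct_def tuples_def)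
    then have "\<exists>x \<in> H. sat K (x # a) ?\<phi>" by (intro TV) (use l f ev in auto)
    then show ?thesis using ev by auto
  qed
  obtain \<phi>0 :: "('f, 'r) fo_form" where "\<phi>0 \<in> ?F" using codes[of "[]"] by auto
  then have Hne: "H \<noteq> {}" by (auto simp: H_def)
  let ?K = "K\<lparr>univ := H\<rparr>"
  have "is_struct L ?K" using Hne cl by (auto simp: is_struct_def)
  moreover have "sat ?K a \<phi> = sat K a \<phi>" if "a \<in> tuples H n" "form L n \<phi>" for n \<phi> a
    using that by (intro sat_univ_update[OF HK TV]) (auto simp: tuples_def)
  ultimately have "elem_substruct L ?K K" using K HK by (auto simp: elem_substruct_def)
  moreover have "|H| \<le>o |?F|" unfolding H_def by (rule card_of_image)
  ultimately show ?thesis using that[of ?K] bH by simp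
qed

text \<open>\<open>entails\<close> ranges over structures made of formulas. A Loewenheim--Skolem
  submodel of \<open>K\<close> is small enough to be copied injectively into that type, and the copy
  \<open>N0\<close> satisfies the same sentences.\<close>

lemma entails_sat:
  fixes K :: "('f, 'r, 'm) fo_struct"
  assumes K: "is_model L T K" and T: "\<forall>\<sigma> \<in> T. sentence L \<sigma>" and ent: "entails L T \<sigma>" and \<sigma>: "sentence L \<sigma>"
  shows "sat K [] \<sigma>"
proof -
  have Ks: "is_struct L K" using K by (simp add: is_model_def)
  obtain K' :: "('f, 'r, 'm) fo_struct" where K': "elem_substruct L K' K"
      "|univ K'| \<le>o |{\<phi> :: ('f, 'r) fo_form. \<exists>n. form L n \<phi>}|"
    using ex_small_elem_substruct[OF Ks, of "[]"] by auto
  let ?H = "univ K'"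
  obtain h :: "'m \<Rightarrow> ('f, 'r) fo_form" where h: "inj_on h ?H"
    using K'(2) unfolding card_of_ordLeq[symmetric] by blast
  define k where "k = inv_into ?H h"
  have kh: "k (h a) = a" if "a \<in> ?H" for a using h that by (simp add: k_def)
  have kh': "map (k \<circ> h) e = e" if "set e \<subseteq> ?H" for e using kh that by (intro map_idI) auto
  define N0 where "N0 = \<lparr>univ = h ` ?H, fint = (\<lambda>f a. h (fint K' f (map k a))), rint = (\<lambda>r a. rint K' r (map k a))\<rparr>"
  have N0: "fint N0 f a = h (fint K' f (map k a))" "rint N0 r a = rint K' r (map k a)" for f r a
    by (simp_all add: N0_def)
  have s': "is_struct L K'" using K'(1) by (simp add: elem_substruct_def)
  have ev: "eval_term K' e t \<in> ?H \<and> eval_term N0 (map h e) t = h (eval_term K' e t)"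
    if "wf_term L (length e) t" "set e \<subseteq> ?H" for e t
    using that(1)
  proof (induction t)
    case (FVar i)
    then show ?case using that(2) by auto
  next
    case (FApp f ts)
    have IH: "eval_term K' e t \<in> ?H" "eval_term N0 (map h e) t = h (eval_term K' e t)" if "t \<in> set ts" for t
      using FApp that by auto
    have "set (map (eval_term K' e) ts) \<subseteq> ?H" using IH(1) by auto
    then have m: "map (k \<circ> h) (map (eval_term K' e) ts) = map (eval_term K' e) ts" by (rule kh')
    have "map (eval_term N0 (map h e)) ts = map h (map (eval_term K' e) ts)" using IH(2) by simp
    then have "map k (map (eval_term N0 (map h e)) ts) = map (eval_term K' e) ts" using m by (simp only: map_map comp_assoc)
    then have "eval_term N0 (map h e) (FApp f ts) = h (eval_term K' e (FApp f ts))"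
      by (simp only: eval_term.simps N0)
    moreover have "map (eval_term K' e) ts \<in> tuples ?H (farity L f)"
      using FApp.prems IH(1) by (auto simp: tuples_def)
    then have "fint K' f (map (eval_term K' e) ts) \<in> ?H"
      using s' FApp.prems by (auto simp: is_struct_def)
    ultimately show ?case by simp
  qed
  have sat: "sat N0 (map h e) \<phi> = sat K' e \<phi>" if "form L (length e) \<phi>" "set e \<subseteq> ?H" for e \<phi>
    using that
  proof (induction \<phi> arbitrary: e)
    case (FEq s t)
    then show ?case using ev[of e s] ev[of e t] h by (auto simp: inj_on_eq_iff)
  next
    case (FRel r ts)
    have "set (map (eval_term K' e) ts) \<subseteq> ?H" using ev FRel by auto
    then have m: "map (k \<circ> h) (map (eval_term K' e) ts) = map (eval_term K' e) ts" by (rule kh')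
    have "map (eval_term N0 (map h e)) ts = map h (map (eval_term K' e) ts)" using ev FRel by simp
    then have "map k (map (eval_term N0 (map h e)) ts) = map (eval_term K' e) ts" using m by (simp only: map_map comp_assoc)
    then show ?case by (simp only: sat.simps N0)
  next
    case (FEx \<phi>)
    have "sat N0 (h a # map h e) \<phi> = sat K' (a # e) \<phi>" if "a \<in> ?H" for a
      using FEx.IH[of "a # e"] FEx.prems that by simp
    then show ?case by (simp add: N0_def)
  qed auto
  have "is_struct L N0"
    unfolding is_struct_def
  proof (intro conjI ballI)
    show "univ N0 \<noteq> {}" using s' by (simp add: N0_def is_struct_def)
    fix f a assume f: "f \<in> funcs L" "a \<in> tuples (univ N0) (farity L f)"
    have "k x \<in> ?H" if "x \<in> univ N0" for x using that kh by (auto simp: N0_def)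
    then have "map k a \<in> tuples ?H (farity L f)" using f(2) by (auto simp: tuples_def)
    then show "fint N0 f a \<in> univ N0" using s' f(1) by (auto simp: N0_def is_struct_def)
  qed
  moreover have sent: "sat N0 [] \<tau> = sat K [] \<tau>" if "sentence L \<tau>" for \<tau>
  proof -
    have "[] \<in> tuples ?H 0" by (simp add: tuples_def)
    then have "sat K' [] \<tau> = sat K [] \<tau>" using K'(1) that unfolding elem_substruct_def by blast
    then show ?thesis using sat[of "[]"] that by simp
  qed
  ultimately have "is_model L T N0" using K T by (auto simp: is_model_def)
  then have "sat N0 [] \<sigma>" using ent unfolding entails_def by blast
  then show ?thesis using sent \<sigma> by blast
qed

lemma elementarily_equivalent:
  assumes "complete_theory L T" "is_model L T K" "is_model L T K'" "sentence L \<sigma>"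
  shows "sat K [] \<sigma> \<longleftrightarrow> sat K' [] \<sigma>"
proof -
  have T: "\<forall>\<sigma> \<in> T. sentence L \<sigma>" using assms(1) by (simp add: complete_theory_def)
  have s: "sentence L (FNot \<sigma>)" using assms(4) by simp
  have "entails L T \<sigma> \<or> entails L T (FNot \<sigma>)" using assms(1,4) unfolding complete_theory_def by blast
  then show ?thesis
    using entails_sat[OF assms(2) T _ assms(4)] entails_sat[OF assms(2) T _ s]
      entails_sat[OF assms(3) T _ assms(4)] entails_sat[OF assms(3) T _ s] by auto
qed

section \<open>Translates of definable sets\<close>

definition nat_form :: "('f, 'r, nat) nform \<Rightarrow> ('f, 'r) fo_form" where
  "nat_form f = ren (\<lambda>i. snd f ! i) (fst f)"

lemma form_nat_form: "nwf L f \<Longrightarrow> set (snd f) \<subseteq> {..<m} \<Longrightarrow> form L m (nat_form f)"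
  unfolding nat_form_def nwf_def by (erule form_ren) (meson lessThan_iff nth_mem subset_iff)

lemma sat_nat_form: "nwf L f \<Longrightarrow> sat K e (nat_form f) = holds K (\<lambda>i. e ! i) f"
  unfolding nat_form_def nwf_def holds_def by (erule sat_ren) simp

text \<open>
  \<open>tr_form d n \<gamma> \<mu> \<phi>\<close> is the formula ``\<open>x \<in> g (\<phi>(K,b) \<inter> G)\<close>'' in the variables \<open>x, g, b\<close> of lengths
  \<open>d, d, n\<close>. The factor from \<open>\<phi>(K,b)\<close> is quantified in the variables from \<open>d + d + n\<close> on; the names of
  these bound variables are then identified with \<open>0\<close>, as they may not count as free.
\<close>

definition tr_body :: "nat \<Rightarrow> nat \<Rightarrow> ('f, 'r) fo_form \<Rightarrow> ('f, 'r) fo_form \<Rightarrow> ('f, 'r) fo_form \<Rightarrow> ('f, 'r, nat) nform" where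
  "tr_body d n \<gamma> \<mu> \<phi> = nAnd (\<gamma>, [d+d+n..<d+d+n+d]) (nAnd (\<phi>, [d+d+n..<d+d+n+d] @ [d+d..<d+d+n])
       (\<mu>, [d..<d+d] @ [d+d+n..<d+d+n+d] @ [0..<d]))"

definition tr_form :: "nat \<Rightarrow> nat \<Rightarrow> ('f, 'r) fo_form \<Rightarrow> ('f, 'r) fo_form \<Rightarrow> ('f, 'r) fo_form \<Rightarrow> ('f, 'r) fo_form" where
  "tr_form d n \<gamma> \<mu> \<phi> = nat_form (nMap (\<lambda>v. if v < d + d + n then v else 0)
     (nAnd (\<gamma>, [0..<d]) (foldr nEx [d+d+n..<d+d+n+d] (tr_body d n \<gamma> \<mu> \<phi>))))"

lemma
  assumes f: "form L d \<gamma>" "form L (d + d + d) \<mu>" "form L (d + n) \<phi>"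
  shows form_tr_form: "form L (d + (d + n)) (tr_form d n \<gamma> \<mu> \<phi>)"
    and sat_tr_form: "x \<in> tuples (univ K) d \<Longrightarrow> g \<in> tuples (univ K) d \<Longrightarrow> b \<in> tuples (univ K) n \<Longrightarrow>
      sat K (x @ g @ b) (tr_form d n \<gamma> \<mu> \<phi>) \<longleftrightarrow> sat K x \<gamma> \<and>
        (\<exists>h \<in> tuples (univ K) d. sat K h \<gamma> \<and> sat K (h @ b) \<phi> \<and> sat K (g @ h @ x) \<mu>)"
proof -
  let ?m = "d + d + n" and ?c = "\<lambda>v. if v < d + d + n then v else 0"
  let ?vs = "[?m..<?m+d]"
  have b0: "nwf L (\<gamma>, ?vs)" "nwf L (\<phi>, ?vs @ [d+d..<d+d+n])" "nwf L (\<mu>, [d..<d+d] @ ?vs @ [0..<d])"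
    "nwf L (\<gamma>, [0..<d])"
    using f by (simp_all add: nwf_def add.assoc)
  have b1: "nwf L (tr_body d n \<gamma> \<mu> \<phi>)" unfolding tr_body_def by (intro nwf_ops b0)
  have b2: "nwf L (foldr nEx ?vs (tr_body d n \<gamma> \<mu> \<phi>))"
    "set (snd (foldr nEx ?vs (tr_body d n \<gamma> \<mu> \<phi>))) = set (snd (tr_body d n \<gamma> \<mu> \<phi>))"
    using holds_nExs[OF b1, of ?vs] by blast+
  let ?f = "nAnd (\<gamma>, [0..<d]) (foldr nEx ?vs (tr_body d n \<gamma> \<mu> \<phi>))"
  have b3: "nwf L ?f" by (intro nwf_ops b0 b2)
  have b4: "nwf L (nMap ?c ?f)" using b3 by simp
  have "set (snd (tr_body d n \<gamma> \<mu> \<phi>)) \<subseteq> {..<?m + d}" unfolding tr_body_def nvars_ops by auto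
  then have "set (snd ?f) \<subseteq> {..<?m + d}" unfolding nvars_ops b2(2) by auto
  \<comment> \<open>If \<open>d = 0\<close> there are no bound names to rename; otherwise
    \<open>0 < ?m\<close>.\<close>
  then have "set (snd (nMap ?c ?f)) \<subseteq> {..<?m}" by (cases "d = 0") auto
  from form_nat_form[OF b4 this] show "form L (d + (d + n)) (tr_form d n \<gamma> \<mu> \<phi>)"
    by (simp add: tr_form_def add.assoc)
  show "sat K (x @ g @ b) (tr_form d n \<gamma> \<mu> \<phi>) \<longleftrightarrow> sat K x \<gamma> \<and>
        (\<exists>h \<in> tuples (univ K) d. sat K h \<gamma> \<and> sat K (h @ b) \<phi> \<and> sat K (g @ h @ x) \<mu>)"
    if t: "x \<in> tuples (univ K) d" "g \<in> tuples (univ K) d" "b \<in> tuples (univ K) n"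
  proof -
    define s where "s = (\<lambda>i. (x @ g @ b) ! i) \<circ> ?c"
    have l: "length x = d" "length g = d" "length b = n" using t by (auto simp: tuples_def)
    have sx: "map s' [0..<d] = x" and sg: "map s' [d..<d+d] = g" and sb: "map s' [d+d..<d+d+n] = b"
      if "\<forall>v. v \<notin> set ?vs \<longrightarrow> s' v = s v" for s'
    proof -
      have e: "s' v = (x @ g @ b) ! v" if "v < ?m" for v
        using that \<open>\<forall>v. v \<notin> set ?vs \<longrightarrow> s' v = s v\<close> by (simp add: s_def)
      show "map s' [0..<d] = x" "map s' [d..<d+d] = g" "map s' [d+d..<d+d+n] = b"
        using l by (auto intro!: nth_equalityI simp: e nth_append)
    qed
    have "sat K (x @ g @ b) (tr_form d n \<gamma> \<mu> \<phi>) \<longleftrightarrow> holds K s ?f"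
      unfolding tr_form_def sat_nat_form[OF b4] holds_nMap s_def ..
    also have "\<dots> \<longleftrightarrow> sat K x \<gamma> \<and> holds K s (foldr nEx ?vs (tr_body d n \<gamma> \<mu> \<phi>))"
      unfolding holds_nAnd[OF b0(4) b2(1)] using sx[of s] by (simp add: holds_def)
    also have "holds K s (foldr nEx ?vs (tr_body d n \<gamma> \<mu> \<phi>)) \<longleftrightarrow>
        (\<exists>s'. (\<forall>v. v \<notin> set ?vs \<longrightarrow> s' v = s v) \<and> (\<forall>v \<in> set ?vs. s' v \<in> univ K) \<and> holds K s' (tr_body d n \<gamma> \<mu> \<phi>))"
      using holds_nExs[OF b1, of ?vs] by blast
    also have "\<dots> \<longleftrightarrow> (\<exists>s'. (\<forall>v. v \<notin> set ?vs \<longrightarrow> s' v = s v) \<and> (\<forall>v \<in> set ?vs. s' v \<in> univ K) \<and>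
        sat K (map s' ?vs) \<gamma> \<and> sat K (map s' ?vs @ b) \<phi> \<and> sat K (g @ map s' ?vs @ x) \<mu>)"
    proof (intro iff_exI conj_cong refl)
      fix s' assume s': "\<forall>v. v \<notin> set ?vs \<longrightarrow> s' v = s v"
      have n2: "nwf L (nAnd (\<phi>, ?vs @ [d+d..<d+d+n]) (\<mu>, [d..<d+d] @ ?vs @ [0..<d]))" by (intro nwf_ops b0)
      show "holds K s' (tr_body d n \<gamma> \<mu> \<phi>) \<longleftrightarrow>
        sat K (map s' ?vs) \<gamma> \<and> sat K (map s' ?vs @ b) \<phi> \<and> sat K (g @ map s' ?vs @ x) \<mu>"
        unfolding tr_body_def holds_nAnd[OF b0(1) n2] holds_nAnd[OF b0(2,3)]
        by (simp only: holds_def fst_conv snd_conv map_append sx[OF s'] sg[OF s'] sb[OF s'])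
    qed
    also have "\<dots> \<longleftrightarrow> (\<exists>h \<in> tuples (univ K) d. sat K h \<gamma> \<and> sat K (h @ b) \<phi> \<and> sat K (g @ h @ x) \<mu>)" (is "?l = ?r")
    proof
      assume ?l
      then obtain s' where s': "\<forall>v \<in> set ?vs. s' v \<in> univ K"
        "sat K (map s' ?vs) \<gamma> \<and> sat K (map s' ?vs @ b) \<phi> \<and> sat K (g @ map s' ?vs @ x) \<mu>" by blast
      have "map s' ?vs \<in> tuples (univ K) d" using s'(1) by (auto simp: tuples_def)
      then show ?r using s'(2) by blast
    next
      assume ?r
      then obtain h where h: "h \<in> tuples (univ K) d" "sat K h \<gamma> \<and> sat K (h @ b) \<phi> \<and> sat K (g @ h @ x) \<mu>" by blast
      define s' where "s' = (\<lambda>v. if v \<in> set ?vs then h ! (v - ?m) else s v)"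
      have lh: "length h = d" "set h \<subseteq> univ K" using h(1) by (auto simp: tuples_def)
      have "map s' ?vs = h" using lh by (intro nth_equalityI) (auto simp: s'_def)
      moreover have "\<forall>v \<in> set ?vs. s' v \<in> univ K"
      proof
        fix v assume v: "v \<in> set ?vs"
        then have "v - ?m < length h" using lh by auto
        then show "s' v \<in> univ K" using lh(2) v by (simp only: s'_def if_True) (meson nth_mem subsetD)
      qed
      moreover have "\<forall>v. v \<notin> set ?vs \<longrightarrow> s' v = s v" by (simp add: s'_def)
      ultimately show ?l using h(2) by (intro exI[of _ s']) (simp only:)
    qed
    finally show ?thesis .
  qed
qed

lemma carrier_def_group: "carrier (def_group K d \<gamma> \<mu>) = dset K d \<gamma> []"
  by (simp add: def_group_def Let_def)

lemma mult_def_group: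
  assumes "definable_group L K d \<gamma> \<mu>" "a \<in> carrier (def_group K d \<gamma> \<mu>)" "c \<in> carrier (def_group K d \<gamma> \<mu>)"
  shows "x \<in> carrier (def_group K d \<gamma> \<mu>) \<and> sat K (a @ c @ x) \<mu> \<longleftrightarrow> x = a \<otimes>\<^bsub>def_group K d \<gamma> \<mu>\<^esub> c"
proof -
  have ex: "\<exists>!c'. c' \<in> dset K d \<gamma> [] \<and> sat K (a @ c @ c') \<mu>"
    using assms unfolding definable_group_def carrier_def_group by blast
  have "a \<otimes>\<^bsub>def_group K d \<gamma> \<mu>\<^esub> c = (THE c'. c' \<in> dset K d \<gamma> [] \<and> sat K (a @ c @ c') \<mu>)"
    by (simp add: def_group_def Let_def)
  then show ?thesis using theI'[OF ex] ex unfolding carrier_def_group by metis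
qed

lemma dset_tr_form:
  assumes G: "definable_group L K d \<gamma> \<mu>" and \<phi>: "form L (d + n) \<phi>"
    and g: "g \<in> carrier (def_group K d \<gamma> \<mu>)" and b: "b \<in> tuples (univ K) n"
  shows "dset K d (tr_form d n \<gamma> \<mu> \<phi>) (g @ b) =
    g <#\<^bsub>def_group K d \<gamma> \<mu>\<^esub> (dset K d \<phi> b \<inter> carrier (def_group K d \<gamma> \<mu>))"
proof -
  have f: "form L d \<gamma>" "form L (d + d + d) \<mu>" using G by (auto simp: definable_group_def)
  have gt: "g \<in> tuples (univ K) d" using g by (auto simp: carrier_def_group dset_def)
  have c: "h \<in> carrier (def_group K d \<gamma> \<mu>) \<longleftrightarrow> h \<in> tuples (univ K) d \<and> sat K h \<gamma>" for h
    by (auto simp: carrier_def_group dset_def)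
  show ?thesis
  proof (intro equalityI subsetI)
    fix x assume "x \<in> dset K d (tr_form d n \<gamma> \<mu> \<phi>) (g @ b)"
    then have x: "x \<in> tuples (univ K) d" "sat K (x @ g @ b) (tr_form d n \<gamma> \<mu> \<phi>)" by (auto simp: dset_def)
    then obtain h where h: "sat K x \<gamma>" "h \<in> tuples (univ K) d" "sat K h \<gamma>" "sat K (h @ b) \<phi>" "sat K (g @ h @ x) \<mu>"
      using sat_tr_form[OF f \<phi> x(1) gt b] by blast
    have "x = g \<otimes>\<^bsub>def_group K d \<gamma> \<mu>\<^esub> h" using mult_def_group[OF G g, of h x] x(1) h c by blast
    then show "x \<in> g <#\<^bsub>def_group K d \<gamma> \<mu>\<^esub> (dset K d \<phi> b \<inter> carrier (def_group K d \<gamma> \<mu>))"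
      using h c by (auto simp: l_coset_def dset_def)
  next
    fix x assume "x \<in> g <#\<^bsub>def_group K d \<gamma> \<mu>\<^esub> (dset K d \<phi> b \<inter> carrier (def_group K d \<gamma> \<mu>))"
    then obtain h where h: "h \<in> dset K d \<phi> b" "h \<in> carrier (def_group K d \<gamma> \<mu>)" "x = g \<otimes>\<^bsub>def_group K d \<gamma> \<mu>\<^esub> h"
      by (auto simp: l_coset_def)
    then have x: "x \<in> carrier (def_group K d \<gamma> \<mu>)" "sat K (g @ h @ x) \<mu>" using mult_def_group[OF G g, of h x] by blast+
    have "sat K (x @ g @ b) (tr_form d n \<gamma> \<mu> \<phi>)"
      using sat_tr_form[OF f \<phi> _ gt b, of x] x h(1,2) c[of x] c[of h] by (auto simp: dset_def)
    then show "x \<in> dset K d (tr_form d n \<gamma> \<mu> \<phi>) (g @ b)" using x(1) c by (auto simp: dset_def)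
  qed
qed

section \<open>\<open>f\<close>-generic sets do not \<open>G\<close>-divide\<close>

text \<open>Assignments are total, so lists are continued by a fixed element.\<close>

definition pad :: "'m \<Rightarrow> 'm list \<Rightarrow> nat \<Rightarrow> 'm" where
  "pad z c = (\<lambda>i. if i < length c then c ! i else z)"

lemma map_pad: "length c = l \<Longrightarrow> map (pad z c) [0..<l] = c"
  by (auto simp: pad_def intro: nth_equalityI)

context big_model
begin

lemma pad_env: "set c \<subseteq> U \<Longrightarrow> z \<in> U \<Longrightarrow> pad z c \<in> env"
  by (auto simp: pad_def mem_env)

lemma map_tuples: "s \<in> env \<Longrightarrow> map (\<lambda>i. s (\<rho> i)) [0..<l] \<in> tuples U l"
  by (auto simp: tuples_def mem_env)

lemma dfn_sat:
  assumes "form L (length vs + length c) \<phi>" "set c \<subseteq> A"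
  shows "dfn A (\<lambda>s. sat N (map s vs @ c) \<phi>)"
proof -
  have "dfn A (\<lambda>s. sat N (map (case_sum s id) (map Inl vs @ map Inr c)) \<phi>)"
    using assms by (intro dfn_form) auto
  moreover have "map (case_sum s id) (map Inl vs @ map Inr c) = map s vs @ c" for s :: "'a \<Rightarrow> 'm"
    by (simp add: comp_def)
  ultimately show ?thesis by (simp only:)
qed

lemma eqv_same_type:
  assumes "eqv A t t'" "A \<subseteq> U" "set c \<subseteq> A"
  shows "same_type L N A (map t vs @ c) (map t' vs @ c)"
  unfolding same_type_def
proof (intro conjI allI ballI impI)
  fix n \<theta> e assume e: "e \<in> tuples A n" and \<theta>: "form L (length (map t vs @ c) + n) \<theta>"
  have "dfn A (\<lambda>s. sat N (map s vs @ (c @ e)) \<theta>)"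
    by (rule dfn_sat) (use e \<theta> assms(3) in \<open>auto simp: tuples_def add.assoc\<close>)
  then show "sat N ((map t vs @ c) @ e) \<theta> \<longleftrightarrow> sat N ((map t' vs @ c) @ e) \<theta>"
    using assms(1)[unfolded eqv_def, rule_format, of "\<lambda>s. sat N (map s vs @ (c @ e)) \<theta>"] by simp
qed simp

text \<open>The padding \<open>z\<close> is taken from \<open>A\<close>, so a formula about padded
  lists is a formula about the lists themselves with parameters from \<open>A\<close>.\<close>

lemma same_type_eqv:
  assumes st: "same_type L N A c c'" and z: "z \<in> A" and A: "A \<subseteq> U" and c: "set c \<subseteq> U" "set c' \<subseteq> U"
  shows "eqv A (pad z c) (pad z c')"
proof (rule eqvI)
  fix P assume P: "dfn A P" "P (pad z c)"
  from P(1) obtain f where f: "nwf L f" "set (snd f) \<subseteq> range Inl \<union> Inr ` A"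
      "\<forall>s \<in> env. P s \<longleftrightarrow> holds N (case_sum s id) f" by (rule dfnE)
  define vs where "vs = snd f"
  define l where "l = length c"
  have l': "length c' = l" using st by (simp add: same_type_def l_def)
  define e where "e = map (case_sum (\<lambda>_. z) id) vs"
  define \<rho> where "\<rho> = (\<lambda>k. case vs ! k of Inl i \<Rightarrow> if i < l then i else l + k | Inr m \<Rightarrow> l + k)"
  have vsA: "v \<in> range Inl \<union> Inr ` A" if "v \<in> set vs" for v using f(2) that by (auto simp: vs_def)
  have "case_sum (\<lambda>_. z) id v \<in> A" if "v \<in> set vs" for v using vsA[OF that] z by auto
  then have e: "e \<in> tuples A (length vs)" by (auto simp: e_def tuples_def)
  have form: "form L (l + length vs) (ren \<rho> (fst f))"
  proof (rule form_ren)
    show "form L (length vs) (fst f)" using f(1) by (simp add: nwf_def vs_def)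
  qed (auto simp: \<rho>_def split: sum.split)
  have sat: "sat N (c @ e) (ren \<rho> (fst f)) = P (pad z c)" if "length c = l" "set c \<subseteq> U" for c
  proof -
    have "sat N (c @ e) (ren \<rho> (fst f)) = sat N (map (case_sum (pad z c) id) vs) (fst f)"
    proof (rule sat_ren)
      show "form L (length vs) (fst f)" using f(1) by (simp add: nwf_def vs_def)
      fix k assume k: "k < length vs"
      show "map (case_sum (pad z c) id) vs ! k = (c @ e) ! \<rho> k"
        using k that(1) by (cases "vs ! k") (auto simp: \<rho>_def e_def nth_append pad_def)
    qed
    moreover have "pad z c \<in> env" using that z A by (intro pad_env) auto
    ultimately show ?thesis using f(3) by (simp add: holds_def vs_def)
  qed
  have "sat N (c @ e) (ren \<rho> (fst f)) \<longleftrightarrow> sat N (c' @ e) (ren \<rho> (fst f))"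
    using st e form unfolding same_type_def l_def by blast
  then show "P (pad z c')" using sat[of c] sat[of c'] c l' P(2) by (simp add: l_def)
qed

end

section \<open>Translates of a definable subset of the group\<close>

locale def_subset = ntp2_model L \<kappa> N for L :: "('f, 'r) language" and \<kappa> :: "'k rel"
    and N :: "('f, 'r, 'm) fo_struct" +
  fixes d :: nat and \<gamma> \<mu> :: "('f, 'r) fo_form" and n :: nat and \<phi> :: "('f, 'r) fo_form" and b :: "'m list"
  assumes grp: "definable_group L N d \<gamma> \<mu>" and form_\<phi>: "form L (d + n) \<phi>" and b: "b \<in> tuples U n"
    and sub: "dset N d \<phi> b \<subseteq> carrier (def_group N d \<gamma> \<mu>)"
begin

abbreviation G where "G \<equiv> def_group N d \<gamma> \<mu>"
abbreviation X where "X \<equiv> dset N d \<phi> b"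
abbreviation tr where "tr \<equiv> tr_form d n \<gamma> \<mu> \<phi>"

lemma group: "Group.group G" using grp by (simp add: definable_group_def)

lemma forms: "form L d \<gamma>" "form L (d + d + d) \<mu>" using grp by (simp_all add: definable_group_def)

lemmas form_tr = form_tr_form[OF forms form_\<phi>]

lemma len_b: "length b = n" "set b \<subseteq> U" using b by (auto simp: tuples_def)

lemma carrier: "a \<in> carrier G \<longleftrightarrow> a \<in> tuples U d \<and> sat N a \<gamma>"
  by (auto simp: carrier_def_group dset_def)

lemma dset_tr: "g \<in> carrier G \<Longrightarrow> dset N d tr (g @ b) = g <#\<^bsub>G\<^esub> X"
  using dset_tr_form[OF grp form_\<phi> _ b] sub by (simp add: Int_absorb2)

text \<open>The point occupies the variables \<open>Inl\<close>, and \<rho> selects the coordinates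
  of the group element among the others. Leaving \<rho> open lets the parameter tuple carry more
  than a group element, as it must when the parameters of a forking cover are added.\<close>

definition trp :: "(nat \<Rightarrow> 'v) \<Rightarrow> (nat + 'v \<Rightarrow> 'm) \<Rightarrow> bool" where
  "trp \<rho> z \<longleftrightarrow> sat N (map (\<lambda>i. z (Inl i)) [0..<d] @ map (\<lambda>i. z (Inr (\<rho> i))) [0..<d] @ b) tr"

lemma dfn_trp: assumes "set b \<subseteq> A" shows "dfn A (trp \<rho>)"
proof -
  have "dfn A (\<lambda>z. sat N (map z (map Inl [0..<d] @ map (\<lambda>i. Inr (\<rho> i)) [0..<d]) @ b) tr)"
    by (rule dfn_sat) (use form_tr assms len_b in \<open>simp_all add: add.assoc\<close>)
  then show ?thesis by (rule dfn_cong) (simp add: trp_def comp_def)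
qed

lemma translates_meet_iff:
  assumes g: "\<And>i. i \<in> I \<Longrightarrow> g i \<in> env" "\<And>i. i \<in> I \<Longrightarrow> map (\<lambda>c. g i (\<rho> c)) [0..<d] \<in> carrier G"
  shows "(\<exists>x \<in> env. \<forall>i \<in> I. trp \<rho> (case_sum x (g i))) \<longleftrightarrow>
    (\<Inter>i \<in> I. map (\<lambda>c. g i (\<rho> c)) [0..<d] <#\<^bsub>G\<^esub> X) \<noteq> {}"
proof -
  have eq: "trp \<rho> (case_sum x (g i)) \<longleftrightarrow> map x [0..<d] \<in> map (\<lambda>c. g i (\<rho> c)) [0..<d] <#\<^bsub>G\<^esub> X"
    if "x \<in> env" "i \<in> I" for x i
    using map_tuples[OF that(1), of "\<lambda>i. i"] unfolding dset_tr[OF g(2)[OF that(2)], symmetric]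
    by (simp add: trp_def dset_def)
  show ?thesis
  proof
    assume "\<exists>x \<in> env. \<forall>i \<in> I. trp \<rho> (case_sum x (g i))"
    then show "(\<Inter>i \<in> I. map (\<lambda>c. g i (\<rho> c)) [0..<d] <#\<^bsub>G\<^esub> X) \<noteq> {}" using eq by blast
  next
    assume ne: "(\<Inter>i \<in> I. map (\<lambda>c. g i (\<rho> c)) [0..<d] <#\<^bsub>G\<^esub> X) \<noteq> {}"
    show "\<exists>x \<in> env. \<forall>i \<in> I. trp \<rho> (case_sum x (g i))"
    proof (cases "I = {}")
      case True
      obtain x where "x \<in> (env :: (nat \<Rightarrow> 'm) set)" using env_nonempty by blast
      then show ?thesis using True by blast
    next
      case False
      obtain a where a: "a \<in> (\<Inter>i \<in> I. map (\<lambda>c. g i (\<rho> c)) [0..<d] <#\<^bsub>G\<^esub> X)" using ne by blast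
      obtain i where i: "i \<in> I" using False by blast
      have "a \<in> dset N d tr (map (\<lambda>c. g i (\<rho> c)) [0..<d] @ b)" unfolding dset_tr[OF g(2)[OF i]] using a i by blast
      then have at: "length a = d" "set a \<subseteq> U" by (auto simp: dset_def tuples_def)
      obtain z where z: "z \<in> U" using struct by (auto simp: is_struct_def)
      have p: "pad z a \<in> env" using at(2) z by (rule pad_env)
      have "\<forall>i \<in> I. trp \<rho> (case_sum (pad z a) (g i))"
        using eq[OF p] a by (simp add: map_pad[OF at(1)])
      then show ?thesis using p by blast
    qed
  qed
qed

lemma kinc_trp_iff:
  assumes "\<And>i. g i \<in> env" "\<And>i. map (\<lambda>c. g i (\<rho> c)) [0..<d] \<in> carrier G"
  shows "kinc (trp \<rho>) k g \<longleftrightarrow> k_inconsistent k (\<lambda>i. map (\<lambda>c. g i (\<rho> c)) [0..<d] <#\<^bsub>G\<^esub> X)"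
proof -
  have "(\<exists>x \<in> env. \<forall>i \<in> I. trp \<rho> (case_sum x (g i))) \<longleftrightarrow>
    (\<Inter>i \<in> I. map (\<lambda>c. g i (\<rho> c)) [0..<d] <#\<^bsub>G\<^esub> X) \<noteq> {}" for I
    by (rule translates_meet_iff) (rule assms)+
  then show ?thesis unfolding kinc_def k_inconsistent_def by (simp add: imp_conjL)
qed

lemma dfn_carrier: "dfn A (\<lambda>s. map (\<lambda>i. s (\<rho> i)) [0..<d] \<in> carrier G)"
proof -
  have "dfn A (\<lambda>s. sat N (map s (map \<rho> [0..<d]) @ []) \<gamma>)" by (rule dfn_sat) (use forms in auto)
  then show ?thesis
  proof (rule dfn_cong)
    fix s :: "'a \<Rightarrow> 'm" assume "s \<in> env"
    from map_tuples[OF this, of \<rho> d]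
    show "sat N (map s (map \<rho> [0..<d]) @ []) \<gamma> = (map (\<lambda>i. s (\<rho> i)) [0..<d] \<in> carrier G)"
      by (simp add: carrier comp_def)
  qed
qed

lemma G_dividesI:
  assumes "\<And>i. g i \<in> carrier G" "k_inconsistent k (\<lambda>i. g i <#\<^bsub>G\<^esub> X)"
  shows "G_divides G X"
  unfolding G_divides_def using assms by (intro exI[of _ g] exI[of _ k] conjI allI)

text \<open>Otherwise there are, for each \<open>p\<close>, \<open>p\<close> translates no
  \<open>k\<close> of which meet, and compactness combines these configurations into a
  \<open>k\<close>-inconsistent sequence.\<close>

lemma not_G_divides_bound:
  assumes "\<not> G_divides G X"
  shows "\<exists>p. \<forall>g :: nat \<Rightarrow> 'm list. (\<forall>i < p. g i \<in> carrier G) \<longrightarrow>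
    (\<exists>I \<subseteq> {..<p}. card I = k \<and> (\<Inter>i \<in> I. g i <#\<^bsub>G\<^esub> X) \<noteq> {})"
proof (rule ccontr)
  assume "\<not> ?thesis"
  then have "\<forall>p. \<exists>g :: nat \<Rightarrow> 'm list. (\<forall>i < p. g i \<in> carrier G) \<and>
      \<not> (\<exists>I \<subseteq> {..<p}. card I = k \<and> (\<Inter>i \<in> I. g i <#\<^bsub>G\<^esub> X) \<noteq> {})" by simp
  from choice[OF this] obtain g :: "nat \<Rightarrow> nat \<Rightarrow> 'm list" where g: "\<forall>p. (\<forall>i < p. g p i \<in> carrier G) \<and>
      \<not> (\<exists>I \<subseteq> {..<p}. card I = k \<and> (\<Inter>i \<in> I. g p i <#\<^bsub>G\<^esub> X) \<noteq> {})" ..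
  have bU: "small (set b)" using len_b by (intro small_countable countable_finite) auto
  define Gc where "Gc = (\<lambda>(i :: nat) (s :: nat \<times> nat \<Rightarrow> 'm). map (\<lambda>c. s (i, c)) [0..<d] \<in> carrier G)"
  define Kc where "Kc = (\<lambda>I (s :: nat \<times> nat \<Rightarrow> 'm). \<not> (\<exists>x \<in> env. \<forall>i \<in> I. trp (\<lambda>c. c) (case_sum x (\<lambda>c. s (i, c)))))"
  let ?I = "{I :: nat set. finite I \<and> card I = k}"
  have "\<exists>s \<in> env. \<forall>P \<in> range Gc \<union> Kc ` ?I. P s"
  proof (rule compactness[OF bU])
    fix P assume "P \<in> range Gc \<union> Kc ` ?I"
    then consider i where "P = Gc i" | I where "P = Kc I" "finite I" by blast
    then show "dfn (set b) P"
    proof cases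
      case 1
      show ?thesis unfolding 1 Gc_def by (rule dfn_carrier)
    next
      case 2
      show ?thesis unfolding 2(1) Kc_def
        by (intro dfn_not dfn_simul dfn_trp small_sub[OF bU] 2(2) order_refl)
    qed
  next
    fix \<Delta> assume \<Delta>: "finite \<Delta>" "\<Delta> \<subseteq> range Gc \<union> Kc ` ?I"
    have "finite (\<Delta> \<inter> range Gc)" "\<Delta> \<inter> range Gc \<subseteq> range Gc" using \<Delta>(1) by auto
    then obtain A where A: "finite A" "\<Delta> \<inter> range Gc = Gc ` A" by (meson finite_subset_image)
    have "finite (\<Delta> \<inter> Kc ` ?I)" "\<Delta> \<inter> Kc ` ?I \<subseteq> Kc ` ?I" using \<Delta>(1) by auto
    then obtain B where B: "B \<subseteq> ?I" "finite B" "\<Delta> \<inter> Kc ` ?I = Kc ` B" by (meson finite_subset_image)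
    have "finite (A \<union> \<Union>B)" using A(1) B by auto
    then obtain p where p: "\<And>i. i \<in> A \<union> \<Union>B \<Longrightarrow> i < p" by (meson finite_nat_set_iff_bounded)
    obtain z where z: "z \<in> U" using struct by (auto simp: is_struct_def)
    define s where "s = (\<lambda>(i, c). if i < p then pad z (g p i) c else z)"
    have gp: "length (g p i) = d" "set (g p i) \<subseteq> U" "g p i \<in> carrier G" if "i < p" for i
      using g that by (auto simp: carrier tuples_def)
    have "pad z (g p i) c \<in> U" if "i < p" for i c using pad_env[OF gp(2)[OF that] z] by (simp add: mem_env)
    then have s: "s \<in> env" using z by (auto simp: s_def mem_env)
    have sg: "map (\<lambda>c. s (i, c)) [0..<d] = g p i" if "i < p" for i
      using map_pad[OF gp(1)[OF that]] that by (simp add: s_def)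
    have "Gc i s" if "i \<in> A" for i using p[of i] that sg gp(3) by (simp add: Gc_def)
    moreover have "Kc I s" if I: "I \<in> B" for I
    proof -
      have Ip: "i < p" if "i \<in> I" for i using p I that by blast
      have "(\<exists>x \<in> env. \<forall>i \<in> I. trp (\<lambda>c. c) (case_sum x (\<lambda>c. s (i, c)))) \<longleftrightarrow>
          (\<Inter>i \<in> I. map (\<lambda>c. s (i, c)) [0..<d] <#\<^bsub>G\<^esub> X) \<noteq> {}"
        by (rule translates_meet_iff) (use s sg gp Ip in \<open>auto simp: mem_env\<close>)
      moreover have "(\<Inter>i \<in> I. map (\<lambda>c. s (i, c)) [0..<d] <#\<^bsub>G\<^esub> X) = (\<Inter>i \<in> I. g p i <#\<^bsub>G\<^esub> X)"
        using sg Ip by simp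
      moreover have "(\<Inter>i \<in> I. g p i <#\<^bsub>G\<^esub> X) = {}"
      proof -
        have "I \<subseteq> {..<p}" "card I = k" using Ip B(1) I by auto
        then show ?thesis using g by blast
      qed
      ultimately show ?thesis unfolding Kc_def by simp
    qed
    moreover have "P \<in> Gc ` A \<or> P \<in> Kc ` B" if "P \<in> \<Delta>" for P
      unfolding A(2)[symmetric] B(3)[symmetric] using that \<Delta>(2) by blast
    ultimately have "P s" if "P \<in> \<Delta>" for P using that by (metis imageE)
    then show "\<exists>s \<in> env. \<forall>P \<in> \<Delta>. P s" using s by (intro bexI[of _ s] ballI)
  qed
  then obtain s where s: "s \<in> env" "\<forall>P \<in> range Gc \<union> Kc ` ?I. P s" by blast
  have c: "map (\<lambda>c. s (i, c)) [0..<d] \<in> carrier G" for i using s(2) by (auto simp: Gc_def)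
  have "kinc (trp (\<lambda>c. c)) k (\<lambda>i c. s (i, c))" using s(2) by (auto simp: kinc_def Kc_def)
  moreover have "(\<lambda>c. s (i, c)) \<in> env" for i using s(1) by (simp add: mem_env)
  ultimately have "k_inconsistent k (\<lambda>i. map (\<lambda>c. s (i, c)) [0..<d] <#\<^bsub>G\<^esub> X)"
    using kinc_trp_iff[of "\<lambda>i c. s (i, c)" "\<lambda>c. c" k] c by simp
  from G_dividesI[OF c this] assms show False by simp
qed

lemma f_generic_imp_not_G_divides:
  assumes "f_generic L N \<kappa> d G X" shows "\<not> G_divides G X"
proof
  assume "G_divides G X"
  then obtain g :: "nat \<Rightarrow> 'm list" and k where g: "\<And>i. g i \<in> carrier G" "k_inconsistent k (\<lambda>i. g i <#\<^bsub>G\<^esub> X)"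
    unfolding G_divides_def by blast
  obtain M :: "('f, 'r, 'm) fo_struct" where M: "elem_substruct L M N" "|univ M| <o \<kappa>"
    "\<forall>g \<in> carrier G. \<not> forks_over L N (univ M) d (g <#\<^bsub>G\<^esub> X)"
    using assms unfolding f_generic_def by blast
  have MU: "univ M \<subseteq> U" using M(1) by (simp add: elem_substruct_def)
  \<comment> \<open>Types are compared over \<open>b\<close> as well: the dividing formula has the
    parameters \<open>q i @ b\<close>, and these full tuples must have the same type over the
    submodel.\<close>
  let ?A = "univ M \<union> set b"
  have "small (univ M)" using M(2) MU by (simp add: small_def)
  then have A: "small ?A" using len_b by (intro small_Un small_countable[of "set b"] countable_finite) auto
  obtain z where z: "z \<in> U" using struct by (auto simp: is_struct_def)
  define h where "h = (\<lambda>i. pad z (g i))"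
  have gt: "length (g i) = d" "set (g i) \<subseteq> U" for i using g(1) by (auto simp: carrier tuples_def)
  have he: "h i \<in> env" for i using gt(2) z by (auto simp: h_def intro: pad_env)
  have hg: "map (\<lambda>c. h i c) [0..<d] = g i" for i unfolding h_def by (rule map_pad[OF gt(1)])
  have hk: "kinc (trp (\<lambda>c. c)) k h" using kinc_trp_iff[of h "\<lambda>c. c" k] he g by (simp add: hg)
  define Gc where "Gc = (\<lambda>(i :: nat) (s :: nat \<times> nat \<Rightarrow> 'm). map (\<lambda>c. s (i, c)) [0..<d] \<in> carrier G)"
  define Kc where "Kc = (\<lambda>I (s :: nat \<times> nat \<Rightarrow> 'm). \<not> (\<exists>x \<in> env. \<forall>i \<in> I. trp (\<lambda>c. c) (case_sum x (\<lambda>c. s (i, c)))))"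
  define Ec where "Ec = (\<lambda>(P, i :: nat, j :: nat) (s :: nat \<times> nat \<Rightarrow> 'm). P (\<lambda>c. s (i, c)) \<longrightarrow> P (\<lambda>c. s (j, c)))"
  let ?I = "{I :: nat set. finite I \<and> card I = k}"
  let ?D = "{P :: (nat \<Rightarrow> 'm) \<Rightarrow> bool. dfn ?A P}"
  have "\<exists>s \<in> env. \<forall>P \<in> range Gc \<union> Kc ` ?I \<union> Ec ` (?D \<times> UNIV). P s"
  proof (rule compactness[OF A])
    fix P assume "P \<in> range Gc \<union> Kc ` ?I \<union> Ec ` (?D \<times> UNIV)"
    then consider i where "P = Gc i" | I where "P = Kc I" "finite I"
      | p where "P = Ec p" "p \<in> ?D \<times> UNIV" by blast
    then show "dfn ?A P"
    proof cases
      case 1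
      show ?thesis unfolding 1 Gc_def by (rule dfn_carrier)
    next
      case 2
      show ?thesis unfolding 2(1) Kc_def
        by (intro dfn_not dfn_simul dfn_trp small_sub[OF A] 2(2)) simp
    next
      case 3
      obtain Q i j where p: "p = (Q, i, j)" by (cases p)
      have Q: "dfn ?A Q" using 3(2) p by simp
      show ?thesis unfolding 3(1) p Ec_def prod.case
        by (intro dfn_imp dfn_reindex[OF Q small_sub[OF A]])
    qed
  next
    fix \<Delta> assume \<Delta>: "finite \<Delta>" "\<Delta> \<subseteq> range Gc \<union> Kc ` ?I \<union> Ec ` (?D \<times> UNIV)"
    have "finite (\<Delta> \<inter> Ec ` (?D \<times> UNIV))" "\<Delta> \<inter> Ec ` (?D \<times> UNIV) \<subseteq> Ec ` (?D \<times> UNIV)" using \<Delta>(1) by auto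
    then obtain B where B: "B \<subseteq> ?D \<times> UNIV" "finite B" "\<Delta> \<inter> Ec ` (?D \<times> UNIV) = Ec ` B"
      by (meson finite_subset_image)
    \<comment> \<open>Only finitely many relations have to be made constant along the sequence, so
      the pigeonhole principle on their truth values gives an infinite subsequence; it is still
      \<open>k\<close>-inconsistent.\<close>
    define col where "col = (\<lambda>i. {P \<in> fst ` B. P (h i)})"
    have "finite (range col)" using B(2)
      by (intro finite_subset[of "range col" "Pow (fst ` B)"]) (auto simp: col_def)
    from pigeonhole_infinite[OF infinite_UNIV_nat this]
    obtain i0 where i0: "infinite {i. col i = col i0}" by auto
    define e where "e = enumerate {i. col i = col i0}"
    have e: "inj e" "col (e i) = col i0" for i
      using i0 strict_mono_enumerate[OF i0] enumerate_in_set[OF i0]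
      by (auto simp: e_def strict_mono_imp_inj_on)
    define s where "s = (\<lambda>(i, c). h (e i) c)"
    have se: "(\<lambda>c. s (i, c)) = h (e i)" for i by (simp add: s_def)
    have s: "s \<in> env" using he by (auto simp: s_def mem_env)
    have gc: "Gc i s" for i unfolding Gc_def se hg by (rule g(1))
    have kc: "Kc I s" if "I \<in> ?I" for I
      using kinc_inj[OF hk e(1)] that unfolding Kc_def se kinc_def by simp
    have ec: "Ec p s" if "p \<in> B" for p
    proof -
      obtain P i j where p: "p = (P, i, j)" by (cases p)
      have P: "P \<in> fst ` B" using that p by force
      have "P \<in> col (e i) \<longleftrightarrow> P \<in> col (e j)" using e(2) by simp
      then show ?thesis unfolding p Ec_def prod.case se using P by (simp add: col_def)
    qed
    have "P s" if P: "P \<in> \<Delta>" for P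
    proof -
      have "P \<in> range Gc \<or> P \<in> Kc ` ?I \<or> P \<in> Ec ` B"
        unfolding B(3)[symmetric] using P \<Delta>(2) by blast
      then show ?thesis by (elim disjE imageE) (simp_all only: gc kc ec)
    qed
    then show "\<exists>s \<in> env. \<forall>P \<in> \<Delta>. P s" using s by (intro bexI[of _ s] ballI)
  qed
  then obtain s where s: "s \<in> env" and sP: "\<forall>P \<in> range Gc \<union> Kc ` ?I \<union> Ec ` (?D \<times> UNIV). P s" by blast
  define t where "t = (\<lambda>i c. s (i, c))"
  define q where "q = (\<lambda>i. map (t i) [0..<d])"
  have te: "t i \<in> env" for i using s by (simp add: t_def mem_env)
  have qG: "q i \<in> carrier G" for i using sP by (auto simp: q_def t_def Gc_def)
  have "kinc (trp (\<lambda>c. c)) k t" using sP by (auto simp: kinc_def Kc_def t_def)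
  then have qk: "k_inconsistent k (\<lambda>i. q i <#\<^bsub>G\<^esub> X)"
    using kinc_trp_iff[of t "\<lambda>c. c" k] te qG by (simp add: q_def)
  have teq: "eqv ?A (t i) (t 0)" for i
  proof (rule eqvI)
    fix P assume P: "dfn ?A P" "P (t i)"
    then have "Ec (P, i, 0) \<in> range Gc \<union> Kc ` ?I \<union> Ec ` (?D \<times> UNIV)" by blast
    then have "Ec (P, i, 0) s" using sP by blast
    then show "P (t 0)" using P(2) by (simp add: Ec_def t_def)
  qed
  have "forks_over L N (univ M) d (q 0 <#\<^bsub>G\<^esub> X)"
    unfolding forks_over_def
  proof (intro exI[of _ "{(tr, q 0 @ b)}"] conjI)
    have "divides_over L N (univ M) d tr (q 0 @ b)"
      unfolding divides_over_def
    proof (intro exI[of _ k] exI[of _ "\<lambda>i. q i @ b"] conjI allI)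
      show "k_inconsistent k (\<lambda>i. dset N d tr (q i @ b))" using qk dset_tr[OF qG] by simp
      show "q i @ b \<in> tuples U (length (q 0 @ b))" for i
        using qG[of i] len_b by (auto simp: carrier tuples_def q_def)
      show "same_type L N (univ M) (q i @ b) (q 0 @ b)" for i
      proof -
        have "same_type L N ?A (q i @ b) (q 0 @ b)"
          unfolding q_def by (rule eqv_same_type[OF teq small_sub[OF A]]) simp
        then show ?thesis unfolding same_type_def tuples_def by blast
      qed
    qed
    moreover have "set (q 0 @ b) \<subseteq> U" using qG[of 0] len_b by (auto simp: carrier tuples_def)
    moreover have "form L (d + length (q 0 @ b)) tr" using form_tr len_b by (simp add: q_def)
    ultimately show "\<forall>(\<psi>, c) \<in> {(tr, q 0 @ b)}. set c \<subseteq> U \<and> form L (d + length c) \<psi> \<and> divides_over L N (univ M) d \<psi> c"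
      by blast
    show "q 0 <#\<^bsub>G\<^esub> X \<subseteq> (\<Union>(\<psi>, c) \<in> {(tr, q 0 @ b)}. dset N d \<psi> c)" using dset_tr[OF qG] by simp
  qed simp
  then show False using M(3) qG by blast
qed

section \<open>Sets that do not \<open>G\<close>-divide are \<open>f\<close>-generic\<close>

lemma not_G_divides_imp_f_generic:
  assumes nG: "\<not> G_divides G X" shows "f_generic L N \<kappa> d G X"
proof -
  obtain M :: "('f, 'r, 'm) fo_struct" where M: "elem_substruct L M N" "set b \<subseteq> univ M"
      "|univ M| \<le>o |{\<phi> :: ('f, 'r) fo_form. \<exists>n. form L n \<phi>}|"
    using ex_small_elem_substruct[OF struct len_b(2)] by blast
  have Ms: "|univ M| <o \<kappa>" using M(3) forms_small by (rule ordLeq_ordLess_trans)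
  interpret elem_submodel L \<kappa> N M
    by (intro elem_submodel.intro elem_submodel_axioms.intro ntp2_model_axioms M(1) Ms)
  have "\<not> forks_over L N (univ M) d (g <#\<^bsub>G\<^esub> X)" if g: "g \<in> carrier G" for g
  proof
    assume "forks_over L N (univ M) d (g <#\<^bsub>G\<^esub> X)"
    then obtain F where F0: "finite F"
      "\<forall>(\<psi>, c) \<in> F. set c \<subseteq> U \<and> form L (d + length c) \<psi> \<and> divides_over L N (univ M) d \<psi> c"
      "g <#\<^bsub>G\<^esub> X \<subseteq> (\<Union>(\<psi>, c) \<in> F. dset N d \<psi> c)"
      unfolding forks_over_def by (elim exE conjE)
    then have F: "finite F"
      "\<And>\<psi> c. (\<psi>, c) \<in> F \<Longrightarrow> set c \<subseteq> U \<and> form L (d + length c) \<psi> \<and> divides_over L N (univ M) d \<psi> c"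
      "g <#\<^bsub>G\<^esub> X \<subseteq> (\<Union>(\<psi>, c) \<in> F. dset N d \<psi> c)"
      by (simp_all only: split_paired_all) (drule (1) bspec, simp)
    obtain s e where e: "F = e ` {..<s :: nat}" using ex_enum_finite[OF F(1)] by blast
    define \<psi> where "\<psi> = (\<lambda>j. fst (e j))"
    \<comment> \<open>The default \<open>[]\<close> keeps the entries in the universe for indices
      beyond the cover.\<close>
    define c where "c = (\<lambda>j. if j < s then snd (e j) else [])"
    have ec: "(\<psi> j, c j) \<in> F" if "j < s" for j using that by (simp add: \<psi>_def c_def e)
    have cU: "set (c j) \<subseteq> U" for j using F(2)[OF ec, of j] by (cases "j < s") (auto simp: c_def)
    obtain z where z: "z \<in> M0" using elem by (auto simp: elem_substruct_def is_struct_def)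
    have zU: "z \<in> U" using z M0_U by blast
    have gt: "length g = d" "set g \<subseteq> U" using g by (auto simp: carrier tuples_def)
    \<comment> \<open>One tuple that holds \<open>g\<close> and the parameters of all disjuncts,
      since \<open>forking_implies_dividing\<close> speaks of formulas in a common tuple.\<close>
    define a where "a = case_sum (pad z g) (\<lambda>(j, i). pad z (c j) i)"
    have a: "a \<in> env"
      unfolding a_def using pad_env[OF gt(2) zU] pad_env[OF cU zU] by (auto simp: mem_env split: sum.split)
    define \<Phi> where "\<Phi> = (\<lambda>j (w :: nat + nat + nat \<times> nat \<Rightarrow> 'm).
      sat N (map (\<lambda>i. w (Inl i)) [0..<d] @ map (\<lambda>i. w (Inr (Inr (j, i)))) [0..<length (c j)]) (\<psi> j))"
    have \<Phi>: "dfn M0 (\<Phi> j)" if j: "j < s" for j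
    proof -
      have "dfn M0 (\<lambda>w. sat N (map w (map Inl [0..<d] @ map (\<lambda>i. Inr (Inr (j, i))) [0..<length (c j)]) @ []) (\<psi> j))"
        by (rule dfn_sat) (use F(2)[OF ec[OF j]] in auto)
      then show ?thesis by (rule dfn_cong) (simp add: \<Phi>_def comp_def)
    qed
    have div: "divs M0 (\<Phi> j) a" if j: "j < s" for j
    proof -
      obtain k t where t: "\<And>i. t i \<in> tuples U (length (c j))" "\<And>i. same_type L N M0 (t i) (c j)"
          "k_inconsistent k (\<lambda>i :: nat. dset N d (\<psi> j) (t i))"
        using F(2)[OF ec[OF j]] unfolding divides_over_def by blast
      have tU: "set (t i) \<subseteq> U" "length (t i) = length (c j)" for i using t(1) by (auto simp: tuples_def)
      have pt: "pad z (t i) \<in> env" for i by (rule pad_env[OF tU(1) zU])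
      \<comment> \<open>A copy of \<open>c j\<close> alone is extended to a copy of the whole tuple
        \<open>a\<close>; \<rho> then puts the prescribed copy back into block
        \<open>j\<close>.\<close>
      have "\<exists>a'. a' \<in> env \<and> eqv M0 a' a \<and> (\<forall>l. a' (Inr (j, l)) = pad z (t i) l)" for i
      proof -
        have "eqv M0 (pad z (c j)) (pad z (t i))"
          by (rule eqv_sym, rule same_type_eqv[OF t(2) z M0_U tU(1) cU])
        from eqv_extend[OF small_M0 this pad_env[OF cU zU] pt a]
        obtain u where u: "u \<in> env" "eqv M0 (case_sum (pad z (c j)) a) (case_sum (pad z (t i)) u)" by blast
        define \<rho> :: "nat + nat \<times> nat \<Rightarrow> nat + (nat + nat \<times> nat)"
          where "\<rho> = case_sum (\<lambda>l. Inr (Inl l)) (\<lambda>(j', l). if j' = j then Inl l else Inr (Inr (j', l)))"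
        have "(\<lambda>v. case_sum (pad z (c j)) a (\<rho> v)) = a"
          by (auto simp: \<rho>_def a_def fun_eq_iff split: sum.split)
        then have "eqv M0 (\<lambda>v. case_sum (pad z (t i)) u (\<rho> v)) a"
          using eqv_reindex[OF eqv_sym[OF u(2)] M0_U, of \<rho>] by simp
        moreover have "(\<lambda>v. case_sum (pad z (t i)) u (\<rho> v)) \<in> env"
          using u(1) pt[of i] by (auto simp: mem_env split: sum.split)
        moreover have "\<rho> (Inr (j, l)) = Inl l" for l by (simp add: \<rho>_def)
        ultimately show ?thesis by (intro exI[of _ "\<lambda>v. case_sum (pad z (t i)) u (\<rho> v)"]) simp
      qed
      then have "\<forall>i. \<exists>a'. a' \<in> env \<and> eqv M0 a' a \<and> (\<forall>l. a' (Inr (j, l)) = pad z (t i) l)" ..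
      from choice[OF this] obtain a' where
        a': "\<forall>i. a' i \<in> env \<and> eqv M0 (a' i) a \<and> (\<forall>l. a' i (Inr (j, l)) = pad z (t i) l)" ..
      have "kinc (\<Phi> j) k a'"
        unfolding kinc_def
      proof (intro allI impI notI, elim bexE)
        fix I :: "nat set" and x :: "nat \<Rightarrow> 'm"
        assume I: "finite I" "card I = k" "x \<in> env" "\<forall>i \<in> I. \<Phi> j (case_sum x (a' i))"
        have "map x [0..<d] \<in> dset N d (\<psi> j) (t i)" if "i \<in> I" for i
        proof -
          have "map (\<lambda>l. a' i (Inr (j, l))) [0..<length (c j)] = t i" using a' map_pad[OF tU(2)] by simp
          moreover have "\<Phi> j (case_sum x (a' i))" using I(4) that by blast
          ultimately show ?thesis using map_tuples[OF I(3), of "\<lambda>i. i"] by (simp add: dset_def \<Phi>_def)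
        qed
        then have "(\<Inter>i \<in> I. dset N d (\<psi> j) (t i)) \<noteq> {}" by blast
        then show False using t(3) I(1,2) unfolding k_inconsistent_def by blast
      qed
      then show ?thesis unfolding divs_def using a' by blast
    qed
    have tg: "map (\<lambda>i. a (Inl i)) [0..<d] = g" using map_pad[OF gt(1)] by (simp add: a_def)
    have dT: "dfn M0 (trp Inl)" by (rule dfn_trp[OF M(2)])
    have "divs M0 (trp Inl) a"
    proof (rule forking_implies_dividing[OF a dT \<Phi> div])
      fix x :: "nat \<Rightarrow> 'm" assume x: "x \<in> env" "trp Inl (case_sum x a)"
      have mx: "map x [0..<d] \<in> tuples U d" using map_tuples[OF x(1), of "\<lambda>i. i"] by simp
      then have "map x [0..<d] \<in> dset N d tr (g @ b)" using x(2) tg by (simp add: trp_def dset_def)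
      then have "map x [0..<d] \<in> g <#\<^bsub>G\<^esub> X" using dset_tr[OF g] by simp
      then obtain \<psi>' c' where "(\<psi>', c') \<in> F" "map x [0..<d] \<in> dset N d \<psi>' c'" using F(3) by blast
      then obtain j where "j < s" "(\<psi>', c') = e j" "map x [0..<d] \<in> dset N d \<psi>' c'"
        by (auto simp: e)
      moreover from this(2) have "fst (e j) = \<psi>'" "snd (e j) = c'" by (metis fst_conv, metis snd_conv)
      ultimately have j: "j < s" "map x [0..<d] \<in> dset N d (\<psi> j) (c j)"
        by (simp_all add: \<psi>_def c_def)
      have "map (\<lambda>i. a (Inr (j, i))) [0..<length (c j)] = c j" by (simp add: a_def map_pad)
      then have "\<Phi> j (case_sum x a)" using j(2) by (simp add: \<Phi>_def dset_def)
      then show "\<exists>j < s. \<Phi> j (case_sum x a)" using j(1) by blast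
    qed
    then obtain k r where r: "\<And>i. r i \<in> env" "\<And>i. eqv M0 (r i) a" "kinc (trp Inl) k r"
      unfolding divs_def by blast
    \<comment> \<open>The \<open>Inl\<close> part of a copy of \<open>a\<close> is a group element,
      and \<open>b\<close> lies in the submodel, so the dividing sequence consists of translates of
      the same \<open>X\<close>.\<close>
    have rG: "map (\<lambda>l. r i (Inl l)) [0..<d] \<in> carrier G" for i
      using eqvD[OF eqv_sym[OF r(2)] dfn_carrier[of M0 Inl]] tg g by simp
    have "k_inconsistent k (\<lambda>i. map (\<lambda>l. r i (Inl l)) [0..<d] <#\<^bsub>G\<^esub> X)"
      using kinc_trp_iff[of r Inl k] r(1,3) rG by simp
    from G_dividesI[OF rG this] nG show False by simp
  qed
  then show ?thesis unfolding f_generic_def using M(1) Ms by blast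
qed

end

section \<open>Finitely additive measures\<close>

lemma fin_add_probD:
  assumes "fin_add_prob \<Omega> \<A> \<nu>"
  shows "\<nu> \<Omega> = 1" "A \<in> \<A> \<Longrightarrow> 0 \<le> \<nu> A"
    "A \<in> \<A> \<Longrightarrow> B \<in> \<A> \<Longrightarrow> A \<inter> B = {} \<Longrightarrow> \<nu> (A \<union> B) = \<nu> A + \<nu> B"
  using assms unfolding fin_add_prob_def by blast+

definition atom :: "'a set \<Rightarrow> ('i \<Rightarrow> 'a set) \<Rightarrow> 'i set \<Rightarrow> 'i set \<Rightarrow> 'a set" where
  "atom \<Omega> Z I \<sigma> = {x \<in> \<Omega>. {i \<in> I. x \<in> Z i} = \<sigma>}"

locale set_ring =
  fixes \<Omega> :: "'a set" and \<A> :: "'a set set"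
  assumes space: "\<Omega> \<in> \<A>" and sub: "A \<in> \<A> \<Longrightarrow> A \<subseteq> \<Omega>"
    and Int: "A \<in> \<A> \<Longrightarrow> B \<in> \<A> \<Longrightarrow> A \<inter> B \<in> \<A>" and Diff: "A \<in> \<A> \<Longrightarrow> B \<in> \<A> \<Longrightarrow> A - B \<in> \<A>"
begin

lemma empty: "{} \<in> \<A>" using Diff[OF space space] by simp

lemma atom_insert:
  assumes "i \<notin> I" "\<sigma> \<subseteq> I"
  shows "atom \<Omega> Z (insert i I) \<sigma> = atom \<Omega> Z I \<sigma> - Z i"
    "atom \<Omega> Z (insert i I) (insert i \<sigma>) = atom \<Omega> Z I \<sigma> \<inter> Z i"
proof -
  have e: "{k \<in> insert i I. x \<in> Z k} = (if x \<in> Z i then insert i {k \<in> I. x \<in> Z k} else {k \<in> I. x \<in> Z k})" for x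
    by auto
  have n: "i \<notin> {k \<in> I. x \<in> Z k}" "i \<notin> \<sigma>" for x using assms by auto
  have "insert i {k \<in> I. x \<in> Z k} \<noteq> \<sigma>" "insert i \<sigma> \<noteq> {k \<in> I. x \<in> Z k}" for x using n by blast+
  moreover have "insert i {k \<in> I. x \<in> Z k} = insert i \<sigma> \<longleftrightarrow> {k \<in> I. x \<in> Z k} = \<sigma>" for x
    by (rule insert_ident[OF n])
  ultimately show "atom \<Omega> Z (insert i I) \<sigma> = atom \<Omega> Z I \<sigma> - Z i"
    "atom \<Omega> Z (insert i I) (insert i \<sigma>) = atom \<Omega> Z I \<sigma> \<inter> Z i"
    unfolding atom_def e by (auto split: if_splits)
qed

lemma atom_mem: "finite I \<Longrightarrow> (\<And>i. i \<in> I \<Longrightarrow> Z i \<in> \<A>) \<Longrightarrow> \<sigma> \<subseteq> I \<Longrightarrow> atom \<Omega> Z I \<sigma> \<in> \<A>"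
proof (induction I arbitrary: \<sigma> rule: finite_induct)
  case empty
  have "atom \<Omega> Z {} {} = \<Omega>" by (auto simp: atom_def)
  then show ?case using empty space by simp
next
  case (insert i I)
  show ?case
  proof (cases "i \<in> \<sigma>")
    case True
    then have e: "\<sigma> = insert i (\<sigma> - {i})" "\<sigma> - {i} \<subseteq> I" using insert.prems by auto
    have "atom \<Omega> Z I (\<sigma> - {i}) \<inter> Z i \<in> \<A>" using insert e(2) by (intro Int insert.IH) auto
    then show ?thesis using atom_insert(2)[OF insert.hyps(2) e(2)] e(1) by simp
  next
    case False
    then have e: "\<sigma> \<subseteq> I" using insert.prems by auto
    have "atom \<Omega> Z I \<sigma> - Z i \<in> \<A>" using insert e by (intro Diff insert.IH) auto
    then show ?thesis using atom_insert(1)[OF insert.hyps(2) e] by simp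
  qed
qed

lemma measure_atoms:
  assumes \<nu>: "fin_add_prob \<Omega> \<A> \<nu>" and "finite I" "\<And>i. i \<in> I \<Longrightarrow> Z i \<in> \<A>" "E \<in> \<A>"
  shows "\<nu> E = (\<Sum>\<sigma> \<in> Pow I. \<nu> (E \<inter> atom \<Omega> Z I \<sigma>))"
  using assms(2,3)
proof (induction I rule: finite_induct)
  case empty
  have "E \<inter> atom \<Omega> Z {} {} = E" using sub[OF assms(4)] by (auto simp: atom_def)
  then show ?case by simp
next
  case (insert i I)
  have split: "\<nu> (E \<inter> atom \<Omega> Z I \<sigma>) = \<nu> (E \<inter> atom \<Omega> Z (insert i I) \<sigma>) + \<nu> (E \<inter> atom \<Omega> Z (insert i I) (insert i \<sigma>))"
    if \<sigma>: "\<sigma> \<subseteq> I" for \<sigma>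
  proof -
    have at: "atom \<Omega> Z I \<sigma> \<in> \<A>" using insert \<sigma> by (intro atom_mem) auto
    have Zi: "Z i \<in> \<A>" using insert by auto
    have "\<nu> ((E \<inter> (atom \<Omega> Z I \<sigma> - Z i)) \<union> (E \<inter> (atom \<Omega> Z I \<sigma> \<inter> Z i))) =
        \<nu> (E \<inter> (atom \<Omega> Z I \<sigma> - Z i)) + \<nu> (E \<inter> (atom \<Omega> Z I \<sigma> \<inter> Z i))"
      by (rule fin_add_probD(3)[OF \<nu>]) (use at Zi assms(4) Int Diff in auto)
    moreover have "(E \<inter> (atom \<Omega> Z I \<sigma> - Z i)) \<union> (E \<inter> (atom \<Omega> Z I \<sigma> \<inter> Z i)) = E \<inter> atom \<Omega> Z I \<sigma>" by auto
    ultimately show ?thesis unfolding atom_insert[OF insert.hyps(2) \<sigma>] by simp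
  qed
  have inj: "inj_on (insert i) (Pow I)"
  proof (rule inj_onI)
    fix A B assume "A \<in> Pow I" "B \<in> Pow I" "insert i A = insert i B"
    then show "A = B" using insert.hyps(2) by (metis Diff_insert_absorb PowD subsetD)
  qed
  have "\<nu> E = (\<Sum>\<sigma> \<in> Pow I. \<nu> (E \<inter> atom \<Omega> Z I \<sigma>))" using insert by auto
  also have "\<dots> = (\<Sum>\<sigma> \<in> Pow I. \<nu> (E \<inter> atom \<Omega> Z (insert i I) \<sigma>)) +
      (\<Sum>\<sigma> \<in> Pow I. \<nu> (E \<inter> atom \<Omega> Z (insert i I) (insert i \<sigma>)))"
    unfolding sum.distrib[symmetric] by (rule sum.cong) (use split in auto)
  also have "(\<Sum>\<sigma> \<in> Pow I. \<nu> (E \<inter> atom \<Omega> Z (insert i I) (insert i \<sigma>))) =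
      (\<Sum>\<sigma> \<in> insert i ` Pow I. \<nu> (E \<inter> atom \<Omega> Z (insert i I) \<sigma>))"
    by (simp add: sum.reindex[OF inj])
  also have "(\<Sum>\<sigma> \<in> Pow I. \<nu> (E \<inter> atom \<Omega> Z (insert i I) \<sigma>)) + \<dots> =
      (\<Sum>\<sigma> \<in> Pow I \<union> insert i ` Pow I. \<nu> (E \<inter> atom \<Omega> Z (insert i I) \<sigma>))"
    by (rule sum.union_disjoint[symmetric]) (use insert.hyps in auto)
  finally show ?case by (simp add: Pow_insert)
qed

lemma measure_empty: "fin_add_prob \<Omega> \<A> \<nu> \<Longrightarrow> \<nu> {} = 0"
  using fin_add_probD(3)[of \<Omega> \<A> \<nu> "{}" "{}"] empty by simp

lemma measure_eq_sum_atoms: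
  assumes \<nu>: "fin_add_prob \<Omega> \<A> \<nu>" and I: "finite I" "\<And>i. i \<in> I \<Longrightarrow> Z i \<in> \<A>" and j: "j \<in> I"
  shows "\<nu> (Z j) = (\<Sum>\<sigma> \<in> Pow I. if j \<in> \<sigma> then \<nu> (atom \<Omega> Z I \<sigma>) else 0)"
proof (rule trans[OF measure_atoms[where Z = Z and E = "Z j", OF \<nu> I I(2)[OF j]] sum.cong[OF refl]])
  fix \<sigma> assume "\<sigma> \<in> Pow I"
  have "Z j \<inter> atom \<Omega> Z I \<sigma> = (if j \<in> \<sigma> then atom \<Omega> Z I \<sigma> else {})" using j by (auto simp: atom_def)
  then show "\<nu> (Z j \<inter> atom \<Omega> Z I \<sigma>) = (if j \<in> \<sigma> then \<nu> (atom \<Omega> Z I \<sigma>) else 0)"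
    using measure_empty[OF \<nu>] by simp
qed

lemma sum_atoms:
  assumes "fin_add_prob \<Omega> \<A> \<nu>" "finite I" "\<And>i. i \<in> I \<Longrightarrow> Z i \<in> \<A>"
  shows "(\<Sum>\<sigma> \<in> Pow I. \<nu> (atom \<Omega> Z I \<sigma>)) = 1"
proof -
  have "\<Omega> \<inter> atom \<Omega> Z I \<sigma> = atom \<Omega> Z I \<sigma>" for \<sigma> by (auto simp: atom_def)
  then show ?thesis using measure_atoms[where Z = Z and E = \<Omega>, OF assms space] fin_add_probD(1)[OF assms(1)] by simp
qed

text \<open>Double counting over atoms: the measures of the first \<open>n\<close> sets add up to
  the sum of \<open>card \<sigma>\<close> times the measure of the atom \<sigma>. Atoms with more
  than \<open>k\<close> indices are empty, so \<open>n * c\<close> is at most \<open>k\<close> for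
  every \<open>n\<close>.\<close>

lemma measure_k_inconsistent:
  assumes \<nu>: "fin_add_prob \<Omega> \<A> \<nu>" and Z: "\<And>i :: nat. Z i \<in> \<A>" "\<And>i. \<nu> (Z i) = c" and k: "k_inconsistent k Z"
  shows "c \<le> 0"
proof -
  have bound: "real n * c \<le> real k" for n :: nat
  proof -
    let ?I = "{..<n}"
    have *: "real (card \<sigma>) * \<nu> (atom \<Omega> Z ?I \<sigma>) \<le> real k * \<nu> (atom \<Omega> Z ?I \<sigma>)" if \<sigma>: "\<sigma> \<subseteq> ?I" for \<sigma>
    proof (cases "card \<sigma> \<le> k")
      case True
      have "0 \<le> \<nu> (atom \<Omega> Z ?I \<sigma>)" using fin_add_probD(2)[OF \<nu>] atom_mem[of ?I Z \<sigma>] Z(1) \<sigma> by auto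
      then show ?thesis using True by (intro mult_right_mono) auto
    next
      case False
      then obtain \<tau> where \<tau>: "\<tau> \<subseteq> \<sigma>" "card \<tau> = k" "finite \<tau>"
        by (metis nat_le_linear obtain_subset_with_card_n)
      have "(\<Inter>i \<in> \<tau>. Z i) = {}" using k \<tau>(2,3) unfolding k_inconsistent_def by blast
      then have "atom \<Omega> Z ?I \<sigma> = {}" using \<tau>(1) unfolding atom_def by blast
      then show ?thesis using measure_empty[OF \<nu>] by simp
    qed
    have "real n * c = (\<Sum>i \<in> ?I. \<nu> (Z i))" using Z(2) by simp
    also have "\<dots> = (\<Sum>i \<in> ?I. \<Sum>\<sigma> \<in> Pow ?I. if i \<in> \<sigma> then \<nu> (atom \<Omega> Z ?I \<sigma>) else 0)"
      by (intro sum.cong refl measure_eq_sum_atoms[OF \<nu>]) (use Z in auto)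
    also have "\<dots> = (\<Sum>\<sigma> \<in> Pow ?I. \<Sum>i \<in> ?I. if i \<in> \<sigma> then \<nu> (atom \<Omega> Z ?I \<sigma>) else 0)" by (rule sum.swap)
    also have "\<dots> = (\<Sum>\<sigma> \<in> Pow ?I. real (card \<sigma>) * \<nu> (atom \<Omega> Z ?I \<sigma>))"
    proof (rule sum.cong[OF refl])
      fix \<sigma> assume "\<sigma> \<in> Pow ?I"
      then have "?I \<inter> \<sigma> = \<sigma>" by auto
      then show "(\<Sum>i \<in> ?I. if i \<in> \<sigma> then \<nu> (atom \<Omega> Z ?I \<sigma>) else 0) = real (card \<sigma>) * \<nu> (atom \<Omega> Z ?I \<sigma>)"
        by (simp add: sum.inter_restrict[symmetric])
    qed
    also have "\<dots> \<le> (\<Sum>\<sigma> \<in> Pow ?I. real k * \<nu> (atom \<Omega> Z ?I \<sigma>))" by (rule sum_mono) (use * in auto)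
    also have "\<dots> = real k * (\<Sum>\<sigma> \<in> Pow ?I. \<nu> (atom \<Omega> Z ?I \<sigma>))" by (rule sum_distrib_left[symmetric])
    also have "(\<Sum>\<sigma> \<in> Pow ?I. \<nu> (atom \<Omega> Z ?I \<sigma>)) = 1" by (rule sum_atoms[OF \<nu>]) (use Z in auto)
    finally show ?thesis by simp
  qed
  show ?thesis
  proof (rule ccontr)
    assume "\<not> c \<le> 0"
    then obtain n :: nat where "real k < real n * c" using reals_Archimedean3[of c] by auto
    then show False using bound[of n] by simp
  qed
qed

end

text \<open>Tychonoff for functions into the unit interval. Set functions are taken on all sets,
  measured or not, so the finite stages have to bound every value.\<close>

lemma measure_compactness:
  fixes \<C> :: "('a set \<Rightarrow> real) set set"
  assumes closed: "\<And>C. C \<in> \<C> \<Longrightarrow> closed C"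
    and fip: "\<And>F. finite F \<Longrightarrow> F \<subseteq> \<C> \<Longrightarrow> \<exists>\<nu>. (\<forall>A. \<nu> A \<in> {0..1}) \<and> (\<forall>C \<in> F. \<nu> \<in> C)"
  shows "\<exists>\<nu>. \<forall>C \<in> \<C>. \<nu> \<in> C"
proof -
  let ?S = "PiE UNIV (\<lambda>_ :: 'a set. {0..1 :: real})"
  have "compactin (product_topology (\<lambda>_ :: 'a set. euclidean) UNIV) ?S"
    by (subst compactin_PiE) auto
  then have "compact ?S" by (simp add: euclidean_product_topology)
  then have "?S \<inter> \<Inter>\<C> \<noteq> {}"
  proof (rule compact_imp_fip)
    fix F assume "finite F" "F \<subseteq> \<C>"
    then obtain \<nu> where "\<forall>A. \<nu> A \<in> {0..1}" "\<forall>C \<in> F. \<nu> \<in> C" using fip by blast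
    then have "\<nu> \<in> ?S \<inter> \<Inter>F" by (auto simp: PiE_UNIV_domain)
    then show "?S \<inter> \<Inter>F \<noteq> {}" by blast
  qed (rule closed)
  then show ?thesis by blast
qed

lemma closed_fin_add_prob: "closed {\<nu>. fin_add_prob \<Omega> \<A> \<nu>}"
proof -
  have c: "continuous_on UNIV (\<lambda>\<nu> :: 'a set \<Rightarrow> real. \<nu> A)" for A by (rule continuous_on_product_coordinates)
  have "{\<nu>. fin_add_prob \<Omega> \<A> \<nu>} = {\<nu>. \<nu> \<Omega> = 1} \<inter> (\<Inter>A \<in> \<A>. {\<nu>. 0 \<le> \<nu> A}) \<inter>
      (\<Inter>A \<in> \<A>. \<Inter>B \<in> {B \<in> \<A>. A \<inter> B = {}}. {\<nu>. \<nu> (A \<union> B) = \<nu> A + \<nu> B})"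
    unfolding fin_add_prob_def by auto
  also have "closed \<dots>"
    by (intro closed_Int closed_INT ballI closed_Collect_eq closed_Collect_le continuous_on_const
        continuous_on_add c)
  finally show ?thesis .
qed

text \<open>
  Multiplicative weights: if every weighting of \<open>E\<close> is met by some point up to a fraction \<open>\<beta>\<close>, then
  repeatedly taking such a point and doubling the weights of the \<open>g\<close> it misses produces a sequence
  of points hitting every \<open>g\<close> with frequency \<open>\<delta>\<close>, where \<open>2 powr (2 * \<delta>) = 2 / (2 - \<beta>)\<close>.
\<close>

lemma multiplicative_weights:
  fixes hit :: "'x \<Rightarrow> 'g \<Rightarrow> bool"
  assumes \<beta>: "0 < \<beta>" "\<beta> \<le> 1" and E: "finite E"
    and H: "\<And>w :: 'g \<Rightarrow> nat. \<exists>x \<in> \<Omega>. \<beta> * real (\<Sum>g \<in> E. w g) \<le> real (\<Sum>g \<in> {g \<in> E. hit x g}. w g)"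
    and \<delta>: "\<delta> = log 2 (2 / (2 - \<beta>)) / 2"
  shows "\<exists>(n :: nat) x. 0 < n \<and> (\<forall>l. x l \<in> \<Omega>) \<and> (\<forall>g \<in> E. \<delta> * real n \<le> real (card {l. l < n \<and> hit (x l) g}))"
proof -
  have \<delta>0: "0 < \<delta>" using \<beta> unfolding \<delta> by (simp add: zero_less_log_cancel_iff)
  from H have "\<forall>w :: 'g \<Rightarrow> nat. \<exists>x. x \<in> \<Omega> \<and> \<beta> * real (\<Sum>g \<in> E. w g) \<le> real (\<Sum>g \<in> {g \<in> E. hit x g}. w g)" by blast
  from choice[OF this] obtain X :: "('g \<Rightarrow> nat) \<Rightarrow> 'x" where
    X: "\<forall>w. X w \<in> \<Omega> \<and> \<beta> * real (\<Sum>g \<in> E. w g) \<le> real (\<Sum>g \<in> {g \<in> E. hit (X w) g}. w g)" ..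
  define w where "w = rec_nat (\<lambda>_ :: 'g. 1 :: nat) (\<lambda>_ w g. if hit (X w) g then w g else 2 * w g)"
  have w0: "w 0 g = 1" and wS: "w (Suc t) g = (if hit (X (w t)) g then w t g else 2 * w t g)" for t g
    by (simp_all add: w_def)
  define x where "x = (\<lambda>t. X (w t))"
  define h where "h = (\<lambda>t g. card {l. l < t \<and> hit (x l) g})"
  have hS: "h (Suc t) g = h t g + (if hit (x t) g then 1 else 0)" for t g
  proof -
    have "{l. l < Suc t \<and> hit (x l) g} = (if hit (x t) g then insert t {l. l < t \<and> hit (x l) g} else {l. l < t \<and> hit (x l) g})"
      by (auto simp: less_Suc_eq)
    then show ?thesis by (simp add: h_def)
  qed
  \<comment> \<open>The weight of \<open>g\<close> after \<open>t\<close> rounds is 2 to the number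
    of its misses.\<close>
  have wh: "w t g * 2 ^ h t g = 2 ^ t" for t g
  proof (induction t)
    case 0
    show ?case by (simp add: w0 h_def)
  next
    case (Suc t)
    then show ?case by (simp add: wS hS x_def mult.commute mult.left_commute)
  qed
  \<comment> \<open>A round doubles the total weight except for the part that is hit, which is at
    least the fraction \<beta> of it.\<close>
  have W: "real (\<Sum>g \<in> E. w t g) \<le> real (card E) * (2 - \<beta>) ^ t" for t
  proof (induction t)
    case 0
    show ?case by (simp add: w0)
  next
    case (Suc t)
    have "w (Suc t) g + (if hit (x t) g then w t g else 0) = 2 * w t g" for g
      by (simp add: wS x_def)
    then have "(\<Sum>g \<in> E. w (Suc t) g + (if hit (x t) g then w t g else 0)) = (\<Sum>g \<in> E. 2 * w t g)"
      by (intro sum.cong) auto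
    then have "(\<Sum>g \<in> E. w (Suc t) g) + (\<Sum>g \<in> {g \<in> E. hit (x t) g}. w t g) = 2 * (\<Sum>g \<in> E. w t g)"
      using E by (simp add: sum.distrib sum.inter_filter sum_distrib_left)
    then have "real (\<Sum>g \<in> E. w (Suc t) g) + real (\<Sum>g \<in> {g \<in> E. hit (x t) g}. w t g) = 2 * real (\<Sum>g \<in> E. w t g)"
      by (metis of_nat_add of_nat_mult of_nat_numeral)
    moreover have "\<beta> * real (\<Sum>g \<in> E. w t g) \<le> real (\<Sum>g \<in> {g \<in> E. hit (x t) g}. w t g)"
      using X unfolding x_def by blast
    ultimately have "real (\<Sum>g \<in> E. w (Suc t) g) \<le> (2 - \<beta>) * real (\<Sum>g \<in> E. w t g)"
      by (simp add: algebra_simps)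
    also have "\<dots> \<le> (2 - \<beta>) * (real (card E) * (2 - \<beta>) ^ t)" using Suc \<beta> by (intro mult_left_mono) auto
    finally show ?case by (simp add: mult.left_commute)
  qed
  \<comment> \<open>Comparing one weight with the total gives frequency \<open>2 * \<delta>\<close>
    up to the additive term \<open>log 2 (card E)\<close>; for \<open>n\<close> this large, half of
    the frequency pays for that term.\<close>
  obtain n0 :: nat where n0: "log 2 (real (card E)) / \<delta> \<le> real n0" using real_arch_simple by blast
  define n where "n = Suc n0"
  have "\<delta> * real n \<le> real (h n g)" if g: "g \<in> E" for g
  proof -
    have cE: "0 < card E" using g E by (auto simp: card_gt_0_iff)
    have b2: "0 < 2 - \<beta>" using \<beta> by simp
    have "w n g \<le> (\<Sum>g \<in> E. w n g)" using g E by (intro member_le_sum) auto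
    then have "real (w n g) \<le> real (card E) * (2 - \<beta>) ^ n" using W[of n] by linarith
    then have "real (w n g) * 2 ^ h n g \<le> real (card E) * (2 - \<beta>) ^ n * 2 ^ h n g" by (intro mult_right_mono) auto
    moreover have "real (w n g) * 2 ^ h n g = 2 ^ n" using wh[of n g] by (metis of_nat_mult of_nat_numeral of_nat_power)
    ultimately have "2 ^ n \<le> real (card E) * (2 - \<beta>) ^ n * 2 ^ h n g" by simp
    then have "(2 / (2 - \<beta>)) ^ n \<le> real (card E) * 2 ^ h n g"
      using b2 by (simp add: power_divide divide_simps mult.commute mult.left_commute)
    then have "log 2 ((2 / (2 - \<beta>)) ^ n) \<le> log 2 (real (card E) * 2 ^ h n g)"
      using b2 cE by (subst log_le_cancel_iff) auto
    also have "log 2 ((2 / (2 - \<beta>)) ^ n) = 2 * \<delta> * real n" using b2 by (simp add: log_nat_power \<delta>)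
    also have "log 2 (real (card E) * 2 ^ h n g) = log 2 (real (card E)) + real (h n g)"
      using cE by (simp add: log_mult log_nat_power)
    finally have "2 * \<delta> * real n \<le> log 2 (real (card E)) + real (h n g)" .
    moreover have "log 2 (real (card E)) \<le> \<delta> * real n"
      using n0 \<delta>0 by (simp add: n_def field_simps)
    ultimately show ?thesis by linarith
  qed
  moreover have "x l \<in> \<Omega>" for l using X by (simp add: x_def)
  ultimately show ?thesis unfolding h_def by (intro exI[of _ n] exI[of _ x]) (simp add: n_def)
qed

section \<open>Averaging over an amenable group\<close>

lemma length_filter_weighted_list:
  "length (filter P (concat (map (\<lambda>g. replicate (w g) g) es))) = (\<Sum>g \<leftarrow> es. if P g then w g else 0)"
  by (induction es) auto

text \<open>For finite \<open>E\<close> the measure counts how often the sequence of points from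
  \<open>multiplicative_weights\<close> falls into a set. Since \<delta> does not depend on
  \<open>E\<close>, compactness yields one measure for all of \<Gamma>.\<close>

lemma exists_measure_hitting:
  fixes S :: "'g \<Rightarrow> 'x set"
  assumes \<beta>: "0 < \<beta>" "\<beta> \<le> 1" and \<Omega>: "\<Omega> \<noteq> {}" and S: "\<And>g. g \<in> \<Gamma> \<Longrightarrow> S g \<subseteq> \<Omega>"
    and meet: "\<And>(n :: nat) g. \<forall>i < n. g i \<in> \<Gamma> \<Longrightarrow>
      \<exists>J \<subseteq> {..<n}. \<beta> * real n \<le> real (card J) \<and> (\<Inter>i \<in> J. S (g i)) \<noteq> {}"
    and \<delta>: "\<delta> = log 2 (2 / (2 - \<beta>)) / 2"
  shows "\<exists>\<rho>. fin_add_prob \<Omega> UNIV \<rho> \<and> (\<forall>g \<in> \<Gamma>. \<delta> \<le> \<rho> (S g))"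
proof -
  have fin: "\<exists>\<rho>. (\<forall>A. \<rho> A \<in> {0..1}) \<and> fin_add_prob \<Omega> UNIV \<rho> \<and> (\<forall>g \<in> E. \<delta> \<le> \<rho> (S g))"
    if E: "finite E" "E \<subseteq> \<Gamma>" for E
  proof -
    have H: "\<exists>x \<in> \<Omega>. \<beta> * real (\<Sum>g \<in> E. w g) \<le> real (\<Sum>g \<in> {g \<in> E. x \<in> S g}. w g)" for w :: "'g \<Rightarrow> nat"
    proof (cases "(\<Sum>g \<in> E. w g) = 0")
      case True
      obtain x where "x \<in> \<Omega>" using \<Omega> by blast
      then show ?thesis by (intro bexI[of _ x]) (simp_all only: True of_nat_0 mult_zero_right of_nat_0_le_iff)
    next
      case False
      obtain es where es: "set es = E" "distinct es" using finite_distinct_list[OF E(1)] by blast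
      \<comment> \<open>Integer weights become repetitions in a list, to which \<open>meet\<close>
        applies.\<close>
      define ls where "ls = concat (map (\<lambda>g. replicate (w g) g) es)"
      have lsE: "set ls \<subseteq> E" using es(1) by (auto simp: ls_def)
      have len: "length (filter P ls) = (\<Sum>g \<in> {g \<in> E. P g}. w g)" for P
        unfolding ls_def length_filter_weighted_list
        using es by (simp add: sum_list_distinct_conv_sum_set sum.inter_filter[OF E(1)])
      have n: "length ls = (\<Sum>g \<in> E. w g)" using len[of "\<lambda>_. True"] by simp
      have "\<forall>i < length ls. ls ! i \<in> \<Gamma>" using lsE E(2) nth_mem by blast
      from meet[OF this] obtain J x where J: "J \<subseteq> {..<length ls}" "\<beta> * real (length ls) \<le> real (card J)"
        "x \<in> (\<Inter>i \<in> J. S (ls ! i))" by blast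
      have "0 < length ls" using False n by simp
      then have "0 < \<beta> * real (length ls)" using \<beta> by simp
      \<comment> \<open>A nonempty \<open>J\<close> puts the common point into \<Omega>; for
        \<open>J = {}\<close> it could be anything.\<close>
      then have "card J \<noteq> 0" using J(2) by auto
      then obtain i where i: "i \<in> J" by fastforce
      then have "ls ! i \<in> set ls" using J(1) by auto
      then have "x \<in> \<Omega>" using J(3) i S lsE E(2) by blast
      have "card J \<le> card {i. i < length ls \<and> x \<in> S (ls ! i)}"
        using J(1,3) by (intro card_mono) auto
      then have "card J \<le> (\<Sum>g \<in> {g \<in> E. x \<in> S g}. w g)"
        using len[of "\<lambda>g. x \<in> S g"] by (simp add: length_filter_conv_card)
      then have "real (card J) \<le> real (\<Sum>g \<in> {g \<in> E. x \<in> S g}. w g)" by (rule of_nat_mono)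
      with J(2) have "\<beta> * real (\<Sum>g \<in> E. w g) \<le> real (\<Sum>g \<in> {g \<in> E. x \<in> S g}. w g)"
        unfolding n by (rule order_trans)
      with \<open>x \<in> \<Omega>\<close> show ?thesis by blast
    qed
    obtain n :: nat and x where x: "0 < n" "\<And>l. x l \<in> \<Omega>"
        "\<And>g. g \<in> E \<Longrightarrow> \<delta> * real n \<le> real (card {l. l < n \<and> x l \<in> S g})"
      using multiplicative_weights[where hit = "\<lambda>x g. x \<in> S g", OF \<beta> E(1) H \<delta>] by blast
    define \<rho> where "\<rho> = (\<lambda>A. real (card {l. l < n \<and> x l \<in> A}) / real n)"
    have "card {l. l < n \<and> x l \<in> A} \<le> n" for A
      using card_mono[of "{..<n}" "{l. l < n \<and> x l \<in> A}"] by auto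
    then have "\<forall>A. \<rho> A \<in> {0..1}" using x(1) by (simp add: \<rho>_def)
    moreover have "card {l. l < n \<and> x l \<in> A \<union> B} = card {l. l < n \<and> x l \<in> A} + card {l. l < n \<and> x l \<in> B}"
      if "A \<inter> B = {}" for A B
    proof -
      have "{l. l < n \<and> x l \<in> A \<union> B} = {l. l < n \<and> x l \<in> A} \<union> {l. l < n \<and> x l \<in> B}" by auto
      then show ?thesis using that by (simp add: card_Un_disjoint disjoint_iff)
    qed
    then have "fin_add_prob \<Omega> UNIV \<rho>"
      unfolding fin_add_prob_def \<rho>_def using x(1,2) by (simp add: add_divide_distrib)
    moreover have "\<forall>g \<in> E. \<delta> \<le> \<rho> (S g)" using x(1,3) by (simp add: \<rho>_def pos_le_divide_eq)
    ultimately show ?thesis by blast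
  qed
  let ?C = "\<lambda>g. {\<nu> :: 'x set \<Rightarrow> real. \<delta> \<le> \<nu> (S g)}"
  have "\<exists>\<nu>. \<forall>C \<in> insert {\<nu>. fin_add_prob \<Omega> UNIV \<nu>} (?C ` \<Gamma>). \<nu> \<in> C"
  proof (rule measure_compactness)
    fix C assume "C \<in> insert {\<nu>. fin_add_prob \<Omega> UNIV \<nu>} (?C ` \<Gamma>)"
    then show "closed C"
      by (auto intro!: closed_fin_add_prob closed_Collect_le continuous_on_const continuous_on_product_coordinates)
  next
    fix F assume F: "finite F" "F \<subseteq> insert {\<nu>. fin_add_prob \<Omega> UNIV \<nu>} (?C ` \<Gamma>)"
    have "finite (F \<inter> ?C ` \<Gamma>)" "F \<inter> ?C ` \<Gamma> \<subseteq> ?C ` \<Gamma>" using F(1) by auto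
    then obtain E where E: "E \<subseteq> \<Gamma>" "finite E" "F \<inter> ?C ` \<Gamma> = ?C ` E" by (meson finite_subset_image)
    obtain \<rho> where \<rho>: "\<forall>A. \<rho> A \<in> {0..1}" "fin_add_prob \<Omega> UNIV \<rho>" "\<forall>g \<in> E. \<delta> \<le> \<rho> (S g)" using fin[OF E(2,1)] by blast
    have "\<rho> \<in> C" if "C \<in> F" for C
    proof -
      have "C = {\<nu>. fin_add_prob \<Omega> UNIV \<nu>} \<or> C \<in> ?C ` E" using that F(2) E(3) by blast
      then show ?thesis using \<rho>(2,3) by auto
    qed
    then show "\<exists>\<nu>. (\<forall>A. \<nu> A \<in> {0..1}) \<and> (\<forall>C \<in> F. \<nu> \<in> C)" using \<rho>(1) by blast
  qed
  then obtain \<nu> where "\<forall>C \<in> insert {\<nu>. fin_add_prob \<Omega> UNIV \<nu>} (?C ` \<Gamma>). \<nu> \<in> C" ..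
  then show ?thesis by (intro exI[of _ \<nu>]) auto
qed

lemma fin_add_fibres:
  assumes \<nu>: "fin_add_prob \<Omega> (Pow \<Omega>) \<nu>" and T: "finite T"
  shows "A \<subseteq> \<Omega> \<Longrightarrow> f ` A \<subseteq> T \<Longrightarrow> \<nu> A = (\<Sum>t \<in> T. \<nu> {k \<in> A. f k = t})"
  using T
proof (induction T arbitrary: A rule: finite_induct)
  case empty
  then show ?case using fin_add_probD(3)[OF \<nu>, of "{}" "{}"] by simp
next
  case (insert t T)
  let ?B = "{k \<in> A. f k \<noteq> t}"
  have "{k \<in> A. f k = t} \<union> ?B = A" "{k \<in> A. f k = t} \<inter> ?B = {}" by auto
  then have "\<nu> A = \<nu> {k \<in> A. f k = t} + \<nu> ?B"
    using fin_add_probD(3)[OF \<nu>, of "{k \<in> A. f k = t}" ?B] insert.prems(1) by auto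
  also have "\<nu> ?B = (\<Sum>s \<in> T. \<nu> {k \<in> ?B. f k = s})"
    by (rule insert.IH) (use insert.prems in auto)
  also have "\<dots> = (\<Sum>s \<in> T. \<nu> {k \<in> A. f k = s})"
  proof (rule sum.cong[OF refl])
    fix s assume "s \<in> T"
    then have "{k \<in> ?B. f k = s} = {k \<in> A. f k = s}" using insert.hyps(2) by auto
    then show "\<nu> {k \<in> ?B. f k = s} = \<nu> {k \<in> A. f k = s}" by simp
  qed
  finally show ?case using insert.hyps by simp
qed

text \<open>
  The average \<open>\<integral> \<rho>(k\<^sup>-\<^sup>1 A) d\<nu>(k)\<close> is left invariant. For finitely many sets \<open>A\<close> it is approximated by a
  finite sum: partition the group into the sets on which all \<open>\<lfloor>K \<rho>(k\<^sup>-\<^sup>1 A)\<rfloor>\<close> are constant.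
\<close>

lemma averaging:
  fixes G (structure)
  assumes G: "group G" and \<nu>: "fin_add_prob (carrier G) (Pow (carrier G)) \<nu>"
    and inv: "\<And>g A. g \<in> carrier G \<Longrightarrow> A \<subseteq> carrier G \<Longrightarrow> \<nu> (g <# A) = \<nu> A"
    and \<rho>: "fin_add_prob (carrier G) UNIV \<rho>"
    and X: "X \<subseteq> carrier G" "\<And>g. g \<in> carrier G \<Longrightarrow> \<delta> \<le> \<rho> (g <# X)"
    and I: "finite I" "\<And>i. i \<in> I \<Longrightarrow> Y i \<subseteq> carrier G" "\<And>i. i \<in> I \<Longrightarrow> h i \<in> carrier G" and K: "0 < K"
  shows "\<exists>\<nu>'. fin_add_prob (carrier G) UNIV \<nu>' \<and> \<delta> \<le> \<nu>' X \<and>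
    (\<forall>i \<in> I. \<bar>\<nu>' (h i <# Y i) - \<nu>' (Y i)\<bar> \<le> 2 / real K)"
proof -
  interpret group G by (rule G)
  let ?\<Omega> = "carrier G"
  define J where "J = I \<times> (UNIV :: bool set)"
  define Z where "Z = (\<lambda>(i, c). if c then h i <# Y i else Y i)"
  define F where "F = (\<lambda>j k. \<rho> (inv k <# Z j))"
  define lev where "lev = (\<lambda>j k. nat \<lfloor>real K * F j k\<rfloor>)"
  have ZG: "Z j \<subseteq> ?\<Omega>" if j: "j \<in> J" for j
  proof -
    obtain i c where "j = (i, c)" "i \<in> I" using j by (auto simp: J_def)
    then show ?thesis using I(2,3)[of i] l_coset_subset_G by (cases c) (simp_all add: Z_def)
  qed
  have \<rho>1: "\<rho> A \<le> 1" if "A \<subseteq> ?\<Omega>" for A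
  proof -
    have "\<rho> (A \<union> (?\<Omega> - A)) = \<rho> A + \<rho> (?\<Omega> - A)" by (rule fin_add_probD(3)[OF \<rho>]) auto
    moreover have "A \<union> (?\<Omega> - A) = ?\<Omega>" using that by auto
    ultimately show ?thesis using fin_add_probD(1)[OF \<rho>] fin_add_probD(2)[OF \<rho>, of "?\<Omega> - A"] by simp
  qed
  have F01: "0 \<le> F j k" "F j k \<le> 1" if "j \<in> J" "k \<in> ?\<Omega>" for j k
    using fin_add_probD(2)[OF \<rho>] \<rho>1[OF l_coset_subset_G[OF ZG[OF that(1)], of "inv k"]] that(2) by (auto simp: F_def)
  have lev: "\<bar>F j k - real (lev j k) / real K\<bar> \<le> 1 / real K" "lev j k \<le> K" if "j \<in> J" "k \<in> ?\<Omega>" for j k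
  proof -
    have p: "0 \<le> real K * F j k" using F01(1)[OF that] by simp
    then have e: "real (lev j k) = of_int \<lfloor>real K * F j k\<rfloor>" by (simp add: lev_def)
    then have "real (lev j k) \<le> real K * F j k" "real K * F j k \<le> real (lev j k) + 1" by linarith+
    then have "real (lev j k) / real K \<le> F j k" "F j k \<le> real (lev j k) / real K + 1 / real K"
      using K by (simp_all add: field_simps)
    then show "\<bar>F j k - real (lev j k) / real K\<bar> \<le> 1 / real K" by linarith
    have "real (lev j k) \<le> real K"
      using \<open>real (lev j k) \<le> real K * F j k\<close> mult_left_le[OF F01(2)[OF that], of "real K"] by simp
    then show "lev j k \<le> K" by simp
  qed
  \<comment> \<open>Constant outside the finite set \<open>J\<close>, so that only finitely many
    level functions occur.\<close>
  define pt where "pt = (\<lambda>k j. if j \<in> J then lev j k else 0)"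
  define T where "T = pt ` ?\<Omega>"
  have fJ: "finite J" using I(1) by (simp add: J_def)
  have fT: "finite T"
  proof (rule finite_subset)
    show "T \<subseteq> {f. \<forall>j. (j \<in> J \<longrightarrow> f j \<in> {..K}) \<and> (j \<notin> J \<longrightarrow> f j = 0)}"
      using lev(2) by (auto simp: T_def pt_def)
    show "finite {f. \<forall>j. (j \<in> J \<longrightarrow> f j \<in> {..K}) \<and> (j \<notin> J \<longrightarrow> f j = 0)}"
      by (rule finite_set_of_finite_funs[OF fJ]) simp
  qed
  define cls where "cls = (\<lambda>p. {k \<in> ?\<Omega>. pt k = p})"
  have "\<forall>p. \<exists>k. p \<in> T \<longrightarrow> k \<in> ?\<Omega> \<and> pt k = p" by (auto simp: T_def)
  from choice[OF this] obtain rep where rep: "\<forall>p. p \<in> T \<longrightarrow> rep p \<in> ?\<Omega> \<and> pt (rep p) = p" ..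
  \<comment> \<open>A finite average of translates of \<rho> is exactly additive and keeps the bound
    \<delta>; sampling at representatives only makes the invariance approximate. Intersecting with
    the carrier extends it to all sets.\<close>
  define \<nu>' where "\<nu>' = (\<lambda>A. \<Sum>p \<in> T. \<nu> (cls p) * \<rho> (inv (rep p) <# (A \<inter> ?\<Omega>)))"
  have cls0: "0 \<le> \<nu> (cls p)" for p by (rule fin_add_probD(2)[OF \<nu>]) (auto simp: cls_def)
  have cls1: "(\<Sum>p \<in> T. \<nu> (cls p)) = 1"
    using fin_add_fibres[OF \<nu> fT, of ?\<Omega> pt] fin_add_probD(1)[OF \<nu>] by (simp add: T_def cls_def)
  have all: "k <# ?\<Omega> = ?\<Omega>" if k: "k \<in> ?\<Omega>" for k
  proof (intro equalityI subsetI)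
    fix x assume x: "x \<in> ?\<Omega>"
    have "x = k \<otimes> (inv k \<otimes> x)" using k x by (simp add: m_assoc[symmetric])
    then show "x \<in> k <# ?\<Omega>" using k x unfolding l_coset_def by blast
  qed (use k in \<open>auto simp: l_coset_def\<close>)
  have "fin_add_prob ?\<Omega> UNIV \<nu>'"
    unfolding fin_add_prob_def
  proof (intro conjI ballI impI)
    show "\<nu>' ?\<Omega> = 1"
      using rep all fin_add_probD(1)[OF \<rho>] cls1 by (simp add: \<nu>'_def)
    show "0 \<le> \<nu>' A" for A
      unfolding \<nu>'_def by (intro sum_nonneg mult_nonneg_nonneg cls0 fin_add_probD(2)[OF \<rho>]) simp
    fix A B :: "'a set" assume AB: "A \<inter> B = {}"
    have "\<rho> (inv (rep p) <# ((A \<union> B) \<inter> ?\<Omega>)) = \<rho> (inv (rep p) <# (A \<inter> ?\<Omega>)) + \<rho> (inv (rep p) <# (B \<inter> ?\<Omega>))"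
      if p: "p \<in> T" for p
    proof -
      have r: "inv (rep p) \<in> ?\<Omega>" using rep p by simp
      have "(inv (rep p) <# (A \<inter> ?\<Omega>)) \<inter> (inv (rep p) <# (B \<inter> ?\<Omega>)) = {}"
        using AB r unfolding l_coset_def by (auto simp: disjoint_iff)
      moreover have "inv (rep p) <# ((A \<union> B) \<inter> ?\<Omega>) = (inv (rep p) <# (A \<inter> ?\<Omega>)) \<union> (inv (rep p) <# (B \<inter> ?\<Omega>))"
        unfolding l_coset_def by auto
      ultimately show ?thesis using fin_add_probD(3)[OF \<rho>] by simp
    qed
    then show "\<nu>' (A \<union> B) = \<nu>' A + \<nu>' B"
      unfolding \<nu>'_def sum.distrib[symmetric] by (intro sum.cong refl) (simp add: distrib_left)
  qed
  moreover have "\<delta> \<le> \<nu>' X"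
  proof -
    have "\<delta> = (\<Sum>p \<in> T. \<nu> (cls p) * \<delta>)" using cls1 by (simp add: sum_distrib_right[symmetric])
    also have "\<dots> \<le> \<nu>' X"
      unfolding \<nu>'_def
    proof (intro sum_mono mult_left_mono cls0)
      fix p assume "p \<in> T"
      moreover have "X \<inter> ?\<Omega> = X" using X(1) by auto
      ultimately show "\<delta> \<le> \<rho> (inv (rep p) <# (X \<inter> ?\<Omega>))" using X(2) rep by simp
    qed
    finally show ?thesis .
  qed
  moreover have "\<bar>\<nu>' (h i <# Y i) - \<nu>' (Y i)\<bar> \<le> 2 / real K" if i: "i \<in> I" for i
  proof -
    \<comment> \<open>This sum sees only how \<nu> distributes the levels of \<open>j\<close>. It
      approximates the value of \<nu>' up to \<open>1 / K\<close>, and it is the same for both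
      indices of \<open>i\<close> because \<nu> is invariant.\<close>
    define s where "s = (\<lambda>j. \<Sum>t \<le> K. real t / real K * \<nu> {k \<in> ?\<Omega>. lev j k = t})"
    have approx: "\<bar>\<nu>' (Z j) - s j\<bar> \<le> 1 / real K" if j: "j \<in> J" for j
    proof -
      have lT: "p j \<le> K" if "p \<in> T" for p using that lev(2)[OF j] j by (auto simp: T_def pt_def)
      have "s j = (\<Sum>t \<le> K. \<Sum>p \<in> T. if p j = t then real t / real K * \<nu> (cls p) else 0)"
        unfolding s_def
      proof (rule sum.cong[OF refl])
        fix t
        have "\<nu> {k \<in> ?\<Omega>. lev j k = t} = (\<Sum>p \<in> T. \<nu> {k \<in> {k \<in> ?\<Omega>. lev j k = t}. pt k = p})"
          by (rule fin_add_fibres[OF \<nu> fT]) (auto simp: T_def)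
        also have "\<dots> = (\<Sum>p \<in> T. if p j = t then \<nu> (cls p) else 0)"
        proof (rule sum.cong[OF refl])
          fix p assume "p \<in> T"
          have "{k \<in> {k \<in> ?\<Omega>. lev j k = t}. pt k = p} = (if p j = t then cls p else {})"
            using j by (auto simp: cls_def pt_def)
          moreover have "\<nu> {} = 0" using fin_add_probD(3)[OF \<nu>, of "{}" "{}"] by simp
          ultimately show "\<nu> {k \<in> {k \<in> ?\<Omega>. lev j k = t}. pt k = p} = (if p j = t then \<nu> (cls p) else 0)" by simp
        qed
        finally show "real t / real K * \<nu> {k \<in> ?\<Omega>. lev j k = t} =
            (\<Sum>p \<in> T. if p j = t then real t / real K * \<nu> (cls p) else 0)"
          by (simp add: sum_distrib_left if_distrib cong: if_cong)
      qed
      also have "\<dots> = (\<Sum>p \<in> T. \<Sum>t \<le> K. if p j = t then real t / real K * \<nu> (cls p) else 0)" by (rule sum.swap)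
      also have "\<dots> = (\<Sum>p \<in> T. \<nu> (cls p) * (real (p j) / real K))"
        by (rule sum.cong[OF refl]) (use lT in \<open>simp add: sum.delta'\<close>)
      finally have sj: "s j = (\<Sum>p \<in> T. \<nu> (cls p) * (real (p j) / real K))" .
      have "Z j \<inter> ?\<Omega> = Z j" using ZG[OF j] by auto
      then have "\<nu>' (Z j) - s j = (\<Sum>p \<in> T. \<nu> (cls p) * (F j (rep p) - real (p j) / real K))"
        unfolding \<nu>'_def sj F_def by (simp add: sum_subtractf right_diff_distrib)
      also have "\<bar>\<dots>\<bar> \<le> (\<Sum>p \<in> T. \<bar>\<nu> (cls p) * (F j (rep p) - real (p j) / real K)\<bar>)" by (rule sum_abs)
      also have "\<dots> \<le> (\<Sum>p \<in> T. \<nu> (cls p) * (1 / real K))"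
      proof (rule sum_mono)
        fix p assume p: "p \<in> T"
        have "p j = lev j (rep p)" using rep p j by (metis pt_def)
        then have "\<bar>F j (rep p) - real (p j) / real K\<bar> \<le> 1 / real K" using lev(1)[OF j] rep p by simp
        then show "\<bar>\<nu> (cls p) * (F j (rep p) - real (p j) / real K)\<bar> \<le> \<nu> (cls p) * (1 / real K)"
          unfolding abs_mult abs_of_nonneg[OF cls0] by (rule mult_left_mono) (rule cls0)
      qed
      also have "\<dots> = 1 / real K" using cls1 by (simp add: sum_distrib_right[symmetric] sum_divide_distrib[symmetric])
      finally show ?thesis .
    qed
    have hi: "h i \<in> ?\<Omega>" "Y i \<subseteq> ?\<Omega>" using I i by auto
    \<comment> \<open>The source of invariance: replacing \<open>k\<close> by
      \<open>h i \<otimes> k\<close> cancels the translation by \<open>h i\<close>, so the level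
      sets of the two indices are translates of each other.\<close>
    have FF: "F (i, True) (h i \<otimes> k) = F (i, False) k" if k: "k \<in> ?\<Omega>" for k
    proof -
      have "inv (h i \<otimes> k) \<otimes> h i = inv k" using hi(1) k by (simp add: inv_mult_group m_assoc)
      then have "inv (h i \<otimes> k) <# (h i <# Y i) = inv k <# Y i"
        using lcos_m_assoc[OF hi(2), of "inv (h i \<otimes> k)" "h i"] hi(1) k by simp
      then show ?thesis by (simp add: F_def Z_def)
    qed
    have "{k \<in> ?\<Omega>. lev (i, True) k = t} = h i <# {k \<in> ?\<Omega>. lev (i, False) k = t}" for t
    proof (intro equalityI subsetI)
      fix k assume k: "k \<in> {k \<in> ?\<Omega>. lev (i, True) k = t}"
      have e: "k = h i \<otimes> (inv (h i) \<otimes> k)" using hi(1) k by (simp add: m_assoc[symmetric])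
      moreover have "lev (i, False) (inv (h i) \<otimes> k) = t"
        using FF[of "inv (h i) \<otimes> k"] e k hi(1) by (simp add: lev_def)
      moreover have "inv (h i) \<otimes> k \<in> ?\<Omega>" using k hi(1) by simp
      ultimately show "k \<in> h i <# {k \<in> ?\<Omega>. lev (i, False) k = t}" unfolding l_coset_def by blast
    next
      fix k assume "k \<in> h i <# {k \<in> ?\<Omega>. lev (i, False) k = t}"
      then show "k \<in> {k \<in> ?\<Omega>. lev (i, True) k = t}"
        using FF hi(1) by (auto simp: l_coset_def lev_def)
    qed
    then have "s (i, True) = s (i, False)"
      unfolding s_def using inv[OF hi(1)] by (intro sum.cong refl) simp
    moreover have "(i, True) \<in> J" "(i, False) \<in> J" using i by (simp_all add: J_def)
    ultimately have "\<bar>\<nu>' (Z (i, True)) - \<nu>' (Z (i, False))\<bar> \<le> 1 / real K + 1 / real K"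
      using approx[of "(i, True)"] approx[of "(i, False)"] by linarith
    then show ?thesis by (simp add: Z_def)
  qed
  ultimately show ?thesis by blast
qed

section \<open>Transfer between elementarily equivalent structures\<close>

lemma sat_FEx_pow: "sat K e ((FEx ^^ m) \<phi>) \<longleftrightarrow> (\<exists>a \<in> tuples (univ K) m. sat K (a @ e) \<phi>)"
proof (induction m arbitrary: e)
  case 0
  show ?case by (auto simp: tuples_def)
next
  case (Suc m)
  have "(\<exists>x \<in> univ K. \<exists>a \<in> tuples (univ K) m. sat K (a @ x # e) \<phi>) \<longleftrightarrow>
      (\<exists>a \<in> tuples (univ K) (Suc m). sat K (a @ e) \<phi>)" (is "?l = ?r")
  proof
    assume ?l
    then obtain x a where "x \<in> univ K" "a \<in> tuples (univ K) m" "sat K (a @ x # e) \<phi>" by blast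
    then show ?r by (intro bexI[of _ "a @ [x]"]) (auto simp: tuples_def)
  next
    assume ?r
    then obtain a where a: "a \<in> tuples (univ K) (Suc m)" "sat K (a @ e) \<phi>" by blast
    then have ne: "a \<noteq> []" by (auto simp: tuples_def)
    have "last a \<in> univ K" using a(1) ne last_in_set[OF ne] by (auto simp: tuples_def)
    moreover have "butlast a \<in> tuples (univ K) m" using a(1) by (auto simp: tuples_def dest: in_set_butlastD)
    moreover have "butlast a @ last a # e = a @ e" using ne by (metis append.assoc append_Cons append_Nil append_butlast_last_id)
    ultimately show ?l using a(2) by metis
  qed
  then show ?case using Suc by simp
qed

lemma form_FEx_pow: "form L n ((FEx ^^ m) \<phi>) \<longleftrightarrow> form L (m + n) \<phi>"
  by (induction m arbitrary: n) simp_all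

text \<open>Variables are pairs of a block and a coordinate, so that quantifiers over several tuples
  need no index arithmetic.\<close>

definition blk :: "(nat \<times> nat \<Rightarrow> 'a) \<Rightarrow> nat \<Rightarrow> nat \<Rightarrow> 'a list" where
  "blk s i l = map (\<lambda>c. s (i, c)) [0..<l]"

definition upd :: "nat \<Rightarrow> nat \<Rightarrow> nat \<Rightarrow> (nat \<Rightarrow> 'a list) \<Rightarrow> (nat \<times> nat \<Rightarrow> 'a) \<Rightarrow> nat \<times> nat \<Rightarrow> 'a" where
  "upd q p l g s = (\<lambda>(j, c). if q \<le> j \<and> j < q + p \<and> c < l then g (j - q) ! c else s (j, c))"

lemma blk_upd_in: "i < p \<Longrightarrow> length (g i) = l \<Longrightarrow> blk (upd q p l g s) (q + i) l = g i"
  by (auto simp: blk_def upd_def intro: nth_equalityI)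

lemma blk_upd_out: "j < q \<or> q + p \<le> j \<Longrightarrow> blk (upd q p l g s) j l' = blk s j l'"
  by (auto simp: blk_def upd_def)

lemma ex_upd_iff:
  assumes "\<And>v. s v \<in> A"
  shows "(\<exists>s'. (\<forall>v. v \<notin> {q..<q+p} \<times> {..<l} \<longrightarrow> s' v = s v) \<and> (\<forall>v \<in> {q..<q+p} \<times> {..<l}. s' v \<in> A) \<and> P s') \<longleftrightarrow>
    (\<exists>g. (\<forall>i < p. g i \<in> tuples A l) \<and> P (upd q p l g s))" (is "?l = ?r")
proof
  assume ?l
  then obtain s' where s': "\<forall>v. v \<notin> {q..<q+p} \<times> {..<l} \<longrightarrow> s' v = s v"
    "\<forall>v \<in> {q..<q+p} \<times> {..<l}. s' v \<in> A" "P s'" by blast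
  have "upd q p l (\<lambda>i. blk s' (q + i) l) s = s'"
    using s'(1) by (auto simp: upd_def blk_def fun_eq_iff)
  moreover have "\<forall>i < p. blk s' (q + i) l \<in> tuples A l" using s'(2) by (auto simp: blk_def tuples_def)
  ultimately show ?r using s'(3) by (intro exI[of _ "\<lambda>i. blk s' (q + i) l"]) simp
next
  assume ?r
  then obtain g where g: "\<forall>i < p. g i \<in> tuples A l" "P (upd q p l g s)" by blast
  have "g (j - q) ! c \<in> A" if "q \<le> j" "j < q + p" "c < l" for j c
  proof -
    have "g (j - q) \<in> tuples A l" using g(1) that by auto
    then show ?thesis using that by (auto simp: tuples_def)
  qed
  then show ?l using g(2) by (intro exI[of _ "upd q p l g s"]) (auto simp: upd_def)
qed

lemma ex_upd_1: "(\<exists>g. (\<forall>i < 1. g i \<in> T) \<and> P (upd q 1 l g s)) \<longleftrightarrow> (\<exists>x \<in> T. P (upd q 1 l (\<lambda>_. x) s))" (is "?l = ?r")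
proof
  assume ?l
  then obtain g where g: "g 0 \<in> T" "P (upd q 1 l g s)" by auto
  have "upd q 1 l g s = upd q 1 l (\<lambda>_. g 0) s" by (auto simp: upd_def fun_eq_iff)
  then show ?r using g by auto
qed auto

lemma sat_existential_closure:
  assumes f: "nwf L f" "set (snd f) \<subseteq> {..<m}" and K: "is_struct L K"
  shows "sat K [] ((FEx ^^ m) (nat_form f)) \<longleftrightarrow> (\<exists>s. (\<forall>v. s v \<in> univ K) \<and> holds K s f)"
proof -
  obtain u where u: "u \<in> univ K" using K by (auto simp: is_struct_def)
  have "sat K [] ((FEx ^^ m) (nat_form f)) \<longleftrightarrow> (\<exists>a \<in> tuples (univ K) m. holds K (\<lambda>i. a ! i) f)"
    unfolding sat_FEx_pow append_Nil2 sat_nat_form[OF f(1)] ..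
  also have "\<dots> \<longleftrightarrow> (\<exists>s. (\<forall>v. s v \<in> univ K) \<and> holds K s f)" (is "?l = ?r")
  proof
    assume ?l
    then obtain a where a: "a \<in> tuples (univ K) m" "holds K (\<lambda>i. a ! i) f" by blast
    let ?s = "\<lambda>i. if i < m then a ! i else u"
    have "holds K ?s f = holds K (\<lambda>i. a ! i) f" by (rule holds_cong) (use f(2) in auto)
    moreover have "\<forall>v. ?s v \<in> univ K" using a(1) u by (auto simp: tuples_def)
    ultimately show ?r using a(2) by (intro exI[of _ ?s]) simp
  next
    assume ?r
    then obtain s where s: "\<forall>v. s v \<in> univ K" "holds K s f" by blast
    have "holds K (\<lambda>i. map s [0..<m] ! i) f = holds K s f" by (rule holds_cong) (use f(2) in auto)
    moreover have "map s [0..<m] \<in> tuples (univ K) m" using s(1) by (auto simp: tuples_def)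
    ultimately show ?l using s(2) by blast
  qed
  finally show ?thesis .
qed

lemma ex_env_to_nat:
  fixes f :: "('f, 'r, 'v :: countable) nform"
  shows "(\<exists>s. (\<forall>v. s v \<in> A) \<and> holds K s (nMap to_nat f)) \<longleftrightarrow> (\<exists>s. (\<forall>v. s v \<in> A) \<and> holds K s f)" (is "?l = ?r")
proof
  assume ?l
  then obtain s where "\<forall>v. s v \<in> A" "holds K s (nMap to_nat f)" by blast
  then show ?r by (intro exI[of _ "s \<circ> to_nat"]) simp
next
  assume ?r
  then obtain s where "\<forall>v. s v \<in> A" "holds K s f" by blast
  moreover have "s \<circ> from_nat \<circ> to_nat = s" by (auto simp: fun_eq_iff)
  ultimately show ?l by (intro exI[of _ "s \<circ> from_nat"]) simp
qed

locale elem_equiv =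
  fixes L :: "('f, 'r) language" and N :: "('f, 'r, 'm) fo_struct" and M :: "('f, 'r, 'n) fo_struct"
  assumes N_struct: "is_struct L N" and M_struct: "is_struct L M"
    and equiv: "\<And>\<sigma>. sentence L \<sigma> \<Longrightarrow> sat N [] \<sigma> \<longleftrightarrow> sat M [] \<sigma>"
begin

text \<open>The two predicates are the readings in \<open>N\<close> and \<open>M\<close> of one
  formula without parameters. Transfer can then be carried out on HOL predicates without writing the
  formula down.\<close>

definition same :: "(('v \<Rightarrow> 'm) \<Rightarrow> bool) \<Rightarrow> (('v \<Rightarrow> 'n) \<Rightarrow> bool) \<Rightarrow> bool" where
  "same P P' \<longleftrightarrow> (\<exists>f :: ('f, 'r, 'v) nform. nwf L f \<and> (\<forall>s. (\<forall>v. s v \<in> univ N) \<longrightarrow> P s = holds N s f) \<and>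
     (\<forall>s. (\<forall>v. s v \<in> univ M) \<longrightarrow> P' s = holds M s f))"

lemma same_base: "form L (length vs) \<phi> \<Longrightarrow> same (\<lambda>s. sat N (map s vs) \<phi>) (\<lambda>s. sat M (map s vs) \<phi>)"
  unfolding same_def by (intro exI[of _ "(\<phi>, vs)"]) (simp add: nwf_def holds_def)

lemma same_not: assumes "same P P'" shows "same (\<lambda>s. \<not> P s) (\<lambda>s. \<not> P' s)"
proof -
  obtain f where "nwf L f" "\<forall>s. (\<forall>v. s v \<in> univ N) \<longrightarrow> P s = holds N s f"
    "\<forall>s. (\<forall>v. s v \<in> univ M) \<longrightarrow> P' s = holds M s f" using assms unfolding same_def by (elim exE conjE)
  then show ?thesis unfolding same_def by (intro exI[of _ "nNot f"]) simp
qed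

lemma same_conj:
  assumes "same P P'" "same Q Q'" shows "same (\<lambda>s. P s \<and> Q s) (\<lambda>s. P' s \<and> Q' s)"
proof -
  obtain f where f: "nwf L f" "\<forall>s. (\<forall>v. s v \<in> univ N) \<longrightarrow> P s = holds N s f"
    "\<forall>s. (\<forall>v. s v \<in> univ M) \<longrightarrow> P' s = holds M s f" using assms(1) unfolding same_def by (elim exE conjE)
  obtain g where g: "nwf L g" "\<forall>s. (\<forall>v. s v \<in> univ N) \<longrightarrow> Q s = holds N s g"
    "\<forall>s. (\<forall>v. s v \<in> univ M) \<longrightarrow> Q' s = holds M s g" using assms(2) unfolding same_def by (elim exE conjE)
  show ?thesis unfolding same_def
    by (intro exI[of _ "nAnd f g"]) (use f g in \<open>simp add: holds_nAnd[OF f(1) g(1)]\<close>)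
qed

lemma same_True: "same (\<lambda>s. True) (\<lambda>s. True)"
  unfolding same_def by (intro exI[of _ nTrue]) (simp add: holds_nTrue[OF N_struct] holds_nTrue[OF M_struct])

lemma same_ball: "finite I \<Longrightarrow> (\<And>i. i \<in> I \<Longrightarrow> same (P i) (P' i)) \<Longrightarrow> same (\<lambda>s. \<forall>i \<in> I. P i s) (\<lambda>s. \<forall>i \<in> I. P' i s)"
  by (induction I rule: finite_induct) (simp_all add: same_True same_conj)

lemma same_bex:
  assumes "finite I" "\<And>i. i \<in> I \<Longrightarrow> same (P i) (P' i)" shows "same (\<lambda>s. \<exists>i \<in> I. P i s) (\<lambda>s. \<exists>i \<in> I. P' i s)"
proof -
  have "same (\<lambda>s. \<forall>i \<in> I. \<not> P i s) (\<lambda>s. \<forall>i \<in> I. \<not> P' i s)" by (intro same_ball same_not assms)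
  from same_not[OF this] show ?thesis by simp
qed

lemma same_cong:
  assumes "same P P'" "\<And>s. (\<And>v. s v \<in> univ N) \<Longrightarrow> P s = Q s" "\<And>s. (\<And>v. s v \<in> univ M) \<Longrightarrow> P' s = Q' s"
  shows "same Q Q'"
proof -
  obtain f where f: "nwf L f" "\<forall>s. (\<forall>v. s v \<in> univ N) \<longrightarrow> P s = holds N s f"
    "\<forall>s. (\<forall>v. s v \<in> univ M) \<longrightarrow> P' s = holds M s f" using assms(1) unfolding same_def by (elim exE conjE)
  show ?thesis unfolding same_def by (intro exI[of _ f]) (use f assms(2,3) in simp)
qed

lemma same_ex:
  fixes P :: "(nat \<times> nat \<Rightarrow> 'm) \<Rightarrow> bool" and P' :: "(nat \<times> nat \<Rightarrow> 'n) \<Rightarrow> bool"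
  assumes "same P P'"
  shows "same (\<lambda>s. \<exists>g. (\<forall>i < p. g i \<in> tuples (univ N) l) \<and> P (upd q p l g s))
    (\<lambda>s. \<exists>g. (\<forall>i < p. g i \<in> tuples (univ M) l) \<and> P' (upd q p l g s))"
proof -
  obtain f where f: "nwf L f" "\<forall>s. (\<forall>v. s v \<in> univ N) \<longrightarrow> P s = holds N s f"
    "\<forall>s. (\<forall>v. s v \<in> univ M) \<longrightarrow> P' s = holds M s f" using assms(1) unfolding same_def by (elim exE conjE)
  define vs where "vs = List.product [q..<q+p] [0..<l]"
  have vs: "set vs = {q..<q+p} \<times> {..<l}" by (auto simp: vs_def)
  note E = holds_nExs[OF f(1), of vs, unfolded vs]
  have "same (\<lambda>s. \<exists>s'. (\<forall>v. v \<notin> {q..<q+p} \<times> {..<l} \<longrightarrow> s' v = s v) \<and> (\<forall>v \<in> {q..<q+p} \<times> {..<l}. s' v \<in> univ N) \<and> P s')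
    (\<lambda>s. \<exists>s'. (\<forall>v. v \<notin> {q..<q+p} \<times> {..<l} \<longrightarrow> s' v = s v) \<and> (\<forall>v \<in> {q..<q+p} \<times> {..<l}. s' v \<in> univ M) \<and> P' s')"
    unfolding same_def
  proof (intro exI[of _ "foldr nEx vs f"] conjI allI impI)
    show "nwf L (foldr nEx vs f)" using E by blast
  next
    fix s :: "nat \<times> nat \<Rightarrow> 'm" assume s: "\<forall>v. s v \<in> univ N"
    have "s' v \<in> univ N" if "\<forall>v. v \<notin> {q..<q+p} \<times> {..<l} \<longrightarrow> s' v = s v" "\<forall>v \<in> {q..<q+p} \<times> {..<l}. s' v \<in> univ N" for s' v
    proof (cases "v \<in> {q..<q+p} \<times> {..<l}")
      case True
      then show ?thesis by (rule bspec[OF that(2)])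
    next
      case False
      then have "s' v = s v" using that(1) by blast
      then show ?thesis using spec[OF s, of v] by (simp only:)
    qed
    then show "(\<exists>s'. (\<forall>v. v \<notin> {q..<q+p} \<times> {..<l} \<longrightarrow> s' v = s v) \<and> (\<forall>v \<in> {q..<q+p} \<times> {..<l}. s' v \<in> univ N) \<and> P s') =
        holds N s (foldr nEx vs f)"
      unfolding E[THEN conjunct2, THEN conjunct2] by (intro iff_exI conj_cong refl) (simp add: f(2))
  next
    fix s :: "nat \<times> nat \<Rightarrow> 'n" assume s: "\<forall>v. s v \<in> univ M"
    have "s' v \<in> univ M" if "\<forall>v. v \<notin> {q..<q+p} \<times> {..<l} \<longrightarrow> s' v = s v" "\<forall>v \<in> {q..<q+p} \<times> {..<l}. s' v \<in> univ M" for s' v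
    proof (cases "v \<in> {q..<q+p} \<times> {..<l}")
      case True
      then show ?thesis by (rule bspec[OF that(2)])
    next
      case False
      then have "s' v = s v" using that(1) by blast
      then show ?thesis using spec[OF s, of v] by (simp only:)
    qed
    then show "(\<exists>s'. (\<forall>v. v \<notin> {q..<q+p} \<times> {..<l} \<longrightarrow> s' v = s v) \<and> (\<forall>v \<in> {q..<q+p} \<times> {..<l}. s' v \<in> univ M) \<and> P' s') =
        holds M s (foldr nEx vs f)"
      unfolding E[THEN conjunct2, THEN conjunct2] by (intro iff_exI conj_cong refl) (simp add: f(3))
  qed
  then show ?thesis by (rule same_cong) (rule ex_upd_iff, assumption)+
qed

lemma same_ex_blk:
  assumes "same P P'"
  shows "same (\<lambda>s. \<exists>x \<in> tuples (univ N) l. P (upd q 1 l (\<lambda>_. x) s)) (\<lambda>s. \<exists>x \<in> tuples (univ M) l. P' (upd q 1 l (\<lambda>_. x) s))"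
  using same_ex[OF assms, of 1 l q] unfolding ex_upd_1 .

lemma transfer:
  fixes P :: "('v :: countable \<Rightarrow> 'm) \<Rightarrow> bool" and P' :: "('v \<Rightarrow> 'n) \<Rightarrow> bool"
  assumes "same P P'"
  shows "(\<exists>s. (\<forall>v. s v \<in> univ N) \<and> P s) \<longleftrightarrow> (\<exists>s. (\<forall>v. s v \<in> univ M) \<and> P' s)"
proof -
  obtain f where f: "nwf L f" "\<forall>s. (\<forall>v. s v \<in> univ N) \<longrightarrow> P s = holds N s f"
    "\<forall>s. (\<forall>v. s v \<in> univ M) \<longrightarrow> P' s = holds M s f" using assms unfolding same_def by (elim exE conjE)
  let ?g = "nMap to_nat f"
  have "finite (set (snd ?g))" by simp
  then obtain m where m: "set (snd ?g) \<subseteq> {..<m}" unfolding finite_nat_iff_bounded ..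
  have g: "nwf L ?g" using f(1) by simp
  have "sentence L ((FEx ^^ m) (nat_form ?g))" using form_nat_form[OF g m] by (simp add: form_FEx_pow)
  from equiv[OF this]
  have "(\<exists>s. (\<forall>v. s v \<in> univ N) \<and> holds N s f) \<longleftrightarrow> (\<exists>s. (\<forall>v. s v \<in> univ M) \<and> holds M s f)"
    unfolding sat_existential_closure[OF g m N_struct] sat_existential_closure[OF g m M_struct] ex_env_to_nat .
  then show ?thesis using f(2,3) by auto
qed

end

section \<open>Transfer of group configurations\<close>

definition meets :: "('f, 'r, 'm) fo_struct \<Rightarrow> nat \<Rightarrow> ('f, 'r) fo_form \<Rightarrow> 'm list \<Rightarrow> (nat \<Rightarrow> 'm list) \<Rightarrow> nat set \<Rightarrow> bool" where
  "meets K d \<tau> b g J \<longleftrightarrow> (\<exists>x \<in> tuples (univ K) d. \<forall>i \<in> J. sat K (x @ g i @ b) \<tau>)"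

text \<open>The \<open>(p,k)\<close>-property of the translates, as a first-order condition on the parameters \<open>b\<close>.\<close>

definition cond :: "('f, 'r, 'm) fo_struct \<Rightarrow> nat \<Rightarrow> ('f, 'r) fo_form \<Rightarrow> ('f, 'r) fo_form \<Rightarrow> nat \<Rightarrow> nat \<Rightarrow> 'm list \<Rightarrow> bool" where
  "cond K d \<gamma> \<tau> p k b \<longleftrightarrow> (\<forall>g. (\<forall>i < p. g i \<in> tuples (univ K) d) \<longrightarrow> (\<forall>i \<in> {..<p}. sat K (g i) \<gamma>) \<longrightarrow>
     (\<exists>I \<in> {I. I \<subseteq> {..<p} \<and> card I = k}. meets K d \<tau> b g I))"

text \<open>
  When \<open>\<chi> i\<close> defines \<open>Y i\<close> and \<open>\<theta> i\<close> its translate by \<open>h i\<close>, the indices \<open>(0,0)\<close>, \<open>(1,i)\<close>, \<open>(2,i)\<close> stand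
  for membership of \<open>x\<close> in \<open>X\<close>, \<open>Y i\<close> and \<open>h i Y i\<close>.
\<close>

definition lit :: "('f, 'r, 'm) fo_struct \<Rightarrow> nat \<Rightarrow> ('f, 'r) fo_form \<Rightarrow> (nat \<Rightarrow> ('f, 'r) fo_form) \<Rightarrow> (nat \<Rightarrow> ('f, 'r) fo_form) \<Rightarrow>
    'm list \<Rightarrow> (nat \<Rightarrow> 'm list) \<Rightarrow> (nat \<Rightarrow> 'm list) \<Rightarrow> nat \<times> nat \<Rightarrow> 'm list \<Rightarrow> bool" where
  "lit K d \<phi> \<chi> \<theta> b h e j x \<longleftrightarrow> (if fst j = 0 then sat K (x @ b) \<phi>
     else if fst j = 1 then sat K (x @ e (snd j)) (\<chi> (snd j))
     else sat K (x @ h (snd j) @ e (snd j)) (\<theta> (snd j)))"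

lemma meets_cong: "(\<And>i. i \<in> J \<Longrightarrow> g i = g' i) \<Longrightarrow> meets K d \<tau> b g J = meets K d \<tau> b g' J"
  by (simp add: meets_def)

lemma upd_mem:
  assumes "\<forall>i < p. g i \<in> tuples A l" "\<And>v. s v \<in> A" shows "upd q p l g s v \<in> A"
proof -
  have "g (j - q) ! c \<in> A" if "q \<le> j" "j < q + p" "c < l" for j c
  proof -
    have "g (j - q) \<in> tuples A l" using assms(1) that by auto
    then show ?thesis using that by (auto simp: tuples_def)
  qed
  then show ?thesis using assms(2) by (cases v) (auto simp: upd_def)
qed

lemma blk_tuples: "(\<And>v. s v \<in> A) \<Longrightarrow> blk s i l \<in> tuples A l"
  by (auto simp: blk_def tuples_def)

lemma blk_upd_same: "x \<in> tuples A l \<Longrightarrow> blk (upd q 1 l (\<lambda>_. x) s) q l = x"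
  using blk_upd_in[of 0 1 "\<lambda>_. x" l q s] by (simp add: tuples_def)

context elem_equiv
begin

lemma same_exI:
  assumes "same P P'" "\<And>g s. \<forall>i < p. g i \<in> tuples (univ N) l \<Longrightarrow> P (upd q p l g s) = Q g s"
    "\<And>g s. \<forall>i < p. g i \<in> tuples (univ M) l \<Longrightarrow> P' (upd q p l g s) = Q' g s"
  shows "same (\<lambda>s. \<exists>g. (\<forall>i < p. g i \<in> tuples (univ N) l) \<and> Q g s) (\<lambda>s. \<exists>g. (\<forall>i < p. g i \<in> tuples (univ M) l) \<and> Q' g s)"
  using same_ex[OF assms(1), of p l q] by (simp only: assms(2,3) cong: conj_cong)

lemma same_ex_blkI:
  assumes "same P P'" "\<And>x s. x \<in> tuples (univ N) l \<Longrightarrow> P (upd q 1 l (\<lambda>_. x) s) = Q x s"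
    "\<And>x s. x \<in> tuples (univ M) l \<Longrightarrow> P' (upd q 1 l (\<lambda>_. x) s) = Q' x s"
  shows "same (\<lambda>s. \<exists>x \<in> tuples (univ N) l. Q x s) (\<lambda>s. \<exists>x \<in> tuples (univ M) l. Q' x s)"
  using same_ex_blk[OF assms(1), of l q] by (simp only: assms(2,3) cong: bex_cong)

lemma same_sat:
  assumes "form L (sum_list (map snd bs)) \<phi>"
  shows "same (\<lambda>s. sat N (concat (map (\<lambda>(i, l). blk s i l) bs)) \<phi>) (\<lambda>s. sat M (concat (map (\<lambda>(i, l). blk s i l) bs)) \<phi>)"
proof -
  define vs where "vs = concat (map (\<lambda>(i, l). map (Pair i) [0..<l]) bs)"
  have "length vs = sum_list (map snd bs)" unfolding vs_def by (induction bs) auto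
  moreover have "map s vs = concat (map (\<lambda>(i, l). blk s i l) bs)" for s :: "nat \<times> nat \<Rightarrow> 'z"
    unfolding vs_def by (induction bs) (auto simp: blk_def)
  moreover have "map s vs = concat (map (\<lambda>(i, l). blk s i l) bs)" for s :: "nat \<times> nat \<Rightarrow> 'm"
    unfolding vs_def by (induction bs) (auto simp: blk_def)
  moreover have "map s vs = concat (map (\<lambda>(i, l). blk s i l) bs)" for s :: "nat \<times> nat \<Rightarrow> 'n"
    unfolding vs_def by (induction bs) (auto simp: blk_def)
  ultimately show ?thesis using same_base[of vs \<phi>] assms by simp
qed

lemma same_sat1: "form L l \<phi> \<Longrightarrow> same (\<lambda>s. sat N (blk s i l) \<phi>) (\<lambda>s. sat M (blk s i l) \<phi>)"
  using same_sat[of "[(i, l)]" \<phi>] by simp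

lemma same_sat2: "form L (l + l') \<phi> \<Longrightarrow> same (\<lambda>s. sat N (blk s i l @ blk s i' l') \<phi>) (\<lambda>s. sat M (blk s i l @ blk s i' l') \<phi>)"
  using same_sat[of "[(i, l), (i', l')]" \<phi>] by simp

lemma same_sat3: "form L (l + (l' + l'')) \<phi> \<Longrightarrow>
    same (\<lambda>s. sat N (blk s i l @ blk s i' l' @ blk s i'' l'') \<phi>) (\<lambda>s. sat M (blk s i l @ blk s i' l' @ blk s i'' l'') \<phi>)"
  using same_sat[of "[(i, l), (i', l'), (i'', l'')]" \<phi>] by simp

lemma same_meets:
  assumes \<tau>: "form L (d + (d + n)) \<tau>" and J: "J \<subseteq> {..<m}"
  shows "same (\<lambda>s. meets N d \<tau> (blk s 0 n) (\<lambda>i. blk s (1 + i) d) J) (\<lambda>s. meets M d \<tau> (blk s 0 n) (\<lambda>i. blk s (1 + i) d) J)"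
proof -
  have fJ: "finite J" using J by (rule finite_subset) simp
  have out': "blk (upd (1 + m) 1 d (\<lambda>_. x) s) 0 n = blk s 0 n"
    "i \<in> J \<Longrightarrow> blk (upd (1 + m) 1 d (\<lambda>_. x) s) (1 + i) d = blk s (1 + i) d" for x :: "'m list" and s i
    using J by (auto intro!: blk_upd_out)
  have out'': "blk (upd (1 + m) 1 d (\<lambda>_. x) s) 0 n = blk s 0 n"
    "i \<in> J \<Longrightarrow> blk (upd (1 + m) 1 d (\<lambda>_. x) s) (1 + i) d = blk s (1 + i) d" for x :: "'n list" and s i
    using J by (auto intro!: blk_upd_out)
  have "same (\<lambda>s. \<forall>i \<in> J. sat N (blk s (1 + m) d @ blk s (1 + i) d @ blk s 0 n) \<tau>)
      (\<lambda>s. \<forall>i \<in> J. sat M (blk s (1 + m) d @ blk s (1 + i) d @ blk s 0 n) \<tau>)"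
    by (intro same_ball fJ same_sat3 \<tau>)
  then show ?thesis
    unfolding meets_def
    by (rule same_ex_blkI[where q = "1 + m"]) (simp_all only: out' out'' blk_upd_same cong: ball_cong)
qed

lemma same_cond:
  assumes \<gamma>: "form L d \<gamma>" and \<tau>: "form L (d + (d + n)) \<tau>"
  shows "same (\<lambda>s. cond N d \<gamma> \<tau> p k (blk s 0 n)) (\<lambda>s. cond M d \<gamma> \<tau> p k (blk s 0 n))"
proof -
  let ?\<I> = "{I. I \<subseteq> {..<p} \<and> card I = k}"
  have f: "finite ?\<I>" by (rule finite_subset[of _ "Pow {..<p}"]) auto
  have "same (\<lambda>s. (\<forall>i \<in> {..<p}. sat N (blk s (1 + i) d) \<gamma>) \<and> (\<forall>I \<in> ?\<I>. \<not> meets N d \<tau> (blk s 0 n) (\<lambda>i. blk s (1 + i) d) I))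
      (\<lambda>s. (\<forall>i \<in> {..<p}. sat M (blk s (1 + i) d) \<gamma>) \<and> (\<forall>I \<in> ?\<I>. \<not> meets M d \<tau> (blk s 0 n) (\<lambda>i. blk s (1 + i) d) I))"
    by (intro same_conj same_ball same_not same_sat1 \<gamma> f finite_lessThan same_meets[OF \<tau>, of _ p]) auto
  then have "same (\<lambda>s. \<exists>g. (\<forall>i < p. g i \<in> tuples (univ N) d) \<and>
        (\<forall>i \<in> {..<p}. sat N (g i) \<gamma>) \<and> (\<forall>I \<in> ?\<I>. \<not> meets N d \<tau> (blk s 0 n) g I))
      (\<lambda>s. \<exists>g. (\<forall>i < p. g i \<in> tuples (univ M) d) \<and>
        (\<forall>i \<in> {..<p}. sat M (g i) \<gamma>) \<and> (\<forall>I \<in> ?\<I>. \<not> meets M d \<tau> (blk s 0 n) g I))"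
  proof (rule same_exI[where q = 1])
    fix g s assume g: "\<forall>i < p. g i \<in> tuples (univ N) d"
    have e: "blk (upd 1 p d g s) 0 n = blk s 0 n" by (intro blk_upd_out) simp
    have i: "blk (upd 1 p d g s) (1 + i) d = g i" if "i < p" for i
      using that g by (intro blk_upd_in) (auto simp: tuples_def)
    have "meets N d \<tau> (blk s 0 n) (\<lambda>i. blk (upd 1 p d g s) (1 + i) d) I = meets N d \<tau> (blk s 0 n) g I" if "I \<in> ?\<I>" for I
      using i that by (intro meets_cong) auto
    then show "((\<forall>i \<in> {..<p}. sat N (blk (upd 1 p d g s) (1 + i) d) \<gamma>) \<and>
        (\<forall>I \<in> ?\<I>. \<not> meets N d \<tau> (blk (upd 1 p d g s) 0 n) (\<lambda>i. blk (upd 1 p d g s) (1 + i) d) I)) \<longleftrightarrow>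
      (\<forall>i \<in> {..<p}. sat N (g i) \<gamma>) \<and> (\<forall>I \<in> ?\<I>. \<not> meets N d \<tau> (blk s 0 n) g I)"
      unfolding e using i by (intro arg_cong2[where f = "(\<and>)"] ball_cong refl) simp_all
  next
    fix g s assume g: "\<forall>i < p. g i \<in> tuples (univ M) d"
    have e: "blk (upd 1 p d g s) 0 n = blk s 0 n" by (intro blk_upd_out) simp
    have i: "blk (upd 1 p d g s) (1 + i) d = g i" if "i < p" for i
      using that g by (intro blk_upd_in) (auto simp: tuples_def)
    have "meets M d \<tau> (blk s 0 n) (\<lambda>i. blk (upd 1 p d g s) (1 + i) d) I = meets M d \<tau> (blk s 0 n) g I" if "I \<in> ?\<I>" for I
      using i that by (intro meets_cong) auto
    then show "((\<forall>i \<in> {..<p}. sat M (blk (upd 1 p d g s) (1 + i) d) \<gamma>) \<and>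
        (\<forall>I \<in> ?\<I>. \<not> meets M d \<tau> (blk (upd 1 p d g s) 0 n) (\<lambda>i. blk (upd 1 p d g s) (1 + i) d) I)) \<longleftrightarrow>
      (\<forall>i \<in> {..<p}. sat M (g i) \<gamma>) \<and> (\<forall>I \<in> ?\<I>. \<not> meets M d \<tau> (blk s 0 n) g I)"
      unfolding e using i by (intro arg_cong2[where f = "(\<and>)"] ball_cong refl) simp_all
  qed
  from same_not[OF this] show ?thesis by (rule same_cong) (auto simp only: cond_def)
qed

text \<open>For fixed \<open>m\<close> there are finitely many candidates in \<J>, so a
  counterexample consists of finitely many tuples subject to one first-order condition; one in
  \<open>M\<close> would yield one in \<open>N\<close>.\<close>

lemma cond_density_transfer:
  assumes \<gamma>: "form L d \<gamma>" and \<tau>: "form L (d + (d + n)) \<tau>" and \<J>: "\<J> \<subseteq> Pow {..<m}"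
    and N: "\<And>b g. b \<in> tuples (univ N) n \<Longrightarrow> cond N d \<gamma> \<tau> p k b \<Longrightarrow> \<forall>i < m. g i \<in> tuples (univ N) d \<Longrightarrow>
      \<forall>i < m. sat N (g i) \<gamma> \<Longrightarrow> \<exists>J \<in> \<J>. meets N d \<tau> b g J"
    and b: "b \<in> tuples (univ M) n" "cond M d \<gamma> \<tau> p k b"
    and g: "\<forall>i < m. g i \<in> tuples (univ M) d" "\<forall>i < m. sat M (g i) \<gamma>"
  shows "\<exists>J \<in> \<J>. meets M d \<tau> b g J"
proof (rule ccontr)
  assume neg: "\<not> ?thesis"
  have fJ: "finite \<J>" using \<J> by (rule finite_subset) simp
  have "same (\<lambda>s. cond N d \<gamma> \<tau> p k (blk s 0 n) \<and> (\<forall>i \<in> {..<m}. sat N (blk s (1 + i) d) \<gamma>) \<and>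
        (\<forall>J \<in> \<J>. \<not> meets N d \<tau> (blk s 0 n) (\<lambda>i. blk s (1 + i) d) J))
      (\<lambda>s. cond M d \<gamma> \<tau> p k (blk s 0 n) \<and> (\<forall>i \<in> {..<m}. sat M (blk s (1 + i) d) \<gamma>) \<and>
        (\<forall>J \<in> \<J>. \<not> meets M d \<tau> (blk s 0 n) (\<lambda>i. blk s (1 + i) d) J))"
    using \<J> by (intro same_conj same_ball same_not same_sat1 same_cond \<gamma> \<tau> fJ finite_lessThan same_meets[OF \<tau>, of _ m]) auto
  note T = transfer[OF this]
  obtain u where u: "u \<in> univ M" using M_struct by (auto simp: is_struct_def)
  define s where "s = upd 1 m d g (upd 0 1 n (\<lambda>_. b) (\<lambda>_. u))"
  have sM: "s v \<in> univ M" for v unfolding s_def by (intro upd_mem) (use b g u in auto)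
  have s0: "blk s 0 n = b" using b(1) unfolding s_def by (subst blk_upd_out) (simp, rule blk_upd_same)
  have sg: "blk s (1 + i) d = g i" if "i < m" for i
    using that g(1) unfolding s_def by (intro blk_upd_in) (auto simp: tuples_def)
  have "meets M d \<tau> b (\<lambda>i. blk s (1 + i) d) J = meets M d \<tau> b g J" if "J \<in> \<J>" for J
    using that \<J> sg by (intro meets_cong) auto
  then have "\<exists>s. (\<forall>v. s v \<in> univ M) \<and> cond M d \<gamma> \<tau> p k (blk s 0 n) \<and> (\<forall>i \<in> {..<m}. sat M (blk s (1 + i) d) \<gamma>) \<and>
        (\<forall>J \<in> \<J>. \<not> meets M d \<tau> (blk s 0 n) (\<lambda>i. blk s (1 + i) d) J)"
    using sM s0 sg b(2) g(2) neg by (intro exI[of _ s]) auto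
  with T obtain t where t: "\<forall>v. t v \<in> univ N" "cond N d \<gamma> \<tau> p k (blk t 0 n)" "\<forall>i \<in> {..<m}. sat N (blk t (1 + i) d) \<gamma>"
        "\<forall>J \<in> \<J>. \<not> meets N d \<tau> (blk t 0 n) (\<lambda>i. blk t (1 + i) d) J" by blast
  have bt: "blk t i l \<in> tuples (univ N) l" for i l by (rule blk_tuples) (rule t(1)[rule_format])
  have "\<exists>J \<in> \<J>. meets N d \<tau> (blk t 0 n) (\<lambda>i. blk t (1 + i) d) J"
    by (rule N) (use t bt in auto)
  then show False using t(4) by blast
qed

text \<open>The group axioms in \<open>M\<close> are given; what remains is existence and uniqueness
  of products, and a failure of either is witnessed by finitely many tuples.\<close>

lemma definable_group_transfer:
  assumes G: "definable_group L N d \<gamma> \<mu>" and grp: "Group.group (def_group M d \<gamma> \<mu>)"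
  shows "definable_group L M d \<gamma> \<mu>"
proof -
  have f: "form L d \<gamma>" "form L (d + (d + d)) \<mu>" using G by (auto simp: definable_group_def add.assoc)
  have ds: "a \<in> dset K d \<gamma> [] \<longleftrightarrow> a \<in> tuples (univ K) d \<and> sat K a \<gamma>" for a and K :: "('f, 'r, 'z) fo_struct"
    by (simp add: dset_def)
  have exN: "\<exists>!c. c \<in> dset N d \<gamma> [] \<and> sat N (a @ b @ c) \<mu>" if "a \<in> dset N d \<gamma> []" "b \<in> dset N d \<gamma> []" for a b
    using G that unfolding definable_group_def by blast
  have sx: "same (\<lambda>s. \<exists>x \<in> tuples (univ N) d. sat N x \<gamma> \<and> sat N (blk s 0 d @ blk s 1 d @ x) \<mu>)
      (\<lambda>s. \<exists>x \<in> tuples (univ M) d. sat M x \<gamma> \<and> sat M (blk s 0 d @ blk s 1 d @ x) \<mu>)"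
  proof -
    have "same (\<lambda>s. sat N (blk s 2 d) \<gamma> \<and> sat N (blk s 0 d @ blk s 1 d @ blk s 2 d) \<mu>)
      (\<lambda>s. sat M (blk s 2 d) \<gamma> \<and> sat M (blk s 0 d @ blk s 1 d @ blk s 2 d) \<mu>)"
      by (intro same_conj same_sat1 same_sat3 f)
    then show ?thesis
      by (rule same_ex_blkI[where q = 2]) (simp_all add: blk_upd_same[unfolded One_nat_def] blk_upd_out)
  qed
  have same1: "same (\<lambda>s. sat N (blk s 0 d) \<gamma> \<and> sat N (blk s 1 d) \<gamma> \<and>
       \<not> (\<exists>x \<in> tuples (univ N) d. sat N x \<gamma> \<and> sat N (blk s 0 d @ blk s 1 d @ x) \<mu>))
     (\<lambda>s. sat M (blk s 0 d) \<gamma> \<and> sat M (blk s 1 d) \<gamma> \<and>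
       \<not> (\<exists>x \<in> tuples (univ M) d. sat M x \<gamma> \<and> sat M (blk s 0 d @ blk s 1 d @ x) \<mu>))"
    by (intro same_conj same_not sx same_sat1 f)
  \<comment> \<open>Formulas compare single elements, so inequality of two products is expressed by
    a coordinate in which they differ.\<close>
  have same2: "same (\<lambda>s. sat N (blk s 0 d) \<gamma> \<and> sat N (blk s 1 d) \<gamma> \<and> sat N (blk s 2 d) \<gamma> \<and> sat N (blk s 3 d) \<gamma> \<and>
       sat N (blk s 0 d @ blk s 1 d @ blk s 2 d) \<mu> \<and> sat N (blk s 0 d @ blk s 1 d @ blk s 3 d) \<mu> \<and>
       (\<exists>i \<in> {..<d}. \<not> sat N (map s [(2, i), (3, i)]) (FEq (FVar 0) (FVar 1))))
     (\<lambda>s. sat M (blk s 0 d) \<gamma> \<and> sat M (blk s 1 d) \<gamma> \<and> sat M (blk s 2 d) \<gamma> \<and> sat M (blk s 3 d) \<gamma> \<and>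
       sat M (blk s 0 d @ blk s 1 d @ blk s 2 d) \<mu> \<and> sat M (blk s 0 d @ blk s 1 d @ blk s 3 d) \<mu> \<and>
       (\<exists>i \<in> {..<d}. \<not> sat M (map s [(2, i), (3, i)]) (FEq (FVar 0) (FVar 1))))"
    by (intro same_conj same_bex same_not same_base same_sat1 same_sat3 f) auto
  obtain u where u: "u \<in> univ M" using M_struct by (auto simp: is_struct_def)
  have build: "\<exists>s. (\<forall>v. s v \<in> univ M) \<and> (\<forall>i < 4. blk s i d = g i)" if "\<forall>i < 4. g i \<in> tuples (univ M) d" for g
  proof (intro exI[of _ "upd 0 4 d g (\<lambda>_. u)"] conjI allI impI)
    show "upd 0 4 d g (\<lambda>_. u) v \<in> univ M" for v by (intro upd_mem) (use that u in auto)
    show "blk (upd 0 4 d g (\<lambda>_. u)) i d = g i" if i: "i < 4" for i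
      using blk_upd_in[of i 4 g d 0] i \<open>\<forall>i < 4. g i \<in> tuples (univ M) d\<close> by (simp add: tuples_def)
  qed
  have tN: "blk s i d \<in> dset N d \<gamma> []" if "\<forall>v. s v \<in> univ N" "sat N (blk s i d) \<gamma>" for s i
    using that(2) blk_tuples[of s "univ N" i d, OF that(1)[rule_format]] by (simp add: dset_def)
  have "\<exists>!c. c \<in> dset M d \<gamma> [] \<and> sat M (a @ b @ c) \<mu>" if ab: "a \<in> dset M d \<gamma> []" "b \<in> dset M d \<gamma> []" for a b
  proof -
    have "\<exists>x \<in> tuples (univ M) d. sat M x \<gamma> \<and> sat M (a @ b @ x) \<mu>"
    proof (rule ccontr)
      assume neg: "\<not> ?thesis"
      have "\<forall>i < 4. (\<lambda>i :: nat. if i = 0 then a else b) i \<in> tuples (univ M) d" using ab by (auto simp: dset_def)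
      from build[OF this] obtain s where s: "\<forall>v. s v \<in> univ M" "\<forall>i < 4. blk s i d = (\<lambda>i :: nat. if i = 0 then a else b) i"
        by (elim exE conjE)
      have "blk s 0 d = a" "blk s 1 d = b" using s(2) by simp_all
      then have "\<exists>s. (\<forall>v. s v \<in> univ M) \<and> sat M (blk s 0 d) \<gamma> \<and> sat M (blk s 1 d) \<gamma> \<and>
       \<not> (\<exists>x \<in> tuples (univ M) d. sat M x \<gamma> \<and> sat M (blk s 0 d @ blk s 1 d @ x) \<mu>)"
        using s(1) ab neg by (intro exI[of _ s]) (simp add: dset_def)
      then obtain t where t: "\<forall>v. t v \<in> univ N" "sat N (blk t 0 d) \<gamma>" "sat N (blk t 1 d) \<gamma>"
        "\<not> (\<exists>x \<in> tuples (univ N) d. sat N x \<gamma> \<and> sat N (blk t 0 d @ blk t 1 d @ x) \<mu>)"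
        unfolding transfer[OF same1, symmetric] by (elim exE conjE)
      from exN[OF tN[OF t(1,2)] tN[OF t(1,3)]] show False using t(4) by (auto simp: dset_def)
    qed
    then obtain c where c: "c \<in> tuples (univ M) d" "sat M c \<gamma>" "sat M (a @ b @ c) \<mu>" by blast
    have "c' = c" if c': "c' \<in> tuples (univ M) d" "sat M c' \<gamma>" "sat M (a @ b @ c') \<mu>" for c'
    proof (rule ccontr)
      assume ne: "c' \<noteq> c"
      have "\<forall>i < 4. (\<lambda>i :: nat. if i = 0 then a else if i = 1 then b else if i = 2 then c else c') i \<in> tuples (univ M) d" using ab c c' by (auto simp: dset_def)
      from build[OF this] obtain s where s: "\<forall>v. s v \<in> univ M" "\<forall>i < 4. blk s i d = (\<lambda>i :: nat. if i = 0 then a else if i = 1 then b else if i = 2 then c else c') i"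
        by (elim exE conjE)
      have bs: "blk s 0 d = a" "blk s 1 d = b" "blk s 2 d = c" "blk s 3 d = c'" using s(2) by simp_all
      have "\<exists>i \<in> {..<d}. s (2, i) \<noteq> s (3, i)"
      proof (rule ccontr)
        assume "\<not> ?thesis"
        then have "blk s 2 d = blk s 3 d" by (simp add: blk_def)
        then show False using bs(3,4) ne by simp
      qed
      then have "\<exists>s. (\<forall>v. s v \<in> univ M) \<and> sat M (blk s 0 d) \<gamma> \<and> sat M (blk s 1 d) \<gamma> \<and> sat M (blk s 2 d) \<gamma> \<and> sat M (blk s 3 d) \<gamma> \<and>
       sat M (blk s 0 d @ blk s 1 d @ blk s 2 d) \<mu> \<and> sat M (blk s 0 d @ blk s 1 d @ blk s 3 d) \<mu> \<and>
       (\<exists>i \<in> {..<d}. \<not> sat M (map s [(2, i), (3, i)]) (FEq (FVar 0) (FVar 1)))"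
        using s(1) ab c c' by (intro exI[of _ s]) (simp add: dset_def bs[unfolded One_nat_def])
      then obtain t where t: "\<forall>v. t v \<in> univ N" "sat N (blk t 0 d) \<gamma>" "sat N (blk t 1 d) \<gamma>" "sat N (blk t 2 d) \<gamma>" "sat N (blk t 3 d) \<gamma>"
        "sat N (blk t 0 d @ blk t 1 d @ blk t 2 d) \<mu>" "sat N (blk t 0 d @ blk t 1 d @ blk t 3 d) \<mu>"
        "\<exists>i \<in> {..<d}. \<not> sat N (map t [(2, i), (3, i)]) (FEq (FVar 0) (FVar 1))"
        unfolding transfer[OF same2, symmetric] by (elim exE conjE)
      have "blk t 2 d = blk t 3 d"
        using exN[OF tN[OF t(1,2)] tN[OF t(1,3)]] tN[OF t(1,4)] tN[OF t(1,5)] t(6,7) by blast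
      then have "\<forall>i \<in> {..<d}. t (2, i) = t (3, i)" by (simp add: blk_def)
      then show False using t(8) by simp
    qed
    note uniq = this
    show ?thesis
    proof (rule ex1I[of _ c])
      show "c \<in> dset M d \<gamma> [] \<and> sat M (a @ b @ c) \<mu>" using c by (simp add: dset_def)
      show "c' = c" if "c' \<in> dset M d \<gamma> [] \<and> sat M (a @ b @ c') \<mu>" for c'
        by (rule uniq) (use that in \<open>simp_all add: dset_def\<close>)
    qed
  qed
  note ex = this
  have f': "form L (d + d + d) \<mu>" using G by (simp add: definable_group_def)
  show ?thesis
    unfolding definable_group_def by (intro conjI ballI f(1) f' grp ex)
qed

text \<open>All parameters are quantified existentially at once. As \<open>A\<close> and
  \<open>J\<close> are finite, that every group element has a pattern in \<open>A\<close> is one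
  first-order condition on them; it excludes new patterns in \<open>M\<close>.\<close>

lemma pattern_transfer:
  assumes \<gamma>: "form L d \<gamma>" and \<tau>: "form L (d + (d + n)) \<tau>" and \<phi>: "form L (d + n) \<phi>"
    and \<chi>: "\<And>i. i < r \<Longrightarrow> form L (d + l i) (\<chi> i)" and \<theta>: "\<And>i. i < r \<Longrightarrow> form L (d + (d + l i)) (\<theta> i)"
    and A: "finite A" and J: "J = insert (0, 0) ({1, 2} \<times> {..<r})"
    and b: "b \<in> tuples (univ N) n" "cond N d \<gamma> \<tau> p k b"
    and h: "\<And>i. i < r \<Longrightarrow> h i \<in> tuples (univ N) d \<and> sat N (h i) \<gamma>"
    and e: "\<And>i. i < r \<Longrightarrow> e i \<in> tuples (univ N) (l i)"
    and cover: "\<And>x. x \<in> tuples (univ N) d \<Longrightarrow> sat N x \<gamma> \<Longrightarrow> \<exists>\<sigma> \<in> A. \<forall>j \<in> J. j \<in> \<sigma> \<longleftrightarrow> lit N d \<phi> \<chi> \<theta> b h e j x"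
  shows "\<exists>b' h' e'. b' \<in> tuples (univ M) n \<and> cond M d \<gamma> \<tau> p k b' \<and>
    (\<forall>i < r. h' i \<in> tuples (univ M) d \<and> sat M (h' i) \<gamma> \<and> e' i \<in> tuples (univ M) (l i)) \<and>
    (\<forall>x \<in> tuples (univ M) d. sat M x \<gamma> \<longrightarrow> (\<exists>\<sigma> \<in> A. \<forall>j \<in> J. j \<in> \<sigma> \<longleftrightarrow> lit M d \<phi> \<chi> \<theta> b' h' e' j x))"
proof -
  let ?q = "1 + r + r"
  have fJ: "finite J" unfolding J by simp
  have lit: "same (\<lambda>s. lit N d \<phi> \<chi> \<theta> (blk s 0 n) (\<lambda>i. blk s (1 + i) d) (\<lambda>i. blk s (1 + r + i) (l i)) j (blk s ?q d))
     (\<lambda>s. lit M d \<phi> \<chi> \<theta> (blk s 0 n) (\<lambda>i. blk s (1 + i) d) (\<lambda>i. blk s (1 + r + i) (l i)) j (blk s ?q d))" if j: "j \<in> J" for j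
  proof -
    consider "j = (0, 0)" | i where "j = (1, i)" "i < r" | i where "j = (2, i)" "i < r" using j J by auto
    then show ?thesis
    proof cases
      case 1
      then show ?thesis using same_sat2[OF \<phi>] by (simp add: lit_def)
    next
      case 2
      then show ?thesis using same_sat2[OF \<chi>[OF 2(2)]] by (simp add: lit_def)
    next
      case 3
      then show ?thesis using same_sat3[OF \<theta>[OF 3(2)]] by (simp add: lit_def)
    qed
  qed
  have iff: "same (\<lambda>s. (j \<in> \<sigma>) \<longleftrightarrow> P s) (\<lambda>s. (j \<in> \<sigma>) \<longleftrightarrow> P' s)" if "same P P'" for P P' and j :: "nat \<times> nat" and \<sigma>
    using that same_not[OF that] by (cases "j \<in> \<sigma>") simp_all
  have "same (\<lambda>s. sat N (blk s ?q d) \<gamma> \<and> \<not> (\<exists>\<sigma> \<in> A. \<forall>j \<in> J. j \<in> \<sigma> \<longleftrightarrow>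
        lit N d \<phi> \<chi> \<theta> (blk s 0 n) (\<lambda>i. blk s (1 + i) d) (\<lambda>i. blk s (1 + r + i) (l i)) j (blk s ?q d)))
     (\<lambda>s. sat M (blk s ?q d) \<gamma> \<and> \<not> (\<exists>\<sigma> \<in> A. \<forall>j \<in> J. j \<in> \<sigma> \<longleftrightarrow>
        lit M d \<phi> \<chi> \<theta> (blk s 0 n) (\<lambda>i. blk s (1 + i) d) (\<lambda>i. blk s (1 + r + i) (l i)) j (blk s ?q d)))"
    by (intro same_conj same_not same_bex same_ball iff same_sat1 \<gamma> A fJ lit)
  note S0 = this
  have litN: "lit N d \<phi> \<chi> \<theta> (blk (upd ?q 1 d (\<lambda>_. x) s) 0 n) (\<lambda>i. blk (upd ?q 1 d (\<lambda>_. x) s) (1 + i) d)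
      (\<lambda>i. blk (upd ?q 1 d (\<lambda>_. x) s) (1 + r + i) (l i)) j x =
      lit N d \<phi> \<chi> \<theta> (blk s 0 n) (\<lambda>i. blk s (1 + i) d) (\<lambda>i. blk s (1 + r + i) (l i)) j x" if "j \<in> J" for x s j
    using that unfolding J lit_def by (auto simp: blk_upd_out)
  have litM: "lit M d \<phi> \<chi> \<theta> (blk (upd ?q 1 d (\<lambda>_. x) s) 0 n) (\<lambda>i. blk (upd ?q 1 d (\<lambda>_. x) s) (1 + i) d)
      (\<lambda>i. blk (upd ?q 1 d (\<lambda>_. x) s) (1 + r + i) (l i)) j x =
      lit M d \<phi> \<chi> \<theta> (blk s 0 n) (\<lambda>i. blk s (1 + i) d) (\<lambda>i. blk s (1 + r + i) (l i)) j x" if "j \<in> J" for x s j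
    using that unfolding J lit_def by (auto simp: blk_upd_out)
  have all: "same (\<lambda>s. \<forall>x \<in> tuples (univ N) d. sat N x \<gamma> \<longrightarrow> (\<exists>\<sigma> \<in> A. \<forall>j \<in> J. j \<in> \<sigma> \<longleftrightarrow>
        lit N d \<phi> \<chi> \<theta> (blk s 0 n) (\<lambda>i. blk s (1 + i) d) (\<lambda>i. blk s (1 + r + i) (l i)) j x))
     (\<lambda>s. \<forall>x \<in> tuples (univ M) d. sat M x \<gamma> \<longrightarrow> (\<exists>\<sigma> \<in> A. \<forall>j \<in> J. j \<in> \<sigma> \<longleftrightarrow>
        lit M d \<phi> \<chi> \<theta> (blk s 0 n) (\<lambda>i. blk s (1 + i) d) (\<lambda>i. blk s (1 + r + i) (l i)) j x))"
  proof -
    have "same (\<lambda>s. \<exists>x \<in> tuples (univ N) d. sat N x \<gamma> \<and> \<not> (\<exists>\<sigma> \<in> A. \<forall>j \<in> J. j \<in> \<sigma> \<longleftrightarrow>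
        lit N d \<phi> \<chi> \<theta> (blk s 0 n) (\<lambda>i. blk s (1 + i) d) (\<lambda>i. blk s (1 + r + i) (l i)) j x))
      (\<lambda>s. \<exists>x \<in> tuples (univ M) d. sat M x \<gamma> \<and> \<not> (\<exists>\<sigma> \<in> A. \<forall>j \<in> J. j \<in> \<sigma> \<longleftrightarrow>
        lit M d \<phi> \<chi> \<theta> (blk s 0 n) (\<lambda>i. blk s (1 + i) d) (\<lambda>i. blk s (1 + r + i) (l i)) j x))"
      by (rule same_ex_blkI[OF S0, where q = ?q]) (simp_all only: blk_upd_same litN litM cong: ball_cong)
    from same_not[OF this] show ?thesis by (rule same_cong) blast+
  qed
  have S: "same (\<lambda>s. cond N d \<gamma> \<tau> p k (blk s 0 n) \<and> (\<forall>i \<in> {..<r}. sat N (blk s (1 + i) d) \<gamma>) \<and>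
      (\<forall>x \<in> tuples (univ N) d. sat N x \<gamma> \<longrightarrow> (\<exists>\<sigma> \<in> A. \<forall>j \<in> J. j \<in> \<sigma> \<longleftrightarrow>
        lit N d \<phi> \<chi> \<theta> (blk s 0 n) (\<lambda>i. blk s (1 + i) d) (\<lambda>i. blk s (1 + r + i) (l i)) j x)))
     (\<lambda>s. cond M d \<gamma> \<tau> p k (blk s 0 n) \<and> (\<forall>i \<in> {..<r}. sat M (blk s (1 + i) d) \<gamma>) \<and>
      (\<forall>x \<in> tuples (univ M) d. sat M x \<gamma> \<longrightarrow> (\<exists>\<sigma> \<in> A. \<forall>j \<in> J. j \<in> \<sigma> \<longleftrightarrow>
        lit M d \<phi> \<chi> \<theta> (blk s 0 n) (\<lambda>i. blk s (1 + i) d) (\<lambda>i. blk s (1 + r + i) (l i)) j x)))"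
    by (intro same_conj same_ball same_sat1 same_cond all \<gamma> \<tau> finite_lessThan)
  obtain u where u: "u \<in> univ N" using N_struct by (auto simp: is_struct_def)
  \<comment> \<open>Block 0 holds \<open>b\<close>, blocks 1 to \<open>r\<close> the group elements
    \<open>h\<close>, and the next \<open>r\<close> blocks the parameters \<open>e\<close>; block
    \<open>?q\<close> is left for the point \<open>x\<close>.\<close>
  define w where "w = (\<lambda>j. if j = 0 then b else if j \<le> r then h (j - 1) else if j < ?q then e (j - 1 - r) else [])"
  define s where "s = (\<lambda>(j, c). if c < length (w j) then w j ! c else u)"
  have wN: "set (w j) \<subseteq> univ N" for j
  proof -
    have "h (j - 1) \<in> tuples (univ N) d" if "j \<noteq> 0" "j \<le> r" using h[of "j - 1"] that by auto
    moreover have "e (j - 1 - r) \<in> tuples (univ N) (l (j - 1 - r))" if "\<not> j \<le> r" "j < ?q" using e[of "j - 1 - r"] that by auto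
    ultimately show ?thesis using b(1) by (auto simp: w_def tuples_def split: if_splits)
  qed
  have sN: "s v \<in> univ N" for v using wN u by (cases v) (auto simp: s_def dest: nth_mem)
  have sb: "blk s j (length (w j)) = w j" for j by (auto simp: blk_def s_def intro: nth_equalityI)
  have s0: "blk s 0 n = b" using sb[of 0] b(1) by (simp add: w_def tuples_def)
  have sh: "blk s (1 + i) d = h i" if "i < r" for i using sb[of "1 + i"] h[OF that] that by (simp add: w_def tuples_def)
  have se: "blk s (1 + r + i) (l i) = e i" if "i < r" for i using sb[of "1 + r + i"] e[OF that] that by (simp add: w_def tuples_def)
  have lits: "lit N d \<phi> \<chi> \<theta> b (\<lambda>i. blk s (1 + i) d) (\<lambda>i. blk s (1 + r + i) (l i)) j x = lit N d \<phi> \<chi> \<theta> b h e j x" if "j \<in> J" for j x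
    using that sh se unfolding J lit_def by auto
  have "\<exists>s. (\<forall>v. s v \<in> univ N) \<and> cond N d \<gamma> \<tau> p k (blk s 0 n) \<and> (\<forall>i \<in> {..<r}. sat N (blk s (1 + i) d) \<gamma>) \<and>
      (\<forall>x \<in> tuples (univ N) d. sat N x \<gamma> \<longrightarrow> (\<exists>\<sigma> \<in> A. \<forall>j \<in> J. j \<in> \<sigma> \<longleftrightarrow>
        lit N d \<phi> \<chi> \<theta> (blk s 0 n) (\<lambda>i. blk s (1 + i) d) (\<lambda>i. blk s (1 + r + i) (l i)) j x))"
  proof (intro exI[of _ s] conjI ballI allI impI)
    fix x assume "x \<in> tuples (univ N) d" "sat N x \<gamma>"
    from cover[OF this] show "\<exists>\<sigma> \<in> A. \<forall>j \<in> J. j \<in> \<sigma> \<longleftrightarrow>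
        lit N d \<phi> \<chi> \<theta> (blk s 0 n) (\<lambda>i. blk s (1 + i) d) (\<lambda>i. blk s (1 + r + i) (l i)) j x"
      unfolding s0 by (simp only: lits cong: ball_cong)
  qed (use sN s0 b(2) sh h in auto)
  then obtain t where t: "\<forall>v. t v \<in> univ M" "cond M d \<gamma> \<tau> p k (blk t 0 n)" "\<forall>i \<in> {..<r}. sat M (blk t (1 + i) d) \<gamma>"
      "\<forall>x \<in> tuples (univ M) d. sat M x \<gamma> \<longrightarrow> (\<exists>\<sigma> \<in> A. \<forall>j \<in> J. j \<in> \<sigma> \<longleftrightarrow>
        lit M d \<phi> \<chi> \<theta> (blk t 0 n) (\<lambda>i. blk t (1 + i) d) (\<lambda>i. blk t (1 + r + i) (l i)) j x)"
    unfolding transfer[OF S] by (elim exE conjE)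
  have bt: "blk t i l \<in> tuples (univ M) l" for i l by (rule blk_tuples) (rule t(1)[rule_format])
  show ?thesis
    by (rule exI[of _ "blk t 0 n"], rule exI[of _ "\<lambda>i. blk t (1 + i) d"], rule exI[of _ "\<lambda>i. blk t (1 + r + i) (l i)"])
      (use t bt in auto)
qed

end

section \<open>Invariant Keisler measures\<close>

lemma dset_mem: "a \<in> dset K d \<gamma> [] \<longleftrightarrow> a \<in> tuples (univ K) d \<and> sat K a \<gamma>"
  by (simp add: dset_def)

lemma definable_ring:
  assumes "is_struct L N" shows "set_ring (tuples (univ N) d) (definable L N d)"
proof
  have "dset N d (FEx (FEq (FVar 0) (FVar 0))) [] = tuples (univ N) d"
    using assms by (auto simp: dset_def is_struct_def)
  moreover have "form L (d + 0) (FEx (FEq (FVar 0) (FVar 0)))" by simp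
  moreover have "[] \<in> tuples (univ N) 0" by (simp add: tuples_def)
  ultimately show "tuples (univ N) d \<in> definable L N d" unfolding definable_def by blast
next
  fix A assume "A \<in> definable L N d"
  then show "A \<subseteq> tuples (univ N) d" by (auto simp: definable_def dset_def)
next
  fix A B assume "A \<in> definable L N d" "B \<in> definable L N d"
  then obtain \<phi> m a \<psi> n b where A: "form L (d + m) \<phi>" "a \<in> tuples (univ N) m" "A = dset N d \<phi> a"
    and B: "form L (d + n) \<psi>" "b \<in> tuples (univ N) n" "B = dset N d \<psi> b"
    unfolding definable_def by blast
  \<comment> \<open>The parameters of \<psi> move behind those of \<phi>, so that both formulas read
    one common list.\<close>
  define \<psi>' where "\<psi>' = ren (\<lambda>i. if i < d then i else i + m) \<psi>"
  have f: "form L (d + (m + n)) \<psi>'" unfolding \<psi>'_def by (rule form_ren[OF B(1)]) auto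
  have f': "form L (d + (m + n)) \<phi>" using A(1) by (rule form_mono) simp
  have ab: "a @ b \<in> tuples (univ N) (m + n)" using A(2) B(2) by (auto simp: tuples_def)
  have s: "sat N (x @ a @ b) \<psi>' = sat N (x @ b) \<psi>" if "x \<in> tuples (univ N) d" for x
    unfolding \<psi>'_def by (rule sat_ren[OF B(1)]) (use that A(2) in \<open>auto simp: tuples_def nth_append\<close>)
  have s': "sat N (x @ a @ b) \<phi> = sat N (x @ a) \<phi>" if "x \<in> tuples (univ N) d" for x
    using sat_append[of L "x @ a" \<phi> N b] A(1,2) that by (simp add: tuples_def)
  have "A \<inter> B = dset N d (FAnd \<phi> \<psi>') (a @ b)" unfolding A(3) B(3) using s s' by (auto simp: dset_def)
  moreover have "form L (d + (m + n)) (FAnd \<phi> \<psi>')" using f f' by simp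
  ultimately show "A \<inter> B \<in> definable L N d" unfolding definable_def using ab by blast
  have "A - B = dset N d (FAnd \<phi> (FNot \<psi>')) (a @ b)" unfolding A(3) B(3) using s s' by (auto simp: dset_def)
  moreover have "form L (d + (m + n)) (FAnd \<phi> (FNot \<psi>'))" using f f' by simp
  ultimately show "A - B \<in> definable L N d" unfolding definable_def using ab by blast
qed

lemma translate_definable:
  assumes G: "definable_group L N d \<gamma> \<mu>" and Y: "Y \<in> definable L N d" "Y \<subseteq> carrier (def_group N d \<gamma> \<mu>)"
    and g: "g \<in> carrier (def_group N d \<gamma> \<mu>)"
  shows "g <#\<^bsub>def_group N d \<gamma> \<mu>\<^esub> Y \<in> definable L N d"
proof -
  obtain \<chi> l e where e: "form L (d + l) \<chi>" "e \<in> tuples (univ N) l" "Y = dset N d \<chi> e"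
    using Y(1) unfolding definable_def by blast
  have f: "form L d \<gamma>" "form L (d + d + d) \<mu>" using G by (auto simp: definable_group_def)
  have "g <#\<^bsub>def_group N d \<gamma> \<mu>\<^esub> Y = dset N d (tr_form d l \<gamma> \<mu> \<chi>) (g @ e)"
    using dset_tr_form[OF G e(1) g e(2)] Y(2) e(3) by (simp add: Int_absorb2)
  moreover have "g @ e \<in> tuples (univ N) (d + l)" using g e(2) by (auto simp: carrier_def_group dset_def tuples_def)
  ultimately show ?thesis unfolding definable_def using form_tr_form[OF f e(1)] by blast
qed

lemma non_null_imp_not_G_divides:
  assumes N: "is_struct L N" and G: "definable_group L N d \<gamma> \<mu>"
    and X: "X \<in> definable L N d" "X \<subseteq> carrier (def_group N d \<gamma> \<mu>)"
    and nn: "non_null L N d (def_group N d \<gamma> \<mu>) X"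
  shows "\<not> G_divides (def_group N d \<gamma> \<mu>) X"
proof
  let ?G = "def_group N d \<gamma> \<mu>"
  assume "G_divides ?G X"
  then obtain g :: "nat \<Rightarrow> _" and k where g: "\<And>i. g i \<in> carrier ?G" "k_inconsistent k (\<lambda>i. g i <#\<^bsub>?G\<^esub> X)"
    unfolding G_divides_def by blast
  obtain \<nu> where \<nu>: "fin_add_prob (tuples (univ N) d) (definable L N d) \<nu>" "0 < \<nu> X"
    "\<forall>g \<in> carrier ?G. \<forall>Y \<in> definable L N d. Y \<subseteq> carrier ?G \<longrightarrow> \<nu> (g <#\<^bsub>?G\<^esub> Y) = \<nu> Y"
    using nn unfolding non_null_def keisler_measure_def by blast
  have "\<nu> X \<le> 0"
    by (rule set_ring.measure_k_inconsistent[OF definable_ring[OF N] \<nu>(1) _ _ g(2)])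
      (use translate_definable[OF G X g(1)] \<nu>(3) X g(1) in auto)
  then show False using \<nu>(2) by simp
qed

context def_subset
begin

text \<open>
  For parameters in \<open>M\<close> transferred from \<open>N\<close>, the sets \<open>X\<close>, \<open>Y i\<close>, \<open>h i Y i\<close> have no nonempty atoms besides
  those they have in \<open>N\<close>. So the measure in \<open>M\<close>, which need only be defined on these atoms, can be
  carried over to points of \<open>N\<close> chosen in the atoms.
\<close>

lemma finite_invariant_measure:
  fixes M :: "('f, 'r, 'n) fo_struct" and r :: nat
  assumes E: "elem_equiv L N M" and GM: "definable_group L M d \<gamma> \<mu>"
    and cond: "cond N d \<gamma> tr p k b"
    and XM: "\<And>b' r Y h K. b' \<in> tuples (univ M) n \<Longrightarrow> cond M d \<gamma> tr p k b' \<Longrightarrow> 0 < K \<Longrightarrow>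
      (\<And>i. i < r \<Longrightarrow> Y i \<subseteq> carrier (def_group M d \<gamma> \<mu>)) \<Longrightarrow> (\<And>i. i < r \<Longrightarrow> h i \<in> carrier (def_group M d \<gamma> \<mu>)) \<Longrightarrow>
      \<exists>\<nu>. fin_add_prob (carrier (def_group M d \<gamma> \<mu>)) UNIV \<nu> \<and> \<delta> \<le> \<nu> (dset M d \<phi> b' \<inter> carrier (def_group M d \<gamma> \<mu>)) \<and>
        (\<forall>i < r :: nat. \<bar>\<nu> (h i <#\<^bsub>def_group M d \<gamma> \<mu>\<^esub> Y i) - \<nu> (Y i)\<bar> \<le> 2 / real K)"
    and h: "\<And>i. i < r \<Longrightarrow> h i \<in> carrier G"
    and Y: "\<And>i. i < r \<Longrightarrow> Y i \<in> definable L N d" "\<And>i. i < r \<Longrightarrow> Y i \<subseteq> carrier G" and K: "0 < K"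
  shows "\<exists>\<nu>. (\<forall>A. \<nu> A \<in> {0..1}) \<and> fin_add_prob (tuples U d) UNIV \<nu> \<and> \<nu> (carrier G) = 1 \<and> \<delta> \<le> \<nu> X \<and>
    (\<forall>i < r. \<bar>\<nu> (h i <#\<^bsub>G\<^esub> Y i) - \<nu> (Y i)\<bar> \<le> 2 / real K)"
proof -
  interpret E: elem_equiv L N M by (rule E)
  let ?GM = "def_group M d \<gamma> \<mu>"
  have "\<forall>i. \<exists>t. i < r \<longrightarrow> form L (d + fst (snd t)) (fst t) \<and> snd (snd t) \<in> tuples U (fst (snd t)) \<and>
      Y i = dset N d (fst t) (snd (snd t))"
  proof
    fix i
    show "\<exists>t. i < r \<longrightarrow> form L (d + fst (snd t)) (fst t) \<and> snd (snd t) \<in> tuples U (fst (snd t)) \<and>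
      Y i = dset N d (fst t) (snd (snd t))"
    proof (cases "i < r")
      case True
      obtain \<chi> l e where "form L (d + l) \<chi>" "e \<in> tuples U l" "Y i = dset N d \<chi> e"
        using Y(1)[OF True] unfolding definable_def by blast
      then show ?thesis by (intro exI[of _ "(\<chi>, l, e)"]) simp
    qed simp
  qed
  from choice[OF this] obtain t where t: "\<forall>i. i < r \<longrightarrow> form L (d + fst (snd (t i))) (fst (t i)) \<and>
      snd (snd (t i)) \<in> tuples U (fst (snd (t i))) \<and> Y i = dset N d (fst (t i)) (snd (snd (t i)))" ..
  define \<chi> where "\<chi> = (\<lambda>i. fst (t i))"
  define l where "l = (\<lambda>i. fst (snd (t i)))"
  define e where "e = (\<lambda>i. snd (snd (t i)))"
  define \<theta> where "\<theta> = (\<lambda>i. tr_form d (l i) \<gamma> \<mu> (\<chi> i))"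
  have Ye: "form L (d + l i) (\<chi> i)" "e i \<in> tuples U (l i)" "Y i = dset N d (\<chi> i) (e i)" if "i < r" for i
    using t that by (simp_all add: \<chi>_def l_def e_def)
  have \<theta>: "form L (d + (d + l i)) (\<theta> i)" if "i < r" for i
    unfolding \<theta>_def by (rule form_tr_form[OF forms Ye(1)[OF that]])
  define J :: "(nat \<times> nat) set" where "J = insert (0, 0) ({1, 2} \<times> {..<r})"
  have fJ: "finite J" by (simp add: J_def)
  define pat where "pat = (\<lambda>x. {j \<in> J. lit N d \<phi> \<chi> \<theta> b h e j x})"
  define A where "A = pat ` carrier G"
  have AJ: "A \<subseteq> Pow J" by (auto simp: A_def pat_def)
  then have fA: "finite A" using fJ by (meson finite_Pow_iff finite_subset)
  obtain b' h' e' where M': "b' \<in> tuples (univ M) n" "cond M d \<gamma> tr p k b'"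
    "\<forall>i < r. h' i \<in> tuples (univ M) d \<and> sat M (h' i) \<gamma> \<and> e' i \<in> tuples (univ M) (l i)"
    "\<forall>x \<in> tuples (univ M) d. sat M x \<gamma> \<longrightarrow> (\<exists>\<sigma> \<in> A. \<forall>j \<in> J. j \<in> \<sigma> \<longleftrightarrow> lit M d \<phi> \<chi> \<theta> b' h' e' j x)"
  proof -
    have "\<exists>b' h' e'. b' \<in> tuples (univ M) n \<and> cond M d \<gamma> tr p k b' \<and>
      (\<forall>i < r. h' i \<in> tuples (univ M) d \<and> sat M (h' i) \<gamma> \<and> e' i \<in> tuples (univ M) (l i)) \<and>
      (\<forall>x \<in> tuples (univ M) d. sat M x \<gamma> \<longrightarrow> (\<exists>\<sigma> \<in> A. \<forall>j \<in> J. j \<in> \<sigma> \<longleftrightarrow> lit M d \<phi> \<chi> \<theta> b' h' e' j x))"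
    proof (rule E.pattern_transfer[OF forms(1) form_tr form_\<phi> Ye(1) \<theta> fA J_def b cond])
      fix x assume x: "x \<in> tuples U d" "sat N x \<gamma>"
      then have "pat x \<in> A" using carrier by (auto simp: A_def)
      then show "\<exists>\<sigma> \<in> A. \<forall>j \<in> J. j \<in> \<sigma> \<longleftrightarrow> lit N d \<phi> \<chi> \<theta> b h e j x" by (rule rev_bexI) (simp add: pat_def)
    qed (use h carrier Ye(2) in auto)
    then show ?thesis using that by (elim exE conjE)
  qed
  have cM: "a \<in> carrier ?GM \<longleftrightarrow> a \<in> tuples (univ M) d \<and> sat M a \<gamma>" for a by (simp add: carrier_def_group dset_mem)
  define Y' where "Y' = (\<lambda>i. dset M d (\<chi> i) (e' i) \<inter> carrier ?GM)"
  define Z where "Z = (\<lambda>j. {x \<in> carrier ?GM. lit M d \<phi> \<chi> \<theta> b' h' e' j x})"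
  have h'G: "h' i \<in> carrier ?GM" if "i < r" for i using M'(3) that cM by simp
  obtain \<nu>' where \<nu>': "fin_add_prob (carrier ?GM) UNIV \<nu>'" "\<delta> \<le> \<nu>' (dset M d \<phi> b' \<inter> carrier ?GM)"
    "\<forall>i < r. \<bar>\<nu>' (h' i <#\<^bsub>?GM\<^esub> Y' i) - \<nu>' (Y' i)\<bar> \<le> 2 / real K"
    using XM[OF M'(1,2) K, of r Y' h'] h'G unfolding Y'_def by blast
  have Z0: "Z (0, 0) = dset M d \<phi> b' \<inter> carrier ?GM" by (auto simp: Z_def lit_def cM dset_def)
  have Z1: "Z (1, i) = Y' i" for i by (auto simp: Z_def lit_def Y'_def cM dset_def)
  have Z2: "Z (2, i) = h' i <#\<^bsub>?GM\<^esub> Y' i" if i: "i < r" for i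
  proof -
    have e'i: "e' i \<in> tuples (univ M) (l i)" using M'(3) i by blast
    have "dset M d (\<theta> i) (h' i @ e' i) = h' i <#\<^bsub>?GM\<^esub> Y' i"
      unfolding \<theta>_def Y'_def by (rule dset_tr_form[OF GM Ye(1)[OF i] h'G[OF i] e'i])
    moreover have "h' i <#\<^bsub>?GM\<^esub> Y' i \<subseteq> carrier ?GM"
      using h'G[OF i] group.l_coset_subset_G[of ?GM "Y' i" "h' i"] GM by (simp add: definable_group_def Y'_def)
    ultimately show ?thesis unfolding Z_def by (auto simp: lit_def dset_def cM)
  qed
  interpret R: set_ring "carrier ?GM" "Pow (carrier ?GM)" by unfold_locales auto
  have \<nu>P: "fin_add_prob (carrier ?GM) (Pow (carrier ?GM)) \<nu>'" using \<nu>'(1) by (auto simp: fin_add_prob_def)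
  have ZP: "Z j \<in> Pow (carrier ?GM)" for j by (auto simp: Z_def)
  define w where "w = (\<lambda>\<sigma>. \<nu>' (atom (carrier ?GM) Z J \<sigma>))"
  have w0: "0 \<le> w \<sigma>" for \<sigma> unfolding w_def by (rule fin_add_probD(2)[OF \<nu>'(1)]) simp
  have wA: "w \<sigma> = 0" if "\<sigma> \<in> Pow J - A" for \<sigma>
  proof -
    have "atom (carrier ?GM) Z J \<sigma> = {}"
    proof (rule ccontr)
      assume "atom (carrier ?GM) Z J \<sigma> \<noteq> {}"
      then obtain x where x: "x \<in> carrier ?GM" "{j \<in> J. x \<in> Z j} = \<sigma>" by (auto simp: atom_def)
      obtain \<sigma>' where \<sigma>': "\<sigma>' \<in> A" "\<forall>j \<in> J. j \<in> \<sigma>' \<longleftrightarrow> lit M d \<phi> \<chi> \<theta> b' h' e' j x"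
        using M'(4) x(1) cM by blast
      have "\<sigma>' \<subseteq> J" using \<sigma>'(1) AJ by blast
      then have "\<sigma>' = \<sigma>" using \<sigma>'(2) x by (auto simp: Z_def)
      then show False using \<sigma>'(1) that by blast
    qed
    then show ?thesis using R.measure_empty[OF \<nu>P] by (simp add: w_def)
  qed
  have sumA: "(\<Sum>\<sigma> \<in> Pow J. f \<sigma>) = (\<Sum>\<sigma> \<in> A. f \<sigma>)" if "\<And>\<sigma>. \<sigma> \<in> Pow J - A \<Longrightarrow> f \<sigma> = 0" for f :: "(nat \<times> nat) set \<Rightarrow> real"
    by (rule sum.mono_neutral_right) (use fJ AJ that in auto)
  have w1: "(\<Sum>\<sigma> \<in> A. w \<sigma>) = 1"
  proof -
    have "(\<Sum>\<sigma> \<in> Pow J. w \<sigma>) = 1" unfolding w_def by (rule R.sum_atoms[OF \<nu>P fJ ZP])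
    then show ?thesis using sumA[of w] wA by simp
  qed
  have \<nu>Z: "\<nu>' (Z j) = (\<Sum>\<sigma> \<in> A. if j \<in> \<sigma> then w \<sigma> else 0)" if "j \<in> J" for j
  proof -
    have "\<nu>' (Z j) = (\<Sum>\<sigma> \<in> Pow J. if j \<in> \<sigma> then w \<sigma> else 0)"
      unfolding w_def by (rule R.measure_eq_sum_atoms[OF \<nu>P fJ ZP that])
    also have "\<dots> = (\<Sum>\<sigma> \<in> A. if j \<in> \<sigma> then w \<sigma> else 0)" by (rule sumA) (simp add: wA)
    finally show ?thesis .
  qed
  have "\<forall>\<sigma>. \<exists>x. \<sigma> \<in> A \<longrightarrow> x \<in> carrier G \<and> pat x = \<sigma>" by (auto simp: A_def)
  from choice[OF this] obtain x where x: "\<forall>\<sigma>. \<sigma> \<in> A \<longrightarrow> x \<sigma> \<in> carrier G \<and> pat (x \<sigma>) = \<sigma>" ..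
  define \<nu> where "\<nu> = (\<lambda>B. \<Sum>\<sigma> \<in> A. if x \<sigma> \<in> B then w \<sigma> else 0)"
  have \<nu>1: "\<nu> B = 1" if "carrier G \<subseteq> B" for B
  proof -
    have "\<nu> B = (\<Sum>\<sigma> \<in> A. w \<sigma>)" unfolding \<nu>_def by (rule sum.cong) (use x that in auto)
    then show ?thesis using w1 by simp
  qed
  have pos: "0 \<le> \<nu> B" for B unfolding \<nu>_def by (intro sum_nonneg) (simp add: w0)
  have le1: "\<nu> B \<le> 1" for B
    unfolding \<nu>_def w1[symmetric] by (intro sum_mono) (simp add: w0)
  have "fin_add_prob (tuples U d) UNIV \<nu>"
    unfolding fin_add_prob_def
  proof (intro conjI ballI impI)
    show "\<nu> (tuples U d) = 1" by (rule \<nu>1) (use carrier in auto)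
    show "0 \<le> \<nu> B" for B by (rule pos)
    fix B C :: "'m list set" assume "B \<inter> C = {}"
    then show "\<nu> (B \<union> C) = \<nu> B + \<nu> C"
      unfolding \<nu>_def sum.distrib[symmetric] by (intro sum.cong refl) auto
  qed
  \<comment> \<open>Representatives are chosen by pattern, so membership of
    \<open>x \<sigma>\<close> in a set given by the literal \<open>j\<close> is decided by whether
    \<open>j\<close> is in \<sigma>, just as for the atom \<sigma> in \<open>M\<close>.\<close>
  moreover have \<nu>lit: "\<nu> B = \<nu>' (Z j)" if "j \<in> J" "\<And>x. x \<in> carrier G \<Longrightarrow> x \<in> B \<longleftrightarrow> lit N d \<phi> \<chi> \<theta> b h e j x" for B j
    unfolding \<nu>Z[OF that(1)] \<nu>_def
  proof (rule sum.cong[OF refl])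
    fix \<sigma> assume \<sigma>: "\<sigma> \<in> A"
    have xc: "x \<sigma> \<in> carrier G" and px: "pat (x \<sigma>) = \<sigma>" using x \<sigma> by simp_all
    have "x \<sigma> \<in> B \<longleftrightarrow> lit N d \<phi> \<chi> \<theta> b h e j (x \<sigma>)" by (rule that(2)[OF xc])
    also have "\<dots> \<longleftrightarrow> j \<in> pat (x \<sigma>)" using that(1) by (simp add: pat_def)
    finally have "x \<sigma> \<in> B \<longleftrightarrow> j \<in> \<sigma>" unfolding px .
    then show "(if x \<sigma> \<in> B then w \<sigma> else 0) = (if j \<in> \<sigma> then w \<sigma> else 0)" by simp
  qed
  have "\<nu> X = \<nu>' (Z (0, 0))" by (rule \<nu>lit) (auto simp: J_def lit_def dset_def carrier)
  then have "\<delta> \<le> \<nu> X" using \<nu>'(2) Z0 by simp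
  moreover have "\<bar>\<nu> (h i <#\<^bsub>G\<^esub> Y i) - \<nu> (Y i)\<bar> \<le> 2 / real K" if i: "i < r" for i
  proof -
    have "\<nu> (Y i) = \<nu>' (Z (1, i))" by (rule \<nu>lit) (use i Ye(3)[OF i] in \<open>auto simp: J_def lit_def dset_def carrier\<close>)
    moreover have "dset N d (\<theta> i) (h i @ e i) = h i <#\<^bsub>G\<^esub> Y i"
      unfolding \<theta>_def using dset_tr_form[OF grp Ye(1)[OF i] h[OF i] Ye(2)[OF i]] Y(2)[OF i] Ye(3)[OF i] by (simp add: Int_absorb2)
    then have "\<nu> (h i <#\<^bsub>G\<^esub> Y i) = \<nu>' (Z (2, i))"
      by (intro \<nu>lit) (use i in \<open>auto simp: J_def lit_def dset_def carrier\<close>)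
    ultimately show ?thesis using \<nu>'(3) i Z1 Z2 by simp
  qed
  ultimately show ?thesis using pos le1 \<nu>1[of "carrier G"] by (intro exI[of _ \<nu>]) auto
qed

lemma not_G_divides_imp_non_null:
  fixes M :: "('f, 'r, 'n) fo_struct"
  assumes nG: "\<not> G_divides G X" and E: "elem_equiv L N M" and am: "amenable_discrete (def_group M d \<gamma> \<mu>)"
    and wf: "WFHP_at k {dset N d tr c | c. c \<in> tuples U (d + n)}"
  shows "non_null L N d G X"
proof -
  interpret E: elem_equiv L N M by (rule E)
  let ?GM = "def_group M d \<gamma> \<mu>"
  have gM: "Group.group ?GM" using am by (simp add: amenable_discrete_def)
  obtain \<zeta> where \<zeta>: "fin_add_prob (carrier ?GM) (Pow (carrier ?GM)) \<zeta>"
    "\<forall>g \<in> carrier ?GM. \<forall>A \<subseteq> carrier ?GM. \<zeta> (g <#\<^bsub>?GM\<^esub> A) = \<zeta> A"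
    using am unfolding amenable_discrete_def by blast
  have GM: "definable_group L M d \<gamma> \<mu>" by (rule E.definable_group_transfer[OF grp gM])
  obtain p1 where p1: "\<forall>g :: nat \<Rightarrow> 'm list. (\<forall>i < p1. g i \<in> carrier G) \<longrightarrow>
    (\<exists>I \<subseteq> {..<p1}. card I = k \<and> (\<Inter>i \<in> I. g i <#\<^bsub>G\<^esub> X) \<noteq> {})" using not_G_divides_bound[OF nG, of k] by (rule exE)
  obtain p0 where p0: "\<forall>p \<ge> p0. \<exists>\<beta> > 0. WFHP k p \<beta> {dset N d tr c | c. c \<in> tuples U (d + n)}"
    using wf unfolding WFHP_at_def by (elim exE conjE)
  \<comment> \<open>At least \<open>p1\<close>, so that \<open>k\<close> of any \<open>p\<close>
    translates meet, and at least \<open>p0\<close>, so that the \<open>WFHP\<close> hypothesis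
    applies.\<close>
  define p where "p = max p0 p1"
  have "\<exists>\<beta> > 0. WFHP k p \<beta> {dset N d tr c | c. c \<in> tuples U (d + n)}"
    by (rule p0[rule_format]) (simp add: p_def)
  then obtain \<beta>0 where \<beta>0: "0 < \<beta>0" "WFHP k p \<beta>0 {dset N d tr c | c. c \<in> tuples U (d + n)}"
    by (elim exE conjE)
  \<comment> \<open>Capped at 1 so that \<open>2 - \<beta>\<close> stays positive in the definition
    of \<delta>.\<close>
  define \<beta> where "\<beta> = min \<beta>0 1"
  have \<beta>: "0 < \<beta>" "\<beta> \<le> 1" using \<beta>0(1) by (auto simp: \<beta>_def)
  obtain u where u: "u \<in> tuples U d"
  proof -
    obtain z where "z \<in> U" using struct by (auto simp: is_struct_def)
    then have "replicate d z \<in> tuples U d" by (auto simp: tuples_def)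
    then show ?thesis using that by blast
  qed
  have cond: "cond N d \<gamma> tr p k b"
    unfolding cond_def
  proof (intro allI impI)
    fix g :: "nat \<Rightarrow> 'm list" assume g: "\<forall>i < p. g i \<in> tuples U d" "\<forall>i \<in> {..<p}. sat N (g i) \<gamma>"
    have gG: "g i \<in> carrier G" if "i < p" for i using g that carrier by simp
    then obtain I where I: "I \<subseteq> {..<p1}" "card I = k" "(\<Inter>i \<in> I. g i <#\<^bsub>G\<^esub> X) \<noteq> {}"
      using p1[rule_format, of g] by (auto simp: p_def)
    have Ip: "I \<subseteq> {..<p}" using I(1) by (auto simp: p_def)
    have "meets N d tr b g I"
    proof (cases "I = {}")
      case True
      then show ?thesis using u by (auto simp: meets_def)
    next
      case False
      obtain a where a: "\<And>i. i \<in> I \<Longrightarrow> a \<in> g i <#\<^bsub>G\<^esub> X" using I(3) by blast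
      have "a \<in> dset N d tr (g i @ b)" if i: "i \<in> I" for i
        using a[OF i] dset_tr[OF gG, of i] Ip i by auto
      then show ?thesis using False by (auto simp: meets_def dset_def)
    qed
    then show "\<exists>I \<in> {I. I \<subseteq> {..<p} \<and> card I = k}. meets N d tr b g I" using Ip I(2) by blast
  qed
  \<comment> \<open>Stated for every \<open>b0\<close> with the same condition and not just for
    \<open>b\<close>, because the parameters found in \<open>M\<close> are different ones.\<close>
  have dense: "\<exists>J \<in> {J. J \<subseteq> {..<m} \<and> \<beta> * real m \<le> real (card J)}. meets N d tr b0 g J"
    if b0: "b0 \<in> tuples U n" "cond N d \<gamma> tr p k b0"
      and g: "\<forall>i < m. g i \<in> tuples U d" "\<forall>i < m. sat N (g i) \<gamma>" for m g b0
  proof -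
    define S where "S = (\<lambda>i. dset N d tr (g i @ b0))"
    have SF: "S i \<in> {dset N d tr c | c. c \<in> tuples U (d + n)}" if "i < m" for i
    proof -
      have "g i \<in> tuples U d" using g(1) that by blast
      then have "g i @ b0 \<in> tuples U (d + n)" using b0(1) by (auto simp: tuples_def)
      then show ?thesis by (auto simp: S_def)
    qed
    have "pk_property p k (S ` {..<m})"
      unfolding pk_property_def
    proof (intro allI impI)
      fix T :: "nat \<Rightarrow> 'm list set" assume T: "\<forall>i < p. T i \<in> S ` {..<m}"
      \<comment> \<open>The \<open>(p,k)\<close>-property concerns tuples with repetitions;
        \<open>cond\<close> lets the group elements repeat as well.\<close>
      then have "\<forall>i. \<exists>j. i < p \<longrightarrow> j < m \<and> T i = S j" by blast
      from choice[OF this] obtain c where c: "\<forall>i. i < p \<longrightarrow> c i < m \<and> T i = S (c i)" ..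
      have gc: "\<forall>i < p. g (c i) \<in> tuples U d" "\<forall>i \<in> {..<p}. sat N (g (c i)) \<gamma>" using c g by simp_all
      obtain I where I: "I \<subseteq> {..<p}" "card I = k" "meets N d tr b0 (\<lambda>i. g (c i)) I"
        using b0(2)[unfolded cond_def, rule_format, of "\<lambda>i. g (c i)"] gc by auto
      then obtain x where x: "x \<in> tuples U d" "\<forall>i \<in> I. sat N (x @ g (c i) @ b0) tr" by (auto simp: meets_def)
      have "x \<in> T i" if "i \<in> I" for i
      proof -
        have "T i = S (c i)" using c I(1) that by blast
        then show ?thesis using x that by (simp add: S_def dset_def)
      qed
      then have "(\<Inter>i \<in> I. T i) \<noteq> {}" by blast
      then show "\<exists>I \<subseteq> {..<p}. card I = k \<and> (\<Inter>i \<in> I. T i) \<noteq> {}" using I(1,2) by blast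
    qed
    note pk = this
    have "\<exists>J \<subseteq> {..<m}. \<beta>0 * real m \<le> real (card J) \<and> (\<Inter>i \<in> J. S i) \<noteq> {}"
      by (rule \<beta>0(2)[unfolded WFHP_def, THEN spec, THEN spec, THEN mp]) (intro conjI allI impI SF pk)
    then obtain J where J: "J \<subseteq> {..<m}" "\<beta>0 * real m \<le> real (card J)" "(\<Inter>i \<in> J. S i) \<noteq> {}"
      by (elim exE conjE)
    have "meets N d tr b0 g J"
    proof (cases "J = {}")
      case True
      then show ?thesis using u by (auto simp: meets_def)
    next
      case False
      obtain a where a: "\<And>i. i \<in> J \<Longrightarrow> a \<in> S i" using J(3) by blast
      then show ?thesis using False by (auto simp: meets_def S_def dset_def)
    qed
    moreover have "\<beta> * real m \<le> \<beta>0 * real m" unfolding \<beta>_def by (rule mult_right_mono) auto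
    ultimately show ?thesis using J(1,2) by (intro bexI[of _ J]) auto
  qed
  define \<delta> where "\<delta> = log 2 (2 / (2 - \<beta>)) / 2"
  have \<delta>0: "0 < \<delta>" using \<beta> unfolding \<delta>_def by (simp add: zero_less_log_cancel_iff)
  have XM: "\<exists>\<nu>. fin_add_prob (carrier ?GM) UNIV \<nu> \<and> \<delta> \<le> \<nu> (dset M d \<phi> b' \<inter> carrier ?GM) \<and>
        (\<forall>i < r :: nat. \<bar>\<nu> (h i <#\<^bsub>?GM\<^esub> Y i) - \<nu> (Y i)\<bar> \<le> 2 / real K)"
    if b': "b' \<in> tuples (univ M) n" "cond M d \<gamma> tr p k b'" and K: "0 < K"
      and Y: "\<And>i. i < r \<Longrightarrow> Y i \<subseteq> carrier ?GM" "\<And>i. i < r \<Longrightarrow> h i \<in> carrier ?GM" for b' r Y h K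
  proof -
    let ?X = "dset M d \<phi> b' \<inter> carrier ?GM"
    have trM: "dset M d tr (g @ b') = g <#\<^bsub>?GM\<^esub> ?X" if "g \<in> carrier ?GM" for g
      by (rule dset_tr_form[OF GM form_\<phi> that b'(1)])
    have cM: "a \<in> carrier ?GM \<longleftrightarrow> a \<in> tuples (univ M) d \<and> sat M a \<gamma>" for a by (simp add: carrier_def_group dset_mem)
    have ne: "carrier ?GM \<noteq> {}" using group.is_monoid[OF gM] monoid.one_closed by blast
    have "\<exists>\<rho>. fin_add_prob (carrier ?GM) UNIV \<rho> \<and> (\<forall>g \<in> carrier ?GM. \<delta> \<le> \<rho> (g <#\<^bsub>?GM\<^esub> ?X))"
    proof (rule exists_measure_hitting[OF \<beta> ne _ _ \<delta>_def])
      show "g <#\<^bsub>?GM\<^esub> ?X \<subseteq> carrier ?GM" if "g \<in> carrier ?GM" for g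
        using group.l_coset_subset_G[OF gM _ that, of ?X] by simp
      fix m :: nat and g assume g: "\<forall>i < m. g i \<in> carrier ?GM"
      have "\<exists>J \<in> {J. J \<subseteq> {..<m} \<and> \<beta> * real m \<le> real (card J)}. meets M d tr b' g J"
        by (rule E.cond_density_transfer[OF forms(1) form_tr _ dense b']) (use g cM in auto)
      then obtain J x where J: "J \<subseteq> {..<m}" "\<beta> * real m \<le> real (card J)"
        and x: "x \<in> tuples (univ M) d" "\<forall>i \<in> J. sat M (x @ g i @ b') tr" unfolding meets_def by blast
      have "x \<in> g i <#\<^bsub>?GM\<^esub> ?X" if i: "i \<in> J" for i
      proof -
        have "x \<in> dset M d tr (g i @ b')" using x i by (simp add: dset_def)
        moreover have "g i \<in> carrier ?GM" using g J(1) i by blast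
        ultimately show ?thesis using trM by simp
      qed
      then have "(\<Inter>i \<in> J. g i <#\<^bsub>?GM\<^esub> ?X) \<noteq> {}" by blast
      then show "\<exists>J \<subseteq> {..<m}. \<beta> * real m \<le> real (card J) \<and> (\<Inter>i \<in> J. g i <#\<^bsub>?GM\<^esub> ?X) \<noteq> {}" using J by blast
    qed
    then obtain \<rho> where \<rho>: "fin_add_prob (carrier ?GM) UNIV \<rho>" "\<And>g. g \<in> carrier ?GM \<Longrightarrow> \<delta> \<le> \<rho> (g <#\<^bsub>?GM\<^esub> ?X)" by blast
    have inv: "\<And>g A. g \<in> carrier ?GM \<Longrightarrow> A \<subseteq> carrier ?GM \<Longrightarrow> \<zeta> (g <#\<^bsub>?GM\<^esub> A) = \<zeta> A" using \<zeta>(2) by blast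
    have "\<exists>\<nu>. fin_add_prob (carrier ?GM) UNIV \<nu> \<and> \<delta> \<le> \<nu> ?X \<and>
        (\<forall>i \<in> {..<r}. \<bar>\<nu> (h i <#\<^bsub>?GM\<^esub> Y i) - \<nu> (Y i)\<bar> \<le> 2 / real K)"
      by (rule averaging[OF gM \<zeta>(1) inv \<rho>(1) _ \<rho>(2) _ _ _ K]) (use Y in auto)
    then show ?thesis unfolding Ball_def lessThan_iff .
  qed
  note fin = finite_invariant_measure[OF E GM cond XM]
  let ?base = "{\<nu> :: 'm list set \<Rightarrow> real. fin_add_prob (tuples U d) UNIV \<nu>} \<inter> {\<nu>. \<nu> (carrier G) = 1} \<inter> {\<nu>. \<delta> \<le> \<nu> X}"
  let ?C = "\<lambda>(g, Y, K). {\<nu> :: 'm list set \<Rightarrow> real. \<bar>\<nu> (g <#\<^bsub>G\<^esub> Y) - \<nu> Y\<bar> \<le> 2 / real (Suc K)}"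
  let ?P = "carrier G \<times> {Y \<in> definable L N d. Y \<subseteq> carrier G} \<times> (UNIV :: nat set)"
  have "\<exists>\<nu>. \<forall>C \<in> insert ?base (?C ` ?P). \<nu> \<in> C"
  proof (rule measure_compactness)
    have c: "continuous_on UNIV (\<lambda>\<nu> :: 'm list set \<Rightarrow> real. \<nu> A)" for A by (rule continuous_on_product_coordinates)
    have "closed ?base"
      by (intro closed_Int closed_fin_add_prob closed_Collect_eq closed_Collect_le continuous_on_const c)
    moreover have "closed (?C q)" for q
      unfolding split_beta by (intro closed_Collect_le continuous_on_const continuous_on_rabs continuous_on_diff c)
    ultimately show "closed C" if "C \<in> insert ?base (?C ` ?P)" for C using that by blast
  next
    fix F assume F: "finite F" "F \<subseteq> insert ?base (?C ` ?P)"
    have "finite (F \<inter> ?C ` ?P)" "F \<inter> ?C ` ?P \<subseteq> ?C ` ?P" using F(1) by auto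
    then obtain Q where Q: "Q \<subseteq> ?P" "finite Q" "F \<inter> ?C ` ?P = ?C ` Q" by (meson finite_subset_image)
    obtain r q where q: "Q = q ` {..<r :: nat}"
      using finite_imp_nat_seg_image_inj_on[OF Q(2)] unfolding lessThan_def by (elim exE conjE)
    \<comment> \<open>Fine enough for all the finitely many tolerances that occur in
      \<open>Q\<close>.\<close>
    define K where "K = Suc (Max (insert 0 ((\<lambda>t. snd (snd t)) ` Q)))"
    have KQ: "Suc (snd (snd t)) \<le> K" if "t \<in> Q" for t using Q(2) that by (simp add: K_def)
    have qP: "q i \<in> ?P" if "i < r" for i using Q(1) q that by blast
    have "\<exists>\<nu>. (\<forall>A. \<nu> A \<in> {0..1}) \<and> fin_add_prob (tuples U d) UNIV \<nu> \<and> \<nu> (carrier G) = 1 \<and> \<delta> \<le> \<nu> X \<and>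
      (\<forall>i < r. \<bar>\<nu> (fst (q i) <#\<^bsub>G\<^esub> fst (snd (q i))) - \<nu> (fst (snd (q i)))\<bar> \<le> 2 / real K)"
    proof (rule fin)
      show "0 < K" by (simp add: K_def)
    qed (use qP in \<open>auto simp: mem_Times_iff\<close>)
    then obtain \<nu> where \<nu>: "\<forall>A. \<nu> A \<in> {0..1}" "fin_add_prob (tuples U d) UNIV \<nu>" "\<nu> (carrier G) = 1" "\<delta> \<le> \<nu> X"
      "\<forall>i < r. \<bar>\<nu> (fst (q i) <#\<^bsub>G\<^esub> fst (snd (q i))) - \<nu> (fst (snd (q i)))\<bar> \<le> 2 / real K" by (elim exE conjE)
    have "\<nu> \<in> ?C t" if t: "t \<in> Q" for t
    proof -
      obtain i where i: "i < r" "t = q i" using t q by auto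
      have "2 / real K \<le> 2 / real (Suc (snd (snd t)))"
        using KQ[OF t] by (intro divide_left_mono) (auto simp: K_def)
      then show ?thesis using \<nu>(5)[rule_format, OF i(1)] i(2) by (simp add: split_beta)
    qed
    moreover have "\<nu> \<in> ?base" using \<nu>(2-4) by simp
    moreover have "C = ?base \<or> C \<in> ?C ` Q" if "C \<in> F" for C using F(2) Q(3) that by blast
    ultimately have "\<forall>C \<in> F. \<nu> \<in> C" by blast
    then show "\<exists>\<nu>. (\<forall>A. \<nu> A \<in> {0..1}) \<and> (\<forall>C \<in> F. \<nu> \<in> C)" using \<nu>(1) by blast
  qed
  then obtain \<nu> where \<nu>: "\<forall>C \<in> insert ?base (?C ` ?P). \<nu> \<in> C" ..
  then have base: "fin_add_prob (tuples U d) UNIV \<nu>" "\<nu> (carrier G) = 1" "\<delta> \<le> \<nu> X" by simp_all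
  have inv: "\<nu> (g <#\<^bsub>G\<^esub> Y) = \<nu> Y" if "g \<in> carrier G" "Y \<in> definable L N d" "Y \<subseteq> carrier G" for g Y
  proof -
    have le: "\<bar>\<nu> (g <#\<^bsub>G\<^esub> Y) - \<nu> Y\<bar> \<le> 2 / real (Suc K)" for K
    proof -
      have "(g, Y, K) \<in> ?P" using that by simp
      from bspec[OF \<nu> insertI2[OF imageI[OF this]]] show ?thesis by simp
    qed
    show ?thesis
    proof (rule ccontr)
      assume "\<nu> (g <#\<^bsub>G\<^esub> Y) \<noteq> \<nu> Y"
      then have p: "0 < \<bar>\<nu> (g <#\<^bsub>G\<^esub> Y) - \<nu> Y\<bar> / 2" by simp
      obtain K where "inverse (real (Suc K)) < \<bar>\<nu> (g <#\<^bsub>G\<^esub> Y) - \<nu> Y\<bar> / 2"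
        using reals_Archimedean[OF p] by blast
      then show False using le[of K] by (simp add: inverse_eq_divide)
    qed
  qed
  have "fin_add_prob (tuples U d) (definable L N d) \<nu>" using base(1) by (auto simp: fin_add_prob_def)
  then show ?thesis
    unfolding non_null_def keisler_measure_def
  proof (intro exI[of _ \<nu>] conjI ballI impI)
    show "0 < \<nu> X" using base(3) \<delta>0 by simp
  qed (use base(2) inv in simp_all)
qed

end

theorem mainTheorem4:
  fixes L :: "('f, 'r) language"
    and T :: "('f, 'r) fo_form set"
    and \<kappa> :: "'k rel"
    and \<MM> :: "('f, 'r, 'm) fo_struct"
    and d :: nat
    and \<gamma> \<mu> :: "('f, 'r) fo_form"
    and G :: "'m list monoid"
  assumes "complete_theory L T"
    and "weakly_FHP TYPE('m) L T"
    and "monster_model L T \<kappa> \<MM>"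
    and "NTP2 L \<MM>"
    and "definable_group L \<MM> d \<gamma> \<mu>"
    and "\<exists>M :: ('f, 'r, 'n) fo_struct. is_model L T M \<and> amenable_discrete (def_group M d \<gamma> \<mu>)"
    and "G = def_group \<MM> d \<gamma> \<mu>"
  shows "\<forall>X \<in> definable L \<MM> d. X \<subseteq> carrier G \<longrightarrow>
           (\<not> G_divides G X \<longleftrightarrow> f_generic L \<MM> \<kappa> d G X) \<and>
           (f_generic L \<MM> \<kappa> d G X \<longleftrightarrow> non_null L \<MM> d G X)"
proof (intro ballI impI)
  fix X assume X: "X \<in> definable L \<MM> d" "X \<subseteq> carrier G"
  obtain M :: "('f, 'r, 'n) fo_struct" where M: "is_model L T M" "amenable_discrete (def_group M d \<gamma> \<mu>)"
    using assms(6) by blast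
  have mm: "is_model L T \<MM>" "is_struct L \<MM>" "is_struct L M"
    using assms(3) M(1) by (simp_all add: monster_model_def is_model_def)
  obtain \<phi> n b where bX: "form L (d + n) \<phi>" "b \<in> tuples (univ \<MM>) n" "X = dset \<MM> d \<phi> b"
    using X(1) unfolding definable_def by blast
  have big: "big_model L \<kappa> \<MM>"
    using assms(3) mm(2) unfolding monster_model_def big_model_def by blast
  interpret def_subset L \<kappa> \<MM> d \<gamma> \<mu> n \<phi> b
    by (intro def_subset.intro ntp2_model.intro ntp2_model_axioms.intro def_subset_axioms.intro big assms(4,5) bX(1,2))
      (use X(2) bX(3) assms(7) in simp)
  have E: "elem_equiv L \<MM> M"
    by (rule elem_equiv.intro[OF mm(2,3)]) (rule elementarily_equivalent[OF assms(1) mm(1) M(1)])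
  \<comment> \<open>Weak FHP is applied to the formula for the translates rather than to \<phi>, so
    that all translates of \<open>X\<close> belong to one family.\<close>
  obtain k where k: "\<And>N :: ('f, 'r, 'm) fo_struct. is_model L T N \<Longrightarrow>
      WFHP_at k {dset N d (tr_form d n \<gamma> \<mu> \<phi>) c | c. c \<in> tuples (univ N) (d + n)}"
    using assms(2) form_tr unfolding weakly_FHP_def by blast
  have 1: "f_generic L \<MM> \<kappa> d G X \<Longrightarrow> \<not> G_divides G X"
    unfolding bX(3) assms(7) by (rule f_generic_imp_not_G_divides)
  have 2: "\<not> G_divides G X \<Longrightarrow> f_generic L \<MM> \<kappa> d G X"
    unfolding bX(3) assms(7) by (rule not_G_divides_imp_f_generic)
  have 3: "\<not> G_divides G X \<Longrightarrow> non_null L \<MM> d G X"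
    unfolding bX(3) assms(7) by (rule not_G_divides_imp_non_null[OF _ E M(2) k[OF mm(1)]])
  have 4: "non_null L \<MM> d G X \<Longrightarrow> \<not> G_divides G X"
    using non_null_imp_not_G_divides[OF mm(2) assms(5) X(1)] X(2) unfolding assms(7) by blast
  show "(\<not> G_divides G X \<longleftrightarrow> f_generic L \<MM> \<kappa> d G X) \<and> (f_generic L \<MM> \<kappa> d G X \<longleftrightarrow> non_null L \<MM> d G X)"
    using 1 2 3 4 by blast
qed

end
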